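(* Let $\Lambda_{(\phi,\psi)}=\begin{pmatrix} A & N\\ M & B\end{pmatrix}$ be a Morita ring which is an Artin algebra. Assume that the adjoint pair $(M\otimes_A-,\ \mathrm{Hom}_B(M,-))$ induces an equivalence $$M\otimes_A-:(\mathrm{proj}\,A)^{<\infty}\ \rightleftarrows\ (\mathrm{inj}\,B)^{<\infty}:\mathrm{Hom}_B(M,-)$$ and that the adjoint pair $(N\otimes_B-,\ \mathrm{Hom}_A(N,-))$ induces an equivalence $$N\otimes_B-:(\mathrm{proj}\,B)^{<\infty}\ \rightleftarrows\ (\mathrm{inj}\,A)^{<\infty}:\mathrm{Hom}_A(N,-).$$ Then the Morita ring $\Lambda_{(\phi,\psi)}$ is Gorenstein.
   Context: $A,B$ are unital associative rings, $N$ is an $A$-$B$-bimodule, $M$ is a $B$-$A$-bimodule, $\phi:M\otimes_AN\to B$ is a $B$-$B$-bimodule homomorphism and $\psi:N\otimes_BM\to A$ is an $A$-$A$-bimodule homomorphism such that $\phi(m\otimes n)m'=m\psi(n\otimes m')$ and $n\phi(m\otimes n')=\psi(n\otimes m)n'$ for all $m,m'\in M$, $n,n'\in N$. The Morita ring $\Lambda_{(\phi,\psi)}$ is the set of matrices $\begin{pmatrix} a & n\\ m & b\end{pmatrix}$ with componentwise addition and multiplication $\begin{pmatrix} a & n\\ m & b\end{pmatrix}\begin{pmatrix} a' & n'\\ m' & b'\end{pmatrix}=\begin{pmatrix} aa'+\psi(n\otimes m') & an'+nb'\\ ma'+bm' & bb'+\phi(m\otimes n')\end{pmatrix}$. For an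 Artin algebra $\Gamma$, $\mathrm{mod}\,\Gamma$ is the category of finitely generated left $\Gamma$-modules, and $(\mathrm{proj}\,\Gamma)^{<\infty}$ (resp. $(\mathrm{inj}\,\Gamma)^{<\infty}$) is the full subcategory of $\mathrm{mod}\,\Gamma$ of modules of finite projective (resp. injective) dimension. "An adjoint pair induces an equivalence" between two such subcategories means that the two functors restrict to mutually quasi-inverse equivalences between them, via the unit and counit of the adjunction. An Artin algebra $\Gamma$ is Gorenstein if $\Gamma$ has finite injective dimension both as a left and as a right $\Gamma$-module; equivalently $(\mathrm{proj}\,\Gamma)^{<\infty}=(\mathrm{inj}\,\Gamma)^{<\infty}$. *)

theory Defs
  imports "HOL-Algebra.Free_Abelian_Groups" "HOL-Algebra.Ideal" "HOL-Algebra.Module"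
begin

section \<open>Modules over a non-commutative ring\<close>

text \<open>
  Modules use the record of \<^theory>\<open>HOL-Algebra.Module\<close>, but its locale
  requires a commutative ring of scalars. The ring fields \<open>mult\<close> and \<open>one\<close> of the
  record carry no meaning.
\<close>

locale left_module = R?: ring R + M?: abelian_group M
  for R :: "('r, 'p) ring_scheme" (structure) and M :: "('r, 'x, 'q) module_scheme" (structure) +
  assumes smult_closed [simp, intro]:
      "\<lbrakk>a \<in> carrier R; x \<in> carrier M\<rbrakk> \<Longrightarrow> a \<odot>\<^bsub>M\<^esub> x \<in> carrier M"
    and smult_l_distr:
      "\<lbrakk>a \<in> carrier R; b \<in> carrier R; x \<in> carrier M\<rbrakk> \<Longrightarrow>
       (a \<oplus>\<^bsub>R\<^esub> b) \<odot>\<^bsub>M\<^esub> x = a \<odot>\<^bsub>M\<^esub> x \<oplus>\<^bsub>M\<^esub> b \<odot>\<^bsub>M\<^esub> x"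
    and smult_r_distr:
      "\<lbrakk>a \<in> carrier R; x \<in> carrier M; y \<in> carrier M\<rbrakk> \<Longrightarrow>
       a \<odot>\<^bsub>M\<^esub> (x \<oplus>\<^bsub>M\<^esub> y) = a \<odot>\<^bsub>M\<^esub> x \<oplus>\<^bsub>M\<^esub> a \<odot>\<^bsub>M\<^esub> y"
    and smult_assoc1:
      "\<lbrakk>a \<in> carrier R; b \<in> carrier R; x \<in> carrier M\<rbrakk> \<Longrightarrow>
       (a \<otimes>\<^bsub>R\<^esub> b) \<odot>\<^bsub>M\<^esub> x = a \<odot>\<^bsub>M\<^esub> (b \<odot>\<^bsub>M\<^esub> x)"
    and smult_one [simp]:
      "x \<in> carrier M \<Longrightarrow> \<one>\<^bsub>R\<^esub> \<odot>\<^bsub>M\<^esub> x = x"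

record ('r, 'x, 's) bimodule = "('r, 'x) module" +
  rsmult :: "'x \<Rightarrow> 's \<Rightarrow> 'x"  (infixl \<open>\<triangleleft>\<index>\<close> 70)

locale bimodule = L?: left_module R M + S?: ring S
  for R :: "('r, 'p) ring_scheme" (structure) and S :: "('s, 'q) ring_scheme" (structure)
    and M :: "('r, 'x, 's, 't) bimodule_scheme" (structure) +
  assumes rsmult_closed [simp, intro]:
      "\<lbrakk>x \<in> carrier M; s \<in> carrier S\<rbrakk> \<Longrightarrow> x \<triangleleft>\<^bsub>M\<^esub> s \<in> carrier M"
    and rsmult_l_distr:
      "\<lbrakk>x \<in> carrier M; y \<in> carrier M; s \<in> carrier S\<rbrakk> \<Longrightarrow>
       (x \<oplus>\<^bsub>M\<^esub> y) \<triangleleft>\<^bsub>M\<^esub> s = x \<triangleleft>\<^bsub>M\<^esub> s \<oplus>\<^bsub>M\<^esub> y \<triangleleft>\<^bsub>M\<^esub> s"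
    and rsmult_r_distr:
      "\<lbrakk>x \<in> carrier M; s \<in> carrier S; t \<in> carrier S\<rbrakk> \<Longrightarrow>
       x \<triangleleft>\<^bsub>M\<^esub> (s \<oplus>\<^bsub>S\<^esub> t) = x \<triangleleft>\<^bsub>M\<^esub> s \<oplus>\<^bsub>M\<^esub> x \<triangleleft>\<^bsub>M\<^esub> t"
    and rsmult_assoc:
      "\<lbrakk>x \<in> carrier M; s \<in> carrier S; t \<in> carrier S\<rbrakk> \<Longrightarrow>
       x \<triangleleft>\<^bsub>M\<^esub> (s \<otimes>\<^bsub>S\<^esub> t) = (x \<triangleleft>\<^bsub>M\<^esub> s) \<triangleleft>\<^bsub>M\<^esub> t"
    and rsmult_one [simp]:
      "x \<in> carrier M \<Longrightarrow> x \<triangleleft>\<^bsub>M\<^esub> \<one>\<^bsub>S\<^esub> = x"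
    and smult_rsmult_assoc:
      "\<lbrakk>r \<in> carrier R; x \<in> carrier M; s \<in> carrier S\<rbrakk> \<Longrightarrow>
       (r \<odot>\<^bsub>M\<^esub> x) \<triangleleft>\<^bsub>M\<^esub> s = r \<odot>\<^bsub>M\<^esub> (x \<triangleleft>\<^bsub>M\<^esub> s)"

definition lmod_hom ::
    "('r, 'p) ring_scheme \<Rightarrow> ('r, 'x, 'q) module_scheme \<Rightarrow> ('r, 'y, 't) module_scheme \<Rightarrow> ('x \<Rightarrow> 'y) set"
  where "lmod_hom R X Y =
    {h \<in> carrier X \<rightarrow> carrier Y.
       (\<forall>x \<in> carrier X. \<forall>y \<in> carrier X. h (x \<oplus>\<^bsub>X\<^esub> y) = h x \<oplus>\<^bsub>Y\<^esub> h y) \<and>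
       (\<forall>r \<in> carrier R. \<forall>x \<in> carrier X. h (r \<odot>\<^bsub>X\<^esub> x) = r \<odot>\<^bsub>Y\<^esub> h x)}"

definition lmod_iso ::
    "('r, 'p) ring_scheme \<Rightarrow> ('r, 'x, 'q) module_scheme \<Rightarrow> ('r, 'y, 't) module_scheme \<Rightarrow> ('x \<Rightarrow> 'y) set"
  where "lmod_iso R X Y = {h \<in> lmod_hom R X Y. bij_betw h (carrier X) (carrier Y)}"

definition bimod_hom ::
    "('r, 'p) ring_scheme \<Rightarrow> ('s, 'p') ring_scheme \<Rightarrow>
     ('r, 'x, 's, 'q) bimodule_scheme \<Rightarrow> ('r, 'y, 's, 't) bimodule_scheme \<Rightarrow> ('x \<Rightarrow> 'y) set"
  where "bimod_hom R S X Y =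
    {h \<in> lmod_hom R X Y. \<forall>x \<in> carrier X. \<forall>s \<in> carrier S. h (x \<triangleleft>\<^bsub>X\<^esub> s) = h x \<triangleleft>\<^bsub>Y\<^esub> s}"

text \<open>A ring as a bimodule over itself; as \<open>module_scheme\<close> it is also the regular left module.\<close>

definition regular_bimodule :: "('r, 'p) ring_scheme \<Rightarrow> ('r, 'r, 'r) bimodule"
  where "regular_bimodule R =
    \<lparr>carrier = carrier R, mult = mult R, one = one R, zero = zero R, add = add R,
     smult = mult R, rsmult = mult R\<rparr>"

definition opposite_ring :: "'r ring \<Rightarrow> 'r ring"
  where "opposite_ring R = R\<lparr>mult := (\<lambda>x y. y \<otimes>\<^bsub>R\<^esub> x)\<rparr>"

definition finitely_generated :: "('r, 'p) ring_scheme \<Rightarrow> ('r, 'x, 'q) module_scheme \<Rightarrow> bool"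
  where "finitely_generated R X \<longleftrightarrow>
    (\<exists>S. finite S \<and> S \<subseteq> carrier X \<and>
      (\<forall>x \<in> carrier X. \<exists>c \<in> S \<rightarrow> carrier R. x = (\<Oplus>\<^bsub>X\<^esub>s \<in> S. c s \<odot>\<^bsub>X\<^esub> s)))"

definition fg_module :: "('r, 'p) ring_scheme \<Rightarrow> ('r, 'x, 'q) module_scheme \<Rightarrow> bool"
  where "fg_module R X \<longleftrightarrow> left_module R X \<and> finitely_generated R X"


section \<open>A carrier type for all finitely generated modules\<close>

text \<open>
  HOL cannot quantify over modules of all types inside a formula. Whenever \<open>mod R\<close> is
  quantified over, the modules have carriers of the type \<open>'r fg_carrier\<close>. It contains an
  isomorphic copy of every finitely generated module of any type (proved next: an element is
  represented by the set of its coordinate families with respect to a finite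
  generating sequence), so no isomorphism class of \<open>mod R\<close> is lost.
\<close>

type_synonym 'r fg_carrier = "(nat \<Rightarrow> 'r) set"

lemma lmod_hom_finsum:
  assumes X: "left_module R X" and Y: "left_module R Y" and j: "j \<in> lmod_hom R X Y"
    and "finite S" and "f \<in> S \<rightarrow> carrier X"
  shows "j (\<Oplus>\<^bsub>X\<^esub>s \<in> S. f s) = (\<Oplus>\<^bsub>Y\<^esub>s \<in> S. j (f s))"
  using assms(4,5)
proof (induction S rule: finite_induct)
  case empty
  interpret X: left_module R X by (rule X)
  interpret Y: left_module R Y by (rule Y)
  have z: "j \<zero>\<^bsub>X\<^esub> \<in> carrier Y" using j by (auto simp: lmod_hom_def)
  have "j (\<zero>\<^bsub>X\<^esub> \<oplus>\<^bsub>X\<^esub> \<zero>\<^bsub>X\<^esub>) = j \<zero>\<^bsub>X\<^esub> \<oplus>\<^bsub>Y\<^esub> j \<zero>\<^bsub>X\<^esub>"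
    using j X.M.zero_closed unfolding lmod_hom_def by blast
  then have "j \<zero>\<^bsub>X\<^esub> = \<zero>\<^bsub>Y\<^esub>" using z by simp
  then show ?case by simp
next
  case (insert a S)
  interpret X: left_module R X by (rule X)
  interpret Y: left_module R Y by (rule Y)
  have f: "f a \<in> carrier X" "f \<in> S \<rightarrow> carrier X" using insert.prems by auto
  have jf: "j (f a) \<in> carrier Y" "(\<lambda>s. j (f s)) \<in> S \<rightarrow> carrier Y"
    using f j by (auto simp: lmod_hom_def)
  have "j (f a \<oplus>\<^bsub>X\<^esub> (\<Oplus>\<^bsub>X\<^esub>s \<in> S. f s)) = j (f a) \<oplus>\<^bsub>Y\<^esub> j (\<Oplus>\<^bsub>X\<^esub>s \<in> S. f s)"
    using j f X.M.finsum_closed[OF f(2)] unfolding lmod_hom_def by blast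
  then show ?case
    using insert.hyps insert.IH[OF f(2)] f jf by simp
qed

lemma fg_module_transport:
  fixes R :: "('r, 'p) ring_scheme" and X :: "('r, 'x, 'q) module_scheme" and j :: "'x \<Rightarrow> 'z"
  assumes fg: "fg_module R X" and inj: "inj_on j (carrier X)"
  shows "\<exists>Y :: ('r, 'z) module. fg_module R Y \<and> j \<in> lmod_iso R X Y"
proof -
  have lmX: "left_module R X" using fg by (simp add: fg_module_def)
  interpret X: left_module R X by (rule lmX)
  define g where "g = inv_into (carrier X) j"
  have gj [simp]: "g (j x) = x" if "x \<in> carrier X" for x
    using inj that by (simp add: g_def)
  define Y :: "('r, 'z) module" where "Y =
    \<lparr>carrier = j ` carrier X, mult = undefined, one = undefined, zero = j \<zero>\<^bsub>X\<^esub>,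
     add = (\<lambda>u v. j (g u \<oplus>\<^bsub>X\<^esub> g v)), smult = (\<lambda>r u. j (r \<odot>\<^bsub>X\<^esub> g u))\<rparr>"
  have Y [simp]: "carrier Y = j ` carrier X" "zero Y = j \<zero>\<^bsub>X\<^esub>"
    "u \<oplus>\<^bsub>Y\<^esub> v = j (g u \<oplus>\<^bsub>X\<^esub> g v)" "r \<odot>\<^bsub>Y\<^esub> u = j (r \<odot>\<^bsub>X\<^esub> g u)" for u v r
    by (simp_all add: Y_def)
  have "abelian_group Y"
  proof (rule abelian_groupI)
    fix u assume "u \<in> carrier Y"
    then obtain x where x: "x \<in> carrier X" "u = j x" by auto
    then have "j (\<ominus>\<^bsub>X\<^esub> x) \<oplus>\<^bsub>Y\<^esub> u = \<zero>\<^bsub>Y\<^esub>" by (simp add: X.M.l_neg)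
    then show "\<exists>v \<in> carrier Y. v \<oplus>\<^bsub>Y\<^esub> u = \<zero>\<^bsub>Y\<^esub>" using x by force
  qed (auto simp: X.M.a_ac)
  then have lmY: "left_module R Y"
    by (intro left_module.intro left_module_axioms.intro X.R.ring_axioms)
      (auto simp: X.smult_l_distr X.smult_r_distr X.smult_assoc1)
  have hom: "j \<in> lmod_hom R X Y" by (auto simp: lmod_hom_def)
  obtain S where S: "finite S" "S \<subseteq> carrier X"
    "\<And>x. x \<in> carrier X \<Longrightarrow> \<exists>c \<in> S \<rightarrow> carrier R. x = (\<Oplus>\<^bsub>X\<^esub>s \<in> S. c s \<odot>\<^bsub>X\<^esub> s)"
    using fg unfolding fg_module_def finitely_generated_def by blast
  have "finitely_generated R Y"
    unfolding finitely_generated_def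
  proof (intro exI[of _ "j ` S"] conjI ballI)
    fix u assume "u \<in> carrier Y"
    then obtain x where x: "x \<in> carrier X" "u = j x" by auto
    obtain c where c: "c \<in> S \<rightarrow> carrier R" "x = (\<Oplus>\<^bsub>X\<^esub>s \<in> S. c s \<odot>\<^bsub>X\<^esub> s)" using S(3) x by blast
    have cl: "(\<lambda>s. c s \<odot>\<^bsub>X\<^esub> s) \<in> S \<rightarrow> carrier X" using c S by auto
    have injS: "inj_on j S" using inj S(2) inj_on_subset by blast
    interpret Y: left_module R Y by (rule lmY)
    have "u = (\<Oplus>\<^bsub>Y\<^esub>s \<in> S. j (c s \<odot>\<^bsub>X\<^esub> s))"
      using lmod_hom_finsum[OF lmX lmY hom S(1) cl] x(2) c(2) by simp
    also have "\<dots> = (\<Oplus>\<^bsub>Y\<^esub>s \<in> S. c (g (j s)) \<odot>\<^bsub>Y\<^esub> j s)"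
      using S(2) c(1) by (intro Y.M.finsum_cong') (auto simp: subset_iff Pi_iff)
    also have "\<dots> = (\<Oplus>\<^bsub>Y\<^esub>v \<in> j ` S. c (g v) \<odot>\<^bsub>Y\<^esub> v)"
      using S(2) c(1) by (intro Y.M.finsum_reindex[symmetric] injS)
        (auto simp: subset_iff Pi_iff)
    finally have "u = (\<Oplus>\<^bsub>Y\<^esub>v \<in> j ` S. (c \<circ> g) v \<odot>\<^bsub>Y\<^esub> v)" by simp
    moreover have "c \<circ> g \<in> j ` S \<rightarrow> carrier R"
      using S(2) c(1) by (auto simp: subset_iff Pi_iff)
    ultimately show "\<exists>d \<in> j ` S \<rightarrow> carrier R. u = (\<Oplus>\<^bsub>Y\<^esub>v \<in> j ` S. d v \<odot>\<^bsub>Y\<^esub> v)" by blast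
  qed (use S in auto)
  then have "fg_module R Y \<and> j \<in> lmod_iso R X Y"
    using lmY hom inj by (simp add: fg_module_def lmod_iso_def bij_betw_def)
  then show ?thesis by blast
qed

lemma fg_module_copy:
  fixes R :: "('r, 'p) ring_scheme" and X :: "('r, 'x, 'q) module_scheme"
  assumes "fg_module R X"
  shows "\<exists>(Y :: ('r, 'r fg_carrier) module) h. fg_module R Y \<and> h \<in> lmod_iso R X Y"
proof -
  interpret X: left_module R X using assms by (simp add: fg_module_def)
  obtain S where S: "finite S" "S \<subseteq> carrier X"
    "\<And>x. x \<in> carrier X \<Longrightarrow> \<exists>c \<in> S \<rightarrow> carrier R. x = (\<Oplus>\<^bsub>X\<^esub>s \<in> S. c s \<odot>\<^bsub>X\<^esub> s)"
    using assms unfolding fg_module_def finitely_generated_def by blast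
  obtain e :: "'x \<Rightarrow> nat" where e: "inj_on e S"
    using finite_imp_inj_to_nat_seg[OF S(1)] by blast
  define j where "j x =
    {f. (\<forall>s \<in> S. f (e s) \<in> carrier R) \<and> x = (\<Oplus>\<^bsub>X\<^esub>s \<in> S. f (e s) \<odot>\<^bsub>X\<^esub> s)}" for x
  have ne: "j x \<noteq> {}" if x: "x \<in> carrier X" for x
  proof -
    obtain c where c: "c \<in> S \<rightarrow> carrier R" "x = (\<Oplus>\<^bsub>X\<^esub>s \<in> S. c s \<odot>\<^bsub>X\<^esub> s)" using S(3) x by blast
    have ce: "c (inv_into S e (e s)) = c s" if "s \<in> S" for s using e that by simp
    have "(\<Oplus>\<^bsub>X\<^esub>s \<in> S. c (inv_into S e (e s)) \<odot>\<^bsub>X\<^esub> s) = (\<Oplus>\<^bsub>X\<^esub>s \<in> S. c s \<odot>\<^bsub>X\<^esub> s)"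
      using c(1) S(2) by (intro X.M.finsum_cong') (auto simp: ce subset_iff)
    then have "(\<lambda>k. c (inv_into S e k)) \<in> j x"
      using c by (auto simp: j_def ce)
    then show ?thesis by blast
  qed
  have "inj_on j (carrier X)"
  proof (rule inj_onI)
    fix x y assume "x \<in> carrier X" "y \<in> carrier X" "j x = j y"
    then obtain f where "f \<in> j x" "f \<in> j y" using ne by blast
    then show "x = y" by (simp add: j_def)
  qed
  then show ?thesis using fg_module_transport[OF assms] by blast
qed


section \<open>Projective and injective dimension\<close>

text \<open>
  The test modules below need not be finitely generated. For finitely generated \<open>P\<close> a free
  cover \<open>R\<^sup>n \<rightarrow> P\<close> has a copy among them, and for any \<open>I\<close> so have all
  inclusions of left ideals into \<open>R\<close>; hence these are projectivity (of finitely generated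
  modules) and, by Baer's criterion, injectivity in the category of all modules.
\<close>

definition projective_module :: "('r, 'p) ring_scheme \<Rightarrow> ('r, 'x, 'q) module_scheme \<Rightarrow> bool"
  where "projective_module R P \<longleftrightarrow> left_module R P \<and>
    (\<forall>(X :: ('r, 'r fg_carrier) module) (Y :: ('r, 'r fg_carrier) module) g f.
       left_module R X \<and> left_module R Y \<and>
       g \<in> lmod_hom R X Y \<and> g ` carrier X = carrier Y \<and> f \<in> lmod_hom R P Y \<longrightarrow>
       (\<exists>h \<in> lmod_hom R P X. \<forall>p \<in> carrier P. g (h p) = f p))"

definition injective_module :: "('r, 'p) ring_scheme \<Rightarrow> ('r, 'x, 'q) module_scheme \<Rightarrow> bool"
  where "injective_module R I \<longleftrightarrow> left_module R I \<and>
    (\<forall>(X :: ('r, 'r fg_carrier) module) (Y :: ('r, 'r fg_carrier) module) g f.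
       left_module R X \<and> left_module R Y \<and>
       g \<in> lmod_hom R X Y \<and> inj_on g (carrier X) \<and> f \<in> lmod_hom R X I \<longrightarrow>
       (\<exists>h \<in> lmod_hom R Y I. \<forall>x \<in> carrier X. h (g x) = f x))"

definition mod_kernel :: "('r, 'x, 'q) module_scheme \<Rightarrow> ('r, 'y, 't) module_scheme \<Rightarrow> ('x \<Rightarrow> 'y) \<Rightarrow> 'x set"
  where "mod_kernel X Y h = {x \<in> carrier X. h x = \<zero>\<^bsub>Y\<^esub>}"

text \<open>Exactness of \<open>\<dots> \<rightarrow> P 1 \<rightarrow> P 0 \<rightarrow> X \<rightarrow> 0\<close> in \<open>mod R\<close>, with \<open>P i = 0\<close> for \<open>i > n\<close>.\<close>

definition proj_dim_le :: "('r, 'p) ring_scheme \<Rightarrow> nat \<Rightarrow> ('r, 'x, 'q) module_scheme \<Rightarrow> bool"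
  where "proj_dim_le R n X \<longleftrightarrow>
    (\<exists>(P :: nat \<Rightarrow> ('r, 'r fg_carrier) module) d e.
       (\<forall>i. finitely_generated R (P i) \<and> projective_module R (P i)) \<and>
       (\<forall>i>n. carrier (P i) = {\<zero>\<^bsub>P i\<^esub>}) \<and>
       e \<in> lmod_hom R (P 0) X \<and> e ` carrier (P 0) = carrier X \<and>
       (\<forall>i. d i \<in> lmod_hom R (P (Suc i)) (P i)) \<and>
       d 0 ` carrier (P (Suc 0)) = mod_kernel (P 0) X e \<and>
       (\<forall>i. d (Suc i) ` carrier (P (Suc (Suc i))) = mod_kernel (P (Suc i)) (P i) (d i)))"

text \<open>Exactness of \<open>0 \<rightarrow> X \<rightarrow> I 0 \<rightarrow> I 1 \<rightarrow> \<dots>\<close> in \<open>mod R\<close>, with \<open>I i = 0\<close> for \<open>i > n\<close>.\<close>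

definition inj_dim_le :: "('r, 'p) ring_scheme \<Rightarrow> nat \<Rightarrow> ('r, 'x, 'q) module_scheme \<Rightarrow> bool"
  where "inj_dim_le R n X \<longleftrightarrow>
    (\<exists>(I :: nat \<Rightarrow> ('r, 'r fg_carrier) module) d e.
       (\<forall>i. finitely_generated R (I i) \<and> injective_module R (I i)) \<and>
       (\<forall>i>n. carrier (I i) = {\<zero>\<^bsub>I i\<^esub>}) \<and>
       e \<in> lmod_hom R X (I 0) \<and> inj_on e (carrier X) \<and>
       (\<forall>i. d i \<in> lmod_hom R (I i) (I (Suc i))) \<and>
       e ` carrier X = mod_kernel (I 0) (I (Suc 0)) (d 0) \<and>
       (\<forall>i. d i ` carrier (I i) = mod_kernel (I (Suc i)) (I (Suc (Suc i))) (d (Suc i))))"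

text \<open>Membership in \<open>(proj R)\<^sup><\<^sup>\<infinity>\<close> and \<open>(inj R)\<^sup><\<^sup>\<infinity>\<close>.\<close>

definition fin_proj_dim :: "('r, 'p) ring_scheme \<Rightarrow> ('r, 'x, 'q) module_scheme \<Rightarrow> bool"
  where "fin_proj_dim R X \<longleftrightarrow> fg_module R X \<and> (\<exists>n. proj_dim_le R n X)"

definition fin_inj_dim :: "('r, 'p) ring_scheme \<Rightarrow> ('r, 'x, 'q) module_scheme \<Rightarrow> bool"
  where "fin_inj_dim R X \<longleftrightarrow> fg_module R X \<and> (\<exists>n. inj_dim_le R n X)"


section \<open>Artin algebras and the Gorenstein property\<close>

definition artinian_ring :: "('k, 'p) ring_scheme \<Rightarrow> bool"
  where "artinian_ring K \<longleftrightarrow> cring K \<and>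
    (\<forall>I :: nat \<Rightarrow> 'k set. (\<forall>n. ideal (I n) K \<and> I (Suc n) \<subseteq> I n) \<longrightarrow> (\<exists>n. \<forall>m\<ge>n. I m = I n))"

definition restrict_scalars :: "('k \<Rightarrow> 'r) \<Rightarrow> ('r, 'p) ring_scheme \<Rightarrow> ('k, 'r) module"
  where "restrict_scalars \<eta> R =
    \<lparr>carrier = carrier R, mult = mult R, one = one R, zero = zero R, add = add R,
     smult = (\<lambda>c x. \<eta> c \<otimes>\<^bsub>R\<^esub> x)\<rparr>"

text \<open>\<open>R\<close> is an Artin algebra over the commutative artinian ring \<open>K\<close> via \<open>\<eta>\<close>.\<close>

definition artin_algebra :: "('k, 'p) ring_scheme \<Rightarrow> ('k \<Rightarrow> 'r) \<Rightarrow> ('r, 'q) ring_scheme \<Rightarrow> bool"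
  where "artin_algebra K \<eta> R \<longleftrightarrow>
    artinian_ring K \<and> ring R \<and> \<eta> \<in> ring_hom K R \<and>
    (\<forall>c \<in> carrier K. \<forall>x \<in> carrier R. \<eta> c \<otimes>\<^bsub>R\<^esub> x = x \<otimes>\<^bsub>R\<^esub> \<eta> c) \<and>
    finitely_generated K (restrict_scalars \<eta> R)"

text \<open>The second conjunct concerns \<open>R\<close> as a right module over itself.\<close>

definition gorenstein :: "'r ring \<Rightarrow> bool"
  where "gorenstein R \<longleftrightarrow>
    fin_inj_dim R (regular_bimodule R) \<and>
    fin_inj_dim (opposite_ring R) (regular_bimodule (opposite_ring R))"


section \<open>Tensor products and Hom modules\<close>

definition tensor_relations ::
    "('a, 'p) ring_scheme \<Rightarrow> ('b, 'm, 'a, 'q) bimodule_scheme \<Rightarrow> ('a, 'x, 't) module_scheme \<Rightarrow>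
     (('m \<times> 'x) \<Rightarrow>\<^sub>0 int) set"
  where "tensor_relations A M X =
    {frag_of (m \<oplus>\<^bsub>M\<^esub> m', x) - frag_of (m, x) - frag_of (m', x) | m m' x.
       m \<in> carrier M \<and> m' \<in> carrier M \<and> x \<in> carrier X} \<union>
    {frag_of (m, x \<oplus>\<^bsub>X\<^esub> x') - frag_of (m, x) - frag_of (m, x') | m x x'.
       m \<in> carrier M \<and> x \<in> carrier X \<and> x' \<in> carrier X} \<union>
    {frag_of (m \<triangleleft>\<^bsub>M\<^esub> a, x) - frag_of (m, a \<odot>\<^bsub>X\<^esub> x) | m a x.
       m \<in> carrier M \<and> a \<in> carrier A \<and> x \<in> carrier X}"

abbreviation tensor_free ::
    "('b, 'm, 'a, 'q) bimodule_scheme \<Rightarrow> ('a, 'x, 't) module_scheme \<Rightarrow> (('m \<times> 'x) \<Rightarrow>\<^sub>0 int) monoid"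
  where "tensor_free M X \<equiv> free_Abelian_group (carrier M \<times> carrier X)"

definition tensor_subgroup ::
    "('a, 'p) ring_scheme \<Rightarrow> ('b, 'm, 'a, 'q) bimodule_scheme \<Rightarrow> ('a, 'x, 't) module_scheme \<Rightarrow>
     (('m \<times> 'x) \<Rightarrow>\<^sub>0 int) set"
  where "tensor_subgroup A M X = generate (tensor_free M X) (tensor_relations A M X)"

text \<open>The pure tensor \<open>m \<otimes> x\<close>.\<close>

definition pure_tensor ::
    "('a, 'p) ring_scheme \<Rightarrow> ('b, 'm, 'a, 'q) bimodule_scheme \<Rightarrow> ('a, 'x, 't) module_scheme \<Rightarrow>
     'm \<Rightarrow> 'x \<Rightarrow> (('m \<times> 'x) \<Rightarrow>\<^sub>0 int) set"
  where "pure_tensor A M X m x = tensor_subgroup A M X #>\<^bsub>tensor_free M X\<^esub> frag_of (m, x)"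

text \<open>
  The endomorphism of the quotient group induced by \<open>(m, x) \<mapsto> u (m, x)\<close>: the coset of an
  element goes to the coset of its image. It is meaningful when the extension of \<open>u\<close> to
  the free abelian group preserves the subgroup of relations.
\<close>

definition tensor_induced ::
    "('a, 'p) ring_scheme \<Rightarrow> ('b, 'm, 'a, 'q) bimodule_scheme \<Rightarrow> ('a, 'x, 't) module_scheme \<Rightarrow>
     ('m \<times> 'x \<Rightarrow> 'm \<times> 'x) \<Rightarrow> (('m \<times> 'x) \<Rightarrow>\<^sub>0 int) set \<Rightarrow> (('m \<times> 'x) \<Rightarrow>\<^sub>0 int) set"
  where "tensor_induced A M X u C =
    tensor_subgroup A M X <#>\<^bsub>tensor_free M X\<^esub> (frag_extend (\<lambda>p. frag_of (u p)) ` C)"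

text \<open>
  For a \<open>B\<close>-\<open>A\<close>-bimodule \<open>M\<close> and a left \<open>A\<close>-module \<open>X\<close>, the left \<open>B\<close>-module
  \<open>M \<otimes>\<^sub>A X\<close>: the free abelian group on \<open>M \<times> X\<close> modulo the usual relations.
\<close>

definition tensor_module ::
    "('a, 'p) ring_scheme \<Rightarrow> ('b, 'm, 'a, 'q) bimodule_scheme \<Rightarrow> ('a, 'x, 't) module_scheme \<Rightarrow>
     ('b, (('m \<times> 'x) \<Rightarrow>\<^sub>0 int) set) module"
  where "tensor_module A M X =
    (let Q = tensor_free M X Mod tensor_subgroup A M X in
     \<lparr>carrier = carrier Q, mult = undefined, one = undefined, zero = one Q, add = mult Q,
      smult = (\<lambda>b. tensor_induced A M X (\<lambda>(m, x). (b \<odot>\<^bsub>M\<^esub> m, x)))\<rparr>)"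

definition tensor_bimodule ::
    "('a, 'p) ring_scheme \<Rightarrow> ('b, 'm, 'a, 'q) bimodule_scheme \<Rightarrow> ('a, 'n, 'c, 't) bimodule_scheme \<Rightarrow>
     ('b, (('m \<times> 'n) \<Rightarrow>\<^sub>0 int) set, 'c) bimodule"
  where "tensor_bimodule A M N =
    module.extend (tensor_module A M N)
      (bimodule.fields (\<lambda>C c. tensor_induced A M N (\<lambda>(m, n). (m, n \<triangleleft>\<^bsub>N\<^esub> c)) C))"

text \<open>
  For a \<open>B\<close>-\<open>A\<close>-bimodule \<open>M\<close> and a left \<open>B\<close>-module \<open>Y\<close>, the left \<open>A\<close>-module
  \<open>Hom\<^sub>B(M, Y)\<close> with \<open>(a f)(m) = f(m a)\<close>.
\<close>

definition hom_module ::
    "('b, 'p) ring_scheme \<Rightarrow> ('b, 'm, 'a, 'q) bimodule_scheme \<Rightarrow> ('b, 'y, 't) module_scheme \<Rightarrow>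
     ('a, 'm \<Rightarrow> 'y) module"
  where "hom_module B M Y =
    \<lparr>carrier = lmod_hom B M Y \<inter> extensional (carrier M), mult = undefined, one = undefined,
     zero = (\<lambda>m \<in> carrier M. \<zero>\<^bsub>Y\<^esub>),
     add = (\<lambda>f g. \<lambda>m \<in> carrier M. f m \<oplus>\<^bsub>Y\<^esub> g m),
     smult = (\<lambda>a f. \<lambda>m \<in> carrier M. f (m \<triangleleft>\<^bsub>M\<^esub> a))\<rparr>"

text \<open>The unit \<open>X \<rightarrow> Hom\<^sub>B(M, M \<otimes>\<^sub>A X)\<close>, \<open>x \<mapsto> (m \<mapsto> m \<otimes> x)\<close>.\<close>

definition adj_unit ::
    "('a, 'p) ring_scheme \<Rightarrow> ('b, 'm, 'a, 'q) bimodule_scheme \<Rightarrow> ('a, 'x, 't) module_scheme \<Rightarrow>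
     'x \<Rightarrow> 'm \<Rightarrow> (('m \<times> 'x) \<Rightarrow>\<^sub>0 int) set"
  where "adj_unit A M X x = (\<lambda>m \<in> carrier M. pure_tensor A M X m x)"

text \<open>
  The counit \<open>M \<otimes>\<^sub>A Hom\<^sub>B(M, Y) \<rightarrow> Y\<close>, \<open>m \<otimes> f \<mapsto> f m\<close>: every representative
  \<open>\<Sum>i. k\<^sub>i (m\<^sub>i, f\<^sub>i)\<close> of a coset has the same value \<open>\<Sum>i. k\<^sub>i f\<^sub>i(m\<^sub>i)\<close>.
\<close>

definition adj_counit :: "('b, 'y, 't) module_scheme \<Rightarrow> (('m \<times> ('m \<Rightarrow> 'y)) \<Rightarrow>\<^sub>0 int) set \<Rightarrow> 'y"
  where "adj_counit Y C =
    the_elem ((\<lambda>c. \<Oplus>\<^bsub>Y\<^esub>p \<in> Poly_Mapping.keys c. [Poly_Mapping.lookup c p] \<cdot>\<^bsub>Y\<^esub> (snd p) (fst p)) ` C)"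

text \<open>
  The adjoint pair \<open>(M \<otimes>\<^sub>A -, Hom\<^sub>B(M, -))\<close> of a \<open>B\<close>-\<open>A\<close>-bimodule \<open>M\<close> induces an equivalence
  between \<open>(proj A)\<^sup><\<^sup>\<infinity>\<close> and \<open>(inj B)\<^sup><\<^sup>\<infinity>\<close>: both functors restrict to these full
  subcategories, and unit and counit are isomorphisms on them.
\<close>

definition induces_equivalence ::
    "('a, 'p) ring_scheme \<Rightarrow> ('b, 'q) ring_scheme \<Rightarrow> ('b, 'm, 'a, 't) bimodule_scheme \<Rightarrow> bool"
  where "induces_equivalence A B M \<longleftrightarrow>
    (\<forall>X :: ('a, 'a fg_carrier) module. fin_proj_dim A X \<longrightarrow>
       fin_inj_dim B (tensor_module A M X) \<and>
       adj_unit A M X \<in> lmod_iso A X (hom_module B M (tensor_module A M X))) \<and>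
    (\<forall>Y :: ('b, 'b fg_carrier) module. fin_inj_dim B Y \<longrightarrow>
       fin_proj_dim A (hom_module B M Y) \<and>
       adj_counit Y \<in> lmod_iso B (tensor_module A M (hom_module B M Y)) Y)"


section \<open>Morita rings\<close>

locale morita_context =
  A?: ring A + B?: ring B + N?: bimodule A B N + M?: bimodule B A M
  for A :: "('a, 'p) ring_scheme" and B :: "('b, 'q) ring_scheme"
    and N :: "('a, 'n, 'b, 's) bimodule_scheme" and M :: "('b, 'm, 'a, 't) bimodule_scheme"
    and \<phi> :: "(('m \<times> 'n) \<Rightarrow>\<^sub>0 int) set \<Rightarrow> 'b" and \<psi> :: "(('n \<times> 'm) \<Rightarrow>\<^sub>0 int) set \<Rightarrow> 'a" +
  assumes phi_hom: "\<phi> \<in> bimod_hom B B (tensor_bimodule A M N) (regular_bimodule B)"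
    and psi_hom: "\<psi> \<in> bimod_hom A A (tensor_bimodule B N M) (regular_bimodule A)"
    and phi_psi: "\<lbrakk>m \<in> carrier M; n \<in> carrier N; m' \<in> carrier M\<rbrakk> \<Longrightarrow>
      \<phi> (pure_tensor A M N m n) \<odot>\<^bsub>M\<^esub> m' = m \<triangleleft>\<^bsub>M\<^esub> \<psi> (pure_tensor B N M n m')"
    and psi_phi: "\<lbrakk>n \<in> carrier N; m \<in> carrier M; n' \<in> carrier N\<rbrakk> \<Longrightarrow>
      n \<triangleleft>\<^bsub>N\<^esub> \<phi> (pure_tensor A M N m n') = \<psi> (pure_tensor B N M n m) \<odot>\<^bsub>N\<^esub> n'"

text \<open>The tuple \<open>(a, n, m, b)\<close> stands for the matrix with rows \<open>(a, n)\<close> and \<open>(m, b)\<close>.\<close>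

definition morita_ring ::
    "('a, 'p) ring_scheme \<Rightarrow> ('b, 'q) ring_scheme \<Rightarrow>
     ('a, 'n, 'b, 's) bimodule_scheme \<Rightarrow> ('b, 'm, 'a, 't) bimodule_scheme \<Rightarrow>
     ((('m \<times> 'n) \<Rightarrow>\<^sub>0 int) set \<Rightarrow> 'b) \<Rightarrow> ((('n \<times> 'm) \<Rightarrow>\<^sub>0 int) set \<Rightarrow> 'a) \<Rightarrow>
     ('a \<times> 'n \<times> 'm \<times> 'b) ring"
  where "morita_ring A B N M \<phi> \<psi> =
    \<lparr>carrier = carrier A \<times> carrier N \<times> carrier M \<times> carrier B,
     mult = (\<lambda>(a, n, m, b) (a', n', m', b').
       (a \<otimes>\<^bsub>A\<^esub> a' \<oplus>\<^bsub>A\<^esub> \<psi> (pure_tensor B N M n m'),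
        a \<odot>\<^bsub>N\<^esub> n' \<oplus>\<^bsub>N\<^esub> n \<triangleleft>\<^bsub>N\<^esub> b',
        m \<triangleleft>\<^bsub>M\<^esub> a' \<oplus>\<^bsub>M\<^esub> b \<odot>\<^bsub>M\<^esub> m',
        b \<otimes>\<^bsub>B\<^esub> b' \<oplus>\<^bsub>B\<^esub> \<phi> (pure_tensor A M N m n'))),
     one = (\<one>\<^bsub>A\<^esub>, \<zero>\<^bsub>N\<^esub>, \<zero>\<^bsub>M\<^esub>, \<one>\<^bsub>B\<^esub>),
     zero = (\<zero>\<^bsub>A\<^esub>, \<zero>\<^bsub>N\<^esub>, \<zero>\<^bsub>M\<^esub>, \<zero>\<^bsub>B\<^esub>),
     add = (\<lambda>(a, n, m, b) (a', n', m', b').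
       (a \<oplus>\<^bsub>A\<^esub> a', n \<oplus>\<^bsub>N\<^esub> n', m \<oplus>\<^bsub>M\<^esub> m', b \<oplus>\<^bsub>B\<^esub> b'))\<rparr>"

end

theory Submission
  imports Defs
begin

text \<open>
  Write \<open>L\<close> for the Morita ring. A \<open>B\<close>-module \<open>Y\<close> has a coinduced \<open>L\<close>-module \<open>Hom\<^sub>B(e L, Y)\<close>, where \<open>e\<close> is
  the idempotent of \<open>B\<close>; its underlying group is \<open>Hom\<^sub>B(M, Y) \<oplus> Y\<close> (\<open>cind\<close>). Coinduction is right adjoint to
  \<open>V \<mapsto> e V\<close> and so preserves injectives. Three observations turn this into the theorem.

  First, \<open>Hom\<^sub>B(M, -)\<close>, and with it coinduction, is exact on short exact sequences
  \<open>0 \<rightarrow> Y' \<rightarrow> Y \<rightarrow> Y'' \<rightarrow> 0\<close> of \<open>B\<close>-modules of finite injective dimension (\<open>equivalence_hom_exact\<close>): the image \<open>C\<close> of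
  \<open>Hom\<^sub>B(M, Y)\<close> in \<open>Hom\<^sub>B(M, Y'')\<close> has finite projective dimension and satisfies \<open>M \<otimes>\<^sub>A C \<cong> Y''\<close>, so it is all of
  \<open>Hom\<^sub>B(M, Y'')\<close>. Hence coinduction does not
  increase injective dimension on \<open>(inj B)\<^sup><\<^sup>\<infinity>\<close> (\<open>cind_id\<close>). Since \<open>A \<cong> Hom\<^sub>B(M, M)\<close>, the first column of \<open>L\<close> is
  coinduced from \<open>M\<close>, and \<open>M = M \<otimes>\<^sub>A A\<close> has finite injective dimension; by symmetry the second column
  is coinduced from \<open>N\<close>. So \<open>L\<close> has finite injective dimension as a left module.

  Secondly, for a projective \<open>A\<close>-module \<open>P\<close> the unit identifies \<open>P\<close> with \<open>Hom\<^sub>B(M, M \<otimes>\<^sub>A P)\<close>, so the module coinduced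
  from \<open>M \<otimes>\<^sub>A P\<close> is the projective module induced from \<open>P\<close> (\<open>cind_projective\<close>). A projective resolution of
  \<open>Hom\<^sub>B(M, Y)\<close> therefore becomes a projective resolution of the module coinduced from \<open>Y\<close>, for \<open>Y\<close> in
  \<open>(inj B)\<^sup><\<^sup>\<infinity>\<close> (\<open>cind_pd\<close>).

  Thirdly, let \<open>D = Hom\<^sub>K(-, E)\<close> be the duality of the Artin algebra, \<open>E\<close> being the minimal injective cogenerator of
  \<open>K\<close>. The rows of \<open>L\<close> dualize to the left modules coinduced from \<open>D(B)\<close> and \<open>D(A)\<close> (\<open>dual_row\<close>), and
  \<open>D(B)\<close> is injective; so \<open>D(L)\<close> has finite projective dimension on the left. Dualizing back
  gives the finite injective dimension of \<open>L\<close> as a right module (\<open>gorenstein_matrix_ring\<close>).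
\<close>

text \<open>
 Structures that are plain names are attached to the operations as subscripts.
\<close>

syntax "_index" :: "id_position \<Rightarrow> index"  (\<open>\<^sub>_\<close>)
  "_index" :: "var_position \<Rightarrow> index"  (\<open>\<^sub>_\<close>)

section \<open>Modules, submodules and homomorphisms\<close>

lemma left_moduleI:
 assumes "ring R"
  and "\<And>x y. x \<in> carrier X \<Longrightarrow> y \<in> carrier X \<Longrightarrow> x \<oplus>\<^sub>X y \<in> carrier X"
  and "\<zero>\<^sub>X \<in> carrier X"
  and "\<And>x y z. x \<in> carrier X \<Longrightarrow> y \<in> carrier X \<Longrightarrow> z \<in> carrier X \<Longrightarrow>
    (x \<oplus>\<^sub>X y) \<oplus>\<^sub>X z = x \<oplus>\<^sub>X (y \<oplus>\<^sub>X z)"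
  and "\<And>x y. x \<in> carrier X \<Longrightarrow> y \<in> carrier X \<Longrightarrow> x \<oplus>\<^sub>X y = y \<oplus>\<^sub>X x"
  and zero: "\<And>x. x \<in> carrier X \<Longrightarrow> \<zero>\<^sub>X \<oplus>\<^sub>X x = x"
  and cl: "\<And>r x. r \<in> carrier R \<Longrightarrow> x \<in> carrier X \<Longrightarrow> r \<odot>\<^sub>X x \<in> carrier X"
  and ld: "\<And>r s x. r \<in> carrier R \<Longrightarrow> s \<in> carrier R \<Longrightarrow> x \<in> carrier X \<Longrightarrow>
    (r \<oplus>\<^sub>R s) \<odot>\<^sub>X x = r \<odot>\<^sub>X x \<oplus>\<^sub>X s \<odot>\<^sub>X x"
  and "\<And>r x y. r \<in> carrier R \<Longrightarrow> x \<in> carrier X \<Longrightarrow> y \<in> carrier X \<Longrightarrow>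
    r \<odot>\<^sub>X (x \<oplus>\<^sub>X y) = r \<odot>\<^sub>X x \<oplus>\<^sub>X r \<odot>\<^sub>X y"
  and "\<And>r s x. r \<in> carrier R \<Longrightarrow> s \<in> carrier R \<Longrightarrow> x \<in> carrier X \<Longrightarrow>
    (r \<otimes>\<^sub>R s) \<odot>\<^sub>X x = r \<odot>\<^sub>X (s \<odot>\<^sub>X x)"
  and one: "\<And>x. x \<in> carrier X \<Longrightarrow> \<one>\<^sub>R \<odot>\<^sub>X x = x"
  and null: "\<And>x. x \<in> carrier X \<Longrightarrow> \<zero>\<^sub>R \<odot>\<^sub>X x = \<zero>\<^sub>X"
 shows "left_module R X"
proof -
 interpret R: ring R by fact
 have "abelian_group X"
 proof (rule abelian_groupI)
  fix x assume x: "x \<in> carrier X"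
  have "(\<ominus>\<^sub>R \<one>\<^sub>R) \<odot>\<^sub>X x \<oplus>\<^sub>X x = \<zero>\<^sub>X"
   using ld[of "\<ominus>\<^sub>R \<one>\<^sub>R" "\<one>\<^sub>R" x] x one null by (simp add: R.l_neg)
  then show "\<exists>y\<in>carrier X. y \<oplus>\<^sub>X x = \<zero>\<^sub>X" using cl x by blast
 qed (use assms in auto)
 then show ?thesis
  by (intro left_module.intro left_module_axioms.intro R.ring_axioms) (use assms in auto)
qed

context left_module
begin

lemma smult_l_null [simp]: "x \<in> carrier M \<Longrightarrow> \<zero>\<^sub>R \<odot>\<^sub>M x = \<zero>\<^sub>M"
 using smult_l_distr[of "\<zero>\<^sub>R" "\<zero>\<^sub>R" x] by (simp add: M.add.r_cancel_one')

lemma smult_r_null [simp]: "r \<in> carrier R \<Longrightarrow> r \<odot>\<^sub>M \<zero>\<^sub>M = \<zero>\<^sub>M"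
 using smult_r_distr[of r "\<zero>\<^sub>M" "\<zero>\<^sub>M"] by (simp add: M.add.r_cancel_one')

lemma smult_l_minus: "r \<in> carrier R \<Longrightarrow> x \<in> carrier M \<Longrightarrow> (\<ominus>\<^sub>R r) \<odot>\<^sub>M x = \<ominus>\<^sub>M (r \<odot>\<^sub>M x)"
 using smult_l_distr[of "\<ominus>\<^sub>R r" r x] by (simp add: R.l_neg M.minus_equality)

lemma smult_r_minus: "r \<in> carrier R \<Longrightarrow> x \<in> carrier M \<Longrightarrow> r \<odot>\<^sub>M (\<ominus>\<^sub>M x) = \<ominus>\<^sub>M (r \<odot>\<^sub>M x)"
 using smult_r_distr[of r "\<ominus>\<^sub>M x" x] by (simp add: M.l_neg M.minus_equality)

lemma minus_as_smult: "x \<in> carrier M \<Longrightarrow> \<ominus>\<^sub>M x = (\<ominus>\<^sub>R \<one>\<^sub>R) \<odot>\<^sub>M x"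
 by (simp add: smult_l_minus)

lemma a_minus_zero [simp]: "\<ominus>\<^sub>M \<zero>\<^sub>M = \<zero>\<^sub>M"
 by (simp add: M.minus_equality)

lemma diff_eq_zero: "x \<in> carrier M \<Longrightarrow> y \<in> carrier M \<Longrightarrow> x \<oplus>\<^sub>M \<ominus>\<^sub>M y = \<zero>\<^sub>M \<longleftrightarrow> x = y"
 using M.minus_equality M.r_neg by (metis M.a_inv_closed M.minus_minus)

lemma add_diff_cancel: "x \<in> carrier M \<Longrightarrow> y \<in> carrier M \<Longrightarrow> y \<oplus>\<^sub>M (x \<oplus>\<^sub>M \<ominus>\<^sub>M y) = x"
 by (metis M.a_ac(3) M.a_inv_closed M.r_neg M.r_zero)

end

lemma lmod_homI:
 assumes "\<And>x. x \<in> carrier X \<Longrightarrow> h x \<in> carrier Y"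
  and "\<And>x y. x \<in> carrier X \<Longrightarrow> y \<in> carrier X \<Longrightarrow> h (x \<oplus>\<^sub>X y) = h x \<oplus>\<^sub>Y h y"
  and "\<And>r x. r \<in> carrier R \<Longrightarrow> x \<in> carrier X \<Longrightarrow> h (r \<odot>\<^sub>X x) = r \<odot>\<^sub>Y h x"
 shows "h \<in> lmod_hom R X Y"
 using assms by (auto simp: lmod_hom_def)

lemma hom_closed: "h \<in> lmod_hom R X Y \<Longrightarrow> x \<in> carrier X \<Longrightarrow> h x \<in> carrier Y"
 and hom_add: "h \<in> lmod_hom R X Y \<Longrightarrow> x \<in> carrier X \<Longrightarrow> y \<in> carrier X \<Longrightarrow>
    h (x \<oplus>\<^sub>X y) = h x \<oplus>\<^sub>Y h y"
 and hom_smult: "h \<in> lmod_hom R X Y \<Longrightarrow> r \<in> carrier R \<Longrightarrow> x \<in> carrier X \<Longrightarrow>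
    h (r \<odot>\<^sub>X x) = r \<odot>\<^sub>Y h x"
 by (auto simp: lmod_hom_def)

lemma hom_zero:
 assumes "left_module R X" "left_module R Y" "h \<in> lmod_hom R X Y"
 shows "h \<zero>\<^sub>X = \<zero>\<^sub>Y"
proof -
 interpret X: left_module R X by fact
 interpret Y: left_module R Y by fact
 show ?thesis using hom_add[OF assms(3), of "\<zero>\<^sub>X" "\<zero>\<^sub>X"] hom_closed[OF assms(3), of "\<zero>\<^sub>X"]
  by (simp add: Y.M.add.r_cancel_one')
qed

lemma hom_minus:
 assumes "left_module R X" "left_module R Y" "h \<in> lmod_hom R X Y" "x \<in> carrier X"
 shows "h (\<ominus>\<^sub>X x) = \<ominus>\<^sub>Y h x"
proof -
 interpret X: left_module R X by fact
 interpret Y: left_module R Y by fact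
 show ?thesis using assms(4) hom_closed[OF assms(3)] hom_smult[OF assms(3)]
  by (simp add: X.minus_as_smult Y.minus_as_smult)
qed

lemma hom_comp: "f \<in> lmod_hom R X Y \<Longrightarrow> g \<in> lmod_hom R Y Z \<Longrightarrow> (\<lambda>x. g (f x)) \<in> lmod_hom R X Z"
 by (auto simp: lmod_hom_def Pi_iff)

lemma hom_id: "(\<lambda>x. x) \<in> lmod_hom R X X"
 by (auto simp: lmod_hom_def)

lemma hom_inj_iff:
 assumes X: "left_module R X" and Y: "left_module R Y" and h: "h \<in> lmod_hom R X Y"
 shows "inj_on h (carrier X) \<longleftrightarrow> (\<forall>x \<in> carrier X. h x = \<zero>\<^sub>Y \<longrightarrow> x = \<zero>\<^sub>X)"
proof -
 interpret X: left_module R X by fact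
 interpret Y: left_module R Y by fact
 have "x = y" if z: "\<forall>x \<in> carrier X. h x = \<zero>\<^sub>Y \<longrightarrow> x = \<zero>\<^sub>X"
  and x: "x \<in> carrier X" "y \<in> carrier X" "h x = h y" for x y
 proof -
  have "h (x \<oplus>\<^sub>X \<ominus>\<^sub>X y) = \<zero>\<^sub>Y" using x hom_closed[OF h]
   by (simp add: hom_add[OF h] hom_minus[OF X Y h] Y.M.r_neg)
  then have "x \<oplus>\<^sub>X \<ominus>\<^sub>X y = \<zero>\<^sub>X" using z x by blast
  then show ?thesis using x X.diff_eq_zero by simp
 qed
 then show ?thesis using hom_zero[OF X Y h] X.M.zero_closed
  unfolding inj_on_def by metis
qed

lemma iso_inverse:
 assumes "h \<in> lmod_iso R X Y" and "left_module R X"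
 shows "inv_into (carrier X) h \<in> lmod_iso R Y X"
  and "\<And>x. x \<in> carrier X \<Longrightarrow> inv_into (carrier X) h (h x) = x"
  and "\<And>y. y \<in> carrier Y \<Longrightarrow> h (inv_into (carrier X) h y) = y"
proof -
 interpret X: left_module R X by fact
 have h: "h \<in> lmod_hom R X Y" and b: "bij_betw h (carrier X) (carrier Y)"
  using assms by (auto simp: lmod_iso_def)
 let ?g = "inv_into (carrier X) h"
 show 1: "\<And>x. x \<in> carrier X \<Longrightarrow> ?g (h x) = x" using b by (simp add: bij_betw_def)
 show 2: "\<And>y. y \<in> carrier Y \<Longrightarrow> h (?g y) = y"
  using b by (simp add: bij_betw_inv_into_right)
 have 3: "\<And>y. y \<in> carrier Y \<Longrightarrow> ?g y \<in> carrier X"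
  using bij_betw_inv_into[OF b] by (auto dest: bij_betwE)
 have "?g \<in> lmod_hom R Y X"
 proof (rule lmod_homI)
  fix x y assume a: "x \<in> carrier Y" "y \<in> carrier Y"
  have "?g (x \<oplus>\<^sub>Y y) = ?g (h (?g x \<oplus>\<^sub>X ?g y))" using a by (simp add: hom_add[OF h] 2 3)
  then show "?g (x \<oplus>\<^sub>Y y) = ?g x \<oplus>\<^sub>X ?g y" using a by (simp add: 1 3)
 next
  fix r y assume a: "r \<in> carrier R" "y \<in> carrier Y"
  have "?g (r \<odot>\<^sub>Y y) = ?g (h (r \<odot>\<^sub>X ?g y))" using a by (simp add: hom_smult[OF h] 2 3)
  then show "?g (r \<odot>\<^sub>Y y) = r \<odot>\<^sub>X ?g y" using a by (simp add: 1 3)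
 qed (rule 3)
 then show "?g \<in> lmod_iso R Y X" using bij_betw_inv_into[OF b] by (simp add: lmod_iso_def)
qed

lemma iso_hom: "h \<in> lmod_iso R X Y \<Longrightarrow> h \<in> lmod_hom R X Y"
 and iso_inj: "h \<in> lmod_iso R X Y \<Longrightarrow> inj_on h (carrier X)"
 and iso_surj: "h \<in> lmod_iso R X Y \<Longrightarrow> h ` carrier X = carrier Y"
 by (auto simp: lmod_iso_def bij_betw_def)

lemma isoI: "h \<in> lmod_hom R X Y \<Longrightarrow> inj_on h (carrier X) \<Longrightarrow> h ` carrier X = carrier Y \<Longrightarrow>
  h \<in> lmod_iso R X Y"
 by (auto simp: lmod_iso_def bij_betw_def)

definition submod :: "('r, 'p) ring_scheme \<Rightarrow> ('r, 'x, 'q) module_scheme \<Rightarrow> 'x set \<Rightarrow> bool"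
 where "submod R X U \<longleftrightarrow> U \<subseteq> carrier X \<and> \<zero>\<^sub>X \<in> U \<and> (\<forall>x\<in>U. \<forall>y\<in>U. x \<oplus>\<^sub>X y \<in> U) \<and>
  (\<forall>r\<in>carrier R. \<forall>x\<in>U. r \<odot>\<^sub>X x \<in> U)"

lemma submodD:
 assumes "submod R X U"
 shows "U \<subseteq> carrier X" "\<And>x. x \<in> U \<Longrightarrow> x \<in> carrier X" "\<zero>\<^sub>X \<in> U"
  "\<And>x y. x \<in> U \<Longrightarrow> y \<in> U \<Longrightarrow> x \<oplus>\<^sub>X y \<in> U" "\<And>r x. r \<in> carrier R \<Longrightarrow> x \<in> U \<Longrightarrow> r \<odot>\<^sub>X x \<in> U"
 using assms by (auto simp: submod_def)

abbreviation sub :: "('r, 'x, 'q) module_scheme \<Rightarrow> 'x set \<Rightarrow> ('r, 'x, 'q) module_scheme"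
 where "sub X U \<equiv> X\<lparr>carrier := U\<rparr>"

context left_module
begin

lemma submod_minus: "submod R M U \<Longrightarrow> x \<in> U \<Longrightarrow> \<ominus>\<^sub>M x \<in> U"
 using minus_as_smult submodD[of R M U] by auto

lemma submod_left_module: "submod R M U \<Longrightarrow> left_module R (sub M U)"
 using submodD[of R M U] R.ring_axioms
 by (intro left_moduleI) (auto simp: M.a_ac smult_l_distr smult_r_distr smult_assoc1 subset_iff)

lemma submod_carrier: "submod R M (carrier M)"
 by (auto simp: submod_def)

lemma submod_zero: "submod R M {\<zero>\<^sub>M}"
 by (auto simp: submod_def)

lemma submod_Int: "submod R M U \<Longrightarrow> submod R M V \<Longrightarrow> submod R M (U \<inter> V)"
 by (auto simp: submod_def)

end

lemma sub_hom: "U \<subseteq> carrier X \<Longrightarrow> (\<lambda>x. x) \<in> lmod_hom R (sub X U) X"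
 by (auto simp: lmod_hom_def)

lemma hom_restrict: "h \<in> lmod_hom R X Y \<Longrightarrow> U \<subseteq> carrier X \<Longrightarrow> h \<in> lmod_hom R (sub X U) Y"
 by (auto simp: lmod_hom_def Pi_iff subset_iff)

lemma hom_into_sub: "h \<in> lmod_hom R X Y \<Longrightarrow> h ` carrier X \<subseteq> U \<Longrightarrow> h \<in> lmod_hom R X (sub Y U)"
 by (auto simp: lmod_hom_def Pi_iff subset_iff)

lemma hom_from_sub: "h \<in> lmod_hom R X (sub Y U) \<Longrightarrow> U \<subseteq> carrier Y \<Longrightarrow> h \<in> lmod_hom R X Y"
 by (auto simp: lmod_hom_def Pi_iff subset_iff)

lemma submod_sub: "submod R X U \<Longrightarrow> submod R (sub X U) V \<longleftrightarrow> submod R X V \<and> V \<subseteq> U"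
 by (auto simp: submod_def)

lemma submod_image:
 assumes "left_module R X" "left_module R Y" "h \<in> lmod_hom R X Y" "submod R X U"
 shows "submod R Y (h ` U)"
proof -
 note U = submodD[OF assms(4)] and h = assms(3)
 have "h x \<oplus>\<^sub>Y h y \<in> h ` U" if "x \<in> U" "y \<in> U" for x y
  using that U(2,4) hom_add[OF h, of x y] by (metis imageI)
 moreover have "r \<odot>\<^sub>Y h x \<in> h ` U" if "r \<in> carrier R" "x \<in> U" for r x
  using that U(2,5) hom_smult[OF h, of r x] by (metis imageI)
 moreover have "\<zero>\<^sub>Y \<in> h ` U" using hom_zero[OF assms(1,2,3)] U(3) by (metis imageI)
 ultimately show ?thesis using U(2) hom_closed[OF h] by (auto simp: submod_def)
qed

lemma submod_vimage:
 assumes "left_module R X" "left_module R Y" "h \<in> lmod_hom R X Y" "submod R Y U"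
 shows "submod R X {x \<in> carrier X. h x \<in> U}"
proof -
 interpret X: left_module R X by fact
 show ?thesis
  using hom_zero[OF assms(1,2,3)] submodD(3-5)[OF assms(4)]
  by (auto simp: submod_def hom_add[OF assms(3)] hom_smult[OF assms(3)])
qed

lemma submod_kernel:
 assumes "left_module R X" "left_module R Y" "h \<in> lmod_hom R X Y"
 shows "submod R X (mod_kernel X Y h)"
proof -
 interpret Y: left_module R Y by fact
 show ?thesis using submod_vimage[OF assms Y.submod_zero] by (simp add: mod_kernel_def)
qed

definition span :: "('r, 'p) ring_scheme \<Rightarrow> ('r, 'x, 'q) module_scheme \<Rightarrow> 'x set \<Rightarrow> 'x set"
 where "span R X S = \<Inter>{U. submod R X U \<and> S \<subseteq> U}"

lemma span_least: "submod R X U \<Longrightarrow> S \<subseteq> U \<Longrightarrow> span R X S \<subseteq> U"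
 by (auto simp: span_def)

lemma span_superset: "S \<subseteq> span R X S"
 by (auto simp: span_def)

lemma (in left_module) submod_span: "S \<subseteq> carrier M \<Longrightarrow> submod R M (span R M S)"
 using submod_carrier unfolding submod_def[of R M "span R M S"] by (auto simp: span_def submodD)

text \<open>This form of finite generation makes no reference to linear combinations.\<close>

lemma finitely_generated_iff:
 assumes "left_module R X"
 shows "finitely_generated R X \<longleftrightarrow> (\<exists>S. finite S \<and> S \<subseteq> carrier X \<and> span R X S = carrier X)"
proof -
 interpret X: left_module R X by fact
 have key: "span R X S = {x. \<exists>c \<in> S \<rightarrow> carrier R. x = (\<Oplus>\<^bsub>X\<^esub>s \<in> S. c s \<odot>\<^sub>X s)}" (is "_ = ?L")
  if S: "finite S" "S \<subseteq> carrier X" for S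
 proof
  have cl: "(\<lambda>s. c s \<odot>\<^sub>X s) \<in> S \<rightarrow> carrier X" if "c \<in> S \<rightarrow> carrier R" for c
   using that S by auto
  have "submod R X ?L"
   unfolding submod_def
  proof (intro conjI ballI)
   show "?L \<subseteq> carrier X" using cl by auto
   have "(\<Oplus>\<^bsub>X\<^esub>s \<in> S. \<zero>\<^sub>R \<odot>\<^sub>X s) = (\<Oplus>\<^bsub>X\<^esub>s \<in> S. \<zero>\<^sub>X)"
    using S by (intro X.M.finsum_cong') auto
   then show "\<zero>\<^sub>X \<in> ?L" by (auto intro!: bexI[of _ "\<lambda>_. \<zero>\<^sub>R"])
  next
   fix x y assume "x \<in> ?L" "y \<in> ?L"
   then obtain c d where c: "c \<in> S \<rightarrow> carrier R" "x = (\<Oplus>\<^bsub>X\<^esub>s \<in> S. c s \<odot>\<^sub>X s)"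
    and d: "d \<in> S \<rightarrow> carrier R" "y = (\<Oplus>\<^bsub>X\<^esub>s \<in> S. d s \<odot>\<^sub>X s)" by blast
   have "x \<oplus>\<^sub>X y = (\<Oplus>\<^bsub>X\<^esub>s \<in> S. c s \<odot>\<^sub>X s \<oplus>\<^sub>X d s \<odot>\<^sub>X s)"
    using c d by (simp add: X.M.finsum_addf[OF cl cl])
   also have "\<dots> = (\<Oplus>\<^bsub>X\<^esub>s \<in> S. (\<lambda>s. c s \<oplus>\<^sub>R d s) s \<odot>\<^sub>X s)"
    using S c(1) d(1) by (intro X.M.finsum_cong') (auto simp: X.smult_l_distr Pi_iff subset_iff)
   finally show "x \<oplus>\<^sub>X y \<in> ?L" using c d by (auto simp: Pi_iff intro!: bexI[of _ "\<lambda>s. c s \<oplus>\<^sub>R d s"])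
  next
   fix r x assume r: "r \<in> carrier R" and "x \<in> ?L"
   then obtain c where c: "c \<in> S \<rightarrow> carrier R" "x = (\<Oplus>\<^bsub>X\<^esub>s \<in> S. c s \<odot>\<^sub>X s)" by blast
   have sm: "r \<odot>\<^sub>X (\<Oplus>\<^bsub>X\<^esub>s \<in> T. f s) = (\<Oplus>\<^bsub>X\<^esub>s \<in> T. r \<odot>\<^sub>X f s)"
    if "finite T" "f \<in> T \<rightarrow> carrier X" for f T
    using that by (induction T rule: finite_induct) (simp_all add: r X.smult_r_distr Pi_iff)
   have "r \<odot>\<^sub>X x = (\<Oplus>\<^bsub>X\<^esub>s \<in> S. r \<odot>\<^sub>X (c s \<odot>\<^sub>X s))"
    unfolding c(2) by (rule sm[OF S(1) cl[OF c(1)]])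
   also have "\<dots> = (\<Oplus>\<^bsub>X\<^esub>s \<in> S. (\<lambda>s. r \<otimes>\<^sub>R c s) s \<odot>\<^sub>X s)"
    using S c(1) r by (intro X.M.finsum_cong') (auto simp: X.smult_assoc1 Pi_iff subset_iff)
   finally show "r \<odot>\<^sub>X x \<in> ?L" using c r by (auto simp: Pi_iff intro!: bexI[of _ "\<lambda>s. r \<otimes>\<^sub>R c s"])
  qed
  moreover have "S \<subseteq> ?L"
  proof
   fix t assume t: "t \<in> S"
   let ?c = "\<lambda>s. if t = s then \<one>\<^sub>R else \<zero>\<^sub>R"
   have "(\<Oplus>\<^bsub>X\<^esub>s \<in> S. ?c s \<odot>\<^sub>X s) = (\<Oplus>\<^bsub>X\<^esub>s \<in> S. if t = s then s else \<zero>\<^sub>X)"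
    using S by (intro X.M.finsum_cong') (auto simp: subset_iff)
   also have "\<dots> = t" using S t by (subst X.M.finsum_singleton) (auto simp: subset_iff)
   finally show "t \<in> ?L" by (auto intro!: bexI[of _ ?c])
  qed
  ultimately show "span R X S \<subseteq> ?L" by (rule span_least)
  show "?L \<subseteq> span R X S"
  proof
   fix x assume "x \<in> ?L"
   then obtain c where c: "c \<in> S \<rightarrow> carrier R" "x = (\<Oplus>\<^bsub>X\<^esub>s \<in> S. c s \<odot>\<^sub>X s)" by blast
   have U: "submod R X (span R X S)" using S(2) by (rule X.submod_span)
   have "(\<Oplus>\<^bsub>X\<^esub>s \<in> T. c s \<odot>\<^sub>X s) \<in> span R X S" if "T \<subseteq> S" for T
    using finite_subset[OF that S(1)] that
   proof (induction T rule: finite_induct)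
    case empty then show ?case using submodD(3)[OF U] by simp
   next
    case (insert t T)
    have "(\<lambda>s. c s \<odot>\<^sub>X s) \<in> T \<rightarrow> carrier X" "c t \<odot>\<^sub>X t \<in> carrier X" "c t \<in> carrier R"
     using insert cl[OF c(1)] c(1) by auto
    then show ?case using insert span_superset[of S R X] submodD(4,5)[OF U]
     by (simp add: subset_iff)
   qed
   then show "x \<in> span R X S" using c by simp
  qed
 qed
 show ?thesis
 proof
  assume "finitely_generated R X"
  then obtain S where S: "finite S" "S \<subseteq> carrier X"
   "\<forall>x \<in> carrier X. \<exists>c \<in> S \<rightarrow> carrier R. x = (\<Oplus>\<^bsub>X\<^esub>s \<in> S. c s \<odot>\<^sub>X s)"
   unfolding finitely_generated_def by blast
  have "carrier X \<subseteq> span R X S" using S(3) key[OF S(1,2)] by auto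
  then show "\<exists>S. finite S \<and> S \<subseteq> carrier X \<and> span R X S = carrier X"
   using S span_least[OF X.submod_carrier S(2)] by blast
 next
  assume "\<exists>S. finite S \<and> S \<subseteq> carrier X \<and> span R X S = carrier X"
  then obtain S where "finite S" "S \<subseteq> carrier X" "span R X S = carrier X" by blast
  then show "finitely_generated R X" using key[of S] unfolding finitely_generated_def by blast
 qed
qed

lemma finitely_generatedI:
 assumes "left_module R X" "finite S" "S \<subseteq> carrier X"
  and "\<And>U. submod R X U \<Longrightarrow> S \<subseteq> U \<Longrightarrow> carrier X \<subseteq> U"
 shows "finitely_generated R X"
proof -
 interpret X: left_module R X by fact
 have "span R X S = carrier X"
  using assms(4) span_least[OF X.submod_carrier assms(3)] by (auto simp: span_def)
 then show ?thesis unfolding finitely_generated_iff[OF assms(1)] using assms(2,3) by auto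
qed

lemma finitely_generatedE:
 assumes "left_module R X" "finitely_generated R X"
 obtains S where "finite S" "S \<subseteq> carrier X" "\<And>U. submod R X U \<Longrightarrow> S \<subseteq> U \<Longrightarrow> U = carrier X"
proof -
 obtain S where S: "finite S" "S \<subseteq> carrier X" "span R X S = carrier X"
  using assms(2) unfolding finitely_generated_iff[OF assms(1)] by auto
 have "U = carrier X" if "submod R X U" "S \<subseteq> U" for U
  using span_least[OF that] S(3) submodD(1)[OF that(1)] by blast
 then show ?thesis using that S by blast
qed

lemma finitely_generated_image:
 assumes X: "left_module R X" and Y: "left_module R Y" and h: "h \<in> lmod_hom R X Y"
  and s: "h ` carrier X = carrier Y" and fg: "finitely_generated R X"
 shows "finitely_generated R Y"
proof -
 obtain S where S: "finite S" "S \<subseteq> carrier X" "\<And>U. submod R X U \<Longrightarrow> S \<subseteq> U \<Longrightarrow> U = carrier X"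
  using finitely_generatedE[OF X fg] by blast
 show ?thesis
 proof (rule finitely_generatedI[OF Y])
  fix U assume U: "submod R Y U" "h ` S \<subseteq> U"
  have "{x \<in> carrier X. h x \<in> U} = carrier X"
   using S U by (intro S(3) submod_vimage[OF X Y h U(1)]) auto
  then show "carrier Y \<subseteq> U" unfolding s[symmetric] by auto
 qed (use S s in auto)
qed

lemma span_fg:
 assumes X: "left_module R X" and S: "finite S" "S \<subseteq> carrier X"
 shows "finitely_generated R (sub X (span R X S))"
proof -
 interpret X: left_module R X by fact
 have sp: "submod R X (span R X S)" using S(2) by (rule X.submod_span)
 show ?thesis
 proof (rule finitely_generatedI[OF X.submod_left_module[OF sp] S(1)])
  show "S \<subseteq> carrier (sub X (span R X S))" by (simp add: span_superset)
  fix U assume "submod R (sub X (span R X S)) U" "S \<subseteq> U"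
  then show "carrier (sub X (span R X S)) \<subseteq> U"
   using span_least[of R X U S] by (simp add: submod_sub[OF sp])
 qed
qed

definition dsum :: "('r, 'x, 'q) module_scheme \<Rightarrow> ('r, 'y, 't) module_scheme \<Rightarrow> ('r, 'x \<times> 'y) module"
 where "dsum X Y = \<lparr>carrier = carrier X \<times> carrier Y, mult = undefined, one = undefined,
   zero = (\<zero>\<^sub>X, \<zero>\<^sub>Y), add = (\<lambda>p q. (fst p \<oplus>\<^sub>X fst q, snd p \<oplus>\<^sub>Y snd q)),
   smult = (\<lambda>r p. (r \<odot>\<^sub>X fst p, r \<odot>\<^sub>Y snd p))\<rparr>"

lemma dsum_simps [simp]:
 "carrier (dsum X Y) = carrier X \<times> carrier Y" "\<zero>\<^bsub>dsum X Y\<^esub> = (\<zero>\<^sub>X, \<zero>\<^sub>Y)"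
 "p \<oplus>\<^bsub>dsum X Y\<^esub> q = (fst p \<oplus>\<^sub>X fst q, snd p \<oplus>\<^sub>Y snd q)"
 "r \<odot>\<^bsub>dsum X Y\<^esub> p = (r \<odot>\<^sub>X fst p, r \<odot>\<^sub>Y snd p)"
 by (simp_all add: dsum_def)

lemma dsum_left_module:
 assumes "left_module R X" "left_module R Y" shows "left_module R (dsum X Y)"
proof -
 interpret X: left_module R X by fact
 interpret Y: left_module R Y by fact
 show ?thesis
  by (intro left_moduleI X.R.ring_axioms)
   (auto simp: X.M.a_ac Y.M.a_ac X.smult_l_distr Y.smult_l_distr X.smult_r_distr
    Y.smult_r_distr X.smult_assoc1 Y.smult_assoc1)
qed

lemma dsum_homs:
 assumes "left_module R X" "left_module R Y"
 shows "fst \<in> lmod_hom R (dsum X Y) X" "snd \<in> lmod_hom R (dsum X Y) Y"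
  "(\<lambda>x. (x, \<zero>\<^sub>Y)) \<in> lmod_hom R X (dsum X Y)" "(\<lambda>y. (\<zero>\<^sub>X, y)) \<in> lmod_hom R Y (dsum X Y)"
proof -
 interpret X: left_module R X by fact
 interpret Y: left_module R Y by fact
 show "fst \<in> lmod_hom R (dsum X Y) X" "snd \<in> lmod_hom R (dsum X Y) Y"
  "(\<lambda>x. (x, \<zero>\<^sub>Y)) \<in> lmod_hom R X (dsum X Y)" "(\<lambda>y. (\<zero>\<^sub>X, y)) \<in> lmod_hom R Y (dsum X Y)"
  by (auto simp: lmod_hom_def)
qed

lemma hom_pair:
 assumes "f \<in> lmod_hom R Z X" "g \<in> lmod_hom R Z Y"
 shows "(\<lambda>z. (f z, g z)) \<in> lmod_hom R Z (dsum X Y)"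
 using assms by (auto simp: lmod_hom_def)

lemma hom_sum:
 assumes "left_module R X" "f \<in> lmod_hom R Z X" "g \<in> lmod_hom R Z X"
 shows "(\<lambda>z. f z \<oplus>\<^sub>X g z) \<in> lmod_hom R Z X"
proof -
 interpret X: left_module R X by fact
 show ?thesis
  by (rule lmod_homI) (auto simp: X.M.a_ac X.smult_r_distr hom_closed[OF assms(2)]
    hom_closed[OF assms(3)] hom_add[OF assms(2)] hom_add[OF assms(3)]
    hom_smult[OF assms(2)] hom_smult[OF assms(3)])
qed

lemma hom_neg:
 assumes "left_module R X" "f \<in> lmod_hom R Z X"
 shows "(\<lambda>z. \<ominus>\<^sub>X f z) \<in> lmod_hom R Z X"
proof -
 interpret X: left_module R X by fact
 show ?thesis
  by (rule lmod_homI) (auto simp: X.M.minus_add X.M.a_ac X.smult_r_minus hom_closed[OF assms(2)]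
    hom_add[OF assms(2)] hom_smult[OF assms(2)])
qed

lemma dsum_map:
 assumes "f \<in> lmod_hom R X X'" "g \<in> lmod_hom R Y Y'"
 shows "map_prod f g \<in> lmod_hom R (dsum X Y) (dsum X' Y')"
 using assms by (auto simp: lmod_hom_def)

lemma dsum_fg:
 assumes X: "left_module R X" and Y: "left_module R Y"
  and fg: "finitely_generated R X" "finitely_generated R Y"
 shows "finitely_generated R (dsum X Y)"
proof -
 interpret X: left_module R X by fact
 interpret Y: left_module R Y by fact
 obtain S where S: "finite S" "S \<subseteq> carrier X" "\<And>U. submod R X U \<Longrightarrow> S \<subseteq> U \<Longrightarrow> U = carrier X"
  using finitely_generatedE[OF X fg(1)] by blast
 obtain T where T: "finite T" "T \<subseteq> carrier Y" "\<And>U. submod R Y U \<Longrightarrow> T \<subseteq> U \<Longrightarrow> U = carrier Y"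
  using finitely_generatedE[OF Y fg(2)] by blast
 note XY = dsum_left_module[OF X Y]
 show ?thesis
 proof (rule finitely_generatedI[OF XY, of "S \<times> {\<zero>\<^sub>Y} \<union> {\<zero>\<^sub>X} \<times> T"])
  fix U assume U: "submod R (dsum X Y) U" "S \<times> {\<zero>\<^sub>Y} \<union> {\<zero>\<^sub>X} \<times> T \<subseteq> U"
  have 1: "{x \<in> carrier X. (x, \<zero>\<^sub>Y) \<in> U} = carrier X"
   using S(2) U by (intro S(3) submod_vimage[OF X XY dsum_homs(3)[OF X Y] U(1)]) auto
  have 2: "{y \<in> carrier Y. (\<zero>\<^sub>X, y) \<in> U} = carrier Y"
   using T(2) U by (intro T(3) submod_vimage[OF Y XY dsum_homs(4)[OF X Y] U(1)]) auto
  show "carrier (dsum X Y) \<subseteq> U"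
  proof
   fix p assume p: "p \<in> carrier (dsum X Y)"
   then have "(fst p, \<zero>\<^sub>Y) \<oplus>\<^bsub>dsum X Y\<^esub> (\<zero>\<^sub>X, snd p) \<in> U"
    using 1 2 by (intro submodD(4)[OF U(1)]) auto
   then show "p \<in> U" using p by auto
  qed
 qed (use S T in auto)
qed

text \<open>
 The quotient lives on sets of elements of \<open>X\<close>, its elements being the cosets.
\<close>

lemma quotient_module:
 fixes X :: "('r, 'x, 'q) module_scheme"
 assumes X: "left_module R X" and C: "submod R X C"
 obtains Q :: "('r, 'x set) module" and p where "left_module R Q" "p \<in> lmod_hom R X Q"
  "p ` carrier X = carrier Q" "\<And>x. x \<in> carrier X \<Longrightarrow> p x = \<zero>\<^sub>Q \<longleftrightarrow> x \<in> C"
proof -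
 interpret X: left_module R X by fact
 define p where "p x = {y \<in> carrier X. y \<oplus>\<^sub>X \<ominus>\<^sub>X x \<in> C}" for x
 have pI: "p x = p y" if "x \<in> carrier X" "y \<in> carrier X" "x \<oplus>\<^sub>X \<ominus>\<^sub>X y \<in> C" for x y
 proof -
  have "z \<oplus>\<^sub>X \<ominus>\<^sub>X v \<in> C" if "z \<oplus>\<^sub>X \<ominus>\<^sub>X u \<in> C" "u \<oplus>\<^sub>X \<ominus>\<^sub>X v \<in> C"
   "z \<in> carrier X" "u \<in> carrier X" "v \<in> carrier X" for z u v
  proof -
   have "z \<oplus>\<^sub>X \<ominus>\<^sub>X v = (z \<oplus>\<^sub>X \<ominus>\<^sub>X u) \<oplus>\<^sub>X (u \<oplus>\<^sub>X \<ominus>\<^sub>X v)"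
    using that by (simp add: X.M.a_assoc X.M.r_neg1)
   then show ?thesis using submodD(4)[OF C that(1,2)] by simp
  qed
  moreover have "y \<oplus>\<^sub>X \<ominus>\<^sub>X x \<in> C"
   using X.submod_minus[OF C that(3)] that by (simp add: X.M.minus_add X.M.a_comm)
  ultimately show ?thesis using that unfolding p_def by blast
 qed
 have self: "x \<in> p x" if "x \<in> carrier X" for x
  using that submodD(3)[OF C] by (simp add: p_def X.M.r_neg)
 define g where "g U = (SOME x. x \<in> carrier X \<and> p x = U)" for U
 have g: "g (p x) \<in> carrier X" "p (g (p x)) = p x" if "x \<in> carrier X" for x
  unfolding g_def using someI[of "\<lambda>y. y \<in> carrier X \<and> p y = p x" x] that by auto
 have pD: "x \<oplus>\<^sub>X \<ominus>\<^sub>X y \<in> C" if "x \<in> carrier X" "y \<in> carrier X" "p x = p y" for x y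
  using self[OF that(1)] unfolding that(3) by (simp add: p_def)
 define Q :: "('r, 'x set) module" where "Q =
  \<lparr>carrier = p ` carrier X, mult = undefined, one = undefined, zero = p \<zero>\<^sub>X,
   add = (\<lambda>u v. p (g u \<oplus>\<^sub>X g v)), smult = (\<lambda>r u. p (r \<odot>\<^sub>X g u))\<rparr>"
 have add: "p (g (p x) \<oplus>\<^sub>X g (p y)) = p (x \<oplus>\<^sub>X y)" if "x \<in> carrier X" "y \<in> carrier X" for x y
 proof (rule pI)
  have "g (p x) \<oplus>\<^sub>X g (p y) \<oplus>\<^sub>X \<ominus>\<^sub>X (x \<oplus>\<^sub>X y) =
   (g (p x) \<oplus>\<^sub>X \<ominus>\<^sub>X x) \<oplus>\<^sub>X (g (p y) \<oplus>\<^sub>X \<ominus>\<^sub>X y)"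
   using that g by (simp add: X.M.minus_add X.M.a_ac)
  then show "g (p x) \<oplus>\<^sub>X g (p y) \<oplus>\<^sub>X \<ominus>\<^sub>X (x \<oplus>\<^sub>X y) \<in> C"
   using that g by (simp add: submodD(4)[OF C] pD)
 qed (use that g in auto)
 have sm: "p (r \<odot>\<^sub>X g (p x)) = p (r \<odot>\<^sub>X x)" if "r \<in> carrier R" "x \<in> carrier X" for r x
 proof (rule pI)
  have "r \<odot>\<^sub>X g (p x) \<oplus>\<^sub>X \<ominus>\<^sub>X (r \<odot>\<^sub>X x) = r \<odot>\<^sub>X (g (p x) \<oplus>\<^sub>X \<ominus>\<^sub>X x)"
   using that g by (simp add: X.smult_r_distr X.smult_r_minus)
  then show "r \<odot>\<^sub>X g (p x) \<oplus>\<^sub>X \<ominus>\<^sub>X (r \<odot>\<^sub>X x) \<in> C"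
   using that g by (simp add: submodD(5)[OF C] pD)
 qed (use that g in auto)
 have Q [simp]: "carrier Q = p ` carrier X" "zero Q = p \<zero>\<^sub>X"
  "u \<oplus>\<^sub>Q v = p (g u \<oplus>\<^sub>X g v)" "r \<odot>\<^sub>Q u = p (r \<odot>\<^sub>X g u)" for u v r
  by (simp_all add: Q_def)
 have "left_module R Q"
  by (intro left_moduleI X.R.ring_axioms)
   (auto simp: add sm X.M.a_ac X.smult_l_distr X.smult_r_distr X.smult_assoc1)
 moreover have "p \<in> lmod_hom R X Q" by (auto simp: lmod_hom_def add sm)
 moreover have "p x = \<zero>\<^sub>Q \<longleftrightarrow> x \<in> C" if "x \<in> carrier X" for x
  using pI[of x "\<zero>\<^sub>X"] pD[of x "\<zero>\<^sub>X"] that by (simp, blast)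
 ultimately show ?thesis using that[of Q p] by simp
qed

abbreviation reg :: "('r, 'p) ring_scheme \<Rightarrow> ('r, 'r, 'r) bimodule"
 where "reg R \<equiv> regular_bimodule R"

lemma reg_simps [simp]: "carrier (reg R) = carrier R" "\<zero>\<^bsub>reg R\<^esub> = \<zero>\<^sub>R"
 "x \<oplus>\<^bsub>reg R\<^esub> y = x \<oplus>\<^sub>R y" "x \<odot>\<^bsub>reg R\<^esub> y = x \<otimes>\<^sub>R y"
 by (simp_all add: regular_bimodule_def)

lemma reg_left_module:
 assumes "ring R" shows "left_module R (reg R)"
proof -
 interpret R: ring R by fact
 show ?thesis by (intro left_moduleI assms) (auto simp: R.a_ac R.m_assoc R.l_distr R.r_distr)
qed

lemma reg_fg:
 assumes "ring R" shows "finitely_generated R (reg R)"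
proof -
 interpret R: ring R by fact
 show ?thesis
 proof (rule finitely_generatedI[OF reg_left_module[OF assms], of "{\<one>\<^sub>R}"])
  fix U assume "submod R (reg R) U" "{\<one>\<^sub>R} \<subseteq> U"
  then show "carrier (reg R) \<subseteq> U" using submodD(5)[of R "reg R" U _ "\<one>\<^sub>R"] by fastforce
 qed auto
qed

lemma hom_from_reg:
 assumes "left_module R X" "x \<in> carrier X"
 shows "(\<lambda>r. r \<odot>\<^sub>X x) \<in> lmod_hom R (reg R) X"
proof -
 interpret X: left_module R X by fact
 show ?thesis using assms(2) by (auto simp: lmod_hom_def X.smult_l_distr X.smult_assoc1)
qed

definition ses ::
  "('r, 'p) ring_scheme \<Rightarrow> ('r, 'x, 'q) module_scheme \<Rightarrow> ('r, 'y, 's) module_scheme \<Rightarrow>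
   ('r, 'z, 't) module_scheme \<Rightarrow> ('x \<Rightarrow> 'y) \<Rightarrow> ('y \<Rightarrow> 'z) \<Rightarrow> bool"
 where "ses R X Y Z f g \<longleftrightarrow> left_module R X \<and> left_module R Y \<and> left_module R Z \<and>
  f \<in> lmod_hom R X Y \<and> inj_on f (carrier X) \<and> g \<in> lmod_hom R Y Z \<and>
  g ` carrier Y = carrier Z \<and> f ` carrier X = mod_kernel Y Z g"

lemma sesD:
 assumes "ses R X Y Z f g"
 shows "left_module R X" "left_module R Y" "left_module R Z" "f \<in> lmod_hom R X Y"
  "inj_on f (carrier X)" "g \<in> lmod_hom R Y Z" "g ` carrier Y = carrier Z"
  "f ` carrier X = mod_kernel Y Z g" "\<And>x. x \<in> carrier X \<Longrightarrow> g (f x) = \<zero>\<^sub>Z"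
  "\<And>y. y \<in> carrier Y \<Longrightarrow> g y = \<zero>\<^sub>Z \<Longrightarrow> \<exists>x\<in>carrier X. y = f x"
  "\<And>z. z \<in> carrier Z \<Longrightarrow> \<exists>y\<in>carrier Y. g y = z"
proof -
 show 8: "f ` carrier X = mod_kernel Y Z g" using assms by (simp add: ses_def)
 show "\<And>x. x \<in> carrier X \<Longrightarrow> g (f x) = \<zero>\<^sub>Z" using 8 by (auto simp: mod_kernel_def)
 show "\<And>y. y \<in> carrier Y \<Longrightarrow> g y = \<zero>\<^sub>Z \<Longrightarrow> \<exists>x\<in>carrier X. y = f x"
  using 8 by (auto simp: mod_kernel_def)
 show 7: "g ` carrier Y = carrier Z" using assms by (simp add: ses_def)
 show "\<And>z. z \<in> carrier Z \<Longrightarrow> \<exists>y\<in>carrier Y. g y = z" using 7 by force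
qed (use assms in \<open>auto simp: ses_def\<close>)

lemma sesI:
 assumes "left_module R X" "left_module R Y" "left_module R Z" "f \<in> lmod_hom R X Y"
  "\<And>x. x \<in> carrier X \<Longrightarrow> f x = \<zero>\<^sub>Y \<Longrightarrow> x = \<zero>\<^sub>X"
  "g \<in> lmod_hom R Y Z" "\<And>z. z \<in> carrier Z \<Longrightarrow> \<exists>y\<in>carrier Y. g y = z"
  "\<And>x. x \<in> carrier X \<Longrightarrow> g (f x) = \<zero>\<^sub>Z"
  "\<And>y. y \<in> carrier Y \<Longrightarrow> g y = \<zero>\<^sub>Z \<Longrightarrow> \<exists>x\<in>carrier X. y = f x"
 shows "ses R X Y Z f g"
proof -
 have "inj_on f (carrier X)" using hom_inj_iff[OF assms(1,2,4)] assms(5) by blast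
 moreover have "g ` carrier Y = carrier Z" using assms(6,7) by (force simp: lmod_hom_def)
 moreover have "f ` carrier X = mod_kernel Y Z g" using assms(4,8,9)
  by (fastforce simp: mod_kernel_def lmod_hom_def)
 ultimately show ?thesis using assms by (simp add: ses_def)
qed

lemma ses_kernel:
 assumes "left_module R Y" "left_module R Z" "g \<in> lmod_hom R Y Z" "g ` carrier Y = carrier Z"
 shows "ses R (sub Y (mod_kernel Y Z g)) Y Z (\<lambda>x. x) g"
proof -
 interpret Y: left_module R Y by fact
 have k: "submod R Y (mod_kernel Y Z g)" by (rule submod_kernel[OF assms(1-3)])
 show ?thesis unfolding ses_def
  using assms k Y.submod_left_module[OF k] by (auto simp: sub_hom submodD(1))
qed

section \<open>Testing projectivity and injectivity against modules of arbitrary size\<close>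

lemma projectiveE:
 fixes X Y :: "('r, 'r fg_carrier) module" and R :: "('r, 'p) ring_scheme"
 assumes "projective_module R P" "left_module R X" "left_module R Y"
  "g \<in> lmod_hom R X Y" "g ` carrier X = carrier Y" "f \<in> lmod_hom R P Y"
 obtains h where "h \<in> lmod_hom R P X" "\<And>p. p \<in> carrier P \<Longrightarrow> g (h p) = f p"
 using assms(1)[unfolded projective_module_def, THEN conjunct2, THEN spec, THEN spec, THEN spec, THEN spec,
   THEN mp, OF conjI, OF assms(2) conjI, OF assms(3) conjI, OF assms(4) conjI, OF assms(5,6)]
 by blast

lemma injectiveE:
 fixes X Y :: "('r, 'r fg_carrier) module" and R :: "('r, 'p) ring_scheme"
 assumes "injective_module R I" "left_module R X" "left_module R Y"
  "g \<in> lmod_hom R X Y" "inj_on g (carrier X)" "f \<in> lmod_hom R X I"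
 obtains h where "h \<in> lmod_hom R Y I" "\<And>x. x \<in> carrier X \<Longrightarrow> h (g x) = f x"
 using assms(1)[unfolded injective_module_def, THEN conjunct2, THEN spec, THEN spec, THEN spec, THEN spec,
   THEN mp, OF conjI, OF assms(2) conjI, OF assms(3) conjI, OF assms(4) conjI, OF assms(5,6)]
 by blast

text \<open>
 Projectivity is defined by lifting along surjections of modules on \<open>fg_carrier\<close>. A lifting problem for a finitely
 generated \<open>P\<close> against arbitrary \<open>X\<close> and \<open>Y\<close> only involves finitely generated submodules of them, which have copies there.
\<close>

lemma projective_lift:
 assumes P: "projective_module R P" "finitely_generated R P"
  and X: "left_module R X" and Y: "left_module R Y"
  and g: "g \<in> lmod_hom R X Y" "g ` carrier X = carrier Y" and f: "f \<in> lmod_hom R P Y"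
 obtains h where "h \<in> lmod_hom R P X" "\<And>p. p \<in> carrier P \<Longrightarrow> g (h p) = f p"
proof -
 have lP: "left_module R P" using P by (simp add: projective_module_def)
 interpret X: left_module R X by fact
 interpret Y: left_module R Y by fact
 obtain S where S: "finite S" "S \<subseteq> carrier P" "\<And>U. submod R P U \<Longrightarrow> S \<subseteq> U \<Longrightarrow> U = carrier P"
  using finitely_generatedE[OF lP P(2)] by blast
 have "\<exists>x\<in>carrier X. g x = f s" if "s \<in> S" for s
 proof -
  have "f s \<in> g ` carrier X" using g(2) hom_closed[OF f] S(2) that by auto
  then show ?thesis by auto
 qed
 then obtain x where x: "\<And>s. s \<in> S \<Longrightarrow> x s \<in> carrier X \<and> g (x s) = f s" by metis
 define U where "U = span R X (x ` S)"
 define V where "V = g ` U"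
 have xS: "finite (x ` S)" "x ` S \<subseteq> carrier X" using S(1) x by auto
 have U: "submod R X U" unfolding U_def using xS(2) by (rule X.submod_span)
 have V: "submod R Y V" unfolding V_def by (rule submod_image[OF X Y g(1) U])
 have lU: "left_module R (sub X U)" using U by (rule X.submod_left_module)
 have lV: "left_module R (sub Y V)" using V by (rule Y.submod_left_module)
 have fgU: "finitely_generated R (sub X U)" unfolding U_def by (rule span_fg[OF X xS])
 have gU: "g \<in> lmod_hom R (sub X U) (sub Y V)"
  by (intro hom_into_sub hom_restrict g submodD(1)[OF U]) (simp add: V_def)
 have fgV: "finitely_generated R (sub Y V)"
  by (rule finitely_generated_image[OF lU lV gU _ fgU]) (simp add: V_def)
 have "{p \<in> carrier P. f p \<in> V} = carrier P"
 proof (rule S(3)[OF submod_vimage[OF lP Y f V]])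
  have "f s \<in> V" if "s \<in> S" for s
   using x[OF that] span_superset[of "x ` S" R X] that unfolding V_def U_def by (metis imageI subsetD)
  then show "S \<subseteq> {p \<in> carrier P. f p \<in> V}" using S(2) by auto
 qed
 then have fV: "f \<in> lmod_hom R P (sub Y V)" by (intro hom_into_sub f) auto
 obtain X' :: "('a, 'a fg_carrier) module" and a where a: "fg_module R X'" "a \<in> lmod_iso R (sub X U) X'"
  using fg_module_copy[of R "sub X U"] lU fgU unfolding fg_module_def by blast
 obtain Y' :: "('a, 'a fg_carrier) module" and b where b: "fg_module R Y'" "b \<in> lmod_iso R (sub Y V) Y'"
  using fg_module_copy[of R "sub Y V"] lV fgV unfolding fg_module_def by blast
 define a' where "a' = inv_into (carrier (sub X U)) a"
 note a' = iso_inverse[OF a(2) lU, folded a'_def]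
 have 1: "(\<lambda>x. b (g (a' x))) \<in> lmod_hom R X' Y'"
  by (rule hom_comp[OF hom_comp[OF iso_hom[OF a'(1)] gU] iso_hom[OF b(2)]])
 have "a' ` carrier X' = U" using iso_surj[OF a'(1)] by simp
 then have "(\<lambda>x. b (g (a' x))) ` carrier X' = b ` g ` U" by (metis image_image)
 then have 2: "(\<lambda>x. b (g (a' x))) ` carrier X' = carrier Y'"
  using iso_surj[OF b(2)] by (simp add: V_def)
 have 3: "(\<lambda>p. b (f p)) \<in> lmod_hom R P Y'" by (rule hom_comp[OF fV iso_hom[OF b(2)]])
 obtain h where h: "h \<in> lmod_hom R P X'" "\<And>p. p \<in> carrier P \<Longrightarrow> b (g (a' (h p))) = b (f p)"
  using projectiveE[OF P(1) _ _ 1 2 3] a(1) b(1) unfolding fg_module_def by metis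
 have "(\<lambda>p. a' (h p)) \<in> lmod_hom R P X"
  by (rule hom_from_sub[OF hom_comp[OF h(1) iso_hom[OF a'(1)]] submodD(1)[OF U]])
 moreover have "g (a' (h p)) = f p" if p: "p \<in> carrier P" for p
  using hom_closed[OF hom_comp[OF hom_comp[OF h(1) iso_hom[OF a'(1)]] gU] p]
   hom_closed[OF fV p] h(2)[OF p] iso_inj[OF b(2)] by (simp add: inj_on_def)
 ultimately show ?thesis using that by blast
qed

lemma projective_iso:
 assumes P: "projective_module R P" and h: "h \<in> lmod_iso R P Q" and Q: "left_module R Q"
 shows "projective_module R Q"
 unfolding projective_module_def
proof (intro conjI Q allI impI; elim conjE)
 fix X Y :: "('a, 'a fg_carrier) module" and g f
 assume a: "left_module R X" "left_module R Y" "g \<in> lmod_hom R X Y" "g ` carrier X = carrier Y"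
  "f \<in> lmod_hom R Q Y"
 have lP: "left_module R P" using P by (simp add: projective_module_def)
 note h' = iso_inverse[OF h lP]
 obtain k where k: "k \<in> lmod_hom R P X" "\<And>p. p \<in> carrier P \<Longrightarrow> g (k p) = f (h p)"
  by (rule projectiveE[OF P a(1-4) hom_comp[OF iso_hom[OF h] a(5)]]) (rule that, assumption, simp)
 show "\<exists>h\<in>lmod_hom R Q X. \<forall>p\<in>carrier Q. g (h p) = f p"
  using hom_comp[OF iso_hom[OF h'(1)] k(1)] k(2) h'(3) hom_closed[OF iso_hom[OF h'(1)]] by metis
qed

lemma injective_iso:
 assumes P: "injective_module R P" and h: "h \<in> lmod_iso R P Q" and Q: "left_module R Q"
 shows "injective_module R Q"
 unfolding injective_module_def
proof (intro conjI Q allI impI; elim conjE)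
 fix X Y :: "('a, 'a fg_carrier) module" and g f
 assume a: "left_module R X" "left_module R Y" "g \<in> lmod_hom R X Y" "inj_on g (carrier X)"
  "f \<in> lmod_hom R X Q"
 have lP: "left_module R P" using P by (simp add: injective_module_def)
 note h' = iso_inverse[OF h lP]
 obtain k where k: "k \<in> lmod_hom R Y P" "\<And>x. x \<in> carrier X \<Longrightarrow> k (g x) = inv_into (carrier P) h (f x)"
  by (rule injectiveE[OF P a(1-4) hom_comp[OF a(5) iso_hom[OF h'(1)]]]) (rule that, assumption, simp)
 show "\<exists>h\<in>lmod_hom R Y Q. \<forall>x\<in>carrier X. h (g x) = f x"
  using hom_comp[OF k(1) iso_hom[OF h]] k(2) h'(3) hom_closed[OF a(5)] by metis
qed

lemma projective_dsum:
 assumes P: "projective_module R P" and Q: "projective_module R Q"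
 shows "projective_module R (dsum P Q)"
proof -
 have lP: "left_module R P" and lQ: "left_module R Q" using P Q by (auto simp: projective_module_def)
 interpret P: left_module R P by fact
 interpret Q: left_module R Q by fact
 note PQ = dsum_homs[OF lP lQ]
 show ?thesis
  unfolding projective_module_def
 proof (intro conjI dsum_left_module lP lQ allI impI; elim conjE)
  fix X Y :: "('a, 'a fg_carrier) module" and g f
  assume a: "left_module R X" "left_module R Y" "g \<in> lmod_hom R X Y" "g ` carrier X = carrier Y"
   "f \<in> lmod_hom R (dsum P Q) Y"
  obtain h where h: "h \<in> lmod_hom R P X" "\<And>p. p \<in> carrier P \<Longrightarrow> g (h p) = f (p, \<zero>\<^sub>Q)"
   by (rule projectiveE[OF P a(1-4) hom_comp[OF PQ(3) a(5)]]) (rule that, assumption, simp)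
  obtain k where k: "k \<in> lmod_hom R Q X" "\<And>q. q \<in> carrier Q \<Longrightarrow> g (k q) = f (\<zero>\<^sub>P, q)"
   by (rule projectiveE[OF Q a(1-4) hom_comp[OF PQ(4) a(5)]]) (rule that, assumption, simp)
  have "g (h (fst p) \<oplus>\<^sub>X k (snd p)) = f p" if p: "p \<in> carrier (dsum P Q)" for p
  proof -
   have "f p = f ((fst p, \<zero>\<^sub>Q) \<oplus>\<^bsub>dsum P Q\<^esub> (\<zero>\<^sub>P, snd p))" using p by auto
   also have "\<dots> = f (fst p, \<zero>\<^sub>Q) \<oplus>\<^sub>Y f (\<zero>\<^sub>P, snd p)" using p by (intro hom_add[OF a(5)]) auto
   finally show ?thesis using p hom_closed[OF h(1)] hom_closed[OF k(1)] h(2) k(2)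
    by (auto simp: hom_add[OF a(3)])
  qed
  then show "\<exists>h\<in>lmod_hom R (dsum P Q) X. \<forall>p\<in>carrier (dsum P Q). g (h p) = f p"
   by (intro bexI[OF _ hom_sum[OF a(1) hom_comp[OF PQ(1) h(1)] hom_comp[OF PQ(2) k(1)]]]) simp
 qed
qed

lemma injective_dsum:
 assumes P: "injective_module R P" and Q: "injective_module R Q"
 shows "injective_module R (dsum P Q)"
proof -
 have lP: "left_module R P" and lQ: "left_module R Q" using P Q by (auto simp: injective_module_def)
 note PQ = dsum_homs[OF lP lQ]
 show ?thesis
  unfolding injective_module_def
 proof (intro conjI dsum_left_module lP lQ allI impI; elim conjE)
  fix X Y :: "('a, 'a fg_carrier) module" and g f
  assume a: "left_module R X" "left_module R Y" "g \<in> lmod_hom R X Y" "inj_on g (carrier X)"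
   "f \<in> lmod_hom R X (dsum P Q)"
  obtain h where h: "h \<in> lmod_hom R Y P" "\<And>x. x \<in> carrier X \<Longrightarrow> h (g x) = fst (f x)"
   by (rule injectiveE[OF P a(1-4) hom_comp[OF a(5) PQ(1)]]) (rule that, assumption, simp)
  obtain k where k: "k \<in> lmod_hom R Y Q" "\<And>x. x \<in> carrier X \<Longrightarrow> k (g x) = snd (f x)"
   by (rule injectiveE[OF Q a(1-4) hom_comp[OF a(5) PQ(2)]]) (rule that, assumption, simp)
  show "\<exists>h\<in>lmod_hom R Y (dsum P Q). \<forall>x\<in>carrier X. h (g x) = f x"
   using hom_pair[OF h(1) k(1)] h(2) k(2) by (intro bexI) auto
 qed
qed

text \<open>
 Injectivity as defined only speaks of test modules on \<open>fg_carrier\<close>. Baer's condition is independent of such a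
 choice, and by \<open>baer_extend\<close> below it yields extensions along embeddings of modules of any type.
\<close>

definition baer :: "('r, 'p) ring_scheme \<Rightarrow> ('r, 'x, 'q) module_scheme \<Rightarrow> bool"
 where "baer R I \<longleftrightarrow> (\<forall>U f. submod R (reg R) U \<and> f \<in> lmod_hom R (sub (reg R) U) I \<longrightarrow>
  (\<exists>i \<in> carrier I. \<forall>u \<in> U. f u = u \<odot>\<^sub>I i))"

lemma injective_imp_baer:
 assumes I: "injective_module R I" shows "baer R I"
 unfolding baer_def
proof (intro allI impI; elim conjE)
 fix U f assume U: "submod R (reg R) U" and f: "f \<in> lmod_hom R (sub (reg R) U) I"
 have lI: "left_module R I" using I by (simp add: injective_module_def)
 interpret I: left_module R I by fact
 have lR: "left_module R (reg R)" by (rule reg_left_module) (rule I.R.ring_axioms)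
 interpret RR: left_module R "reg R" by fact
 obtain Y :: "('a, 'a fg_carrier) module" and j where j: "fg_module R Y" "j \<in> lmod_iso R (reg R) Y"
  using fg_module_copy[of R "reg R"] lR reg_fg[OF I.R.ring_axioms] unfolding fg_module_def by blast
 have lY: "left_module R Y" using j by (simp add: fg_module_def)
 interpret Y: left_module R Y by fact
 define j' where "j' = inv_into (carrier (reg R)) j"
 note j' = iso_inverse[OF j(2) lR, folded j'_def]
 note ju = submod_image[OF lR lY iso_hom[OF j(2)] U]
 have "j' ` (j ` U) \<subseteq> U" using submodD(2)[OF U] j'(2) by auto
 then have "j' \<in> lmod_hom R (sub Y (j ` U)) (sub (reg R) U)"
  by (intro hom_into_sub hom_restrict[OF iso_hom[OF j'(1)]] submodD(1)[OF ju]) simp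
 then have "(\<lambda>y. f (j' y)) \<in> lmod_hom R (sub Y (j ` U)) I" using f by (rule hom_comp)
 note fj = this
 have inj: "inj_on (\<lambda>y. y) (carrier (sub Y (j ` U)))" by simp
 obtain h where h: "h \<in> lmod_hom R Y I" "\<And>y. y \<in> carrier (sub Y (j ` U)) \<Longrightarrow> h y = f (j' y)"
  by (rule injectiveE[OF I Y.submod_left_module[OF ju] lY sub_hom[OF submodD(1)[OF ju], of R] inj fj])
   (rule that, assumption, simp)
 have one: "j \<one>\<^sub>R \<in> carrier Y" using hom_closed[OF iso_hom[OF j(2)]] by simp
 have "f u = u \<odot>\<^sub>I h (j \<one>\<^sub>R)" if u: "u \<in> U" for u
 proof -
  have uR: "u \<in> carrier R" using submodD(2)[OF U] u by simp
  have "f u = h (j (u \<odot>\<^bsub>reg R\<^esub> \<one>\<^sub>R))" using h(2) u uR j'(2)[of u] by simp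
  also have "j (u \<odot>\<^bsub>reg R\<^esub> \<one>\<^sub>R) = u \<odot>\<^sub>Y j \<one>\<^sub>R"
   by (rule hom_smult[OF iso_hom[OF j(2)] uR]) simp
  finally show ?thesis using hom_smult[OF h(1) uR one] by simp
 qed
 then show "\<exists>i\<in>carrier I. \<forall>u\<in>U. f u = u \<odot>\<^sub>I i" using hom_closed[OF h(1) one] by blast
qed

lemma (in left_module) submod_adjoin:
 assumes U: "submod R M U" and q: "q \<in> carrier M"
 defines "V \<equiv> {p \<oplus>\<^sub>M r \<odot>\<^sub>M q | p r. p \<in> U \<and> r \<in> carrier R}"
 shows "submod R M V" "U \<subseteq> V" "q \<in> V"
proof -
 note U' = submodD[OF U]
 have zero: "\<zero>\<^sub>M \<oplus>\<^sub>M r \<odot>\<^sub>M q \<in> V" if "r \<in> carrier R" for r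
  unfolding V_def using U'(3) that by blast
 show "U \<subseteq> V"
 proof
  fix u assume u: "u \<in> U"
  have "u = u \<oplus>\<^sub>M \<zero>\<^sub>R \<odot>\<^sub>M q" using U'(2)[OF u] q by simp
  then show "u \<in> V" unfolding V_def using u R.zero_closed by blast
 qed
 show "q \<in> V" using zero[of "\<one>\<^sub>R"] q by simp
 show "submod R M V"
  unfolding submod_def
 proof (intro conjI ballI)
  show "V \<subseteq> carrier M" unfolding V_def using U'(2) q by auto
  show "\<zero>\<^sub>M \<in> V" using zero[of "\<zero>\<^sub>R"] q by simp
  fix x assume "x \<in> V"
  then obtain p r where p: "p \<in> U" "r \<in> carrier R" "x = p \<oplus>\<^sub>M r \<odot>\<^sub>M q" unfolding V_def by blast
  { fix y assume "y \<in> V"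
   then obtain p' r' where p': "p' \<in> U" "r' \<in> carrier R" "y = p' \<oplus>\<^sub>M r' \<odot>\<^sub>M q" unfolding V_def by blast
   have "x \<oplus>\<^sub>M y = (p \<oplus>\<^sub>M p') \<oplus>\<^sub>M (r \<oplus>\<^sub>R r') \<odot>\<^sub>M q"
    using p p' q U'(2) by (simp add: smult_l_distr M.a_ac)
   then show "x \<oplus>\<^sub>M y \<in> V" unfolding V_def using p p' U'(4) R.a_closed by blast }
  fix s assume s: "s \<in> carrier R"
  have "s \<odot>\<^sub>M x = s \<odot>\<^sub>M p \<oplus>\<^sub>M (s \<otimes>\<^sub>R r) \<odot>\<^sub>M q"
   using p s q U'(2) by (simp add: smult_r_distr smult_assoc1)
  then show "s \<odot>\<^sub>M x \<in> V" unfolding V_def using p s U'(5) R.m_closed by blast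
 qed
qed

text \<open>
 Zorn's lemma; a maximal \<open>V\<close> meets \<open>S\<close> as soon as it is enlarged by a further element \<open>x\<close>.
\<close>

lemma maximal_avoiding:
 assumes X: "left_module R X" and U: "submod R X U" and S: "U \<inter> S = {}"
 obtains V where "submod R X V" "U \<subseteq> V" "V \<inter> S = {}"
  "\<And>x. x \<in> carrier X \<Longrightarrow> x \<notin> V \<Longrightarrow> \<exists>v\<in>V. \<exists>r\<in>carrier R. v \<oplus>\<^sub>X r \<odot>\<^sub>X x \<in> S"
proof -
 define \<A> where "\<A> = {V. submod R X V \<and> U \<subseteq> V \<and> V \<inter> S = {}}"
 have ne: "\<A> \<noteq> {}" using U S by (auto simp: \<A>_def)
 have "\<Union>\<C> \<in> \<A>" if C: "\<C> \<noteq> {}" "subset.chain \<A> \<C>" for \<C>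
 proof -
  have CA: "G \<in> \<A>" if "G \<in> \<C>" for G using C(2) that by (auto simp: subset.chain_def)
  have lin: "G \<subseteq> H \<or> H \<subseteq> G" if "G \<in> \<C>" "H \<in> \<C>" for G H
   using C(2) that by (auto simp: subset_chain_def)
  have sm: "submod R X G" if "G \<in> \<C>" for G using CA[OF that] by (simp add: \<A>_def)
  have "submod R X (\<Union>\<C>)"
   unfolding submod_def
  proof (intro conjI ballI)
   show "\<Union>\<C> \<subseteq> carrier X" using submodD(1)[OF sm] by blast
   show "\<zero>\<^sub>X \<in> \<Union>\<C>" using submodD(3)[OF sm] C(1) by blast
   show "x \<oplus>\<^sub>X y \<in> \<Union>\<C>" if xy: "x \<in> \<Union>\<C>" "y \<in> \<Union>\<C>" for x y
   proof -
    obtain G H where GH: "x \<in> G" "G \<in> \<C>" "y \<in> H" "H \<in> \<C>" using xy by blast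
    show ?thesis using lin[OF GH(2,4)] submodD(4)[OF sm[OF GH(2)]] submodD(4)[OF sm[OF GH(4)]] GH
     by (meson UnionI subsetD)
   qed
   show "r \<odot>\<^sub>X x \<in> \<Union>\<C>" if "r \<in> carrier R" "x \<in> \<Union>\<C>" for r x
    using that submodD(5)[OF sm] by blast
  qed
  then show ?thesis using CA C(1) unfolding \<A>_def by blast
 qed
 from subset_Zorn_nonempty[OF ne this] obtain V where V: "V \<in> \<A>" "\<And>W. W \<in> \<A> \<Longrightarrow> V \<subseteq> W \<Longrightarrow> W = V"
  by blast
 show ?thesis
 proof (rule that)
  show "submod R X V" "U \<subseteq> V" "V \<inter> S = {}" using V(1) by (auto simp: \<A>_def)
  fix x assume x: "x \<in> carrier X" "x \<notin> V"
  have sm: "submod R X V" using V(1) by (simp add: \<A>_def)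
  note W = left_module.submod_adjoin[OF X sm x(1)]
  let ?W = "{v \<oplus>\<^sub>X r \<odot>\<^sub>X x | v r. v \<in> V \<and> r \<in> carrier R}"
  have "?W \<notin> \<A>" using V(2)[OF _ W(2)] W(3) x(2) by blast
  then have "?W \<inter> S \<noteq> {}" using W(1,2) V(1) unfolding \<A>_def by blast
  then show "\<exists>v\<in>V. \<exists>r\<in>carrier R. v \<oplus>\<^sub>X r \<odot>\<^sub>X x \<in> S" by blast
 qed
qed

text \<open>
 Baer's criterion: a maximal extension of \<open>f\<close>, found among the submodules of \<open>Y \<oplus> I\<close> that
 are graphs, is total, because it can be prolonged to any further element \<open>y\<close> by the
 condition on the left ideal of those \<open>r\<close> for which \<open>r y\<close> lies in its domain.
\<close>

lemma baer_extend:
 assumes I: "left_module R I" "baer R I" and Y: "left_module R Y" and U: "submod R Y U"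
  and f: "f \<in> lmod_hom R (sub Y U) I"
 obtains h where "h \<in> lmod_hom R Y I" "\<And>u. u \<in> U \<Longrightarrow> h u = f u"
proof -
 interpret I: left_module R I by fact
 interpret Y: left_module R Y by fact
 have lD: "left_module R (dsum Y I)" using Y I(1) by (rule dsum_left_module)
 have lU: "left_module R (sub Y U)" using U by (rule Y.submod_left_module)
 let ?S = "{(\<zero>\<^sub>Y, i) | i. i \<noteq> \<zero>\<^sub>I}"
 have "(\<lambda>u. (u, f u)) \<in> lmod_hom R (sub Y U) (dsum Y I)"
  by (rule hom_pair[OF sub_hom[OF submodD(1)[OF U]] f])
 from submod_image[OF lU lD this left_module.submod_carrier[OF lU]]
 have "submod R (dsum Y I) ((\<lambda>u. (u, f u)) ` U)" by simp
 moreover have "(\<lambda>u. (u, f u)) ` U \<inter> ?S = {}" using hom_zero[OF lU I(1) f] by auto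
 ultimately obtain G where smG: "submod R (dsum Y I) G" and Gf: "(\<lambda>u. (u, f u)) ` U \<subseteq> G" and GS: "G \<inter> ?S = {}"
  and max: "\<And>p. p \<in> carrier (dsum Y I) \<Longrightarrow> p \<notin> G \<Longrightarrow>
   \<exists>q\<in>G. \<exists>r\<in>carrier R. q \<oplus>\<^bsub>dsum Y I\<^esub> r \<odot>\<^bsub>dsum Y I\<^esub> p \<in> ?S"
  by (rule maximal_avoiding[OF lD]) (rule that)
 note Gs = submodD[OF smG]
 have G0: "i = \<zero>\<^sub>I" if "(\<zero>\<^sub>Y, i) \<in> G" for i using GS that by blast
 have neg: "(\<ominus>\<^sub>Y y, \<ominus>\<^sub>I i) \<in> G" if "(y, i) \<in> G" for y i
  using Gs(5)[of "\<ominus>\<^sub>R \<one>\<^sub>R" "(y, i)"] Gs(2)[OF that] that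
  by (simp add: Y.minus_as_smult I.minus_as_smult)
 have func: "i = i'" if "(y, i) \<in> G" "(y, i') \<in> G" for y i i'
 proof -
  have "(y, i) \<oplus>\<^bsub>dsum Y I\<^esub> (\<ominus>\<^sub>Y y, \<ominus>\<^sub>I i') \<in> G" using that neg by (intro Gs(4)) auto
  then show ?thesis using Gs(2)[OF that(1)] Gs(2)[OF that(2)] G0[of "i \<oplus>\<^sub>I \<ominus>\<^sub>I i'"]
   by (simp add: Y.M.r_neg I.diff_eq_zero)
 qed
 have tot: "\<exists>i. (y, i) \<in> G" if y: "y \<in> carrier Y" for y
 proof (rule ccontr)
  assume no: "\<not> (\<exists>i. (y, i) \<in> G)"
  define V where "V = {r \<in> carrier R. \<exists>i. (r \<odot>\<^sub>Y y, i) \<in> G}"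
  define F where "F r = (THE i. (r \<odot>\<^sub>Y y, i) \<in> G)" for r
  have F: "(r \<odot>\<^sub>Y y, F r) \<in> G" if "r \<in> V" for r
   using that func unfolding V_def F_def by (auto intro: theI2)
  have FI: "F r = i" "r \<in> V" if "r \<in> carrier R" "(r \<odot>\<^sub>Y y, i) \<in> G" for r i
   using that func F unfolding V_def by blast+
  have Fadd: "r \<oplus>\<^sub>R s \<in> V \<and> F (r \<oplus>\<^sub>R s) = F r \<oplus>\<^sub>I F s" if "r \<in> V" "s \<in> V" for r s
   using Gs(4)[OF F[OF that(1)] F[OF that(2)]] that y FI[of "r \<oplus>\<^sub>R s"] by (simp add: V_def Y.smult_l_distr)
  have Fsm: "r \<otimes>\<^sub>R s \<in> V \<and> F (r \<otimes>\<^sub>R s) = r \<odot>\<^sub>I F s" if "r \<in> carrier R" "s \<in> V" for r s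
   using Gs(5)[OF that(1) F[OF that(2)]] that y FI[of "r \<otimes>\<^sub>R s"] by (simp add: V_def Y.smult_assoc1)
  have "\<zero>\<^sub>R \<in> V" using FI(2)[of "\<zero>\<^sub>R" "\<zero>\<^sub>I"] Gs(3) y by simp
  then have "submod R (reg R) V" using Fadd Fsm by (auto simp: submod_def V_def)
  moreover have "F \<in> lmod_hom R (sub (reg R) V) I"
   using Gs(2)[OF F] Fadd Fsm by (intro lmod_homI) auto
  ultimately obtain i0 where i0: "i0 \<in> carrier I" "\<forall>u \<in> V. F u = u \<odot>\<^sub>I i0"
   using I(2) unfolding baer_def by blast
  obtain y1 i1 r where p: "(y1, i1) \<in> G" "r \<in> carrier R" "y1 \<oplus>\<^sub>Y r \<odot>\<^sub>Y y = \<zero>\<^sub>Y" "i1 \<oplus>\<^sub>I r \<odot>\<^sub>I i0 \<noteq> \<zero>\<^sub>I"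
   using max[of "(y, i0)"] y i0 no by force
  have c: "y1 \<in> carrier Y" "i1 \<in> carrier I" using Gs(2)[OF p(1)] by auto
  have "r \<odot>\<^sub>Y y = \<ominus>\<^sub>Y y1" using p(2,3) c y
   by (metis Y.M.a_comm Y.M.minus_equality Y.smult_closed)
  then have "(r \<odot>\<^sub>Y y, \<ominus>\<^sub>I i1) \<in> G" using neg[OF p(1)] by simp
  from FI[OF p(2) this] have "\<ominus>\<^sub>I i1 = r \<odot>\<^sub>I i0" using i0(2) by auto
  then show False using p(4) c by (metis I.M.r_neg)
 qed
 define h where "h y = (THE i. (y, i) \<in> G)" for y
 have hG: "(y, h y) \<in> G" if "y \<in> carrier Y" for y
  using tot[OF that] func unfolding h_def by (auto intro: theI2)
 have hI: "h y = i" if "(y, i) \<in> G" for y i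
  using func[OF hG that] Gs(2)[OF that] that by simp
 have "h \<in> lmod_hom R Y I"
 proof (rule lmod_homI)
  fix x y assume xy: "x \<in> carrier Y" "y \<in> carrier Y"
  show "h x \<in> carrier I" using Gs(2)[OF hG[OF xy(1)]] by simp
  show "h (x \<oplus>\<^sub>Y y) = h x \<oplus>\<^sub>I h y" using Gs(4)[OF hG hG] xy by (intro hI) simp
  show "h (r \<odot>\<^sub>Y x) = r \<odot>\<^sub>I h x" if "r \<in> carrier R" for r
   using Gs(5)[OF that hG] xy by (intro hI) simp
 qed
 then show ?thesis using that[of h] hI Gf by blast
qed

lemma baer_extend_inj:
 assumes I: "left_module R I" "baer R I" and X: "left_module R X" and Y: "left_module R Y"
  and g: "g \<in> lmod_hom R X Y" "inj_on g (carrier X)" and f: "f \<in> lmod_hom R X I"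
 obtains h where "h \<in> lmod_hom R Y I" "\<And>x. x \<in> carrier X \<Longrightarrow> h (g x) = f x"
proof -
 interpret X: left_module R X by fact
 have U: "submod R Y (g ` carrier X)" by (rule submod_image[OF X Y g(1) X.submod_carrier])
 have "g \<in> lmod_iso R X (sub Y (g ` carrier X))"
  using hom_into_sub[OF g(1)] g(2) by (intro isoI) auto
 note g' = iso_inverse[OF this X]
 obtain h where "h \<in> lmod_hom R Y I" "\<And>u. u \<in> g ` carrier X \<Longrightarrow> h u = f (inv_into (carrier X) g u)"
  using baer_extend[OF I Y U hom_comp[OF iso_hom[OF g'(1)] f]] by blast
 then show ?thesis using that[of h] g'(2) by auto
qed

section \<open>Modules of finite projective or injective dimension\<close>

text \<open>
 Shifting the bound by one makes the zero module the base of inductions on the dimension.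
\<close>

definition proj_res :: "('r, 'p) ring_scheme \<Rightarrow> nat \<Rightarrow> ('r, 'x, 'q) module_scheme \<Rightarrow>
  (nat \<Rightarrow> ('r, 'r fg_carrier) module) \<Rightarrow> (nat \<Rightarrow> 'r fg_carrier \<Rightarrow> 'r fg_carrier) \<Rightarrow> ('r fg_carrier \<Rightarrow> 'x) \<Rightarrow> bool"
 where "proj_res R n X P d e \<longleftrightarrow>
  (\<forall>i. finitely_generated R (P i) \<and> projective_module R (P i)) \<and>
  (\<forall>i\<ge>n. carrier (P i) = {\<zero>\<^bsub>P i\<^esub>}) \<and>
  e \<in> lmod_hom R (P 0) X \<and> e ` carrier (P 0) = carrier X \<and>
  (\<forall>i. d i \<in> lmod_hom R (P (Suc i)) (P i)) \<and>
  d 0 ` carrier (P (Suc 0)) = mod_kernel (P 0) X e \<and>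
  (\<forall>i. d (Suc i) ` carrier (P (Suc (Suc i))) = mod_kernel (P (Suc i)) (P i) (d i))"

definition inj_res :: "('r, 'p) ring_scheme \<Rightarrow> nat \<Rightarrow> ('r, 'x, 'q) module_scheme \<Rightarrow>
  (nat \<Rightarrow> ('r, 'r fg_carrier) module) \<Rightarrow> (nat \<Rightarrow> 'r fg_carrier \<Rightarrow> 'r fg_carrier) \<Rightarrow> ('x \<Rightarrow> 'r fg_carrier) \<Rightarrow> bool"
 where "inj_res R n X I d e \<longleftrightarrow>
  (\<forall>i. finitely_generated R (I i) \<and> injective_module R (I i)) \<and>
  (\<forall>i\<ge>n. carrier (I i) = {\<zero>\<^bsub>I i\<^esub>}) \<and>
  e \<in> lmod_hom R X (I 0) \<and> inj_on e (carrier X) \<and>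
  (\<forall>i. d i \<in> lmod_hom R (I i) (I (Suc i))) \<and>
  e ` carrier X = mod_kernel (I 0) (I (Suc 0)) (d 0) \<and>
  (\<forall>i. d i ` carrier (I i) = mod_kernel (I (Suc i)) (I (Suc (Suc i))) (d (Suc i)))"

lemma proj_resD:
 assumes "proj_res R n X P d e"
 shows "\<forall>i. finitely_generated R (P i) \<and> projective_module R (P i)" "\<forall>i\<ge>n. carrier (P i) = {\<zero>\<^bsub>P i\<^esub>}"
  "e \<in> lmod_hom R (P 0) X" "e ` carrier (P 0) = carrier X" "\<forall>i. d i \<in> lmod_hom R (P (Suc i)) (P i)"
  "d 0 ` carrier (P (Suc 0)) = mod_kernel (P 0) X e"
  "\<forall>i. d (Suc i) ` carrier (P (Suc (Suc i))) = mod_kernel (P (Suc i)) (P i) (d i)"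
 using assms by (simp_all add: proj_res_def)

lemma inj_resD:
 assumes "inj_res R n X I d e"
 shows "\<forall>i. finitely_generated R (I i) \<and> injective_module R (I i)" "\<forall>i\<ge>n. carrier (I i) = {\<zero>\<^bsub>I i\<^esub>}"
  "e \<in> lmod_hom R X (I 0)" "inj_on e (carrier X)" "\<forall>i. d i \<in> lmod_hom R (I i) (I (Suc i))"
  "e ` carrier X = mod_kernel (I 0) (I (Suc 0)) (d 0)"
  "\<forall>i. d i ` carrier (I i) = mod_kernel (I (Suc i)) (I (Suc (Suc i))) (d (Suc i))"
 using assms by (simp_all add: inj_res_def)

definition pd_lt :: "('r, 'p) ring_scheme \<Rightarrow> nat \<Rightarrow> ('r, 'x, 'q) module_scheme \<Rightarrow> bool"
 where "pd_lt R n X \<longleftrightarrow> (\<exists>P d e. proj_res R n X P d e)"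

definition id_lt :: "('r, 'p) ring_scheme \<Rightarrow> nat \<Rightarrow> ('r, 'x, 'q) module_scheme \<Rightarrow> bool"
 where "id_lt R n X \<longleftrightarrow> (\<exists>I d e. inj_res R n X I d e)"

lemma proj_dim_le_iff: "proj_dim_le R n X \<longleftrightarrow> pd_lt R (Suc n) X"
 by (simp add: proj_dim_le_def pd_lt_def proj_res_def Suc_le_eq)

lemma inj_dim_le_iff: "inj_dim_le R n X \<longleftrightarrow> id_lt R (Suc n) X"
 by (simp add: inj_dim_le_def id_lt_def inj_res_def Suc_le_eq)

lemma pd_lt_mono: "pd_lt R n X \<Longrightarrow> n \<le> m \<Longrightarrow> pd_lt R m X"
 unfolding pd_lt_def proj_res_def by (elim ex_forward conj_forward) auto

lemma id_lt_mono: "id_lt R n X \<Longrightarrow> n \<le> m \<Longrightarrow> id_lt R m X"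
 unfolding id_lt_def inj_res_def by (elim ex_forward conj_forward) auto

lemma fin_proj_dim_iff: "fin_proj_dim R X \<longleftrightarrow> fg_module R X \<and> (\<exists>n. pd_lt R n X)"
 unfolding fin_proj_dim_def proj_dim_le_iff by (meson pd_lt_mono le_SucI order_refl)

lemma fin_inj_dim_iff: "fin_inj_dim R X \<longleftrightarrow> fg_module R X \<and> (\<exists>n. id_lt R n X)"
 unfolding fin_inj_dim_def inj_dim_le_iff by (meson id_lt_mono le_SucI order_refl)

definition zero_module :: "('r, 'x) module"
 where "zero_module = \<lparr>carrier = {undefined}, mult = undefined, one = undefined,
  zero = undefined, add = (\<lambda>_ _. undefined), smult = (\<lambda>_ _. undefined)\<rparr>"

lemma zero_module_left_module: "ring R \<Longrightarrow> left_module R zero_module"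
 by (intro left_moduleI) (auto simp: zero_module_def)

lemma carrier_zero_module: "carrier zero_module = {\<zero>\<^bsub>zero_module\<^esub>}"
 by (simp add: zero_module_def)

lemma trivial_module:
 assumes X: "left_module R X" and z: "carrier X = {\<zero>\<^sub>X}"
 shows "finitely_generated R X" "projective_module R X" "injective_module R X"
proof -
 interpret X: left_module R X by fact
 show "finitely_generated R X"
  by (rule finitely_generatedI[OF X, of "{}"]) (auto simp: z submod_def)
 have *: "(\<lambda>_. \<zero>\<^sub>Y) \<in> lmod_hom R Z Y" if "left_module R Y"
  for Z :: "('a, 'z, 'zz) module_scheme" and Y :: "('a, 'y, 'yy) module_scheme"
 proof -
  interpret Y: left_module R Y by fact
  show ?thesis by (auto simp: lmod_hom_def)
 qed
 show "projective_module R X"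
  unfolding projective_module_def
 proof (intro conjI X allI impI; elim conjE)
  fix Z Y :: "('a, 'a fg_carrier) module" and g f
  assume a: "left_module R Z" "left_module R Y" "g \<in> lmod_hom R Z Y" "f \<in> lmod_hom R X Y"
  show "\<exists>h\<in>lmod_hom R X Z. \<forall>p\<in>carrier X. g (h p) = f p"
   using hom_zero[OF a(1,2,3)] hom_zero[OF X a(2,4)] by (intro bexI[OF _ *[OF a(1)]]) (auto simp: z)
 qed
 show "injective_module R X"
  unfolding injective_module_def
 proof (intro conjI X allI impI; elim conjE)
  fix Z Y :: "('a, 'a fg_carrier) module" and g f
  assume a: "left_module R Z" "left_module R Y" "g \<in> lmod_hom R Z Y" "f \<in> lmod_hom R Z X"
  show "\<exists>h\<in>lmod_hom R Y X. \<forall>p\<in>carrier Z. h (g p) = f p"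
   using hom_closed[OF a(4)] by (intro bexI[OF _ *[OF X]]) (auto simp: z)
 qed
qed

lemma pd_lt_0:
 assumes X: "left_module R X" shows "pd_lt R 0 X \<longleftrightarrow> carrier X = {\<zero>\<^sub>X}"
proof
 interpret X: left_module R X by fact
 assume "pd_lt R 0 X"
 then obtain P :: "nat \<Rightarrow> ('a, 'a fg_carrier) module" and e where
  "\<forall>i\<ge>0. carrier (P i) = {\<zero>\<^bsub>P i\<^esub>}" "e ` carrier (P 0) = carrier X"
  unfolding pd_lt_def proj_res_def by (elim exE conjE) (rule that)
 then have "carrier X = {e \<zero>\<^bsub>P 0\<^esub>}" by auto
 then show "carrier X = {\<zero>\<^sub>X}" using X.M.zero_closed by auto
next
 interpret X: left_module R X by fact
 assume z: "carrier X = {\<zero>\<^sub>X}"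
 note Z = zero_module_left_module[OF X.R.ring_axioms]
 show "pd_lt R 0 X" unfolding pd_lt_def proj_res_def
  by (rule exI[of _ "\<lambda>_. zero_module"], rule exI[of _ "\<lambda>_ _. undefined"], rule exI[of _ "\<lambda>_. \<zero>\<^sub>X"])
   (use trivial_module[OF Z carrier_zero_module] in \<open>auto simp: lmod_hom_def z zero_module_def mod_kernel_def\<close>)
qed

lemma id_lt_0:
 assumes X: "left_module R X" shows "id_lt R 0 X \<longleftrightarrow> carrier X = {\<zero>\<^sub>X}"
proof
 interpret X: left_module R X by fact
 assume "id_lt R 0 X"
 then obtain P :: "nat \<Rightarrow> ('a, 'a fg_carrier) module" and e where
  "\<forall>i\<ge>0. carrier (P i) = {\<zero>\<^bsub>P i\<^esub>}" "e \<in> lmod_hom R X (P 0)" "inj_on e (carrier X)"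
  unfolding id_lt_def inj_res_def by (elim exE conjE) (rule that)
 then have "x = y" if "x \<in> carrier X" "y \<in> carrier X" for x y
  using that hom_closed[of e R X "P 0" x] hom_closed[of e R X "P 0" y] inj_onD[of e "carrier X" x y] by simp
 then show "carrier X = {\<zero>\<^sub>X}" using X.M.zero_closed by blast
next
 interpret X: left_module R X by fact
 assume z: "carrier X = {\<zero>\<^sub>X}"
 note Z = zero_module_left_module[OF X.R.ring_axioms]
 show "id_lt R 0 X" unfolding id_lt_def inj_res_def
  by (rule exI[of _ "\<lambda>_. zero_module"], rule exI[of _ "\<lambda>_ _. undefined"], rule exI[of _ "\<lambda>_. undefined"])
   (use trivial_module[OF Z carrier_zero_module] in \<open>auto simp: lmod_hom_def z zero_module_def mod_kernel_def\<close>)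
qed

lemma pd_lt_iso:
 assumes X: "left_module R X" "left_module R Y" and h: "h \<in> lmod_iso R X Y" and "pd_lt R n X"
 shows "pd_lt R n Y"
proof -
 obtain P d e where res: "proj_res R n X P d e" using assms(4) by (auto simp: pd_lt_def)
 note P = proj_resD[OF res]
 have "mod_kernel (P 0) Y (\<lambda>x. h (e x)) = mod_kernel (P 0) X e"
  using hom_inj_iff[OF X iso_hom[OF h]] iso_inj[OF h] hom_closed[OF P(3)] hom_zero[OF X iso_hom[OF h]]
  by (auto simp: mod_kernel_def)
 moreover have "(\<lambda>x. h (e x)) ` carrier (P 0) = carrier Y" using P(4) iso_surj[OF h] by (metis image_image)
 ultimately show ?thesis unfolding pd_lt_def proj_res_def using P hom_comp[OF P(3) iso_hom[OF h]]
  by (intro exI[of _ P] exI[of _ d] exI[of _ "\<lambda>x. h (e x)"]) simp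
qed

lemma id_lt_iso:
 fixes R :: "('r, 'p) ring_scheme"
 assumes h: "h \<in> lmod_iso R Y X" and "id_lt R n X"
 shows "id_lt R n Y"
proof -
 obtain I d e where res: "inj_res R n X I d e" using assms(2) by (auto simp: id_lt_def)
 note I = inj_resD[OF res]
 have "(\<lambda>x. e (h x)) ` carrier Y = e ` carrier X" using iso_surj[OF h] by (metis image_image)
 moreover have "inj_on (\<lambda>x. e (h x)) (carrier Y)"
  using iso_inj[OF h] I(4) hom_closed[OF iso_hom[OF h]] by (auto simp: inj_on_def)
 ultimately show ?thesis unfolding id_lt_def inj_res_def using I hom_comp[OF iso_hom[OF h] I(3)]
  by (intro exI[of _ I] exI[of _ d] exI[of _ "\<lambda>x. e (h x)"]) simp
qed

lemma pd_lt_SucI: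
 assumes s: "ses R K P X k p" and P: "finitely_generated R P" "projective_module R P" and "pd_lt R n K"
 shows "pd_lt R (Suc n) X"
proof -
 note s' = sesD[OF s]
 obtain Q d e where res: "proj_res R n K Q d e" using assms(4) by (auto simp: pd_lt_def)
 note Q = proj_resD[OF res]
 obtain P' :: "('a, 'a fg_carrier) module" and t where t: "fg_module R P'" "t \<in> lmod_iso R P P'"
  using fg_module_copy[of R P] s'(2) P(1) unfolding fg_module_def by blast
 have lP': "left_module R P'" "finitely_generated R P'" using t by (auto simp: fg_module_def)
 have pP': "projective_module R P'" by (rule projective_iso[OF P(2) t(2) lP'(1)])
 define t' where "t' = inv_into (carrier P) t"
 note t' = iso_inverse[OF t(2) s'(2), folded t'_def]
 define Q' where "Q' = case_nat P' Q"
 define d' where "d' = case_nat (\<lambda>x. t (k (e x))) d"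
 define e' where "e' = (\<lambda>x. p (t' x))"
 have tk: "(\<lambda>x. t (k x)) \<in> lmod_hom R K P'" by (rule hom_comp[OF s'(4) iso_hom[OF t(2)]])
 have d'0: "d' 0 \<in> lmod_hom R (Q 0) P'" unfolding d'_def using hom_comp[OF Q(3) tk] by simp
 have inj: "t (k x) = \<zero>\<^bsub>P'\<^esub> \<longleftrightarrow> x = \<zero>\<^sub>K" if "x \<in> carrier K" for x
 proof -
  have "inj_on (\<lambda>x. t (k x)) (carrier K)"
   using iso_inj[OF t(2)] s'(5) hom_closed[OF s'(4)] by (simp add: inj_on_def)
  then show ?thesis using that hom_inj_iff[OF s'(1) lP'(1) tk] hom_zero[OF s'(1) lP'(1) tk] by blast
 qed
 have "\<forall>i. finitely_generated R (Q' i) \<and> projective_module R (Q' i)"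
  using Q(1) lP' pP' by (auto simp: Q'_def split: nat.split)
 moreover have "\<forall>i\<ge>Suc n. carrier (Q' i) = {\<zero>\<^bsub>Q' i\<^esub>}"
  using Q(2) by (auto simp: Q'_def split: nat.split)
 moreover have "e' \<in> lmod_hom R (Q' 0) X"
  unfolding e'_def Q'_def using hom_comp[OF iso_hom[OF t'(1)] s'(6)] by simp
 moreover have "e' ` carrier (Q' 0) = carrier X"
  unfolding e'_def Q'_def using iso_surj[OF t'(1)] s'(7) by (metis image_image nat.case(1))
 moreover have "d' i \<in> lmod_hom R (Q' (Suc i)) (Q' i)" for i
  using d'0 Q(5) by (cases i) (simp_all add: Q'_def d'_def)
 moreover have "d' 0 ` carrier (Q' (Suc 0)) = mod_kernel (Q' 0) X e'"
 proof -
  have "d' 0 ` carrier (Q' (Suc 0)) = t ` k ` carrier K"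
   unfolding Q'_def d'_def using Q(4) by (metis (no_types) image_image nat.case)
  also have "\<dots> = t ` mod_kernel P X p" using s'(8) by simp
  also have "\<dots> = mod_kernel P' X e'"
  proof
   show "t ` mod_kernel P X p \<subseteq> mod_kernel P' X e'"
    using t'(2) hom_closed[OF iso_hom[OF t(2)]] by (auto simp: mod_kernel_def e'_def)
   show "mod_kernel P' X e' \<subseteq> t ` mod_kernel P X p"
    using t'(3) hom_closed[OF iso_hom[OF t'(1)]] by (force simp: mod_kernel_def e'_def)
  qed
  finally show ?thesis by (simp add: Q'_def)
 qed
 moreover have "d' (Suc i) ` carrier (Q' (Suc (Suc i))) = mod_kernel (Q' (Suc i)) (Q' i) (d' i)" for i
 proof (cases i)
  case 0
  have "mod_kernel (Q 0) K e = mod_kernel (Q 0) P' (\<lambda>x. t (k (e x)))"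
   using inj hom_closed[OF Q(3)] by (auto simp: mod_kernel_def)
  then show ?thesis using Q(6) 0 by (simp add: Q'_def d'_def)
 next
  case (Suc j) then show ?thesis using Q(7) by (simp add: Q'_def d'_def)
 qed
 ultimately show ?thesis unfolding pd_lt_def proj_res_def
  by (intro exI[of _ Q'] exI[of _ d'] exI[of _ e']) simp
qed

lemma pd_lt_SucE:
 fixes R :: "('r, 'p) ring_scheme"
 assumes X: "left_module R X" and "pd_lt R (Suc n) X"
 obtains K P :: "('r, 'r fg_carrier) module" and k p where "ses R K P X k p"
  "finitely_generated R P" "projective_module R P" "pd_lt R n K"
proof -
 obtain P d e where res: "proj_res R (Suc n) X P d e" using assms(2) by (auto simp: pd_lt_def)
 note P = proj_resD[OF res]
 have lP: "left_module R (P 0)" using P(1) by (simp add: projective_module_def)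
 let ?K = "sub (P 0) (mod_kernel (P 0) X e)"
 have "d 0 \<in> lmod_hom R (P (Suc 0)) ?K" using P(5,6) by (intro hom_into_sub) auto
 then have "pd_lt R n ?K" unfolding pd_lt_def proj_res_def using P
  by (intro exI[of _ "\<lambda>i. P (Suc i)"] exI[of _ "\<lambda>i. d (Suc i)"] exI[of _ "d 0"])
   (simp add: mod_kernel_def)
 then show ?thesis using that ses_kernel[OF lP X P(3,4)] P(1) by blast
qed

lemma id_lt_SucI:
 assumes s: "ses R X J C k p" and J: "finitely_generated R J" "injective_module R J" and "id_lt R n C"
 shows "id_lt R (Suc n) X"
proof -
 note s' = sesD[OF s]
 obtain I d e where res: "inj_res R n C I d e" using assms(4) by (auto simp: id_lt_def)
 note I = inj_resD[OF res]
 obtain J' :: "('a, 'a fg_carrier) module" and t where t: "fg_module R J'" "t \<in> lmod_iso R J J'"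
  using fg_module_copy[of R J] s'(2) J(1) unfolding fg_module_def by blast
 have lJ': "left_module R J'" "finitely_generated R J'" using t by (auto simp: fg_module_def)
 have pJ': "injective_module R J'" by (rule injective_iso[OF J(2) t(2) lJ'(1)])
 have lI0: "left_module R (I 0)" using I(1) by (simp add: injective_module_def)
 define t' where "t' = inv_into (carrier J) t"
 note t' = iso_inverse[OF t(2) s'(2), folded t'_def]
 define I' where "I' = case_nat J' I"
 define d' where "d' = case_nat (\<lambda>x. e (p (t' x))) d"
 define e' where "e' = (\<lambda>x. t (k x))"
 have pt: "(\<lambda>x. p (t' x)) \<in> lmod_hom R J' C" by (rule hom_comp[OF iso_hom[OF t'(1)] s'(6)])
 have pts: "(\<lambda>x. p (t' x)) ` carrier J' = carrier C"
  using iso_surj[OF t'(1)] s'(7) by (metis image_image)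
 have d'0: "d' 0 \<in> lmod_hom R J' (I 0)" unfolding d'_def using hom_comp[OF pt I(3)] by simp
 have inj: "e x = \<zero>\<^bsub>I 0\<^esub> \<longleftrightarrow> x = \<zero>\<^sub>C" if "x \<in> carrier C" for x
  using that hom_inj_iff[OF s'(3) lI0 I(3)] I(4) hom_zero[OF s'(3) lI0 I(3)] by blast
 have "\<forall>i. finitely_generated R (I' i) \<and> injective_module R (I' i)"
  using I(1) lJ' pJ' by (auto simp: I'_def split: nat.split)
 moreover have "\<forall>i\<ge>Suc n. carrier (I' i) = {\<zero>\<^bsub>I' i\<^esub>}"
  using I(2) by (auto simp: I'_def split: nat.split)
 moreover have "e' \<in> lmod_hom R X (I' 0)"
  unfolding e'_def I'_def using hom_comp[OF s'(4) iso_hom[OF t(2)]] by simp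
 moreover have "inj_on e' (carrier X)"
  unfolding e'_def using iso_inj[OF t(2)] s'(5) hom_closed[OF s'(4)] by (simp add: inj_on_def)
 moreover have "d' i \<in> lmod_hom R (I' i) (I' (Suc i))" for i
  using d'0 I(5) by (cases i) (simp_all add: I'_def d'_def)
 moreover have "e' ` carrier X = mod_kernel (I' 0) (I' (Suc 0)) (d' 0)"
 proof -
  have "e' ` carrier X = t ` mod_kernel J C p" using s'(8) unfolding e'_def by (metis image_image)
  also have "\<dots> = mod_kernel J' (I 0) (d' 0)"
  proof
   show "t ` mod_kernel J C p \<subseteq> mod_kernel J' (I 0) (d' 0)"
    using t'(2) hom_closed[OF iso_hom[OF t(2)]] hom_zero[OF s'(3) lI0 I(3)]
    by (auto simp: mod_kernel_def d'_def)
   show "mod_kernel J' (I 0) (d' 0) \<subseteq> t ` mod_kernel J C p"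
   proof
    fix y assume "y \<in> mod_kernel J' (I 0) (d' 0)"
    then have y: "y \<in> carrier J'" "e (p (t' y)) = \<zero>\<^bsub>I 0\<^esub>" by (auto simp: mod_kernel_def d'_def)
    then have "p (t' y) = \<zero>\<^sub>C" using inj hom_closed[OF pt] by blast
    then have "t' y \<in> mod_kernel J C p"
     using y hom_closed[OF iso_hom[OF t'(1)]] by (simp add: mod_kernel_def)
    then show "y \<in> t ` mod_kernel J C p" using t'(3)[OF y(1)] by force
   qed
  qed
  finally show ?thesis by (simp add: I'_def)
 qed
 moreover have "d' i ` carrier (I' i) = mod_kernel (I' (Suc i)) (I' (Suc (Suc i))) (d' (Suc i))" for i
 proof (cases i)
  case 0
  have "d' 0 ` carrier J' = e ` carrier C" unfolding d'_def using pts by (metis (no_types) image_image nat.case(1))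
  then show ?thesis using I(6) 0 by (simp add: I'_def d'_def)
 next
  case (Suc j) then show ?thesis using I(7) by (simp add: I'_def d'_def)
 qed
 ultimately show ?thesis unfolding id_lt_def inj_res_def
  by (intro exI[of _ I'] exI[of _ d'] exI[of _ e']) simp
qed

lemma id_lt_SucE:
 fixes R :: "('r, 'p) ring_scheme"
 assumes X: "left_module R X" and "id_lt R (Suc n) X"
 obtains J C :: "('r, 'r fg_carrier) module" and k p where "ses R X J C k p"
  "finitely_generated R J" "injective_module R J" "id_lt R n C"
proof -
 obtain I d e where res: "inj_res R (Suc n) X I d e" using assms(2) by (auto simp: id_lt_def)
 note I = inj_resD[OF res]
 have lI: "left_module R (I i)" for i using I(1) by (simp add: injective_module_def)
 interpret I1: left_module R "I 1" by (rule lI)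
 let ?U = "d 0 ` carrier (I 0)"
 have U: "submod R (I 1) ?U"
  using I(5) lI left_module.submod_carrier[OF lI] by (intro submod_image) auto
 let ?C = "sub (I 1) ?U"
 have "ses R X (I 0) ?C e (d 0)"
  unfolding ses_def using X lI I1.submod_left_module[OF U] I(3,4,5,6)
  by (auto intro!: hom_into_sub simp: mod_kernel_def)
 moreover have "id_lt R n ?C" unfolding id_lt_def inj_res_def using I sub_hom[OF submodD(1)[OF U], of R]
  by (intro exI[of _ "\<lambda>i. I (Suc i)"] exI[of _ "\<lambda>i. d (Suc i)"] exI[of _ "\<lambda>x. x"])
   (auto simp: mod_kernel_def)
 ultimately show ?thesis using that I(1) by blast
qed

lemma pd_lt_fg:
 assumes X: "left_module R X" and "pd_lt R n X" shows "finitely_generated R X"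
proof (cases n)
 case 0
 then have "carrier X = {\<zero>\<^sub>X}" using assms pd_lt_0[OF X] by simp
 then show ?thesis by (rule trivial_module(1)[OF X])
next
 case (Suc m)
 then obtain K P :: "('a, 'a fg_carrier) module" and k p where
  "ses R K P X k p" "finitely_generated R P"
  using pd_lt_SucE[OF X assms(2)[unfolded Suc]] by metis
 then show ?thesis using finitely_generated_image[of R P X p] by (simp add: ses_def)
qed

lemma hom_factor:
 assumes X: "left_module R X" and C: "left_module R C" and W: "left_module R W"
  and q: "q \<in> lmod_hom R X C" "q ` carrier X = carrier C" and h: "h \<in> lmod_hom R X W"
  and ker: "\<And>x. x \<in> carrier X \<Longrightarrow> q x = \<zero>\<^sub>C \<Longrightarrow> h x = \<zero>\<^sub>W"
 obtains k where "k \<in> lmod_hom R C W" "\<And>x. x \<in> carrier X \<Longrightarrow> k (q x) = h x"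
proof -
 interpret X: left_module R X by fact
 interpret C: left_module R C by fact
 interpret W: left_module R W by fact
 define s where "s c = (SOME x. x \<in> carrier X \<and> q x = c)" for c
 have s: "s c \<in> carrier X \<and> q (s c) = c" if "c \<in> carrier C" for c
 proof -
  have "c \<in> q ` carrier X" using that q(2) by simp
  then have "\<exists>x. x \<in> carrier X \<and> q x = c" by auto
  then show ?thesis unfolding s_def by (rule someI_ex)
 qed
 have eq: "h x = h y" if "x \<in> carrier X" "y \<in> carrier X" "q x = q y" for x y
 proof -
  have "h (x \<oplus>\<^sub>X \<ominus>\<^sub>X y) = \<zero>\<^sub>W" using that hom_closed[OF q(1)]
   by (intro ker) (simp_all add: hom_add[OF q(1)] hom_minus[OF X C q(1)] C.M.r_neg)
  then show ?thesis using that hom_closed[OF h]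
   by (simp add: hom_add[OF h] hom_minus[OF X W h] W.diff_eq_zero)
 qed
 have k: "h (s (q x)) = h x" if "x \<in> carrier X" for x
  using s[of "q x"] hom_closed[OF q(1) that] that by (intro eq) auto
 have "(\<lambda>c. h (s c)) \<in> lmod_hom R C W"
 proof (rule lmod_homI)
  fix x y assume xy: "x \<in> carrier C" "y \<in> carrier C"
  show "h (s x) \<in> carrier W" using hom_closed[OF h] s[OF xy(1)] by blast
  have "h (s (q (s x \<oplus>\<^sub>X s y))) = h (s x \<oplus>\<^sub>X s y)" using s xy by (intro k) simp
  then show "h (s (x \<oplus>\<^sub>C y)) = h (s x) \<oplus>\<^sub>W h (s y)"
   using s xy by (simp add: hom_add[OF q(1)] hom_add[OF h])
  fix r assume r: "r \<in> carrier R"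
  have "h (s (q (r \<odot>\<^sub>X s x))) = h (r \<odot>\<^sub>X s x)" using s xy r by (intro k) simp
  then show "h (s (r \<odot>\<^sub>C x)) = r \<odot>\<^sub>W h (s x)"
   using s xy r by (simp add: hom_smult[OF q(1)] hom_smult[OF h])
 qed
 then show ?thesis using that[of "\<lambda>c. h (s c)"] k by blast
qed

lemma ses_iso_middle:
 assumes s: "ses R X Y Z f g" and l: "left_module R Y2" and b: "b \<in> lmod_iso R Y Y2"
 shows "ses R X Y2 Z (\<lambda>x. b (f x)) (\<lambda>y. g (inv_into (carrier Y) b y))"
proof -
 note s' = sesD[OF s] and b' = iso_inverse[OF b sesD(2)[OF s]]
 note c = hom_closed[OF s'(4)] and bc = hom_closed[OF iso_hom[OF b]] and bc' = hom_closed[OF iso_hom[OF b'(1)]]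
 have bf: "inv_into (carrier Y) b (b (f x)) = f x" if "x \<in> carrier X" for x using b'(2)[OF c[OF that]] .
 show ?thesis
 proof (rule sesI[OF s'(1) l s'(3) hom_comp[OF s'(4) iso_hom[OF b]] _ hom_comp[OF iso_hom[OF b'(1)] s'(6)]])
  show "x = \<zero>\<^sub>X" if "x \<in> carrier X" "b (f x) = \<zero>\<^bsub>Y2\<^esub>" for x
   using that bf[of x] hom_zero[OF l s'(2) iso_hom[OF b'(1)]] hom_inj_iff[OF s'(1,2,4)] s'(5) by auto
  show "\<exists>y\<in>carrier Y2. g (inv_into (carrier Y) b y) = z" if z: "z \<in> carrier Z" for z
  proof -
   obtain y where "y \<in> carrier Y" "g y = z" using s'(11)[OF z] by blast
   then show ?thesis using b'(2) bc by (intro bexI[of _ "b y"]) simp_all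
  qed
  show "\<exists>x\<in>carrier X. y = b (f x)" if y: "y \<in> carrier Y2" "g (inv_into (carrier Y) b y) = \<zero>\<^sub>Z" for y
   using s'(10)[OF bc'[OF y(1)] y(2)] b'(3)[OF y(1)] by metis
 qed (simp add: bf s'(9))
qed

lemma iso_comp:
 assumes "f \<in> lmod_iso R X Y" "g \<in> lmod_iso R Y Z" shows "(\<lambda>x. g (f x)) \<in> lmod_iso R X Z"
 using assms hom_comp[OF iso_hom[OF assms(1)] iso_hom[OF assms(2)]]
  bij_betw_trans[of f "carrier X" "carrier Y" g "carrier Z"]
 by (simp add: lmod_iso_def comp_def)

lemma ses_embedding: "ses R X Y Z f g \<Longrightarrow> f \<in> lmod_iso R X (sub Y (mod_kernel Y Z g))"
 using sesD[of R X Y Z f g] by (intro isoI hom_into_sub) auto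

lemma ses_kernel_iso:
 assumes s: "ses R X Y Z f g" and t: "ses R X' Y' Z' f' g'" and u: "u \<in> lmod_iso R Y Y'"
  and k: "\<And>y. y \<in> carrier Y \<Longrightarrow> g' (u y) = \<zero>\<^bsub>Z'\<^esub> \<longleftrightarrow> g y = \<zero>\<^sub>Z"
 obtains i where "i \<in> lmod_iso R X X'"
proof -
 let ?K = "mod_kernel Y Z g" and ?K' = "mod_kernel Y' Z' g'"
 have "u ` ?K = ?K'"
 proof
  show "u ` ?K \<subseteq> ?K'" using k hom_closed[OF iso_hom[OF u]] by (auto simp: mod_kernel_def)
  show "?K' \<subseteq> u ` ?K"
  proof
   fix y assume y: "y \<in> ?K'"
   then have "y \<in> u ` carrier Y" using iso_surj[OF u] by (simp add: mod_kernel_def)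
   then obtain x where x: "x \<in> carrier Y" "y = u x" by auto
   then show "y \<in> u ` ?K" using y k[OF x(1)] by (auto simp: mod_kernel_def)
  qed
 qed
 moreover have "?K \<subseteq> carrier Y" by (auto simp: mod_kernel_def)
 ultimately have "u \<in> lmod_iso R (sub Y ?K) (sub Y' ?K')"
  using hom_into_sub[OF hom_restrict[OF iso_hom[OF u]]] inj_on_subset[OF iso_inj[OF u]] by (intro isoI) auto
 from iso_comp[OF iso_comp[OF ses_embedding[OF s] this] iso_inverse(1)[OF ses_embedding[OF t] sesD(1)[OF t]]]
 show thesis by (rule that)
qed

lemma ses_zero_left:
 assumes s: "ses R X Y Z f g" and z: "carrier X = {\<zero>\<^sub>X}"
 shows "g \<in> lmod_iso R Y Z"
proof -
 note s' = sesD[OF s]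
 have "y = \<zero>\<^sub>Y" if "y \<in> carrier Y" "g y = \<zero>\<^sub>Z" for y
  using s'(10)[OF that] z hom_zero[OF s'(1,2,4)] by auto
 then show ?thesis using s' hom_inj_iff[OF s'(2,3,6)] by (intro isoI) auto
qed

lemma ses_zero_right:
 assumes s: "ses R X Y Z f g" and z: "carrier Z = {\<zero>\<^sub>Z}"
 shows "f \<in> lmod_iso R X Y"
proof -
 note s' = sesD[OF s]
 have "f ` carrier X = carrier Y" using s'(8) hom_closed[OF s'(6)] z by (auto simp: mod_kernel_def)
 then show ?thesis using s' by (intro isoI) auto
qed

lemma ses_dsum:
 assumes s: "ses R X Y Z f g" and t: "ses R X' Y' Z' f' g'"
 shows "ses R (dsum X X') (dsum Y Y') (dsum Z Z') (map_prod f f') (map_prod g g')"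
proof -
 note s' = sesD[OF s] and t' = sesD[OF t]
 show ?thesis
  unfolding ses_def
 proof (intro conjI dsum_left_module dsum_map s'(1-4,6) t'(1-4,6))
  show "inj_on (map_prod f f') (carrier (dsum X X'))" using s'(5) t'(5) by (auto simp: inj_on_def)
  show "map_prod g g' ` carrier (dsum Y Y') = carrier (dsum Z Z')"
   using s'(7) t'(7) by (simp add: map_prod_surj_on)
  show "map_prod f f' ` carrier (dsum X X') = mod_kernel (dsum Y Y') (dsum Z Z') (map_prod g g')"
   using s'(8) t'(8) by (auto simp: map_prod_surj_on mod_kernel_def)
 qed
qed

lemma projective_pd_lt_1:
 assumes P: "projective_module R P" "finitely_generated R P" shows "pd_lt R (Suc 0) P"
proof -
 have lP: "left_module R P" using P by (simp add: projective_module_def)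
 interpret P: left_module R P by fact
 have z: "left_module R (sub P {\<zero>\<^sub>P})" by (rule P.submod_left_module[OF P.submod_zero])
 have "ses R (sub P {\<zero>\<^sub>P}) P P (\<lambda>x. x) (\<lambda>x. x)"
  using lP z by (intro sesI) (auto simp: lmod_hom_def)
 then show ?thesis using pd_lt_SucI[OF _ P(2,1)] pd_lt_0[OF z] by simp
qed

lemma injective_id_lt_1:
 assumes J: "injective_module R J" "finitely_generated R J" shows "id_lt R (Suc 0) J"
proof -
 have lJ: "left_module R J" using J by (simp add: injective_module_def)
 interpret J: left_module R J by fact
 have z: "left_module R (sub J {\<zero>\<^sub>J})" by (rule J.submod_left_module[OF J.submod_zero])
 have "ses R J J (sub J {\<zero>\<^sub>J}) (\<lambda>x. x) (\<lambda>_. \<zero>\<^sub>J)"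
  using lJ z by (intro sesI) (auto simp: lmod_hom_def)
 then show ?thesis using id_lt_SucI[OF _ J(2,1)] id_lt_0[OF z] by simp
qed

text \<open>
 In inductions on the dimension the syzygies live on \<open>fg_carrier\<close>, while the module itself has an arbitrary
 type. The inductive step is therefore a lemma of its own, with the induction hypothesis \<open>step\<close> for syzygies only.
\<close>

lemma pd_lt_dsum_step:
 fixes R :: "('r, 'p) ring_scheme"
 assumes X: "left_module R X" and Y: "left_module R Y" and "pd_lt R (Suc n) X" "pd_lt R (Suc n) Y"
  and step: "\<And>(V :: ('r, 'r fg_carrier) module) (W :: ('r, 'r fg_carrier) module). left_module R V \<Longrightarrow> left_module R W \<Longrightarrow>
   pd_lt R n V \<Longrightarrow> pd_lt R n W \<Longrightarrow> pd_lt R n (dsum V W)"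
 shows "pd_lt R (Suc n) (dsum X Y)"
proof -
 obtain K P :: "('r, 'r fg_carrier) module" and k p where K: "ses R K P X k p"
  "finitely_generated R P" "projective_module R P" "pd_lt R n K"
  using X assms(3) by (elim pd_lt_SucE)
 obtain K' P' :: "('r, 'r fg_carrier) module" and k' p' where K': "ses R K' P' Y k' p'"
  "finitely_generated R P'" "projective_module R P'" "pd_lt R n K'"
  using Y assms(4) by (elim pd_lt_SucE)
 show ?thesis
  by (rule pd_lt_SucI[OF ses_dsum[OF K(1) K'(1)] dsum_fg[OF sesD(2)[OF K(1)] sesD(2)[OF K'(1)] K(2) K'(2)]
     projective_dsum[OF K(3) K'(3)] step[OF sesD(1)[OF K(1)] sesD(1)[OF K'(1)] K(4) K'(4)]])
qed

lemma pd_lt_dsum: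
 fixes R :: "('r, 'p) ring_scheme"
 assumes "left_module R X" "left_module R Y" "pd_lt R n X" "pd_lt R n Y"
 shows "pd_lt R n (dsum X Y)"
proof -
 have zero: "pd_lt R 0 (dsum V W)" if "left_module R V" "left_module R W" "pd_lt R 0 V" "pd_lt R 0 W"
  for V :: "('r, 'v, 'vv) module_scheme" and W :: "('r, 'w, 'ww) module_scheme"
  using that pd_lt_0[OF dsum_left_module[OF that(1,2)]] pd_lt_0[OF that(1)] pd_lt_0[OF that(2)] by simp
 have *: "left_module R V \<Longrightarrow> left_module R W \<Longrightarrow> pd_lt R n V \<Longrightarrow> pd_lt R n W \<Longrightarrow> pd_lt R n (dsum V W)"
  for V W :: "('r, 'r fg_carrier) module" and n
  by (induction n arbitrary: V W) (rule zero, assumption+, rule pd_lt_dsum_step)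
 show ?thesis
 proof (cases n)
  case 0 then show ?thesis using zero assms by simp
 next
  case (Suc k) then show ?thesis using pd_lt_dsum_step[OF assms(1,2) _ _ *] assms(3,4) by blast
 qed
qed

lemma id_lt_dsum_step:
 fixes R :: "('r, 'p) ring_scheme"
 assumes X: "left_module R X" and Y: "left_module R Y" and "id_lt R (Suc n) X" "id_lt R (Suc n) Y"
  and step: "\<And>(V :: ('r, 'r fg_carrier) module) (W :: ('r, 'r fg_carrier) module). left_module R V \<Longrightarrow> left_module R W \<Longrightarrow>
   id_lt R n V \<Longrightarrow> id_lt R n W \<Longrightarrow> id_lt R n (dsum V W)"
 shows "id_lt R (Suc n) (dsum X Y)"
proof -
 obtain K P :: "('r, 'r fg_carrier) module" and k p where K: "ses R X P K k p"
  "finitely_generated R P" "injective_module R P" "id_lt R n K"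
  using X assms(3) by (elim id_lt_SucE)
 obtain K' P' :: "('r, 'r fg_carrier) module" and k' p' where K': "ses R Y P' K' k' p'"
  "finitely_generated R P'" "injective_module R P'" "id_lt R n K'"
  using Y assms(4) by (elim id_lt_SucE)
 show ?thesis
  by (rule id_lt_SucI[OF ses_dsum[OF K(1) K'(1)] dsum_fg[OF sesD(2)[OF K(1)] sesD(2)[OF K'(1)] K(2) K'(2)]
     injective_dsum[OF K(3) K'(3)] step[OF sesD(3)[OF K(1)] sesD(3)[OF K'(1)] K(4) K'(4)]])
qed

lemma id_lt_dsum:
 fixes R :: "('r, 'p) ring_scheme"
 assumes "left_module R X" "left_module R Y" "id_lt R n X" "id_lt R n Y"
 shows "id_lt R n (dsum X Y)"
proof -
 have zero: "id_lt R 0 (dsum V W)" if "left_module R V" "left_module R W" "id_lt R 0 V" "id_lt R 0 W"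
  for V :: "('r, 'v, 'vv) module_scheme" and W :: "('r, 'w, 'ww) module_scheme"
  using that id_lt_0[OF dsum_left_module[OF that(1,2)]] id_lt_0[OF that(1)] id_lt_0[OF that(2)] by simp
 have *: "left_module R V \<Longrightarrow> left_module R W \<Longrightarrow> id_lt R n V \<Longrightarrow> id_lt R n W \<Longrightarrow> id_lt R n (dsum V W)"
  for V W :: "('r, 'r fg_carrier) module" and n
  by (induction n arbitrary: V W) (rule zero, assumption+, rule id_lt_dsum_step)
 show ?thesis
 proof (cases n)
  case 0 then show ?thesis using zero assms by simp
 next
  case (Suc k) then show ?thesis using id_lt_dsum_step[OF assms(1,2) _ _ *] assms(3,4) by blast
 qed
qed

text \<open>
 If \<open>P \<rightarrow> X''\<close> is the composite of a projective presentation of \<open>X\<close> with \<open>v\<close>, its kernel \<open>D\<close> fits into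
 \<open>0 \<rightarrow> K' \<rightarrow> P' \<oplus> K \<rightarrow> D \<rightarrow> 0\<close>, where \<open>K'\<close> and \<open>K\<close> are the syzygies of \<open>X'\<close> and \<open>X\<close>. So the
 dimension of the left term goes down, at the cost of enlarging the middle one.
\<close>

lemma pd_cokernel_step:
 fixes R :: "('r, 'p) ring_scheme"
 assumes s: "ses R X' X X'' u v" and pd: "pd_lt R (Suc n) X'" "pd_lt R m X"
  and step: "\<And>(Y' :: ('r, 'r fg_carrier) module) (Y :: ('r, 'r fg_carrier) module)
   (Y'' :: ('r, 'r fg_carrier) module) f g m. ses R Y' Y Y'' f g \<Longrightarrow> pd_lt R n Y' \<Longrightarrow> pd_lt R m Y \<Longrightarrow>
   \<exists>k. pd_lt R k Y''"
 shows "\<exists>k. pd_lt R k X''"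
proof -
 note s' = sesD[OF s]
 have "pd_lt R (Suc m) X" using pd_lt_mono[OF pd(2)] by simp
 from s'(2) this obtain K P :: "('r, 'r fg_carrier) module" and k p where K: "ses R K P X k p"
  "finitely_generated R P" "projective_module R P" "pd_lt R m K"
  by (elim pd_lt_SucE)
 obtain K' P' :: "('r, 'r fg_carrier) module" and k' p' where K': "ses R K' P' X' k' p'"
  "finitely_generated R P'" "projective_module R P'" "pd_lt R n K'"
  using s'(1) pd(1) by (elim pd_lt_SucE)
 note k = sesD[OF K(1)] and k' = sesD[OF K'(1)]
 interpret X: left_module R X by (rule s'(2))
 interpret P: left_module R P by (rule k(2))
 let ?\<pi> = "\<lambda>x. v (p x)"
 have \<pi>: "?\<pi> \<in> lmod_hom R P X''" by (rule hom_comp[OF k(6) s'(6)])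
 have "?\<pi> ` carrier P = carrier X''" using k(7) s'(7) by (metis image_image)
 note D = ses_kernel[OF k(2) s'(3) \<pi> this]
 let ?D = "sub P (mod_kernel P X'' ?\<pi>)"
 have lD: "left_module R ?D" by (rule sesD(1)[OF D])
 obtain f where f: "f \<in> lmod_hom R P' P" "\<And>x. x \<in> carrier P' \<Longrightarrow> p (f x) = u (p' x)"
  using projective_lift[OF K'(3,2) k(2) s'(2) k(6,7) hom_comp[OF k'(6) s'(4)]] by metis
 define ki where "ki = inv_into (carrier K) k"
 note ki = iso_inverse[OF ses_embedding[OF K(1)] k(1), folded ki_def]
 let ?S = "dsum P' K"
 have lS: "left_module R ?S" using k'(2) k(1) by (rule dsum_left_module)
 have fkh: "(\<lambda>z. \<ominus>\<^sub>P f (k' z)) \<in> lmod_hom R K' (sub P (mod_kernel P X p))"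
 proof (intro hom_into_sub hom_neg[OF k(2)] hom_comp[OF k'(4) f(1)] subsetI)
  fix y assume "y \<in> (\<lambda>z. \<ominus>\<^sub>P f (k' z)) ` carrier K'"
  then obtain z where z: "z \<in> carrier K'" "y = \<ominus>\<^sub>P f (k' z)" by blast
  then show "y \<in> mod_kernel P X p"
   using hom_closed[OF k'(4)] hom_closed[OF f(1)] k'(9) hom_zero[OF s'(1,2,4)]
   by (simp add: mod_kernel_def hom_minus[OF k(2) s'(2) k(6)] f(2))
 qed
 have 1: "(\<lambda>z. (k' z, ki (\<ominus>\<^sub>P f (k' z)))) \<in> lmod_hom R K' ?S"
  by (rule hom_pair[OF k'(4) hom_comp[OF fkh iso_hom[OF ki(1)]]])
 have 2: "(\<lambda>q. f (fst q) \<oplus>\<^sub>P k (snd q)) \<in> lmod_hom R ?S ?D"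
 proof (rule hom_into_sub[OF hom_sum[OF k(2) hom_comp[OF dsum_homs(1)[OF k'(2) k(1)] f(1)]
     hom_comp[OF dsum_homs(2)[OF k'(2) k(1)] k(4)]]], rule subsetI)
  fix y assume "y \<in> (\<lambda>q. f (fst q) \<oplus>\<^sub>P k (snd q)) ` carrier ?S"
  then show "y \<in> mod_kernel P X'' ?\<pi>"
   using hom_closed[OF k(4)] hom_closed[OF f(1)] hom_closed[OF k'(6)] hom_closed[OF s'(4)] k(9) s'(9)
   by (auto simp: mod_kernel_def hom_add[OF k(6)] f(2))
 qed
 have t: "ses R K' ?S ?D (\<lambda>z. (k' z, ki (\<ominus>\<^sub>P f (k' z)))) (\<lambda>q. f (fst q) \<oplus>\<^sub>P k (snd q))"
 proof (rule sesI[OF k'(1) lS lD 1 _ 2])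
  fix z assume z: "z \<in> carrier K'" "(k' z, ki (\<ominus>\<^sub>P f (k' z))) = \<zero>\<^sub>?S"
  then have "k' z = \<zero>\<^bsub>P'\<^esub>" by simp
  then show "z = \<zero>\<^bsub>K'\<^esub>" using hom_inj_iff[OF k'(1,2,4)] k'(5) z by blast
 next
  fix z assume z: "z \<in> carrier K'"
  have "k (ki (\<ominus>\<^sub>P f (k' z))) = \<ominus>\<^sub>P f (k' z)" using ki(3) hom_closed[OF fkh z] by blast
  then show "f (fst (k' z, ki (\<ominus>\<^sub>P f (k' z)))) \<oplus>\<^sub>P k (snd (k' z, ki (\<ominus>\<^sub>P f (k' z)))) = \<zero>\<^sub>?D"
   using hom_closed[OF f(1)] hom_closed[OF k'(4)] z by (simp add: P.M.r_neg)
 next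
  fix d assume "d \<in> carrier ?D"
  then have d: "d \<in> carrier P" "v (p d) = \<zero>\<^bsub>X''\<^esub>" by (auto simp: mod_kernel_def)
  obtain x' where x': "x' \<in> carrier X'" "p d = u x'" using s'(10)[of "p d"] d hom_closed[OF k(6)] by blast
  obtain a where a: "a \<in> carrier P'" "p' a = x'" using k'(11) x' by blast
  have fa: "f a \<in> carrier P" using hom_closed[OF f(1)] a by blast
  have "p (f a) = p d" using f(2)[OF a(1)] a x' by simp
  then have "p (d \<oplus>\<^sub>P \<ominus>\<^sub>P f a) = \<zero>\<^sub>X" using d fa hom_closed[OF k(6)]
   by (simp add: hom_add[OF k(6)] hom_minus[OF k(2) s'(2) k(6)] X.M.r_neg)
  moreover have "d \<oplus>\<^sub>P \<ominus>\<^sub>P f a \<in> carrier P" using d fa by simp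
  ultimately obtain y where y: "y \<in> carrier K" "d \<oplus>\<^sub>P \<ominus>\<^sub>P f a = k y" using k(10) by metis
  then have "f a \<oplus>\<^sub>P k y = d" using P.add_diff_cancel[OF d(1) fa] by simp
  then show "\<exists>q\<in>carrier ?S. f (fst q) \<oplus>\<^sub>P k (snd q) = d" using a y by (intro bexI[of _ "(a, y)"]) auto
 next
  fix q assume q: "q \<in> carrier ?S" "f (fst q) \<oplus>\<^sub>P k (snd q) = \<zero>\<^sub>?D"
  then have qc: "fst q \<in> carrier P'" "snd q \<in> carrier K" by auto
  note c = hom_closed[OF f(1) qc(1)] hom_closed[OF k(4) qc(2)]
  have e: "k (snd q) = \<ominus>\<^sub>P f (fst q)" using q(2) c P.M.minus_equality[of "k (snd q)" "f (fst q)"] by (simp add: P.M.a_comm)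
  have "p (f (fst q)) = p (f (fst q)) \<oplus>\<^sub>X p (k (snd q))"
   using k(9)[OF qc(2)] hom_closed[OF k(6) c(1)] by simp
  also have "\<dots> = \<zero>\<^sub>X" using q(2) hom_zero[OF k(2) s'(2) k(6)] hom_add[OF k(6) c] by simp
  finally have "u (p' (fst q)) = \<zero>\<^sub>X" using f(2)[OF qc(1)] by simp
  then have "p' (fst q) = \<zero>\<^bsub>X'\<^esub>"
   using hom_inj_iff[OF s'(1,2,4)] s'(5) hom_closed[OF k'(6) qc(1)] by blast
  then obtain z where z: "z \<in> carrier K'" "fst q = k' z" using k'(10) qc by blast
  have "ki (\<ominus>\<^sub>P f (k' z)) = snd q" using ki(2)[OF qc(2)] e z by simp
  then have "q = (k' z, ki (\<ominus>\<^sub>P f (k' z)))" using z by (metis prod.collapse)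
  then show "\<exists>z\<in>carrier K'. q = (k' z, ki (\<ominus>\<^sub>P f (k' z)))" using z by blast
 qed
 have fgS: "finitely_generated R ?S"
  by (rule dsum_fg[OF k'(2) k(1) K'(2) pd_lt_fg[OF k(1) K(4)]])
 obtain S :: "('r, 'r fg_carrier) module" and b where b: "fg_module R S" "b \<in> lmod_iso R ?S S"
  using fg_module_copy[of R ?S] lS fgS unfolding fg_module_def by blast
 have "left_module R S" using b by (simp add: fg_module_def)
 note t2 = ses_iso_middle[OF t this b(2)]
 have "pd_lt R (Suc m) ?S"
  using pd_lt_mono[OF projective_pd_lt_1[OF K'(3,2)]] pd_lt_mono[OF K(4)] by (intro pd_lt_dsum k' k) auto
 then have "pd_lt R (Suc m) S" using pd_lt_iso[OF lS sesD(2)[OF t2] b(2)] by blast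
 from step[OF t2 K'(4) this] obtain j where "pd_lt R j ?D" by blast
 then show ?thesis using pd_lt_SucI[OF D K(2,3)] by blast
qed

lemma pd_cokernel:
 fixes R :: "('r, 'p) ring_scheme"
 assumes s: "ses R X' X X'' u v" and pd: "pd_lt R n X'" "pd_lt R m X"
 shows "\<exists>k. pd_lt R k X''"
proof -
 have zero: "\<exists>k. pd_lt R k Y''" if s: "ses R Y' Y Y'' f g" and pd: "pd_lt R 0 Y'" "pd_lt R m Y"
  for Y' :: "('r, 'y, 'z) module_scheme" and Y :: "('r, 'y1, 'z1) module_scheme"
   and Y'' :: "('r, 'y2, 'z2) module_scheme" and f g m
 proof -
  have "carrier Y' = {\<zero>\<^bsub>Y'\<^esub>}" using pd(1) unfolding pd_lt_0[OF sesD(1)[OF s]] .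
  from pd_lt_iso[OF sesD(2,3)[OF s] ses_zero_left[OF s this] pd(2)] show ?thesis by blast
 qed
 have *: "ses R Y' Y Y'' f g \<Longrightarrow> pd_lt R n Y' \<Longrightarrow> pd_lt R m Y \<Longrightarrow> \<exists>k. pd_lt R k Y''"
  for Y' Y Y'' :: "('r, 'r fg_carrier) module" and f g n m
 proof (induction n arbitrary: Y' Y Y'' f g m)
  case 0 then show ?case by (rule zero)
 next
  case (Suc n) show ?case by (rule pd_cokernel_step[OF Suc.prems Suc.IH])
 qed
 show ?thesis
 proof (cases n)
  case 0 then show ?thesis using zero[OF s] pd by simp
 next
  case (Suc k) show ?thesis by (rule pd_cokernel_step[OF s pd(1)[unfolded Suc] pd(2) *])
 qed
qed

text \<open>
 Dually, if \<open>Y\<close> is embedded into an injective module \<open>J\<close> with cokernel \<open>C\<close>, and \<open>Y''\<close> into \<open>J''\<close> with cokernel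
 \<open>C''\<close>, then the cokernel of \<open>Z\<close> in \<open>J\<close> is the kernel of a surjection \<open>J'' \<oplus> C \<rightarrow> C''\<close>.
\<close>

lemma id_kernel:
 fixes Z Y Y'' :: "('r, 'r fg_carrier) module" and R :: "('r, 'p) ring_scheme"
 assumes "ses R Z Y Y'' f g" "id_lt R n Y''" "id_lt R m Y"
 shows "\<exists>k. id_lt R k Z"
 using assms
proof (induction n arbitrary: Z Y Y'' f g m)
 case 0
 note s' = sesD[OF 0(1)]
 have "f \<in> lmod_iso R Z Y" using 0 id_lt_0[OF s'(3)] by (intro ses_zero_right[OF 0(1)]) simp
 then show ?case using id_lt_iso[OF _ 0(3)] by blast
next
 case (Suc n)
 note s' = sesD[OF Suc.prems(1)]
 have "id_lt R (Suc m) Y" using id_lt_mono[OF Suc.prems(3)] by simp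
 from s'(2) this obtain J C :: "('r, 'r fg_carrier) module" and j q where J: "ses R Y J C j q"
  "finitely_generated R J" "injective_module R J" "id_lt R m C"
  by (elim id_lt_SucE)
 obtain J' C' :: "('r, 'r fg_carrier) module" and j' q' where J': "ses R Y'' J' C' j' q'"
  "finitely_generated R J'" "injective_module R J'" "id_lt R n C'"
  using s'(3) Suc.prems(2) by (elim id_lt_SucE)
 note j = sesD[OF J(1)] and j' = sesD[OF J'(1)]
 interpret J: left_module R J by (rule j(2))
 interpret J': left_module R J' by (rule j'(2))
 interpret C': left_module R C' by (rule j'(3))
 interpret C: left_module R C by (rule j(3))
 obtain h where h: "h \<in> lmod_hom R J J'" "\<And>y. y \<in> carrier Y \<Longrightarrow> h (j y) = j' (g y)"
  by (rule injectiveE[OF J'(3) s'(2) j(2) j(4,5) hom_comp[OF s'(6) j'(4)]]) (rule that, assumption, simp)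
 have ker: "q' (h x) = \<zero>\<^bsub>C'\<^esub>" if "x \<in> carrier J" "q x = \<zero>\<^sub>C" for x
  using j(10)[OF that] h(2) j'(9) hom_closed[OF s'(6)] by auto
 obtain hb where hb: "hb \<in> lmod_hom R C C'" "\<And>x. x \<in> carrier J \<Longrightarrow> hb (q x) = q' (h x)"
  by (rule hom_factor[OF j(2,3) j'(3) j(6,7) hom_comp[OF h(1) j'(6)] ker]) (assumption, assumption, rule that, assumption, simp)
 let ?T = "dsum J' C"
 have lT: "left_module R ?T" using j'(2) j(3) by (rule dsum_left_module)
 have fgC: "finitely_generated R C" by (rule finitely_generated_image[OF j(2,3,6,7) J(2)])
 have fgT: "finitely_generated R ?T" by (rule dsum_fg[OF j'(2) j(3) J'(2) fgC])
 obtain S :: "('r, 'r fg_carrier) module" and b where b: "fg_module R S" "b \<in> lmod_iso R ?T S"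
  using fg_module_copy[of R ?T] lT fgT unfolding fg_module_def by blast
 have lS: "left_module R S" using b by (simp add: fg_module_def)
 interpret S: left_module R S by fact
 define b' where "b' = inv_into (carrier ?T) b"
 note b' = iso_inverse[OF b(2) lT, folded b'_def]
 \<comment> \<open>The pushout of \<open>J\<close> and \<open>J'\<close> under \<open>Y\<close>: its two descriptions are \<open>J / Z\<close> and a kernel in \<open>J' \<oplus> C\<close>.\<close>
 let ?d = "\<lambda>x. b (h x, q x)"
 have d: "?d \<in> lmod_hom R J S" by (rule hom_comp[OF hom_pair[OF h(1) j(6)] iso_hom[OF b(2)]])
 have dz: "?d x = \<zero>\<^sub>S \<longleftrightarrow> h x = \<zero>\<^bsub>J'\<^esub> \<and> q x = \<zero>\<^sub>C" if "x \<in> carrier J" for x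
 proof -
  have "(h x, q x) \<in> carrier ?T" using hom_closed[OF h(1) that] hom_closed[OF j(6) that] by simp
  then have "?d x = \<zero>\<^sub>S \<longleftrightarrow> (h x, q x) = \<zero>\<^sub>?T"
   using hom_inj_iff[OF lT lS iso_hom[OF b(2)]] iso_inj[OF b(2)] hom_zero[OF lT lS iso_hom[OF b(2)]] by metis
  then show ?thesis by simp
 qed
 have U: "submod R S (?d ` carrier J)" by (rule submod_image[OF j(2) lS d J.submod_carrier])
 let ?D = "sub S (?d ` carrier J)"
 have lD: "left_module R ?D" by (rule S.submod_left_module[OF U])
 have 1: "ses R Z J ?D (\<lambda>x. j (f x)) ?d"
 proof (rule sesI[OF s'(1) j(2) lD hom_comp[OF s'(4) j(4)] _ hom_into_sub[OF d order_refl]])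
  fix x assume x: "x \<in> carrier Z"
  have fx: "f x \<in> carrier Y" "j (f x) \<in> carrier J" using hom_closed[OF s'(4) x] hom_closed[OF j(4)] by auto
  show "x = \<zero>\<^sub>Z" if "j (f x) = \<zero>\<^sub>J"
   using that x fx hom_inj_iff[OF s'(1,2,4)] s'(5) hom_inj_iff[OF j(1,2,4)] j(5) by blast
  show "b (h (j (f x)), q (j (f x))) = \<zero>\<^sub>?D"
   using dz[OF fx(2)] h(2)[OF fx(1)] s'(9)[OF x] j(9)[OF fx(1)] hom_zero[OF s'(3) j'(2,4)] by simp
 next
  fix x assume x: "x \<in> carrier J" "b (h x, q x) = \<zero>\<^sub>?D"
  then have z: "h x = \<zero>\<^bsub>J'\<^esub>" "q x = \<zero>\<^sub>C" using dz by auto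
  obtain y where y: "y \<in> carrier Y" "x = j y" using j(10)[OF x(1) z(2)] by blast
  then have "g y = \<zero>\<^bsub>Y''\<^esub>"
   using z(1) h(2)[OF y(1)] hom_inj_iff[OF j'(1,2,4)] j'(5) hom_closed[OF s'(6)] by auto
  then show "\<exists>w\<in>carrier Z. x = j (f w)" using s'(10)[OF y(1)] y by blast
 qed auto
 let ?s = "\<lambda>z. q' (fst (b' z)) \<oplus>\<^bsub>C'\<^esub> \<ominus>\<^bsub>C'\<^esub> hb (snd (b' z))"
 note T = dsum_homs[OF j'(2) j(3)]
 have s: "?s \<in> lmod_hom R S C'"
  by (rule hom_comp[OF iso_hom[OF b'(1)] hom_sum[OF j'(3) hom_comp[OF T(1) j'(6)]
     hom_neg[OF j'(3) hom_comp[OF T(2) hb(1)]]]])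
 have bc: "fst (b' z) \<in> carrier J'" "snd (b' z) \<in> carrier C" if "z \<in> carrier S" for z
  using hom_closed[OF iso_hom[OF b'(1)] that] by auto
 have 2: "ses R ?D S C' (\<lambda>x. x) ?s"
 proof (rule sesI[OF lD lS j'(3) sub_hom[OF submodD(1)[OF U]] _ s])
  fix z assume "z \<in> carrier ?D"
  then obtain x where x: "x \<in> carrier J" "z = ?d x" by auto
  have "b' z = (h x, q x)" unfolding x(2)
   using hom_closed[OF h(1) x(1)] hom_closed[OF j(6) x(1)] by (intro b'(2)) simp
  then show "?s z = \<zero>\<^bsub>C'\<^esub>"
   using hb(2)[OF x(1)] hom_closed[OF j'(6)] hom_closed[OF h(1) x(1)] by (simp add: C'.M.r_neg)
 next
  fix c assume c: "c \<in> carrier C'"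
  obtain a where a: "a \<in> carrier J'" "q' a = c" using j'(11)[OF c] by blast
  have "b (a, \<zero>\<^sub>C) \<in> carrier S" using hom_closed[OF iso_hom[OF b(2)]] a by simp
  moreover have "b' (b (a, \<zero>\<^sub>C)) = (a, \<zero>\<^sub>C)" using a by (intro b'(2)) simp
  ultimately show "\<exists>z\<in>carrier S. ?s z = c"
   using a c hom_zero[OF j(3) j'(3) hb(1)] by (intro bexI[of _ "b (a, \<zero>\<^sub>C)"]) simp_all
 next
  fix z assume z: "z \<in> carrier S" "?s z = \<zero>\<^bsub>C'\<^esub>"
  obtain a c where ac: "b' z = (a, c)" by fastforce
  have c: "a \<in> carrier J'" "c \<in> carrier C" using bc[OF z(1)] ac by auto
  obtain x where x: "x \<in> carrier J" "q x = c" using j(11)[OF c(2)] by blast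
  have e: "q' a = q' (h x)" using z(2) ac hb(2)[OF x(1)] x c hom_closed[OF j'(6)] hom_closed[OF h(1)]
   by (simp add: C'.diff_eq_zero)
  have hx: "h x \<in> carrier J'" using hom_closed[OF h(1) x(1)] .
  have "q' (a \<oplus>\<^bsub>J'\<^esub> \<ominus>\<^bsub>J'\<^esub> h x) = \<zero>\<^bsub>C'\<^esub>" using c hx e hom_closed[OF j'(6)]
   by (simp add: hom_add[OF j'(6)] hom_minus[OF j'(2,3,6)] C'.M.r_neg)
  moreover have "a \<oplus>\<^bsub>J'\<^esub> \<ominus>\<^bsub>J'\<^esub> h x \<in> carrier J'" using c hx by simp
  ultimately obtain y'' where y'': "y'' \<in> carrier Y''" "a \<oplus>\<^bsub>J'\<^esub> \<ominus>\<^bsub>J'\<^esub> h x = j' y''"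
   using j'(10) by metis
  obtain y where y: "y \<in> carrier Y" "g y = y''" using s'(11)[OF y''(1)] by blast
  have jy: "j y \<in> carrier J" using hom_closed[OF j(4) y(1)] .
  have "h (x \<oplus>\<^sub>J j y) = a" using J'.add_diff_cancel[OF c(1) hx] y'' y h(2)[OF y(1)] x jy
   by (simp add: hom_add[OF h(1)])
  moreover have "q (x \<oplus>\<^sub>J j y) = c" using x jy j(9)[OF y(1)] c by (simp add: hom_add[OF j(6)])
  ultimately have "z = ?d (x \<oplus>\<^sub>J j y)" using b'(3)[OF z(1)] ac by simp
  then show "\<exists>w\<in>carrier ?D. z = w" using x jy by auto
 qed auto
 have "id_lt R (Suc m) ?T"
  using id_lt_mono[OF injective_id_lt_1[OF J'(3,2)]] id_lt_mono[OF J(4)] by (intro id_lt_dsum j' j) auto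
 then have "id_lt R (Suc m) S" using id_lt_iso[OF b'(1)] by blast
 from Suc.IH[OF 2 J'(4) this] obtain l where "id_lt R l ?D" by blast
 then show ?case using id_lt_SucI[OF 1 J(2,3)] by blast
qed

section \<open>Tensor products\<close>

lemma (in left_module) add_minus_minus:
 assumes "x \<in> carrier M" "y \<in> carrier M"
 shows "x \<oplus>\<^sub>M y \<oplus>\<^sub>M \<ominus>\<^sub>M x \<oplus>\<^sub>M \<ominus>\<^sub>M y = \<zero>\<^sub>M"
proof -
 have "x \<oplus>\<^sub>M y \<oplus>\<^sub>M \<ominus>\<^sub>M x \<oplus>\<^sub>M \<ominus>\<^sub>M y = (x \<oplus>\<^sub>M y) \<oplus>\<^sub>M \<ominus>\<^sub>M (x \<oplus>\<^sub>M y)"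
  using assms by (simp add: M.minus_add M.a_assoc)
 then show ?thesis using assms by (simp add: M.r_neg)
qed

definition frag_eval :: "('y, 't) ring_scheme \<Rightarrow> ('p \<Rightarrow> 'y) \<Rightarrow> ('p \<Rightarrow>\<^sub>0 int) \<Rightarrow> 'y"
 where "frag_eval Y \<beta> c = (\<Oplus>\<^bsub>Y\<^esub>p \<in> Poly_Mapping.keys c. [Poly_Mapping.lookup c p] \<cdot>\<^bsub>Y\<^esub> \<beta> p)"

context abelian_group
begin

lemma frag_eval_superset:
 assumes "finite F" "Poly_Mapping.keys c \<subseteq> F" "\<beta> \<in> F \<rightarrow> carrier G"
 shows "frag_eval G \<beta> c = (\<Oplus>\<^bsub>G\<^esub>p \<in> F. [Poly_Mapping.lookup c p] \<cdot>\<^bsub>G\<^esub> \<beta> p)"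
 unfolding frag_eval_def
proof (rule add.finprod_mono_neutral_cong_left[OF assms(1,2)])
 fix p assume "p \<in> F - Poly_Mapping.keys c"
 then show "[Poly_Mapping.lookup c p] \<cdot>\<^bsub>G\<^esub> \<beta> p = \<zero>\<^sub>G"
  by (simp add: in_keys_iff add_pow_def int_pow_def)
qed (use assms(3) in auto)

lemma frag_eval_closed:
 assumes "\<beta> \<in> S \<rightarrow> carrier G" "Poly_Mapping.keys c \<subseteq> S"
 shows "frag_eval G \<beta> c \<in> carrier G"
 unfolding frag_eval_def using assms by (intro finsum_closed) auto

lemma frag_eval_add:
 assumes \<beta>: "\<beta> \<in> S \<rightarrow> carrier G" and c: "Poly_Mapping.keys c \<subseteq> S" and d: "Poly_Mapping.keys d \<subseteq> S"
 shows "frag_eval G \<beta> (c + d) = frag_eval G \<beta> c \<oplus>\<^sub>G frag_eval G \<beta> d"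
proof -
 let ?F = "Poly_Mapping.keys c \<union> Poly_Mapping.keys d"
 have F: "finite ?F" "\<beta> \<in> ?F \<rightarrow> carrier G" using \<beta> c d by auto
 have "frag_eval G \<beta> (c + d) = (\<Oplus>\<^bsub>G\<^esub>p \<in> ?F. [Poly_Mapping.lookup (c + d) p] \<cdot>\<^bsub>G\<^esub> \<beta> p)"
  by (rule frag_eval_superset[OF F(1) keys_add F(2)])
 also have "\<dots> = (\<Oplus>\<^bsub>G\<^esub>p \<in> ?F. [Poly_Mapping.lookup c p] \<cdot>\<^bsub>G\<^esub> \<beta> p \<oplus>\<^sub>G [Poly_Mapping.lookup d p] \<cdot>\<^bsub>G\<^esub> \<beta> p)"
 proof (rule finsum_cong'[OF refl])
  fix p assume "p \<in> ?F"
  then have "\<beta> p \<in> carrier G" using F by auto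
  then show "[Poly_Mapping.lookup (c + d) p] \<cdot>\<^bsub>G\<^esub> \<beta> p =
    [Poly_Mapping.lookup c p] \<cdot>\<^bsub>G\<^esub> \<beta> p \<oplus>\<^sub>G [Poly_Mapping.lookup d p] \<cdot>\<^bsub>G\<^esub> \<beta> p"
   by (simp add: Poly_Mapping.lookup_add add.int_pow_mult)
 qed (use F in auto)
 also have "\<dots> = frag_eval G \<beta> c \<oplus>\<^sub>G frag_eval G \<beta> d"
  using F by (subst finsum_addf)
   (auto simp: frag_eval_superset[OF F(1) _ F(2)])
 finally show ?thesis .
qed

lemma frag_eval_of:
 assumes "\<beta> p \<in> carrier G" shows "frag_eval G \<beta> (frag_of p) = \<beta> p"
 using assms by (simp add: frag_eval_def)

lemma frag_eval_0: "frag_eval G \<beta> 0 = \<zero>\<^sub>G"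
 by (simp add: frag_eval_def)

lemma frag_eval_diff:
 assumes \<beta>: "\<beta> \<in> S \<rightarrow> carrier G" and c: "Poly_Mapping.keys c \<subseteq> S" and d: "Poly_Mapping.keys d \<subseteq> S"
 shows "frag_eval G \<beta> (c - d) = frag_eval G \<beta> c \<oplus>\<^sub>G \<ominus>\<^sub>G frag_eval G \<beta> d"
proof -
 have cd: "Poly_Mapping.keys (c - d) \<subseteq> S" using keys_diff[of c d] c d by blast
 have "frag_eval G \<beta> c = frag_eval G \<beta> (c - d) \<oplus>\<^sub>G frag_eval G \<beta> d"
  using frag_eval_add[OF \<beta> cd d] by simp
 then show ?thesis using frag_eval_closed[OF \<beta> cd] frag_eval_closed[OF \<beta> d]
  by (simp add: a_assoc r_neg)
qed

end

text \<open>
 The tensor product is a quotient of the free abelian group on pairs. Its elements are handled through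
 representatives: \<open>cls c\<close> is the coset of \<open>c\<close>, and \<open>frag_eval\<close> extends a map on pairs to formal sums.
\<close>

locale tensor_pair = M: bimodule B A M + X: left_module A X
 for A :: "('a, 'p) ring_scheme" and B :: "('b, 'q) ring_scheme"
  and M :: "('b, 'm, 'a, 't) bimodule_scheme" and X :: "('a, 'x, 's) module_scheme"
begin

definition frags :: "(('m \<times> 'x) \<Rightarrow>\<^sub>0 int) set"
 where "frags = {c. Poly_Mapping.keys c \<subseteq> carrier M \<times> carrier X}"

lemma frags_iff: "c \<in> frags \<longleftrightarrow> Poly_Mapping.keys c \<subseteq> carrier M \<times> carrier X"
 by (simp add: frags_def)

lemma carrier_frags: "carrier (tensor_free M X) = frags"
 by (simp add: frags_def free_Abelian_group_def)

abbreviation "N \<equiv> tensor_subgroup A M X"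
abbreviation "T \<equiv> tensor_module A M X"
abbreviation "pt \<equiv> pure_tensor A M X"

definition cls :: "(('m \<times> 'x) \<Rightarrow>\<^sub>0 int) \<Rightarrow> (('m \<times> 'x) \<Rightarrow>\<^sub>0 int) set"
 where "cls c = (\<lambda>n. n + c) ` N"

lemma frags_closed:
 "c \<in> frags \<Longrightarrow> d \<in> frags \<Longrightarrow> c + d \<in> frags" "c \<in> frags \<Longrightarrow> d \<in> frags \<Longrightarrow> c - d \<in> frags"
 "0 \<in> frags" "m \<in> carrier M \<Longrightarrow> x \<in> carrier X \<Longrightarrow> frag_of (m, x) \<in> frags"
 using keys_add[of c d] keys_diff[of c d] by (auto simp: frags_iff)

lemma relations_subset: "tensor_relations A M X \<subseteq> frags"
proof -
 have "a - b - c \<in> frags" if "a \<in> frags" "b \<in> frags" "c \<in> frags" for a b c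
  by (intro frags_closed that)
 then show ?thesis unfolding tensor_relations_def
  by (safe; intro frags_closed(2) frags_closed(4)) auto
qed

lemma subgroup_N: "subgroup N (tensor_free M X)"
 unfolding tensor_subgroup_def
 by (rule group.generate_is_subgroup) (simp_all add: relations_subset carrier_frags)

lemma N_closed: "N \<subseteq> frags" "0 \<in> N" "n \<in> N \<Longrightarrow> n' \<in> N \<Longrightarrow> n + n' \<in> N" "n \<in> N \<Longrightarrow> - n \<in> N"
 "n \<in> N \<Longrightarrow> n' \<in> N \<Longrightarrow> n - n' \<in> N"
proof -
 interpret N: subgroup N "tensor_free M X" by (rule subgroup_N)
 show 1: "N \<subseteq> frags" using N.subset by (simp add: carrier_frags)
 show "0 \<in> N" using N.one_closed by simp
 show 2: "n + n' \<in> N" if "n \<in> N" "n' \<in> N" for n n' using N.m_closed[OF that] by simp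
 show 3: "- n \<in> N" if "n \<in> N" for n
 proof -
  have "Poly_Mapping.keys n \<subseteq> carrier M \<times> carrier X" using 1 that frags_iff by blast
  then show ?thesis using N.m_inv_closed[OF that] by simp
 qed
 show "n \<in> N \<Longrightarrow> n' \<in> N \<Longrightarrow> n - n' \<in> N" using 2[of n "- n'"] 3[of n'] by simp
qed

lemma cls_coset: "N #>\<^bsub>tensor_free M X\<^esub> c = cls c"
 by (auto simp: r_coset_def cls_def)

lemma pt_cls: "pt m x = cls (frag_of (m, x))"
 by (simp add: pure_tensor_def cls_coset)

lemma in_cls: "d \<in> cls c \<longleftrightarrow> d - c \<in> N"
proof
 assume "d - c \<in> N"
 then have "(d - c) + c \<in> cls c" unfolding cls_def by (rule imageI)
 then show "d \<in> cls c" by simp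
qed (auto simp: cls_def)

lemma cls_eq: "cls c = cls d \<longleftrightarrow> c - d \<in> N"
proof
 assume "cls c = cls d"
 moreover have "c \<in> cls c" using N_closed(2) by (simp add: in_cls)
 ultimately show "c - d \<in> N" by (simp add: in_cls)
next
 assume cd: "c - d \<in> N"
 have "e - c \<in> N \<longleftrightarrow> e - d \<in> N" for e
 proof -
  have "e - d = (e - c) + (c - d)" "e - c = (e - d) - (c - d)" by simp_all
  then show ?thesis using cd N_closed(3,5) by metis
 qed
 then show "cls c = cls d" by (auto simp: in_cls)
qed

lemma T_simps: "carrier T = cls ` frags" "\<zero>\<^sub>T = cls 0" "cls c \<oplus>\<^sub>T cls d = cls (c + d)"
proof -
 have "carrier T = (\<Union>a\<in>frags. {N #>\<^bsub>tensor_free M X\<^esub> a})"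
  by (simp add: tensor_module_def FactGroup_def RCOSETS_def carrier_frags)
 then show "carrier T = cls ` frags" by (auto simp: cls_coset)
 show "\<zero>\<^sub>T = cls 0" by (simp add: tensor_module_def FactGroup_def cls_def)
 show "cls c \<oplus>\<^sub>T cls d = cls (c + d)"
 proof -
  have "cls c \<oplus>\<^sub>T cls d = (\<Union>h\<in>cls c. \<Union>k\<in>cls d. {h + k})"
   by (simp add: tensor_module_def FactGroup_def set_mult_def)
  also have "\<dots> = cls (c + d)"
  proof safe
   fix h k assume "h \<in> cls c" "k \<in> cls d"
   then have "(h - c) + (k - d) \<in> N" using N_closed(3) by (simp add: in_cls)
   then show "h + k \<in> cls (c + d)" by (simp add: in_cls algebra_simps)
  next
   fix e assume "e \<in> cls (c + d)"
   then have "e - d \<in> cls c" "d \<in> cls d" using N_closed(2) by (simp_all add: in_cls algebra_simps)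
   moreover have "e = (e - d) + d" by simp
   ultimately show "e \<in> (\<Union>h\<in>cls c. \<Union>k\<in>cls d. {h + k})" by blast
  qed
  finally show ?thesis .
 qed
qed

lemma induced_cls:
 assumes F: "\<And>r. r \<in> tensor_relations A M X \<Longrightarrow> frag_extend (\<lambda>p. frag_of (u p)) r \<in> N"
 shows "tensor_induced A M X u (cls c) = cls (frag_extend (\<lambda>p. frag_of (u p)) c)"
proof -
 let ?F = "frag_extend (\<lambda>p. frag_of (u p))"
 have FN: "?F n \<in> N" if "n \<in> N" for n
  using that unfolding tensor_subgroup_def
 proof (induction n rule: generate.induct)
  case (inv h)
  have "Poly_Mapping.keys h \<subseteq> carrier M \<times> carrier X" using relations_subset inv frags_iff by blast
  then show ?case using N_closed(4)[OF F[OF inv]]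
   by (simp add: frag_extend_minus tensor_subgroup_def)
 next
  case (eng h1 h2)
  then show ?case using N_closed(3) by (simp add: frag_extend_add tensor_subgroup_def)
 qed (use F N_closed(2) in \<open>auto simp: tensor_subgroup_def\<close>)
 have "tensor_induced A M X u (cls c) = (\<Union>h\<in>N. \<Union>k\<in>?F ` cls c. {h + k})"
  by (simp add: tensor_induced_def set_mult_def)
 also have "\<dots> = cls (?F c)"
 proof safe
  fix h e assume "h \<in> N" "e \<in> cls c"
  then have "h + ?F (e - c) \<in> N" using FN N_closed(3) by (simp add: in_cls)
  then show "h + ?F e \<in> cls (?F c)" by (simp add: in_cls frag_extend_diff algebra_simps)
 next
  fix e assume "e \<in> cls (?F c)"
  then have "e - ?F c \<in> N" "c \<in> cls c" using N_closed(2) by (simp_all add: in_cls)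
  moreover have "e = (e - ?F c) + ?F c" by simp
  ultimately show "e \<in> (\<Union>h\<in>N. \<Union>k\<in>?F ` cls c. {h + k})" by blast
 qed
 finally show ?thesis .
qed

abbreviation act :: "'b \<Rightarrow> (('m \<times> 'x) \<Rightarrow>\<^sub>0 int) \<Rightarrow> (('m \<times> 'x) \<Rightarrow>\<^sub>0 int)"
 where "act b \<equiv> frag_extend (\<lambda>p. frag_of ((\<lambda>(m, x). (b \<odot>\<^sub>M m, x)) p))"

lemma relationI:
 "m \<in> carrier M \<Longrightarrow> m' \<in> carrier M \<Longrightarrow> x \<in> carrier X \<Longrightarrow>
   frag_of (m \<oplus>\<^sub>M m', x) - frag_of (m, x) - frag_of (m', x) \<in> N"
 "m \<in> carrier M \<Longrightarrow> x \<in> carrier X \<Longrightarrow> x' \<in> carrier X \<Longrightarrow>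
   frag_of (m, x \<oplus>\<^sub>X x') - frag_of (m, x) - frag_of (m, x') \<in> N"
 "m \<in> carrier M \<Longrightarrow> a \<in> carrier A \<Longrightarrow> x \<in> carrier X \<Longrightarrow>
   frag_of (m \<triangleleft>\<^sub>M a, x) - frag_of (m, a \<odot>\<^sub>X x) \<in> N"
 unfolding tensor_subgroup_def by (rule generate.incl; unfold tensor_relations_def; blast)+

lemma relationE:
 assumes "r \<in> tensor_relations A M X"
  and "\<And>m m' x. m \<in> carrier M \<Longrightarrow> m' \<in> carrier M \<Longrightarrow> x \<in> carrier X \<Longrightarrow>
   P (frag_of (m \<oplus>\<^sub>M m', x) - frag_of (m, x) - frag_of (m', x))"
  and "\<And>m x x'. m \<in> carrier M \<Longrightarrow> x \<in> carrier X \<Longrightarrow> x' \<in> carrier X \<Longrightarrow>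
   P (frag_of (m, x \<oplus>\<^sub>X x') - frag_of (m, x) - frag_of (m, x'))"
  and "\<And>m a x. m \<in> carrier M \<Longrightarrow> a \<in> carrier A \<Longrightarrow> x \<in> carrier X \<Longrightarrow>
   P (frag_of (m \<triangleleft>\<^sub>M a, x) - frag_of (m, a \<odot>\<^sub>X x))"
 shows "P r"
 using assms(1) unfolding tensor_relations_def
 by (elim UnE CollectE exE conjE) (simp_all only: assms(2-4))

lemma smult_T: "b \<in> carrier B \<Longrightarrow> b \<odot>\<^sub>T cls c = cls (act b c)"
proof -
 assume b: "b \<in> carrier B"
 have "act b r \<in> N" if "r \<in> tensor_relations A M X" for r
  using that
 proof (rule relationE[where P = "\<lambda>r. act b r \<in> N"])
  fix m m' x assume "m \<in> carrier M" "m' \<in> carrier M" "x \<in> carrier X"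
  then show "act b (frag_of (m \<oplus>\<^sub>M m', x) - frag_of (m, x) - frag_of (m', x)) \<in> N"
   using b relationI(1)[of "b \<odot>\<^sub>M m" "b \<odot>\<^sub>M m'" x] by (simp add: frag_extend_diff M.smult_r_distr)
 next
  fix m x x' assume "m \<in> carrier M" "x \<in> carrier X" "x' \<in> carrier X"
  then show "act b (frag_of (m, x \<oplus>\<^sub>X x') - frag_of (m, x) - frag_of (m, x')) \<in> N"
   using b relationI(2)[of "b \<odot>\<^sub>M m" x x'] by (simp add: frag_extend_diff)
 next
  fix m a x assume "m \<in> carrier M" "a \<in> carrier A" "x \<in> carrier X"
  then show "act b (frag_of (m \<triangleleft>\<^sub>M a, x) - frag_of (m, a \<odot>\<^sub>X x)) \<in> N"
   using b relationI(3)[of "b \<odot>\<^sub>M m" a x] by (simp add: frag_extend_diff M.smult_rsmult_assoc)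
 qed
 then show ?thesis by (simp add: tensor_module_def induced_cls)
qed

lemma act_closed: "b \<in> carrier B \<Longrightarrow> c \<in> frags \<Longrightarrow> act b c \<in> frags"
proof -
 assume b: "b \<in> carrier B" and "c \<in> frags"
 then have "Poly_Mapping.keys c \<subseteq> carrier M \<times> carrier X" by (simp add: frags_iff)
 then show "act b c \<in> frags"
 proof (induction c rule: free_Abelian_group_induct[consumes 1, case_names zero diff one])
  case (diff x y) then show ?case using frags_closed(2) by (simp add: frag_extend_diff)
 next
  case (one p) then show ?case using b by (cases p) (auto intro: frags_closed(4))
 qed (simp add: frags_closed(3))
qed

lemma pt_closed [simp]: "m \<in> carrier M \<Longrightarrow> x \<in> carrier X \<Longrightarrow> pt m x \<in> carrier T"
 by (auto simp: pt_cls T_simps intro: frags_closed(4))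

lemma pt_add_l: "m \<in> carrier M \<Longrightarrow> m' \<in> carrier M \<Longrightarrow> x \<in> carrier X \<Longrightarrow>
  pt (m \<oplus>\<^sub>M m') x = pt m x \<oplus>\<^sub>T pt m' x"
 using relationI(1)[of m m' x] by (simp add: pt_cls T_simps cls_eq diff_diff_eq)

lemma pt_add_r: "m \<in> carrier M \<Longrightarrow> x \<in> carrier X \<Longrightarrow> x' \<in> carrier X \<Longrightarrow>
  pt m (x \<oplus>\<^sub>X x') = pt m x \<oplus>\<^sub>T pt m x'"
 using relationI(2)[of m x x'] by (simp add: pt_cls T_simps cls_eq diff_diff_eq)

lemma pt_balanced: "m \<in> carrier M \<Longrightarrow> a \<in> carrier A \<Longrightarrow> x \<in> carrier X \<Longrightarrow>
  pt (m \<triangleleft>\<^sub>M a) x = pt m (a \<odot>\<^sub>X x)"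
 using relationI(3)[of m a x] by (simp add: pt_cls cls_eq)

lemma pt_smult: "b \<in> carrier B \<Longrightarrow> b \<odot>\<^sub>T pt m x = pt (b \<odot>\<^sub>M m) x"
 by (simp add: pt_cls smult_T)

lemma T_left_module: "left_module B T"
proof (rule left_moduleI)
 show "ring B" by (rule M.L.R.ring_axioms)
 have ext: "cls (f c) = cls (g c)" if c: "c \<in> frags"
  and f: "\<And>c d. f (c - d) = f c - f d" and g: "\<And>c d. g (c - d) = g c - g d"
  and pure: "\<And>m x. m \<in> carrier M \<Longrightarrow> x \<in> carrier X \<Longrightarrow> f (frag_of (m, x)) - g (frag_of (m, x)) \<in> N"
 for f g :: "(('m \<times> 'x) \<Rightarrow>\<^sub>0 int) \<Rightarrow> (('m \<times> 'x) \<Rightarrow>\<^sub>0 int)" and c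
 proof -
  have 0: "f 0 = 0" "g 0 = 0" using f[of 0 0] g[of 0 0] by simp_all
  have "Poly_Mapping.keys c \<subseteq> carrier M \<times> carrier X" using c by (simp add: frags_iff)
  then have "f c - g c \<in> N"
  proof (induction c rule: free_Abelian_group_induct[consumes 1, case_names zero diff one])
   case (diff x y)
   have "f (x - y) - g (x - y) = (f x - g x) - (f y - g y)" by (simp add: f g)
   then show ?case using diff N_closed(5) by simp
  qed (use 0 pure N_closed(2) in auto)
  then show ?thesis by (simp add: cls_eq)
 qed
 fix x assume "x \<in> carrier T"
 then obtain c where c: "c \<in> frags" "x = cls c" by (auto simp: T_simps)
 { fix y assume "y \<in> carrier T"
  then obtain d where d: "d \<in> frags" "y = cls d" by (auto simp: T_simps)
  show "x \<oplus>\<^sub>T y \<in> carrier T" using c d frags_closed(1) by (simp add: T_simps)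
  show "x \<oplus>\<^sub>T y = y \<oplus>\<^sub>T x" using c d by (simp add: T_simps add.commute)
  { fix z assume "z \<in> carrier T"
   then obtain e where e: "e \<in> frags" "z = cls e" by (auto simp: T_simps)
   show "x \<oplus>\<^sub>T y \<oplus>\<^sub>T z = x \<oplus>\<^sub>T (y \<oplus>\<^sub>T z)" using c d e by (simp add: T_simps add.assoc) }
  fix r assume r: "r \<in> carrier B"
  show "r \<odot>\<^sub>T (x \<oplus>\<^sub>T y) = r \<odot>\<^sub>T x \<oplus>\<^sub>T r \<odot>\<^sub>T y"
   using c d r by (simp add: T_simps smult_T frag_extend_add) }
 show "\<zero>\<^sub>T \<oplus>\<^sub>T x = x" using c by (simp add: T_simps)
 show "\<one>\<^sub>B \<odot>\<^sub>T x = x"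
  unfolding c(2) smult_T[OF M.L.R.one_closed]
  by (rule ext[OF c(1), where g = "\<lambda>c. c"]) (auto simp: frag_extend_diff N_closed(2))
 have "cls (act \<zero>\<^sub>B c) = cls ((\<lambda>_. 0) c)"
 proof (rule ext[OF c(1)])
  fix m x assume a: "m \<in> carrier M" "x \<in> carrier X"
  have "frag_of (\<zero>\<^sub>M \<oplus>\<^sub>M \<zero>\<^sub>M, x) - frag_of (\<zero>\<^sub>M, x) - frag_of (\<zero>\<^sub>M, x) \<in> N"
   using a by (intro relationI) auto
  from N_closed(4)[OF this] show "act \<zero>\<^sub>B (frag_of (m, x)) - 0 \<in> N" using a by simp
 qed (simp_all add: frag_extend_diff)
 then show "\<zero>\<^sub>B \<odot>\<^sub>T x = \<zero>\<^sub>T" by (simp add: c(2) T_simps smult_T)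
 fix r assume r: "r \<in> carrier B"
 show "r \<odot>\<^sub>T x \<in> carrier T" using c r act_closed by (simp add: T_simps smult_T)
 fix s assume s: "s \<in> carrier B"
 have "cls (act (r \<oplus>\<^sub>B s) c) = cls ((\<lambda>c. act r c + act s c) c)"
 proof (rule ext[OF c(1)])
  show "act (r \<oplus>\<^sub>B s) (frag_of (m, x)) - (act r (frag_of (m, x)) + act s (frag_of (m, x))) \<in> N"
   if "m \<in> carrier M" "x \<in> carrier X" for m x
   using relationI(1)[of "r \<odot>\<^sub>M m" "s \<odot>\<^sub>M m" x] that r s by (simp add: M.smult_l_distr diff_diff_eq)
 qed (simp_all add: frag_extend_diff)
 then show "(r \<oplus>\<^sub>B s) \<odot>\<^sub>T x = r \<odot>\<^sub>T x \<oplus>\<^sub>T s \<odot>\<^sub>T x"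
  using r s by (simp add: c(2) T_simps smult_T)
 have "cls (act (r \<otimes>\<^sub>B s) c) = cls ((\<lambda>c. act r (act s c)) c)"
  by (rule ext[OF c(1)]) (use r s in \<open>auto simp: frag_extend_diff M.smult_assoc1 N_closed(2)\<close>)
 then show "(r \<otimes>\<^sub>B s) \<odot>\<^sub>T x = r \<odot>\<^sub>T (s \<odot>\<^sub>T x)" using r s by (simp add: c(2) smult_T)
next
 show "\<zero>\<^sub>T \<in> carrier T" by (auto simp: T_simps intro: frags_closed(3))
qed

lemma tensor_induct [consumes 1, case_names pure add zero]:
 assumes t: "t \<in> carrier T"
  and pure: "\<And>m x. m \<in> carrier M \<Longrightarrow> x \<in> carrier X \<Longrightarrow> P (pt m x)"
  and add: "\<And>s t. s \<in> carrier T \<Longrightarrow> t \<in> carrier T \<Longrightarrow> P s \<Longrightarrow> P t \<Longrightarrow> P (s \<oplus>\<^sub>T t)"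
  and zero: "P \<zero>\<^sub>T"
 shows "P t"
proof -
 interpret T: left_module B T by (rule T_left_module)
 have neg: "\<ominus>\<^sub>T pt m x = pt (\<ominus>\<^sub>M m) x" if "m \<in> carrier M" "x \<in> carrier X" for m x
  using that pt_smult[of "\<ominus>\<^sub>B \<one>\<^sub>B" m x] by (simp add: T.smult_l_minus M.smult_l_minus)
 obtain c where c: "c \<in> frags" "t = cls c" using t by (auto simp: T_simps)
 have "Poly_Mapping.keys c \<subseteq> carrier M \<times> carrier X" using c by (simp add: frags_iff)
 then have "P (cls c) \<and> P (\<ominus>\<^sub>T cls c)"
 proof (induction c rule: free_Abelian_group_induct[consumes 1, case_names zero diff one])
  case zero
  have "\<ominus>\<^sub>T \<zero>\<^sub>T = \<zero>\<^sub>T" by simp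
  then show ?case using assms(4) by (simp add: T_simps(2))
 next
  case (diff x y)
  have xy: "cls x \<in> carrier T" "cls y \<in> carrier T" using diff by (auto simp: T_simps frags_iff)
  have "cls x = cls (x - y) \<oplus>\<^sub>T cls y" "cls (x - y) \<in> carrier T"
   using frags_closed(2)[of x y] diff by (auto simp: T_simps frags_iff)
  then have "cls (x - y) = cls x \<oplus>\<^sub>T \<ominus>\<^sub>T cls y"
   "\<ominus>\<^sub>T cls (x - y) = \<ominus>\<^sub>T cls x \<oplus>\<^sub>T cls y" using xy
   by (simp_all add: T.M.a_assoc T.M.r_neg T.M.l_neg T.M.minus_add)
  then show ?case using diff xy add by simp
 next
  case (one a)
  then show ?case using pure neg by (auto simp: pt_cls)
 qed
 then show ?thesis using c by simp
qed

lemma tensor_hom_eq: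
 assumes Y: "left_module B Y" and f: "f \<in> lmod_hom B T Y" and g: "g \<in> lmod_hom B T Y"
  and eq: "\<And>m x. m \<in> carrier M \<Longrightarrow> x \<in> carrier X \<Longrightarrow> f (pt m x) = g (pt m x)"
  and t: "t \<in> carrier T"
 shows "f t = g t"
 using t
proof (induction t rule: tensor_induct)
 case (add s t) then show ?case by (simp add: hom_add[OF f] hom_add[OF g])
qed (use eq hom_zero[OF T_left_module Y f] hom_zero[OF T_left_module Y g] in auto)

lemma balanced_eval:
 assumes Y: "left_module B Y"
  and cl: "\<And>m x. m \<in> carrier M \<Longrightarrow> x \<in> carrier X \<Longrightarrow> \<beta> (m, x) \<in> carrier Y"
  and l: "\<And>m m' x. m \<in> carrier M \<Longrightarrow> m' \<in> carrier M \<Longrightarrow> x \<in> carrier X \<Longrightarrow>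
   \<beta> (m \<oplus>\<^sub>M m', x) = \<beta> (m, x) \<oplus>\<^sub>Y \<beta> (m', x)"
  and r: "\<And>m x x'. m \<in> carrier M \<Longrightarrow> x \<in> carrier X \<Longrightarrow> x' \<in> carrier X \<Longrightarrow>
   \<beta> (m, x \<oplus>\<^sub>X x') = \<beta> (m, x) \<oplus>\<^sub>Y \<beta> (m, x')"
  and b: "\<And>m a x. m \<in> carrier M \<Longrightarrow> a \<in> carrier A \<Longrightarrow> x \<in> carrier X \<Longrightarrow>
   \<beta> (m \<triangleleft>\<^sub>M a, x) = \<beta> (m, a \<odot>\<^sub>X x)"
  and cd: "d \<in> cls c" "c \<in> frags"
 shows "frag_eval Y \<beta> d = frag_eval Y \<beta> c"
proof -
 interpret Y: left_module B Y by fact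
 have \<beta>: "\<beta> \<in> carrier M \<times> carrier X \<rightarrow> carrier Y" using cl by auto
 have rel: "h \<in> frags" "frag_eval Y \<beta> h = \<zero>\<^sub>Y" if incl: "h \<in> tensor_relations A M X" for h
 proof -
  have *: "frag_eval Y \<beta> (frag_of p - frag_of q - frag_of q') = \<beta> p \<oplus>\<^sub>Y \<ominus>\<^sub>Y \<beta> q \<oplus>\<^sub>Y \<ominus>\<^sub>Y \<beta> q'"
   if "p \<in> carrier M \<times> carrier X" "q \<in> carrier M \<times> carrier X" "q' \<in> carrier M \<times> carrier X" for p q q'
  proof -
   have k: "Poly_Mapping.keys (frag_of p - frag_of q) \<subseteq> carrier M \<times> carrier X"
    using frags_closed(2)[of "frag_of p" "frag_of q"] that by (simp add: frags_iff)
   show ?thesis using that \<beta> k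
    by (subst Y.M.frag_eval_diff[OF \<beta>], simp, simp, subst Y.M.frag_eval_diff[OF \<beta>])
     (auto simp: Y.M.frag_eval_of Pi_iff)
  qed
  show "frag_eval Y \<beta> h = \<zero>\<^sub>Y"
   using incl
  proof (rule relationE[where P = "\<lambda>h. frag_eval Y \<beta> h = \<zero>\<^sub>Y"])
   fix m m' x assume a: "m \<in> carrier M" "m' \<in> carrier M" "x \<in> carrier X"
   then show "frag_eval Y \<beta> (frag_of (m \<oplus>\<^sub>M m', x) - frag_of (m, x) - frag_of (m', x)) = \<zero>\<^sub>Y"
    using cl[OF a(1,3)] cl[OF a(2,3)] l[OF a]
    by (simp add: * Y.add_minus_minus)
  next
   fix m x x' assume a: "m \<in> carrier M" "x \<in> carrier X" "x' \<in> carrier X"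
   then show "frag_eval Y \<beta> (frag_of (m, x \<oplus>\<^sub>X x') - frag_of (m, x) - frag_of (m, x')) = \<zero>\<^sub>Y"
    using cl[OF a(1,2)] cl[OF a(1,3)] r[OF a]
    by (simp add: * Y.add_minus_minus)
  next
   fix m a x assume a: "m \<in> carrier M" "a \<in> carrier A" "x \<in> carrier X"
   have "frag_eval Y \<beta> (frag_of (m \<triangleleft>\<^sub>M a, x) - frag_of (m, a \<odot>\<^sub>X x)) =
     \<beta> (m \<triangleleft>\<^sub>M a, x) \<oplus>\<^sub>Y \<ominus>\<^sub>Y \<beta> (m, a \<odot>\<^sub>X x)"
    using a by (subst Y.M.frag_eval_diff[OF \<beta>]) (auto simp: Y.M.frag_eval_of cl)
   then show "frag_eval Y \<beta> (frag_of (m \<triangleleft>\<^sub>M a, x) - frag_of (m, a \<odot>\<^sub>X x)) = \<zero>\<^sub>Y"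
    using a b[OF a] cl by (simp add: Y.M.r_neg)
  qed
  show "h \<in> frags" using relations_subset incl by blast
 qed
 have "n \<in> frags \<and> frag_eval Y \<beta> n = \<zero>\<^sub>Y" if "n \<in> N" for n
  using that unfolding tensor_subgroup_def
 proof (induction n rule: generate.induct)
  case one then show ?case by (simp add: Y.M.frag_eval_0 frags_closed(3))
 next
  case (incl h) then show ?case using rel by blast
 next
  case (inv h)
  have "frag_eval Y \<beta> (0 - h) = \<zero>\<^sub>Y"
   using rel[OF inv] by (subst Y.M.frag_eval_diff[OF \<beta>]) (auto simp: frags_iff Y.M.frag_eval_0)
  then show ?case using rel(1)[OF inv] frags_closed(2)[OF frags_closed(3), of h] by (simp add: frags_iff)
 next
  case (eng h1 h2)
  then show ?case using Y.M.frag_eval_add[OF \<beta>, of h1 h2] frags_closed(1)[of h1 h2] by (simp add: frags_iff)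
 qed
 then have "d - c \<in> frags" "frag_eval Y \<beta> (d - c) = \<zero>\<^sub>Y" using cd by (auto simp: in_cls)
 then show ?thesis
  using Y.M.frag_eval_add[OF \<beta>, of "d - c" c] cd Y.M.frag_eval_closed[OF \<beta>, of c] by (simp add: frags_iff)
qed

lemma tensor_lift:
 assumes Y: "left_module B Y"
  and cl: "\<And>m x. m \<in> carrier M \<Longrightarrow> x \<in> carrier X \<Longrightarrow> \<beta> m x \<in> carrier Y"
  and l: "\<And>m m' x. m \<in> carrier M \<Longrightarrow> m' \<in> carrier M \<Longrightarrow> x \<in> carrier X \<Longrightarrow>
   \<beta> (m \<oplus>\<^sub>M m') x = \<beta> m x \<oplus>\<^sub>Y \<beta> m' x"
  and r: "\<And>m x x'. m \<in> carrier M \<Longrightarrow> x \<in> carrier X \<Longrightarrow> x' \<in> carrier X \<Longrightarrow>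
   \<beta> m (x \<oplus>\<^sub>X x') = \<beta> m x \<oplus>\<^sub>Y \<beta> m x'"
  and b: "\<And>m a x. m \<in> carrier M \<Longrightarrow> a \<in> carrier A \<Longrightarrow> x \<in> carrier X \<Longrightarrow>
   \<beta> (m \<triangleleft>\<^sub>M a) x = \<beta> m (a \<odot>\<^sub>X x)"
  and s: "\<And>s m x. s \<in> carrier B \<Longrightarrow> m \<in> carrier M \<Longrightarrow> x \<in> carrier X \<Longrightarrow>
   \<beta> (s \<odot>\<^sub>M m) x = s \<odot>\<^sub>Y \<beta> m x"
 obtains h where "h \<in> lmod_hom B T Y" "\<And>m x. m \<in> carrier M \<Longrightarrow> x \<in> carrier X \<Longrightarrow> h (pt m x) = \<beta> m x"
proof -
 interpret Y: left_module B Y by fact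
 interpret T: left_module B T by (rule T_left_module)
 let ?\<beta> = "\<lambda>p. \<beta> (fst p) (snd p)"
 have \<beta>: "?\<beta> \<in> carrier M \<times> carrier X \<rightarrow> carrier Y" using cl by auto
 define h where "h C = frag_eval Y ?\<beta> (SOME c. c \<in> C)" for C
 have h: "h (cls c) = frag_eval Y ?\<beta> c" if "c \<in> frags" for c
 proof -
  have "c \<in> cls c" using N_closed(2) by (simp add: in_cls)
  then have "(SOME d. d \<in> cls c) \<in> cls c" by (rule someI)
  from balanced_eval[OF Y _ _ _ _ this that, of ?\<beta>] show ?thesis
   unfolding h_def using cl l r b by simp
 qed
 have hadd: "h (u \<oplus>\<^sub>T v) = h u \<oplus>\<^sub>Y h v" if "u \<in> carrier T" "v \<in> carrier T" for u v
 proof -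
  obtain c d where c: "c \<in> frags" "u = cls c" "d \<in> frags" "v = cls d" using \<open>u \<in> carrier T\<close> \<open>v \<in> carrier T\<close> by (auto simp: T_simps)
  then show ?thesis using h frags_closed(1)[of c d] Y.M.frag_eval_add[OF \<beta>, of c d] by (simp add: T_simps frags_iff)
 qed
 have hp: "h (pt m x) = \<beta> m x" if "m \<in> carrier M" "x \<in> carrier X" for m x
  using that cl by (simp add: pt_cls h frags_closed(4) Y.M.frag_eval_of)
 have hc: "h u \<in> carrier Y" if "u \<in> carrier T" for u
  using that h Y.M.frag_eval_closed[OF \<beta>] by (auto simp: T_simps frags_iff)
 have h0: "h \<zero>\<^sub>T = \<zero>\<^sub>Y" using h[of 0] by (simp add: T_simps Y.M.frag_eval_0 frags_closed(3))
 have "h (s' \<odot>\<^sub>T u) = s' \<odot>\<^sub>Y h u" if s': "s' \<in> carrier B" and u: "u \<in> carrier T" for s' u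
  using u
 proof (induction u rule: tensor_induct)
  case (pure m x) then show ?case using s' s by (simp add: pt_smult hp)
 next
  case (add u v) then show ?case using s' by (simp add: T.smult_r_distr Y.smult_r_distr hadd hc)
 next
  case zero then show ?case using s' h0 by simp
 qed
 then have "h \<in> lmod_hom B T Y" using hc hadd by (intro lmod_homI)
 then show ?thesis using that hp by blast
qed

end

lemma adj_counit_pure:
 assumes "tensor_pair A B M (hom_module B M Y)" "left_module B Y"
  and "m \<in> carrier M" "f \<in> carrier (hom_module B M Y)"
 shows "adj_counit Y (pure_tensor A M (hom_module B M Y) m f) = f m"
proof -
 interpret t: tensor_pair A B M "hom_module B M Y" by fact
 interpret Y: left_module B Y by fact
 let ?\<beta> = "\<lambda>p. (snd p) (fst p)"
 have hm: "g \<in> lmod_hom B M Y" if "g \<in> carrier (hom_module B M Y)" for g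
  using that by (simp add: hom_module_def)
 have mf: "frag_of (m, f) \<in> t.frags" using assms(3,4) by (rule t.frags_closed(4))
 have "frag_eval Y ?\<beta> d = f m" if d: "d \<in> t.cls (frag_of (m, f))" for d
 proof -
  have "frag_eval Y ?\<beta> d = frag_eval Y ?\<beta> (frag_of (m, f))"
   by (rule t.balanced_eval[OF assms(2) _ _ _ _ d mf])
    (use assms hm in \<open>auto simp: hom_module_def hom_closed hom_add\<close>)
  also have "\<dots> = f m" using hom_closed[OF hm[OF assms(4)] assms(3)] by (simp add: Y.M.frag_eval_of)
  finally show ?thesis .
 qed
 then have "frag_eval Y ?\<beta> ` t.cls (frag_of (m, f)) = {f m}"
  using t.N_closed(2) by (auto simp: t.cls_def)
 then show ?thesis by (simp add: adj_counit_def t.pt_cls frag_eval_def)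
qed

lemma (in tensor_pair) pt_zero: "m \<in> carrier M \<Longrightarrow> pt m \<zero>\<^sub>X = \<zero>\<^sub>T"
proof -
 interpret T: left_module B T by (rule T_left_module)
 assume "m \<in> carrier M"
 then show ?thesis using pt_add_r[of m "\<zero>\<^sub>X" "\<zero>\<^sub>X"] by (simp add: T.M.add.r_cancel_one')
qed

lemma (in tensor_pair) submod_T_total:
 assumes "submod B T U" "\<And>m x. m \<in> carrier M \<Longrightarrow> x \<in> carrier X \<Longrightarrow> pt m x \<in> U"
 shows "U = carrier T"
proof -
 have "t \<in> U" if "t \<in> carrier T" for t
  using that by (induction t rule: tensor_induct) (use assms submodD[OF assms(1)] in auto)
 then show ?thesis using submodD(1)[OF assms(1)] by blast
qed

lemma tensor_map:
 assumes tX: "tensor_pair A B M X" and tZ: "tensor_pair A B M Z" and u: "u \<in> lmod_hom A X Z"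
 obtains v where "v \<in> lmod_hom B (tensor_module A M X) (tensor_module A M Z)"
  "\<And>m x. m \<in> carrier M \<Longrightarrow> x \<in> carrier X \<Longrightarrow> v (pure_tensor A M X m x) = pure_tensor A M Z m (u x)"
proof -
 interpret X: tensor_pair A B M X by fact
 interpret Z: tensor_pair A B M Z by fact
 note c = hom_closed[OF u]
 show ?thesis
 proof (rule X.tensor_lift[OF Z.T_left_module, of "\<lambda>m x. Z.pt m (u x)"])
  fix m x assume "m \<in> carrier M" "x \<in> carrier X"
  then show "Z.pt m (u x) \<in> carrier Z.T" using c by simp
  show "Z.pt (s \<odot>\<^sub>M m) (u x) = s \<odot>\<^bsub>Z.T\<^esub> Z.pt m (u x)" if "s \<in> carrier B" for s
   using that by (simp add: Z.pt_smult)
 next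
  fix m m' x assume "m \<in> carrier M" "m' \<in> carrier M" "x \<in> carrier X"
  then show "Z.pt (m \<oplus>\<^sub>M m') (u x) = Z.pt m (u x) \<oplus>\<^bsub>Z.T\<^esub> Z.pt m' (u x)" using c by (simp add: Z.pt_add_l)
 next
  fix m x x' assume "m \<in> carrier M" "x \<in> carrier X" "x' \<in> carrier X"
  then show "Z.pt m (u (x \<oplus>\<^sub>X x')) = Z.pt m (u x) \<oplus>\<^bsub>Z.T\<^esub> Z.pt m (u x')"
   using c by (simp add: Z.pt_add_r hom_add[OF u])
 next
  fix m a x assume "m \<in> carrier M" "a \<in> carrier A" "x \<in> carrier X"
  then show "Z.pt (m \<triangleleft>\<^sub>M a) (u x) = Z.pt m (u (a \<odot>\<^sub>X x))"
   using c by (simp add: Z.pt_balanced hom_smult[OF u])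
 qed (rule that)
qed

section \<open>Modules of homomorphisms\<close>

lemma hom_module_simps:
 "f \<in> carrier (hom_module B M Y) \<longleftrightarrow> f \<in> lmod_hom B M Y \<and> f \<in> extensional (carrier M)"
 "\<zero>\<^bsub>hom_module B M Y\<^esub> = (\<lambda>m \<in> carrier M. \<zero>\<^sub>Y)"
 "f \<oplus>\<^bsub>hom_module B M Y\<^esub> g = (\<lambda>m \<in> carrier M. f m \<oplus>\<^sub>Y g m)"
 "a \<odot>\<^bsub>hom_module B M Y\<^esub> f = (\<lambda>m \<in> carrier M. f (m \<triangleleft>\<^sub>M a))"
 by (simp_all add: hom_module_def)

lemma hom_module_ext:
 assumes "f \<in> carrier (hom_module B M Y)" "g \<in> carrier (hom_module B M Y)"
  "\<And>m. m \<in> carrier M \<Longrightarrow> f m = g m"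
 shows "f = g"
 using assms by (auto simp: hom_module_simps intro: extensionalityI)

lemma hom_restrictI: "h \<in> lmod_hom B M Y \<Longrightarrow> left_module B M \<Longrightarrow>
  restrict h (carrier M) \<in> carrier (hom_module B M Y)"
 by (auto simp: hom_module_simps lmod_hom_def left_module_def abelian_group_def abelian_monoid.a_closed
   left_module.smult_closed)

lemma hom_module_left_module:
 assumes "bimodule B A M" "left_module B Y"
 shows "left_module A (hom_module B M Y)"
proof -
 interpret M: bimodule B A M by fact
 interpret Y: left_module B Y by fact
 let ?H = "hom_module B M Y"
 have lM: "left_module B M" by (rule M.L.left_module_axioms)
 have D: "f \<in> lmod_hom B M Y" if "f \<in> carrier ?H" for f using that by (simp add: hom_module_simps)
 note c = hom_closed[OF D] and hsm = hom_smult[OF D] and had = hom_add[OF D]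
 have zero: "\<zero>\<^sub>?H \<in> carrier ?H"
  unfolding hom_module_simps(2) by (rule hom_restrictI[OF _ lM]) (auto simp: lmod_hom_def)
 have add: "f \<oplus>\<^sub>?H g \<in> carrier ?H" if "f \<in> carrier ?H" "g \<in> carrier ?H" for f g
  unfolding hom_module_simps(3) by (rule hom_restrictI[OF hom_sum[OF assms(2) D D] lM]) (use that in auto)
 have sm: "a \<odot>\<^sub>?H f \<in> carrier ?H" if "a \<in> carrier A" "f \<in> carrier ?H" for a f
  unfolding hom_module_simps(4)
  by (rule hom_restrictI[OF _ lM], rule lmod_homI)
   (use that c had hsm in \<open>auto simp: M.rsmult_l_distr M.smult_rsmult_assoc\<close>)
 show ?thesis
 proof (rule left_moduleI[OF M.S.ring_axioms add zero])
  fix f g h assume f: "f \<in> carrier ?H" and g: "g \<in> carrier ?H" and h: "h \<in> carrier ?H"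
  show "f \<oplus>\<^sub>?H g \<oplus>\<^sub>?H h = f \<oplus>\<^sub>?H (g \<oplus>\<^sub>?H h)"
   by (rule hom_module_ext[OF add[OF add[OF f g] h] add[OF f add[OF g h]]])
    (use c f g h in \<open>auto simp: hom_module_simps(2-4) Y.M.a_assoc\<close>)
 next
  fix f g assume f: "f \<in> carrier ?H" and g: "g \<in> carrier ?H"
  show "f \<oplus>\<^sub>?H g = g \<oplus>\<^sub>?H f"
   by (rule hom_module_ext[OF add[OF f g] add[OF g f]])
    (use c f g in \<open>auto simp: hom_module_simps(2-4) Y.M.a_comm\<close>)
  fix a assume a: "a \<in> carrier A"
  show "a \<odot>\<^sub>?H (f \<oplus>\<^sub>?H g) = a \<odot>\<^sub>?H f \<oplus>\<^sub>?H a \<odot>\<^sub>?H g"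
   by (rule hom_module_ext[OF sm[OF a add[OF f g]] add[OF sm[OF a f] sm[OF a g]]])
    (use a c f g in \<open>auto simp: hom_module_simps(2-4)\<close>)
 next
  fix f assume f: "f \<in> carrier ?H"
  show "\<zero>\<^sub>?H \<oplus>\<^sub>?H f = f"
   by (rule hom_module_ext[OF add[OF zero f] f]) (use c f in \<open>auto simp: hom_module_simps(2-4)\<close>)
  show "\<one>\<^sub>A \<odot>\<^sub>?H f = f"
   by (rule hom_module_ext[OF sm[OF M.S.one_closed f] f]) (use c f in \<open>auto simp: hom_module_simps(2-4)\<close>)
  have "m \<triangleleft>\<^sub>M \<zero>\<^sub>A = \<zero>\<^sub>M" if "m \<in> carrier M" for m
   using M.rsmult_r_distr[OF that, of "\<zero>\<^sub>A" "\<zero>\<^sub>A"] that by (simp add: M.M.add.r_cancel_one')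
  then show "\<zero>\<^sub>A \<odot>\<^sub>?H f = \<zero>\<^sub>?H"
   using hom_zero[OF lM assms(2) D[OF f]]
   by (intro hom_module_ext[OF sm[OF M.S.zero_closed f] zero]) (auto simp: hom_module_simps(2-4))
  fix a b assume a: "a \<in> carrier A" and b: "b \<in> carrier A"
  have ab: "a \<oplus>\<^sub>A b \<in> carrier A" "a \<otimes>\<^sub>A b \<in> carrier A" using a b by auto
  show "(a \<oplus>\<^sub>A b) \<odot>\<^sub>?H f = a \<odot>\<^sub>?H f \<oplus>\<^sub>?H b \<odot>\<^sub>?H f"
   by (rule hom_module_ext[OF sm[OF ab(1) f] add[OF sm[OF a f] sm[OF b f]]])
    (use a b c f had in \<open>auto simp: hom_module_simps(2-4) M.rsmult_r_distr\<close>)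
  show "(a \<otimes>\<^sub>A b) \<odot>\<^sub>?H f = a \<odot>\<^sub>?H (b \<odot>\<^sub>?H f)"
   by (rule hom_module_ext[OF sm[OF ab(2) f] sm[OF a sm[OF b f]]])
    (use a b in \<open>auto simp: hom_module_simps(2-4) M.rsmult_assoc\<close>)
 qed (use sm in auto)
qed

definition hom_map :: "('b, 'm, 'a, 't) bimodule_scheme \<Rightarrow> ('y \<Rightarrow> 'z) \<Rightarrow> ('m \<Rightarrow> 'y) \<Rightarrow> 'm \<Rightarrow> 'z"
 where "hom_map M g h = (\<lambda>m \<in> carrier M. g (h m))"

lemma hom_map_apply: "m \<in> carrier M \<Longrightarrow> hom_map M g h m = g (h m)"
 by (simp add: hom_map_def)

lemma hom_map_hom:
 assumes M: "bimodule B A M" and g: "g \<in> lmod_hom B Y Z"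
 shows "hom_map M g \<in> lmod_hom A (hom_module B M Y) (hom_module B M Z)"
proof -
 interpret M: bimodule B A M by fact
 have lM: "left_module B M" by (rule M.L.left_module_axioms)
 show ?thesis
 proof (rule lmod_homI)
  fix h assume h: "h \<in> carrier (hom_module B M Y)"
  then have h': "h \<in> lmod_hom B M Y" by (simp add: hom_module_simps)
  show "hom_map M g h \<in> carrier (hom_module B M Z)"
   unfolding hom_map_def by (rule hom_restrictI[OF hom_comp[OF h' g] lM])
  show "hom_map M g (a \<odot>\<^bsub>hom_module B M Y\<^esub> h) = a \<odot>\<^bsub>hom_module B M Z\<^esub> hom_map M g h"
   if "a \<in> carrier A" for a
   using that by (auto simp: hom_map_def hom_module_simps(4) intro!: restrict_ext)
  fix k assume "k \<in> carrier (hom_module B M Y)"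
  then have k': "k \<in> lmod_hom B M Y" by (simp add: hom_module_simps)
  show "hom_map M g (h \<oplus>\<^bsub>hom_module B M Y\<^esub> k) = hom_map M g h \<oplus>\<^bsub>hom_module B M Z\<^esub> hom_map M g k"
   using hom_closed[OF h'] hom_closed[OF k']
   by (auto simp: hom_map_def hom_module_simps(3) hom_add[OF g] intro!: restrict_ext)
 qed
qed

section \<open>Consequences of the equivalence\<close>

lemma equivalence_unit:
 fixes X :: "('a, 'a fg_carrier) module" and A :: "('a, 'p) ring_scheme"
 assumes E: "induces_equivalence A B M" and M: "bimodule B A M" and X: "fin_proj_dim A X"
 shows "tensor_pair A B M X" "fin_inj_dim B (tensor_module A M X)"
  "\<And>h. h \<in> lmod_hom B M (tensor_module A M X) \<Longrightarrow>
    \<exists>x \<in> carrier X. \<forall>m \<in> carrier M. h m = pure_tensor A M X m x"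
  "\<And>x. x \<in> carrier X \<Longrightarrow> (\<And>m. m \<in> carrier M \<Longrightarrow> pure_tensor A M X m x = \<zero>\<^bsub>tensor_module A M X\<^esub>) \<Longrightarrow>
    x = \<zero>\<^sub>X"
  "adj_unit A M X \<in> lmod_iso A X (hom_module B M (tensor_module A M X))"
proof -
 have lX: "left_module A X" using X by (simp add: fin_proj_dim_def fg_module_def)
 show t: "tensor_pair A B M X" using M lX by (simp add: tensor_pair_def)
 interpret t: tensor_pair A B M X by fact
 have lM: "left_module B M" by (rule t.M.L.left_module_axioms)
 show "fin_inj_dim B (tensor_module A M X)" using E X unfolding induces_equivalence_def by blast
 show u: "adj_unit A M X \<in> lmod_iso A X (hom_module B M (tensor_module A M X))"
  using E X unfolding induces_equivalence_def by blast
 show "\<exists>x \<in> carrier X. \<forall>m \<in> carrier M. h m = pure_tensor A M X m x"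
  if h: "h \<in> lmod_hom B M (tensor_module A M X)" for h
 proof -
  have "restrict h (carrier M) \<in> adj_unit A M X ` carrier X"
   using iso_surj[OF u] hom_restrictI[OF h lM] by simp
  then obtain x where "x \<in> carrier X" "restrict h (carrier M) = adj_unit A M X x" by blast
  then have "\<forall>m \<in> carrier M. h m = pure_tensor A M X m x"
   unfolding adj_unit_def by (metis restrict_apply')
  then show ?thesis using \<open>x \<in> carrier X\<close> by blast
 qed
 show "x = \<zero>\<^sub>X" if x: "x \<in> carrier X"
  and z: "\<And>m. m \<in> carrier M \<Longrightarrow> pure_tensor A M X m x = \<zero>\<^bsub>tensor_module A M X\<^esub>" for x
 proof -
  have "adj_unit A M X x = adj_unit A M X \<zero>\<^sub>X"
   unfolding adj_unit_def using z t.pt_zero by (intro restrict_ext) simp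
  then show ?thesis using iso_inj[OF u] x t.X.M.zero_closed by (auto dest: inj_onD)
 qed
qed

lemma equivalence_counit:
 fixes Y :: "('b, 'b fg_carrier) module" and B :: "('b, 'p) ring_scheme"
 assumes E: "induces_equivalence A B M" and M: "bimodule B A M" and Y: "fin_inj_dim B Y"
 shows "tensor_pair A B M (hom_module B M Y)" "fin_proj_dim A (hom_module B M Y)"
  "adj_counit Y \<in> lmod_iso B (tensor_module A M (hom_module B M Y)) Y"
  "\<And>U. submod B Y U \<Longrightarrow> (\<And>h m. h \<in> carrier (hom_module B M Y) \<Longrightarrow> m \<in> carrier M \<Longrightarrow> h m \<in> U) \<Longrightarrow>
    U = carrier Y"
proof -
 have lY: "left_module B Y" using Y by (simp add: fin_inj_dim_def fg_module_def)
 have lH: "left_module A (hom_module B M Y)" by (rule hom_module_left_module[OF M lY])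
 show t: "tensor_pair A B M (hom_module B M Y)" using M lH by (simp add: tensor_pair_def)
 interpret t: tensor_pair A B M "hom_module B M Y" by fact
 show "fin_proj_dim A (hom_module B M Y)" using E Y unfolding induces_equivalence_def by blast
 show u: "adj_counit Y \<in> lmod_iso B (tensor_module A M (hom_module B M Y)) Y"
  using E Y unfolding induces_equivalence_def by blast
 show "U = carrier Y" if U: "submod B Y U"
  "\<And>h m. h \<in> carrier (hom_module B M Y) \<Longrightarrow> m \<in> carrier M \<Longrightarrow> h m \<in> U" for U
 proof -
  have "{s \<in> carrier t.T. adj_counit Y s \<in> U} = carrier t.T"
   using U(2) adj_counit_pure[OF t lY]
   by (intro t.submod_T_total submod_vimage[OF t.T_left_module lY iso_hom[OF u] U(1)]) simp
  then have "adj_counit Y ` carrier t.T \<subseteq> U" by blast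
  then show ?thesis using iso_surj[OF u] submodD(1)[OF U(1)] by simp
 qed
qed

lemma hom_moduleD: "f \<in> carrier (hom_module B M Y) \<Longrightarrow> f \<in> lmod_hom B M Y"
 by (simp add: hom_module_simps)

lemma hom_left_exact:
 assumes M: "bimodule B A M" and s: "ses B Y' Y Y'' f g"
 shows "\<And>h. h \<in> carrier (hom_module B M Y') \<Longrightarrow> hom_map M f h = \<zero>\<^bsub>hom_module B M Y\<^esub> \<Longrightarrow> h = \<zero>\<^bsub>hom_module B M Y'\<^esub>"
  "\<And>h. h \<in> carrier (hom_module B M Y') \<Longrightarrow> hom_map M g (hom_map M f h) = \<zero>\<^bsub>hom_module B M Y''\<^esub>"
  "\<And>h. h \<in> carrier (hom_module B M Y) \<Longrightarrow> hom_map M g h = \<zero>\<^bsub>hom_module B M Y''\<^esub> \<Longrightarrow>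
   \<exists>k\<in>carrier (hom_module B M Y'). h = hom_map M f k"
proof -
 note s' = sesD[OF s]
 interpret M: bimodule B A M by (rule M)
 interpret H': left_module A "hom_module B M Y'" by (rule hom_module_left_module[OF M s'(1)])
 note D = hom_moduleD
 show "h = \<zero>\<^bsub>hom_module B M Y'\<^esub>"
  if h: "h \<in> carrier (hom_module B M Y')" "hom_map M f h = \<zero>\<^bsub>hom_module B M Y\<^esub>" for h
 proof (rule hom_module_ext[OF h(1) H'.M.zero_closed])
  fix m assume m: "m \<in> carrier M"
  have "f (h m) = \<zero>\<^sub>Y" using fun_cong[OF h(2), of m] m by (simp add: hom_map_def hom_module_simps)
  then have "h m = \<zero>\<^bsub>Y'\<^esub>" using hom_inj_iff[OF s'(1,2,4)] s'(5) hom_closed[OF D[OF h(1)] m] by blast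
  then show "h m = \<zero>\<^bsub>hom_module B M Y'\<^esub> m" using m by (simp add: hom_module_simps)
 qed
 show "hom_map M g (hom_map M f h) = \<zero>\<^bsub>hom_module B M Y''\<^esub>" if "h \<in> carrier (hom_module B M Y')" for h
  using s'(9) hom_closed[OF D[OF that]] by (auto simp: hom_map_def hom_module_simps(2) intro!: restrict_ext)
 fix h assume h: "h \<in> carrier (hom_module B M Y)" "hom_map M g h = \<zero>\<^bsub>hom_module B M Y''\<^esub>"
 note fi = iso_inverse[OF ses_embedding[OF s] s'(1)]
 have hm: "h m \<in> mod_kernel Y Y'' g" if "m \<in> carrier M" for m
  using fun_cong[OF h(2), of m] that hom_closed[OF D[OF h(1)] that]
  by (simp add: hom_map_def hom_module_simps mod_kernel_def)
 have hk: "h \<in> lmod_hom B M (sub Y (mod_kernel Y Y'' g))"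
  by (rule hom_into_sub[OF D[OF h(1)]]) (use hm in auto)
 let ?k = "restrict (\<lambda>m. inv_into (carrier Y') f (h m)) (carrier M)"
 have k: "?k \<in> carrier (hom_module B M Y')"
  by (rule hom_restrictI[OF hom_comp[OF hk iso_hom[OF fi(1)]] M.L.left_module_axioms])
 have "h = hom_map M f ?k"
  by (rule hom_module_ext[OF h(1) hom_closed[OF hom_map_hom[OF M s'(4)] k]])
   (use fi(3) hm in \<open>simp add: hom_map_def\<close>)
 then show "\<exists>k\<in>carrier (hom_module B M Y'). h = hom_map M f k" using k by blast
qed

lemma hom_ses:
 assumes M: "bimodule B A M" and s: "ses B Y' Y Y'' f g"
  and ex: "\<And>h. h \<in> carrier (hom_module B M Y'') \<Longrightarrow> \<exists>k \<in> carrier (hom_module B M Y). \<forall>m \<in> carrier M. g (k m) = h m"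
 shows "ses A (hom_module B M Y') (hom_module B M Y) (hom_module B M Y'') (hom_map M f) (hom_map M g)"
proof -
 note s' = sesD[OF s]
 note l = hom_module_left_module[OF M s'(1)] hom_module_left_module[OF M s'(2)] hom_module_left_module[OF M s'(3)]
 note gs = hom_map_hom[OF M s'(6)]
 show ?thesis
 proof (rule sesI[OF l hom_map_hom[OF M s'(4)] hom_left_exact(1)[OF M s] gs _ hom_left_exact(2,3)[OF M s]])
  fix h assume h: "h \<in> carrier (hom_module B M Y'')"
  obtain k where k: "k \<in> carrier (hom_module B M Y)" "\<forall>m \<in> carrier M. g (k m) = h m" using ex[OF h] by blast
  have "hom_map M g k = h"
   by (rule hom_module_ext[OF hom_closed[OF gs k(1)] h]) (use k(2) in \<open>simp add: hom_map_def\<close>)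
  then show "\<exists>k\<in>carrier (hom_module B M Y). hom_map M g k = h" using k(1) by blast
 qed
qed

lemma tensor_eval:
 assumes t: "tensor_pair A B M X" and Y: "left_module B Y" and c: "c \<in> lmod_hom A X (hom_module B M Y)"
 obtains h where "h \<in> lmod_hom B (tensor_module A M X) Y"
  "\<And>m x. m \<in> carrier M \<Longrightarrow> x \<in> carrier X \<Longrightarrow> h (pure_tensor A M X m x) = c x m"
proof -
 interpret t: tensor_pair A B M X by (rule t)
 have cM: "c x \<in> lmod_hom B M Y" if "x \<in> carrier X" for x
  using hom_closed[OF c that] by (simp add: hom_module_simps)
 show thesis
  by (rule t.tensor_lift[OF Y, of "\<lambda>m x. c x m"])
   (use hom_closed[OF cM] hom_add[OF cM] hom_smult[OF cM] hom_add[OF c] hom_smult[OF c] that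
    in \<open>simp_all add: hom_module_simps(3,4)\<close>)
qed

text \<open>
 Let \<open>C\<close> be the image of \<open>Hom(M, Y)\<close> in \<open>Hom(M, Y'')\<close>. As a cokernel of modules of finite projective
 dimension it has finite projective dimension, and \<open>M \<otimes> C\<close> is the cokernel of
 \<open>M \<otimes> Hom(M, Y') \<rightarrow> M \<otimes> Hom(M, Y)\<close>, that is of \<open>Y' \<rightarrow> Y\<close>, so it is \<open>Y''\<close>. Hence
 \<open>C = Hom(M, M \<otimes> C) = Hom(M, Y'')\<close>.
\<close>

lemma equivalence_hom_exact:
 fixes Y' Y Y'' :: "('b, 'b fg_carrier) module" and B :: "('b, 'p) ring_scheme"
  and A :: "('a, 'q) ring_scheme"
 assumes E: "induces_equivalence A B M" and M: "bimodule B A M"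
  and s: "ses B Y' Y Y'' f g" and fin: "fin_inj_dim B Y'" "fin_inj_dim B Y" "fin_inj_dim B Y''"
  and h: "h \<in> lmod_hom B M Y''"
 obtains k where "k \<in> carrier (hom_module B M Y)" "\<And>m. m \<in> carrier M \<Longrightarrow> g (k m) = h m"
proof -
 note s' = sesD[OF s]
 interpret M: bimodule B A M by fact
 have lM: "left_module B M" by (rule M.L.left_module_axioms)
 interpret Y': left_module B Y' by (rule s'(1))
 interpret Y'': left_module B Y'' by (rule s'(3))
 let ?H' = "hom_module B M Y'" and ?H = "hom_module B M Y" and ?H'' = "hom_module B M Y''"
 note e' = equivalence_counit[OF E M fin(1)] and e = equivalence_counit[OF E M fin(2)]
 note l = hom_module_left_module[OF M s'(1)] hom_module_left_module[OF M s'(2)]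
  hom_module_left_module[OF M s'(3)]
 interpret t': tensor_pair A B M ?H' by (rule e'(1))
 interpret t: tensor_pair A B M ?H by (rule e(1))
 interpret H'': left_module A ?H'' by (rule l(3))
 note fs = hom_map_hom[OF M s'(4)] and gs = hom_map_hom[OF M s'(6)]
 define C where "C = hom_map M g ` carrier ?H"
 have C: "submod A ?H'' C"
  unfolding C_def by (rule submod_image[OF l(2,3) gs left_module.submod_carrier[OF l(2)]])
 have lC: "left_module A (sub ?H'' C)" using C by (rule H''.submod_left_module)
 have gC: "hom_map M g \<in> lmod_hom A ?H (sub ?H'' C)" unfolding C_def by (rule hom_into_sub[OF gs order_refl])
 have "ses A ?H' ?H (sub ?H'' C) (hom_map M f) (hom_map M g)"
  by (rule sesI[OF l(1,2) lC fs hom_left_exact(1)[OF M s] gC]) (use hom_left_exact(2,3)[OF M s] in \<open>auto simp: C_def\<close>)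
 moreover obtain n where "pd_lt A n ?H'" using e'(2) by (auto simp: fin_proj_dim_iff)
 moreover obtain m where "pd_lt A m ?H" using e(2) by (auto simp: fin_proj_dim_iff)
 ultimately obtain j where j: "pd_lt A j (sub ?H'' C)" using pd_cokernel by blast
 obtain X :: "('a, 'a fg_carrier) module" and c where c: "fg_module A X" "c \<in> lmod_iso A (sub ?H'' C) X"
  using fg_module_copy[of A "sub ?H'' C"] lC pd_lt_fg[OF lC j] unfolding fg_module_def by blast
 have lX: "left_module A X" using c by (simp add: fg_module_def)
 have "fin_proj_dim A X" using c(1) pd_lt_iso[OF lC lX c(2) j] by (auto simp: fin_proj_dim_iff)
 note u = equivalence_unit[OF E M this]
 interpret X: tensor_pair A B M X by (rule u(1))
 define ci where "ci = inv_into (carrier (sub ?H'' C)) c"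
 note ci = iso_inverse[OF c(2) lC, folded ci_def]
 have ciH: "ci \<in> lmod_hom A X ?H''" by (rule hom_from_sub[OF iso_hom[OF ci(1)] submodD(1)[OF C]])
 obtain \<epsilon> where \<epsilon>: "\<epsilon> \<in> lmod_hom B X.T Y''" "\<And>m z. m \<in> carrier M \<Longrightarrow> z \<in> carrier X \<Longrightarrow> \<epsilon> (X.pt m z) = ci z m"
  by (rule tensor_eval[OF u(1) s'(3) ciH]) (rule that)
 have cg: "(\<lambda>x. c (hom_map M g x)) \<in> lmod_hom A ?H X" by (rule hom_comp[OF gC iso_hom[OF c(2)]])
 have cicg: "ci (c (hom_map M g x)) = hom_map M g x" if "x \<in> carrier ?H" for x
  using ci(2)[of "hom_map M g x"] that by (simp add: C_def)
 obtain q where q: "q \<in> lmod_hom B t.T X.T"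
  "\<And>m x. m \<in> carrier M \<Longrightarrow> x \<in> carrier ?H \<Longrightarrow> q (t.pt m x) = X.pt m (c (hom_map M g x))"
  using tensor_map[OF e(1) u(1) cg] by blast
 obtain p where p: "p \<in> lmod_hom B t'.T t.T"
  "\<And>m x. m \<in> carrier M \<Longrightarrow> x \<in> carrier ?H' \<Longrightarrow> p (t'.pt m x) = t.pt m (hom_map M f x)"
  using tensor_map[OF e'(1) e(1) fs] by blast
 note ac = adj_counit_pure[OF e(1) s'(2)] and ac' = adj_counit_pure[OF e'(1) s'(1)]
 note k = e(3) and k' = e'(3)
 have 1: "\<epsilon> (q x) = g (adj_counit Y x)" if "x \<in> carrier t.T" for x
 proof (rule t.tensor_hom_eq[OF s'(3) hom_comp[OF q(1) \<epsilon>(1)] hom_comp[OF iso_hom[OF k] s'(6)] _ that])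
  fix m x assume "m \<in> carrier M" "x \<in> carrier ?H"
  then show "\<epsilon> (q (t.pt m x)) = g (adj_counit Y (t.pt m x))"
   using hom_closed[OF cg] by (simp add: q(2) \<epsilon>(2) ac cicg hom_map_apply)
 qed
 have 2: "adj_counit Y (p x) = f (adj_counit Y' x)" if "x \<in> carrier t'.T" for x
 proof (rule t'.tensor_hom_eq[OF s'(2) hom_comp[OF p(1) iso_hom[OF k]] hom_comp[OF iso_hom[OF k'] s'(4)] _ that])
  fix m x assume "m \<in> carrier M" "x \<in> carrier ?H'"
  then show "adj_counit Y (p (t'.pt m x)) = f (adj_counit Y' (t'.pt m x))"
   using hom_closed[OF fs] by (simp add: p(2) ac ac' hom_map_apply)
 qed
 interpret XT: left_module B X.T by (rule X.T_left_module)
 have 3: "q (p x) = \<zero>\<^bsub>X.T\<^esub>" if "x \<in> carrier t'.T" for x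
 proof (rule t'.tensor_hom_eq[OF X.T_left_module hom_comp[OF p(1) q(1)] _ _ that])
  show "(\<lambda>_. \<zero>\<^bsub>X.T\<^esub>) \<in> lmod_hom B t'.T X.T" by (auto simp: lmod_hom_def)
  fix m x assume a: "m \<in> carrier M" "x \<in> carrier ?H'"
  have "hom_map M g (hom_map M f x) = \<zero>\<^bsub>sub ?H'' C\<^esub>" using hom_left_exact(2)[OF M s a(2)] by simp
  then show "q (p (t'.pt m x)) = \<zero>\<^bsub>X.T\<^esub>"
   using a hom_closed[OF fs] hom_zero[OF lC lX iso_hom[OF c(2)]] by (simp add: p(2) q(2) X.pt_zero)
 qed
 have qs: "q ` carrier t.T = carrier X.T"
 proof (rule X.submod_T_total[OF submod_image[OF t.T_left_module X.T_left_module q(1) left_module.submod_carrier[OF t.T_left_module]]])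
  fix m z assume a: "m \<in> carrier M" "z \<in> carrier X"
  have "ci z \<in> C" using hom_closed[OF iso_hom[OF ci(1)] a(2)] by simp
  then obtain x where x: "x \<in> carrier ?H" "ci z = hom_map M g x" unfolding C_def by blast
  then have "X.pt m z = q (t.pt m x)" using a ci(3)[OF a(2)] by (simp add: q(2))
  moreover have "t.pt m x \<in> carrier t.T" using a x by simp
  ultimately show "X.pt m z \<in> q ` carrier t.T" by simp
 qed
 \<comment> \<open>An element of \<open>M \<otimes> Hom(M, Y)\<close> that vanishes in \<open>Y''\<close> comes from \<open>Y'\<close>, hence from \<open>M \<otimes> Hom(M, Y')\<close>.\<close>
 have \<epsilon>i: "inj_on \<epsilon> (carrier X.T)"
  unfolding hom_inj_iff[OF X.T_left_module s'(3) \<epsilon>(1)]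
 proof (intro ballI impI)
  fix w assume w: "w \<in> carrier X.T" "\<epsilon> w = \<zero>\<^bsub>Y''\<^esub>"
  obtain x where x: "x \<in> carrier t.T" "w = q x" using w(1) qs by blast
  have "g (adj_counit Y x) = \<zero>\<^bsub>Y''\<^esub>" using 1[OF x(1)] w x by simp
  then obtain y where y: "y \<in> carrier Y'" "adj_counit Y x = f y"
   using s'(10) hom_closed[OF iso_hom[OF k] x(1)] by blast
  obtain x' where x': "x' \<in> carrier t'.T" "y = adj_counit Y' x'" using y(1) iso_surj[OF k'] by blast
  have "adj_counit Y (p x') = adj_counit Y x" using 2[OF x'(1)] x' y by simp
  then have "p x' = x" using iso_inj[OF k] hom_closed[OF p(1) x'(1)] x(1) by (auto dest: inj_onD)
  then show "w = \<zero>\<^bsub>X.T\<^esub>" using 3[OF x'(1)] x by simp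
 qed
 \<comment> \<open>\<open>Y\<close> is generated by the values of the homomorphisms from \<open>M\<close>.\<close>
 have \<epsilon>s: "\<epsilon> ` carrier X.T = carrier Y''"
 proof -
  have sm: "submod B Y'' (\<epsilon> ` carrier X.T)"
   by (rule submod_image[OF X.T_left_module s'(3) \<epsilon>(1) left_module.submod_carrier[OF X.T_left_module]])
  have tot: "{y \<in> carrier Y. g y \<in> \<epsilon> ` carrier X.T} = carrier Y"
  proof (rule e(4)[OF submod_vimage[OF s'(2,3,6) sm]])
   fix x m assume a: "x \<in> carrier ?H" "m \<in> carrier M"
   have "g (x m) = \<epsilon> (X.pt m (c (hom_map M g x)))"
    using a hom_closed[OF cg a(1)] by (simp add: \<epsilon>(2) cicg hom_map_apply)
   moreover have "X.pt m (c (hom_map M g x)) \<in> carrier X.T" using a hom_closed[OF cg a(1)] by simp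
   ultimately have "g (x m) \<in> \<epsilon> ` carrier X.T" by simp
   then show "x m \<in> {y \<in> carrier Y. g y \<in> \<epsilon> ` carrier X.T}"
    using hom_closed[OF hom_moduleD[OF a(1)] a(2)] by simp
  qed
  have "z \<in> \<epsilon> ` carrier X.T" if z: "z \<in> carrier Y''" for z
  proof -
   obtain y where "y \<in> carrier Y" "g y = z" using s'(11)[OF z] by blast
   then show ?thesis using tot by blast
  qed
  then show ?thesis using submodD(1)[OF sm] by blast
 qed
 have "\<epsilon> \<in> lmod_iso B X.T Y''" using \<epsilon>(1) \<epsilon>i \<epsilon>s by (rule isoI)
 note ei = iso_inverse[OF this X.T_left_module]
 obtain z where z: "z \<in> carrier X" "\<forall>m\<in>carrier M. inv_into (carrier X.T) \<epsilon> (h m) = X.pt m z"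
  using u(3)[OF hom_comp[OF h iso_hom[OF ei(1)]]] by blast
 have "ci z \<in> C" using hom_closed[OF iso_hom[OF ci(1)] z(1)] by simp
 then obtain x where x: "x \<in> carrier ?H" "ci z = hom_map M g x" unfolding C_def by blast
 have "g (x m) = h m" if m: "m \<in> carrier M" for m
 proof -
  have "h m = \<epsilon> (X.pt m z)" using z(2) ei(3)[OF hom_closed[OF h m]] m by simp
  then show ?thesis using \<epsilon>(2)[OF m z(1)] x(2) m by (simp add: hom_map_apply)
 qed
 then show ?thesis using that x(1) by blast
qed

section \<open>Morita rings and coinduced modules\<close>

definition corner :: "('s, 'p) ring_scheme \<Rightarrow> ('s \<Rightarrow> 'r) \<Rightarrow> ('r, 'x, 'q) module_scheme \<Rightarrow> ('s, 'x) module"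
 where "corner S \<iota> X = \<lparr>carrier = {x \<in> carrier X. \<iota> \<one>\<^sub>S \<odot>\<^sub>X x = x}, mult = undefined, one = undefined,
   zero = \<zero>\<^sub>X, add = add X, smult = (\<lambda>s x. \<iota> s \<odot>\<^sub>X x)\<rparr>"

lemma corner_simps [simp]:
 "x \<in> carrier (corner S \<iota> X) \<longleftrightarrow> x \<in> carrier X \<and> \<iota> \<one>\<^sub>S \<odot>\<^sub>X x = x" "\<zero>\<^bsub>corner S \<iota> X\<^esub> = \<zero>\<^sub>X"
 "x \<oplus>\<^bsub>corner S \<iota> X\<^esub> y = x \<oplus>\<^sub>X y" "s \<odot>\<^bsub>corner S \<iota> X\<^esub> x = \<iota> s \<odot>\<^sub>X x"
 by (simp_all add: corner_def)

lemma corner_left_module: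
 assumes X: "left_module R X" and S: "ring S"
  and c: "\<And>s. s \<in> carrier S \<Longrightarrow> \<iota> s \<in> carrier R"
  and a: "\<And>s t. s \<in> carrier S \<Longrightarrow> t \<in> carrier S \<Longrightarrow> \<iota> (s \<oplus>\<^sub>S t) = \<iota> s \<oplus>\<^sub>R \<iota> t"
  and m: "\<And>s t. s \<in> carrier S \<Longrightarrow> t \<in> carrier S \<Longrightarrow> \<iota> (s \<otimes>\<^sub>S t) = \<iota> s \<otimes>\<^sub>R \<iota> t"
 shows "left_module S (corner S \<iota> X)"
proof -
 interpret X: left_module R X by fact
 interpret S: ring S by fact
 have 0: "\<iota> \<zero>\<^sub>S = \<zero>\<^sub>R" using a[of "\<zero>\<^sub>S" "\<zero>\<^sub>S"] c[of "\<zero>\<^sub>S"] by (simp add: X.R.add.r_cancel_one')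
 have 1: "\<iota> \<one>\<^sub>S \<odot>\<^sub>X (\<iota> s \<odot>\<^sub>X x) = \<iota> s \<odot>\<^sub>X x" if "s \<in> carrier S" "x \<in> carrier X" for s x
  using that c m[of "\<one>\<^sub>S" s] by (simp add: X.smult_assoc1[symmetric])
 show ?thesis
  by (rule left_moduleI[OF S]) (auto simp: 0 1 a m c X.M.a_ac X.smult_l_distr X.smult_r_distr X.smult_assoc1)
qed

lemma corner_hom:
 assumes "h \<in> lmod_hom R X Y" "\<And>s. s \<in> carrier S \<Longrightarrow> \<iota> s \<in> carrier R" "ring S"
 shows "h \<in> lmod_hom S (corner S \<iota> X) (corner S \<iota> Y)"
proof -
 interpret S: ring S by fact
 show ?thesis
 proof (rule lmod_homI)
  fix x assume x: "x \<in> carrier (corner S \<iota> X)"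
  have "\<iota> \<one>\<^sub>S \<odot>\<^sub>Y h x = h x" using x assms(2) hom_smult[OF assms(1), of "\<iota> \<one>\<^sub>S" x] by simp
  then show "h x \<in> carrier (corner S \<iota> Y)" using x hom_closed[OF assms(1)] by simp
 qed (use assms in \<open>auto simp: hom_add[OF assms(1)] hom_smult[OF assms(1)]\<close>)
qed

lemma reg_projective:
 assumes "ring R" shows "projective_module R (reg R)"
 unfolding projective_module_def
proof (intro conjI reg_left_module assms allI impI; elim conjE)
 interpret R: ring R by fact
 fix X Y :: "('a, 'a fg_carrier) module" and g f
 assume a: "left_module R X" "left_module R Y" "g \<in> lmod_hom R X Y" "g ` carrier X = carrier Y"
  "f \<in> lmod_hom R (reg R) Y"
 have "f \<one>\<^sub>R \<in> g ` carrier X" using hom_closed[OF a(5)] a(4) by simp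
 then obtain x where x: "x \<in> carrier X" "g x = f \<one>\<^sub>R" by auto
 have "g (r \<odot>\<^sub>X x) = f r" if "r \<in> carrier R" for r
  using hom_smult[OF a(3) that x(1)] hom_smult[OF a(5) that, of "\<one>\<^sub>R"] x(2) that by simp
 then show "\<exists>h\<in>lmod_hom R (reg R) X. \<forall>p\<in>carrier (reg R). g (h p) = f p"
  by (intro bexI[OF _ hom_from_reg[OF a(1) x(1)]]) simp
qed

text \<open>
 The ring \<open>L\<close> is only required to be a copy of the Morita ring, through the coordinates \<open>mat\<close>.
 This makes the situation symmetric: interchanging \<open>A\<close> and \<open>B\<close> and reordering the
 coordinates gives a second instance with the same ring \<open>L\<close>.
\<close>

locale morita_matrix =
 A: ring A + B: ring B + L: ring L + N: bimodule A B N + M: bimodule B A M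
 for A :: "'a ring" and B :: "'b ring"
  and N :: "('a, 'n, 'b, 's) bimodule_scheme" and M :: "('b, 'm, 'a, 't) bimodule_scheme"
  and L :: "'l ring" +
 fixes mn :: "'m \<Rightarrow> 'n \<Rightarrow> 'b" and nm :: "'n \<Rightarrow> 'm \<Rightarrow> 'a"
  and mat :: "'a \<Rightarrow> 'n \<Rightarrow> 'm \<Rightarrow> 'b \<Rightarrow> 'l"
  and \<alpha> :: "'l \<Rightarrow> 'a" and \<nu> :: "'l \<Rightarrow> 'n" and \<mu> :: "'l \<Rightarrow> 'm" and \<beta> :: "'l \<Rightarrow> 'b"
 assumes mn_closed [simp]: "\<lbrakk>m \<in> carrier M; n \<in> carrier N\<rbrakk> \<Longrightarrow> mn m n \<in> carrier B"
  and nm_closed [simp]: "\<lbrakk>m \<in> carrier M; n \<in> carrier N\<rbrakk> \<Longrightarrow> nm n m \<in> carrier A"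
  and mn_add_l: "\<lbrakk>m \<in> carrier M; m' \<in> carrier M; n \<in> carrier N\<rbrakk> \<Longrightarrow> mn (m \<oplus>\<^sub>M m') n = mn m n \<oplus>\<^sub>B mn m' n"
  and mn_add_r: "\<lbrakk>m \<in> carrier M; n \<in> carrier N; n' \<in> carrier N\<rbrakk> \<Longrightarrow> mn m (n \<oplus>\<^sub>N n') = mn m n \<oplus>\<^sub>B mn m n'"
  and nm_add_l: "\<lbrakk>m \<in> carrier M; n \<in> carrier N; n' \<in> carrier N\<rbrakk> \<Longrightarrow> nm (n \<oplus>\<^sub>N n') m = nm n m \<oplus>\<^sub>A nm n' m"
  and nm_add_r: "\<lbrakk>m \<in> carrier M; m' \<in> carrier M; n \<in> carrier N\<rbrakk> \<Longrightarrow> nm n (m \<oplus>\<^sub>M m') = nm n m \<oplus>\<^sub>A nm n m'"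
  and mn_smult: "\<lbrakk>b \<in> carrier B; m \<in> carrier M; n \<in> carrier N\<rbrakk> \<Longrightarrow> mn (b \<odot>\<^sub>M m) n = b \<otimes>\<^sub>B mn m n"
  and nm_smult: "\<lbrakk>a \<in> carrier A; m \<in> carrier M; n \<in> carrier N\<rbrakk> \<Longrightarrow> nm (a \<odot>\<^sub>N n) m = a \<otimes>\<^sub>A nm n m"
  and mn_rsmult: "\<lbrakk>b \<in> carrier B; m \<in> carrier M; n \<in> carrier N\<rbrakk> \<Longrightarrow> mn m (n \<triangleleft>\<^sub>N b) = mn m n \<otimes>\<^sub>B b"
  and nm_rsmult: "\<lbrakk>a \<in> carrier A; m \<in> carrier M; n \<in> carrier N\<rbrakk> \<Longrightarrow> nm n (m \<triangleleft>\<^sub>M a) = nm n m \<otimes>\<^sub>A a"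
  and mn_balanced: "\<lbrakk>a \<in> carrier A; m \<in> carrier M; n \<in> carrier N\<rbrakk> \<Longrightarrow> mn (m \<triangleleft>\<^sub>M a) n = mn m (a \<odot>\<^sub>N n)"
  and nm_balanced: "\<lbrakk>b \<in> carrier B; m \<in> carrier M; n \<in> carrier N\<rbrakk> \<Longrightarrow> nm (n \<triangleleft>\<^sub>N b) m = nm n (b \<odot>\<^sub>M m)"
  and mn_nm: "\<lbrakk>m \<in> carrier M; n \<in> carrier N; m' \<in> carrier M\<rbrakk> \<Longrightarrow> mn m n \<odot>\<^sub>M m' = m \<triangleleft>\<^sub>M nm n m'"
  and nm_mn: "\<lbrakk>n \<in> carrier N; m \<in> carrier M; n' \<in> carrier N\<rbrakk> \<Longrightarrow> nm n m \<odot>\<^sub>N n' = n \<triangleleft>\<^sub>N mn m n'"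
  and mat_closed [simp]: "\<lbrakk>a \<in> carrier A; n \<in> carrier N; m \<in> carrier M; b \<in> carrier B\<rbrakk> \<Longrightarrow> mat a n m b \<in> carrier L"
  and proj_mat [simp]: "\<lbrakk>a \<in> carrier A; n \<in> carrier N; m \<in> carrier M; b \<in> carrier B\<rbrakk> \<Longrightarrow>
    \<alpha> (mat a n m b) = a \<and> \<nu> (mat a n m b) = n \<and> \<mu> (mat a n m b) = m \<and> \<beta> (mat a n m b) = b"
  and mat_exists: "l \<in> carrier L \<Longrightarrow>
    \<exists>a\<in>carrier A. \<exists>n\<in>carrier N. \<exists>m\<in>carrier M. \<exists>b\<in>carrier B. l = mat a n m b"
  and mat_add: "\<lbrakk>a \<in> carrier A; n \<in> carrier N; m \<in> carrier M; b \<in> carrier B;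
    a' \<in> carrier A; n' \<in> carrier N; m' \<in> carrier M; b' \<in> carrier B\<rbrakk> \<Longrightarrow>
    mat a n m b \<oplus>\<^sub>L mat a' n' m' b' = mat (a \<oplus>\<^sub>A a') (n \<oplus>\<^sub>N n') (m \<oplus>\<^sub>M m') (b \<oplus>\<^sub>B b')"
  and mat_mult: "\<lbrakk>a \<in> carrier A; n \<in> carrier N; m \<in> carrier M; b \<in> carrier B;
    a' \<in> carrier A; n' \<in> carrier N; m' \<in> carrier M; b' \<in> carrier B\<rbrakk> \<Longrightarrow>
    mat a n m b \<otimes>\<^sub>L mat a' n' m' b' =
    mat (a \<otimes>\<^sub>A a' \<oplus>\<^sub>A nm n m') (a \<odot>\<^sub>N n' \<oplus>\<^sub>N n \<triangleleft>\<^sub>N b')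
     (m \<triangleleft>\<^sub>M a' \<oplus>\<^sub>M b \<odot>\<^sub>M m') (b \<otimes>\<^sub>B b' \<oplus>\<^sub>B mn m n')"
  and mat_one: "\<one>\<^sub>L = mat \<one>\<^sub>A \<zero>\<^sub>N \<zero>\<^sub>M \<one>\<^sub>B"
  and mat_zero: "\<zero>\<^sub>L = mat \<zero>\<^sub>A \<zero>\<^sub>N \<zero>\<^sub>M \<zero>\<^sub>B"
begin

lemma matE:
 assumes "l \<in> carrier L"
 obtains a n m b where "a \<in> carrier A" "n \<in> carrier N" "m \<in> carrier M" "b \<in> carrier B" "l = mat a n m b"
 using mat_exists[OF assms] by blast

lemma bimodule_M: "bimodule B A M" and bimodule_N: "bimodule A B N"
 and left_module_M: "left_module B M" and ring_A: "ring A" and ring_B: "ring B" and ring_L: "ring L"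
 by (rule M.bimodule_axioms N.bimodule_axioms M.L.left_module_axioms A.ring_axioms B.ring_axioms
   L.ring_axioms)+

lemma pairing_zero [simp]:
 "m \<in> carrier M \<Longrightarrow> mn m \<zero>\<^sub>N = \<zero>\<^sub>B" "n \<in> carrier N \<Longrightarrow> mn \<zero>\<^sub>M n = \<zero>\<^sub>B"
 "n \<in> carrier N \<Longrightarrow> nm n \<zero>\<^sub>M = \<zero>\<^sub>A" "m \<in> carrier M \<Longrightarrow> nm \<zero>\<^sub>N m = \<zero>\<^sub>A"
proof -
 have b: "x = \<zero>\<^sub>B" if "x \<in> carrier B" "x = x \<oplus>\<^sub>B x" for x
  using that by (metis B.add.r_cancel_one')
 have a: "x = \<zero>\<^sub>A" if "x \<in> carrier A" "x = x \<oplus>\<^sub>A x" for x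
  using that by (metis A.add.r_cancel_one')
 show "m \<in> carrier M \<Longrightarrow> mn m \<zero>\<^sub>N = \<zero>\<^sub>B" using mn_add_r[of m "\<zero>\<^sub>N" "\<zero>\<^sub>N"] by (intro b) simp_all
 show "n \<in> carrier N \<Longrightarrow> mn \<zero>\<^sub>M n = \<zero>\<^sub>B" using mn_add_l[of "\<zero>\<^sub>M" "\<zero>\<^sub>M" n] by (intro b) simp_all
 show "n \<in> carrier N \<Longrightarrow> nm n \<zero>\<^sub>M = \<zero>\<^sub>A" using nm_add_r[of "\<zero>\<^sub>M" "\<zero>\<^sub>M" n] by (intro a) simp_all
 show "m \<in> carrier M \<Longrightarrow> nm \<zero>\<^sub>N m = \<zero>\<^sub>A" using nm_add_l[of m "\<zero>\<^sub>N" "\<zero>\<^sub>N"] by (intro a) simp_all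
qed

lemma rsmult_zero [simp]:
 "m \<in> carrier M \<Longrightarrow> m \<triangleleft>\<^sub>M \<zero>\<^sub>A = \<zero>\<^sub>M" "n \<in> carrier N \<Longrightarrow> n \<triangleleft>\<^sub>N \<zero>\<^sub>B = \<zero>\<^sub>N"
 "a \<in> carrier A \<Longrightarrow> \<zero>\<^sub>M \<triangleleft>\<^sub>M a = \<zero>\<^sub>M" "b \<in> carrier B \<Longrightarrow> \<zero>\<^sub>N \<triangleleft>\<^sub>N b = \<zero>\<^sub>N"
proof -
 have m: "x = \<zero>\<^sub>M" if "x \<in> carrier M" "x = x \<oplus>\<^sub>M x" for x
  using that by (metis M.L.M.add.r_cancel_one')
 have n: "x = \<zero>\<^sub>N" if "x \<in> carrier N" "x = x \<oplus>\<^sub>N x" for x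
  using that by (metis N.L.M.add.r_cancel_one')
 show "m \<in> carrier M \<Longrightarrow> m \<triangleleft>\<^sub>M \<zero>\<^sub>A = \<zero>\<^sub>M"
  using M.rsmult_r_distr[of m "\<zero>\<^sub>A" "\<zero>\<^sub>A"] by (intro m) simp_all
 show "n \<in> carrier N \<Longrightarrow> n \<triangleleft>\<^sub>N \<zero>\<^sub>B = \<zero>\<^sub>N"
  using N.rsmult_r_distr[of n "\<zero>\<^sub>B" "\<zero>\<^sub>B"] by (intro n) simp_all
 show "a \<in> carrier A \<Longrightarrow> \<zero>\<^sub>M \<triangleleft>\<^sub>M a = \<zero>\<^sub>M"
  using M.rsmult_l_distr[of "\<zero>\<^sub>M" "\<zero>\<^sub>M" a] by (intro m) simp_all
 show "b \<in> carrier B \<Longrightarrow> \<zero>\<^sub>N \<triangleleft>\<^sub>N b = \<zero>\<^sub>N"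
  using N.rsmult_l_distr[of "\<zero>\<^sub>N" "\<zero>\<^sub>N" b] by (intro n) simp_all
qed

abbreviation "eA a \<equiv> mat a \<zero>\<^sub>N \<zero>\<^sub>M \<zero>\<^sub>B"
abbreviation "eB b \<equiv> mat \<zero>\<^sub>A \<zero>\<^sub>N \<zero>\<^sub>M b"
abbreviation "eM m \<equiv> mat \<zero>\<^sub>A \<zero>\<^sub>N m \<zero>\<^sub>B"
abbreviation "eN n \<equiv> mat \<zero>\<^sub>A n \<zero>\<^sub>M \<zero>\<^sub>B"

lemma corner_A: "left_module L X \<Longrightarrow> left_module A (corner A eA X)"
 by (rule corner_left_module[where R = L, OF _ ring_A]) (simp_all add: mat_add mat_mult)

lemma corner_B: "left_module L X \<Longrightarrow> left_module B (corner B eB X)"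
 by (rule corner_left_module[where R = L, OF _ ring_B]) (simp_all add: mat_add mat_mult)

text \<open>
 This is \<open>Hom\<^sub>B(e L, Y)\<close> for the idempotent \<open>e = eB 1\<close>, written through \<open>e L = M \<oplus> B\<close> and \<open>Hom\<^sub>B(B, Y) = Y\<close>.
\<close>

definition cind :: "('b, 'y, 'z) module_scheme \<Rightarrow> ('l, ('m \<Rightarrow> 'y) \<times> 'y) module"
 where "cind Y = \<lparr>carrier = carrier (hom_module B M Y) \<times> carrier Y, mult = undefined, one = undefined,
  zero = (\<zero>\<^bsub>hom_module B M Y\<^esub>, \<zero>\<^sub>Y),
  add = (\<lambda>p q. (fst p \<oplus>\<^bsub>hom_module B M Y\<^esub> fst q, snd p \<oplus>\<^sub>Y snd q)),
  smult = (\<lambda>l p. (\<lambda>m \<in> carrier M. fst p (m \<triangleleft>\<^sub>M \<alpha> l) \<oplus>\<^sub>Y mn m (\<nu> l) \<odot>\<^sub>Y snd p,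
   fst p (\<mu> l) \<oplus>\<^sub>Y \<beta> l \<odot>\<^sub>Y snd p))\<rparr>"

lemma cind_simps:
 "carrier (cind Y) = carrier (hom_module B M Y) \<times> carrier Y" "\<zero>\<^bsub>cind Y\<^esub> = (\<zero>\<^bsub>hom_module B M Y\<^esub>, \<zero>\<^sub>Y)"
 "(h, y) \<oplus>\<^bsub>cind Y\<^esub> (k, z) = (h \<oplus>\<^bsub>hom_module B M Y\<^esub> k, y \<oplus>\<^sub>Y z)"
 by (simp_all add: cind_def)

lemma cind_smult:
 "\<lbrakk>a \<in> carrier A; n \<in> carrier N; m \<in> carrier M; b \<in> carrier B\<rbrakk> \<Longrightarrow> mat a n m b \<odot>\<^bsub>cind Y\<^esub> (h, y) =
   (\<lambda>m' \<in> carrier M. h (m' \<triangleleft>\<^sub>M a) \<oplus>\<^sub>Y mn m' n \<odot>\<^sub>Y y, h m \<oplus>\<^sub>Y b \<odot>\<^sub>Y y)"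
 by (simp add: cind_def)

lemma pairing_hom:
 assumes "left_module B Y" "y \<in> carrier Y" "n \<in> carrier N"
 shows "(\<lambda>m. mn m n \<odot>\<^sub>Y y) \<in> lmod_hom B M Y"
proof -
 interpret Y: left_module B Y by fact
 show ?thesis using assms(2,3)
  by (intro lmod_homI) (simp_all add: mn_add_l mn_smult Y.smult_l_distr Y.smult_assoc1)
qed

lemma rsmult_hom:
 assumes h: "h \<in> lmod_hom B M Y" and a: "a \<in> carrier A"
 shows "(\<lambda>m. h (m \<triangleleft>\<^sub>M a)) \<in> lmod_hom B M Y"
 using a hom_closed[OF h]
 by (intro lmod_homI) (simp_all add: M.rsmult_l_distr M.smult_rsmult_assoc hom_add[OF h] hom_smult[OF h])

lemma cind_left_module:
 assumes Y: "left_module B Y" shows "left_module L (cind Y)"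
proof -
 interpret Y: left_module B Y by fact
 let ?H = "hom_module B M Y"
 interpret H: left_module A ?H by (rule hom_module_left_module[OF bimodule_M Y])
 have D: "h \<in> lmod_hom B M Y" "h \<in> extensional (carrier M)" if "h \<in> carrier ?H" for h
  using that by (auto simp: hom_module_simps)
 note c = hom_closed[OF D(1)] and hs = hom_smult[OF D(1)] and ha = hom_add[OF D(1)]
 have h0: "h \<zero>\<^sub>M = \<zero>\<^sub>Y" if "h \<in> carrier ?H" for h by (rule hom_zero[OF left_module_M Y D(1)[OF that]])
 show ?thesis
 proof (rule left_moduleI[OF ring_L])
  fix p assume "p \<in> carrier (cind Y)"
  then obtain h y where p: "p = (h, y)" "h \<in> carrier ?H" "y \<in> carrier Y" by (auto simp: cind_simps)
  show "\<zero>\<^bsub>cind Y\<^esub> \<oplus>\<^bsub>cind Y\<^esub> p = p" using p by (simp add: cind_simps)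
  show "\<one>\<^sub>L \<odot>\<^bsub>cind Y\<^esub> p = p"
   using p c[OF p(2)] h0[OF p(2)] extensional_restrict[OF D(2)[OF p(2)]] by (simp add: mat_one cind_smult cong: restrict_cong)
  show "\<zero>\<^sub>L \<odot>\<^bsub>cind Y\<^esub> p = \<zero>\<^bsub>cind Y\<^esub>"
   using p c[OF p(2)] h0[OF p(2)] by (simp add: mat_zero cind_smult cind_simps hom_module_simps(2) cong: restrict_cong)
  { fix q assume "q \<in> carrier (cind Y)"
   then obtain k z where q: "q = (k, z)" "k \<in> carrier ?H" "z \<in> carrier Y" by (auto simp: cind_simps)
   show "p \<oplus>\<^bsub>cind Y\<^esub> q \<in> carrier (cind Y)" using p q by (simp add: cind_simps)
   show "p \<oplus>\<^bsub>cind Y\<^esub> q = q \<oplus>\<^bsub>cind Y\<^esub> p" using p q by (simp add: cind_simps H.M.a_comm Y.M.a_comm)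
   { fix r assume "r \<in> carrier (cind Y)"
    then show "p \<oplus>\<^bsub>cind Y\<^esub> q \<oplus>\<^bsub>cind Y\<^esub> r = p \<oplus>\<^bsub>cind Y\<^esub> (q \<oplus>\<^bsub>cind Y\<^esub> r)"
     using p q by (auto simp: cind_simps H.M.a_assoc Y.M.a_assoc) }
   fix l assume "l \<in> carrier L"
   then obtain a n m b where l: "a \<in> carrier A" "n \<in> carrier N" "m \<in> carrier M" "b \<in> carrier B"
    "l = mat a n m b" by (rule matE)
   show "l \<odot>\<^bsub>cind Y\<^esub> (p \<oplus>\<^bsub>cind Y\<^esub> q) = l \<odot>\<^bsub>cind Y\<^esub> p \<oplus>\<^bsub>cind Y\<^esub> l \<odot>\<^bsub>cind Y\<^esub> q"
    using p q l c by (auto simp: cind_simps cind_smult hom_module_simps(3) Y.smult_r_distr Y.M.a_ac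
      intro!: restrict_ext) }
  fix l assume "l \<in> carrier L"
  then obtain a n m b where l: "a \<in> carrier A" "n \<in> carrier N" "m \<in> carrier M" "b \<in> carrier B"
   "l = mat a n m b" by (rule matE)
  have "(\<lambda>m'. h (m' \<triangleleft>\<^sub>M a) \<oplus>\<^sub>Y mn m' n \<odot>\<^sub>Y y) \<in> lmod_hom B M Y"
   by (rule hom_sum[OF Y rsmult_hom[OF D(1)[OF p(2)] l(1)] pairing_hom[OF Y p(3) l(2)]])
  from hom_restrictI[OF this left_module_M] show "l \<odot>\<^bsub>cind Y\<^esub> p \<in> carrier (cind Y)"
   using p l c by (simp add: cind_smult cind_simps)
  fix l' assume "l' \<in> carrier L"
  then obtain a' n' m' b' where l': "a' \<in> carrier A" "n' \<in> carrier N" "m' \<in> carrier M" "b' \<in> carrier B"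
   "l' = mat a' n' m' b'" by (rule matE)
  show "(l \<oplus>\<^sub>L l') \<odot>\<^bsub>cind Y\<^esub> p = l \<odot>\<^bsub>cind Y\<^esub> p \<oplus>\<^bsub>cind Y\<^esub> l' \<odot>\<^bsub>cind Y\<^esub> p"
   using p l l' c[OF p(2)] ha[OF p(2)] by (auto simp: cind_simps cind_smult hom_module_simps(3) mat_add M.rsmult_r_distr
     mn_add_r Y.smult_l_distr Y.M.a_ac intro!: restrict_ext)
  show "(l \<otimes>\<^sub>L l') \<odot>\<^bsub>cind Y\<^esub> p = l \<odot>\<^bsub>cind Y\<^esub> (l' \<odot>\<^bsub>cind Y\<^esub> p)"
   using p l l' c[OF p(2)] ha[OF p(2)] hs[OF p(2)] by (auto simp: cind_smult mat_mult M.rsmult_r_distr mn_nm[symmetric] M.rsmult_assoc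
     mn_add_r mn_rsmult mn_balanced[symmetric] Y.smult_l_distr Y.smult_r_distr Y.smult_assoc1 Y.M.a_ac
     intro!: restrict_ext)
 next
  show "\<zero>\<^bsub>cind Y\<^esub> \<in> carrier (cind Y)" by (simp add: cind_simps)
 qed
qed

definition cind_map :: "('y \<Rightarrow> 'z) \<Rightarrow> ('m \<Rightarrow> 'y) \<times> 'y \<Rightarrow> ('m \<Rightarrow> 'z) \<times> 'z"
 where "cind_map g p = (hom_map M g (fst p), g (snd p))"

lemma cind_map_hom:
 assumes g: "g \<in> lmod_hom B Y Z" and Y: "left_module B Y"
 shows "cind_map g \<in> lmod_hom L (cind Y) (cind Z)"
proof -
 interpret Y: left_module B Y by fact
 note gs = hom_map_hom[OF bimodule_M g]
 have c: "h m \<in> carrier Y" if "h \<in> carrier (hom_module B M Y)" "m \<in> carrier M" for h m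
  using that by (auto simp: hom_module_simps hom_closed)
 show ?thesis
 proof (rule lmod_homI)
  fix p assume "p \<in> carrier (cind Y)"
  then obtain h y where p: "p = (h, y)" "h \<in> carrier (hom_module B M Y)" "y \<in> carrier Y" by (auto simp: cind_simps)
  show "cind_map g p \<in> carrier (cind Z)"
   using p hom_closed[OF gs] hom_closed[OF g] by (simp add: cind_map_def cind_simps)
  show "cind_map g (p \<oplus>\<^bsub>cind Y\<^esub> q) = cind_map g p \<oplus>\<^bsub>cind Z\<^esub> cind_map g q" if "q \<in> carrier (cind Y)" for q
   using that p hom_add[OF gs] hom_add[OF g] by (auto simp: cind_map_def cind_simps)
  fix l assume "l \<in> carrier L"
  then obtain a n m b where l: "a \<in> carrier A" "n \<in> carrier N" "m \<in> carrier M" "b \<in> carrier B"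
   "l = mat a n m b" by (rule matE)
  then show "cind_map g (l \<odot>\<^bsub>cind Y\<^esub> p) = l \<odot>\<^bsub>cind Z\<^esub> cind_map g p"
   using p c by (auto simp: cind_map_def cind_smult hom_map_def hom_add[OF g] hom_smult[OF g] intro!: restrict_ext)
 qed
qed

lemma cind_ses:
 assumes s: "ses B Y' Y Y'' f g"
  and ex: "\<And>h. h \<in> carrier (hom_module B M Y'') \<Longrightarrow>
   \<exists>k \<in> carrier (hom_module B M Y). \<forall>m \<in> carrier M. g (k m) = h m"
 shows "ses L (cind Y') (cind Y) (cind Y'') (cind_map f) (cind_map g)"
proof -
 note s' = sesD[OF s]
 have "ses A (hom_module B M Y') (hom_module B M Y) (hom_module B M Y'') (hom_map M f) (hom_map M g)"
  by (rule hom_ses[OF bimodule_M s]) (rule ex)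
 note H = sesD[OF this]
 note l = cind_left_module[OF s'(1)] cind_left_module[OF s'(2)] cind_left_module[OF s'(3)]
 have f0: "y = \<zero>\<^bsub>Y'\<^esub>" if "y \<in> carrier Y'" "f y = \<zero>\<^sub>Y" for y
  using that hom_inj_iff[OF s'(1,2,4)] s'(5) by blast
 have F0: "h = \<zero>\<^bsub>hom_module B M Y'\<^esub>"
  if "h \<in> carrier (hom_module B M Y')" "hom_map M f h = \<zero>\<^bsub>hom_module B M Y\<^esub>" for h
  using that hom_left_exact(1)[OF bimodule_M s] by blast
 show ?thesis
 proof (rule sesI[OF l cind_map_hom[OF s'(4,1)] _ cind_map_hom[OF s'(6,2)]])
  fix p assume "p \<in> carrier (cind Y'')"
  then obtain h y where p: "p = (h, y)" "h \<in> carrier (hom_module B M Y'')" "y \<in> carrier Y''" by (auto simp: cind_simps)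
  show "\<exists>q\<in>carrier (cind Y). cind_map g q = p" using H(11)[OF p(2)] s'(11)[OF p(3)] p(1)
   by (auto simp: cind_map_def cind_simps)
 next
  fix p assume "p \<in> carrier (cind Y)" "cind_map g p = \<zero>\<^bsub>cind Y''\<^esub>"
  then obtain h y where p: "p = (h, y)" "h \<in> carrier (hom_module B M Y)" "y \<in> carrier Y"
   "hom_map M g h = \<zero>\<^bsub>hom_module B M Y''\<^esub>" "g y = \<zero>\<^bsub>Y''\<^esub>" by (auto simp: cind_map_def cind_simps)
  show "\<exists>q\<in>carrier (cind Y'). p = cind_map f q" using H(10)[OF p(2,4)] s'(10)[OF p(3,5)] p(1)
   by (auto simp: cind_map_def cind_simps)
 qed (use f0 F0 H(9) s'(9) in \<open>auto simp: cind_map_def cind_simps\<close>)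
qed

lemma cind_fg:
 assumes Y: "left_module B Y" and fg: "finitely_generated A (hom_module B M Y)" "finitely_generated B Y"
 shows "finitely_generated L (cind Y)"
proof -
 let ?H = "hom_module B M Y"
 interpret Y: left_module B Y by fact
 note lH = hom_module_left_module[OF bimodule_M Y]
 interpret H: left_module A ?H by (rule lH)
 obtain S where S: "finite S" "S \<subseteq> carrier ?H" "\<And>U. submod A ?H U \<Longrightarrow> S \<subseteq> U \<Longrightarrow> U = carrier ?H"
  using finitely_generatedE[OF lH fg(1)] by blast
 obtain T where T: "finite T" "T \<subseteq> carrier Y" "\<And>U. submod B Y U \<Longrightarrow> T \<subseteq> U \<Longrightarrow> U = carrier Y"
  using finitely_generatedE[OF Y fg(2)] by blast
 show ?thesis
 proof (rule finitely_generatedI[OF cind_left_module[OF Y], of "S \<times> {\<zero>\<^sub>Y} \<union> {\<zero>\<^sub>?H} \<times> T"])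
  fix U assume U: "submod L (cind Y) U" "S \<times> {\<zero>\<^sub>Y} \<union> {\<zero>\<^sub>?H} \<times> T \<subseteq> U"
  note U' = submodD[OF U(1)]
  have h0: "h \<zero>\<^sub>M = \<zero>\<^sub>Y" if "h \<in> carrier ?H" for h
   using that hom_zero[OF left_module_M Y] by (simp add: hom_module_simps)
  have c: "h m \<in> carrier Y" if "h \<in> carrier ?H" "m \<in> carrier M" for h m
   using that hom_closed[of h B M Y] by (simp add: hom_module_simps)
  have 1: "{h \<in> carrier ?H. (h, \<zero>\<^sub>Y) \<in> U} = carrier ?H"
  proof (rule S(3))
   show "submod A ?H {h \<in> carrier ?H. (h, \<zero>\<^sub>Y) \<in> U}"
    unfolding submod_def
   proof (safe)
    show "(\<zero>\<^sub>?H, \<zero>\<^sub>Y) \<in> U" using U'(3) by (simp add: cind_simps)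
    fix h assume h: "h \<in> carrier ?H" "(h, \<zero>\<^sub>Y) \<in> U"
    show "(h \<oplus>\<^sub>?H k, \<zero>\<^sub>Y) \<in> U" if "k \<in> carrier ?H" "(k, \<zero>\<^sub>Y) \<in> U" for k
     using U'(4)[OF h(2) that(2)] by (simp add: cind_simps)
    fix a assume a: "a \<in> carrier A"
    have "eA a \<odot>\<^bsub>cind Y\<^esub> (h, \<zero>\<^sub>Y) = (a \<odot>\<^sub>?H h, \<zero>\<^sub>Y)"
     using a h0[OF h(1)] c[OF h(1)] by (auto simp: cind_smult hom_module_simps(4) intro!: restrict_ext)
    then show "(a \<odot>\<^sub>?H h, \<zero>\<^sub>Y) \<in> U" using U'(5)[OF _ h(2), of "eA a"] a by simp
   qed (auto)
  qed (use S U in auto)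
  have 2: "{y \<in> carrier Y. (\<zero>\<^sub>?H, y) \<in> U} = carrier Y"
  proof (rule T(3))
   show "submod B Y {y \<in> carrier Y. (\<zero>\<^sub>?H, y) \<in> U}"
    unfolding submod_def
   proof (safe)
    show "(\<zero>\<^sub>?H, \<zero>\<^sub>Y) \<in> U" using U'(3) by (simp add: cind_simps)
    fix y assume y: "y \<in> carrier Y" "(\<zero>\<^sub>?H, y) \<in> U"
    show "(\<zero>\<^sub>?H, y \<oplus>\<^sub>Y z) \<in> U" if "z \<in> carrier Y" "(\<zero>\<^sub>?H, z) \<in> U" for z
     using U'(4)[OF y(2) that(2)] by (simp add: cind_simps)
    fix b assume b: "b \<in> carrier B"
    have "eB b \<odot>\<^bsub>cind Y\<^esub> (\<zero>\<^sub>?H, y) = (\<zero>\<^sub>?H, b \<odot>\<^sub>Y y)"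
     using b y by (auto simp: cind_smult hom_module_simps(2) intro!: restrict_ext)
    then show "(\<zero>\<^sub>?H, b \<odot>\<^sub>Y y) \<in> U" using U'(5)[OF _ y(2), of "eB b"] b by simp
   qed (auto)
  qed (use T U in auto)
  show "carrier (cind Y) \<subseteq> U"
  proof
   fix p assume "p \<in> carrier (cind Y)"
   then obtain h y where p: "p = (h, y)" "h \<in> carrier ?H" "y \<in> carrier Y" by (auto simp: cind_simps)
   have "(h, \<zero>\<^sub>Y) \<oplus>\<^bsub>cind Y\<^esub> (\<zero>\<^sub>?H, y) \<in> U" using 1 2 p by (intro U'(4)) auto
   then show "p \<in> U" using p by (simp add: cind_simps)
  qed
 qed (use S T in \<open>auto simp: cind_simps\<close>)
qed

end

context morita_matrix
begin

lemma cind_eA: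
 assumes Y: "left_module B Y" and h: "h \<in> carrier (hom_module B M Y)" and a: "a \<in> carrier A"
 shows "eA a \<odot>\<^bsub>cind Y\<^esub> (h, \<zero>\<^sub>Y) = (a \<odot>\<^bsub>hom_module B M Y\<^esub> h, \<zero>\<^sub>Y)"
proof -
 interpret Y: left_module B Y by fact
 have h': "h \<in> lmod_hom B M Y" using h by (simp add: hom_module_simps)
 show ?thesis using a hom_closed[OF h'] hom_zero[OF left_module_M Y h']
  by (auto simp: cind_smult hom_module_simps(4) intro!: restrict_ext)
qed

lemma cind_eM:
 assumes Y: "left_module B Y" and h: "h \<in> carrier (hom_module B M Y)" and m: "m \<in> carrier M"
 shows "eM m \<odot>\<^bsub>cind Y\<^esub> (h, \<zero>\<^sub>Y) = (\<zero>\<^bsub>hom_module B M Y\<^esub>, h m)"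
proof -
 interpret Y: left_module B Y by fact
 have h': "h \<in> lmod_hom B M Y" using h by (simp add: hom_module_simps)
 show ?thesis using m hom_closed[OF h'] hom_zero[OF left_module_M Y h']
  by (auto simp: cind_smult hom_module_simps(2) intro!: restrict_ext)
qed

lemma cind_pair_homs:
 assumes Y: "left_module B Y"
 shows "(\<lambda>h. (h, \<zero>\<^sub>Y)) \<in> lmod_hom A (hom_module B M Y) (corner A eA (cind Y))"
  "snd \<in> lmod_hom B (corner B eB (cind Y)) Y"
proof -
 interpret Y: left_module B Y by fact
 interpret H: left_module A "hom_module B M Y" by (rule hom_module_left_module[OF bimodule_M Y])
 show "(\<lambda>h. (h, \<zero>\<^sub>Y)) \<in> lmod_hom A (hom_module B M Y) (corner A eA (cind Y))"
  by (rule lmod_homI) (simp_all add: cind_eA[OF Y] cind_simps)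
 show "snd \<in> lmod_hom B (corner B eB (cind Y)) Y"
 proof (rule lmod_homI)
  fix p assume "p \<in> carrier (corner B eB (cind Y))"
  then obtain h y where p: "p = (h, y)" "h \<in> carrier (hom_module B M Y)" "y \<in> carrier Y" by (auto simp: cind_simps)
  show "snd p \<in> carrier Y" using p by simp
  show "snd (p \<oplus>\<^bsub>corner B eB (cind Y)\<^esub> q) = snd p \<oplus>\<^sub>Y snd q" for q
   using p by (cases q) (simp add: cind_simps)
  have h': "h \<in> lmod_hom B M Y" using p by (simp add: hom_module_simps)
  show "snd (b \<odot>\<^bsub>corner B eB (cind Y)\<^esub> p) = b \<odot>\<^sub>Y snd p" if "b \<in> carrier B" for b
   using p that hom_zero[OF left_module_M Y h'] by (simp add: cind_smult)
 qed
qed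

lemma mat_split:
 assumes "a \<in> carrier A" "n \<in> carrier N" "m \<in> carrier M" "b \<in> carrier B"
 shows "mat a n m b \<otimes>\<^sub>L eA \<one>\<^sub>A = eA a \<oplus>\<^sub>L eM m" "mat a n m b \<otimes>\<^sub>L eB \<one>\<^sub>B = eN n \<oplus>\<^sub>L eB b"
  "eB \<one>\<^sub>B \<otimes>\<^sub>L mat a n m b = eM m \<oplus>\<^sub>L eB b"
 using assms by (simp_all add: mat_mult mat_add)

lemma corner_mem:
 assumes Y: "left_module L Y" and y: "y \<in> carrier Y"
 shows "m \<in> carrier M \<Longrightarrow> eM m \<odot>\<^sub>Y y \<in> carrier (corner B eB Y)" "b \<in> carrier B \<Longrightarrow> eB b \<odot>\<^sub>Y y \<in> carrier (corner B eB Y)"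
proof -
 interpret Y: left_module L Y by fact
 show "m \<in> carrier M \<Longrightarrow> eM m \<odot>\<^sub>Y y \<in> carrier (corner B eB Y)"
  using y Y.smult_assoc1[of "eB \<one>\<^sub>B" "eM m" y] by (simp add: mat_mult)
 show "b \<in> carrier B \<Longrightarrow> eB b \<odot>\<^sub>Y y \<in> carrier (corner B eB Y)"
  using y Y.smult_assoc1[of "eB \<one>\<^sub>B" "eB b" y] by (simp add: mat_mult)
qed

text \<open>
 The adjoint of a \<open>B\<close>-homomorphism \<open>G\<close> from the corner \<open>e Y\<close> to \<open>J\<close>: it sends \<open>y\<close> to \<open>x \<mapsto> G (x y)\<close> on \<open>e L = M \<oplus> B\<close>.
\<close>

lemma cind_extend:
 assumes lY: "left_module L Y" and lJ: "left_module B J" and G: "G \<in> lmod_hom B (corner B eB Y) J"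
 shows "(\<lambda>y. (\<lambda>m\<in>carrier M. G (eM m \<odot>\<^sub>Y y), G (eB \<one>\<^sub>B \<odot>\<^sub>Y y))) \<in> lmod_hom L Y (cind J)"
proof -
 interpret Y: left_module L Y by fact
 define F' where "F' = (\<lambda>y. (\<lambda>m\<in>carrier M. G (eM m \<odot>\<^sub>Y y), G (eB \<one>\<^sub>B \<odot>\<^sub>Y y)))"
 have Gadd: "G (y \<oplus>\<^sub>Y y') = G y \<oplus>\<^sub>J G y'"
  if "y \<in> carrier (corner B eB Y)" "y' \<in> carrier (corner B eB Y)" for y y'
  using hom_add[OF G that] by simp
 have Gsm: "G (eB b \<odot>\<^sub>Y y) = b \<odot>\<^sub>J G (eB \<one>\<^sub>B \<odot>\<^sub>Y y)"
  if "b \<in> carrier B" "y \<in> carrier Y" for b y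
 proof -
  have "eB b \<odot>\<^sub>Y (eB \<one>\<^sub>B \<odot>\<^sub>Y y) = eB b \<odot>\<^sub>Y y"
   using that Y.smult_assoc1[of "eB b" "eB \<one>\<^sub>B" y] by (simp add: mat_mult)
  then show ?thesis using hom_smult[OF G that(1) corner_mem(2)[OF lY that(2) B.one_closed]] by simp
 qed
 have eM_add: "eM (m \<oplus>\<^sub>M m') = eM m \<oplus>\<^sub>L eM m'" if "m \<in> carrier M" "m' \<in> carrier M" for m m'
  using that by (simp add: mat_add)
 have eM_sm: "eM (b \<odot>\<^sub>M m) = eB b \<otimes>\<^sub>L eM m" if "m \<in> carrier M" "b \<in> carrier B" for m b
  using that by (simp add: mat_mult)
 have h: "(\<lambda>m. G (eM m \<odot>\<^sub>Y y)) \<in> lmod_hom B M J" if y: "y \<in> carrier Y" for y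
 proof (rule lmod_homI)
  fix m assume m: "m \<in> carrier M"
  show "G (eM m \<odot>\<^sub>Y y) \<in> carrier J" by (rule hom_closed[OF G corner_mem(1)[OF lY y m]])
  show "G (eM (m \<oplus>\<^sub>M m') \<odot>\<^sub>Y y) = G (eM m \<odot>\<^sub>Y y) \<oplus>\<^sub>J G (eM m' \<odot>\<^sub>Y y)" if m': "m' \<in> carrier M" for m'
   using Gadd[OF corner_mem(1)[OF lY y m] corner_mem(1)[OF lY y m']] m m' y by (simp add: eM_add Y.smult_l_distr)
  show "G (eM (b \<odot>\<^sub>M m) \<odot>\<^sub>Y y) = b \<odot>\<^sub>J G (eM m \<odot>\<^sub>Y y)" if b: "b \<in> carrier B" for b
   using hom_smult[OF G b corner_mem(1)[OF lY y m]] m b y by (simp add: eM_sm Y.smult_assoc1)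
 qed
 show ?thesis unfolding F'_def[symmetric]
 proof (rule lmod_homI)
  fix y assume y: "y \<in> carrier Y"
  show "F' y \<in> carrier (cind J)"
   using hom_restrictI[OF h[OF y] left_module_M] hom_closed[OF G corner_mem(2)[OF lY y B.one_closed]]
   by (simp add: F'_def cind_simps)
  { fix y' assume y': "y' \<in> carrier Y"
   have "G (eM m \<odot>\<^sub>Y (y \<oplus>\<^sub>Y y')) = G (eM m \<odot>\<^sub>Y y) \<oplus>\<^sub>J G (eM m \<odot>\<^sub>Y y')" if m: "m \<in> carrier M" for m
    using Gadd[OF corner_mem(1)[OF lY y m] corner_mem(1)[OF lY y' m]] m y y' by (simp add: Y.smult_r_distr)
   moreover have "G (eB \<one>\<^sub>B \<odot>\<^sub>Y (y \<oplus>\<^sub>Y y')) = G (eB \<one>\<^sub>B \<odot>\<^sub>Y y) \<oplus>\<^sub>J G (eB \<one>\<^sub>B \<odot>\<^sub>Y y')"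
    using Gadd[OF corner_mem(2)[OF lY y B.one_closed] corner_mem(2)[OF lY y' B.one_closed]] y y' by (simp add: Y.smult_r_distr)
   ultimately show "F' (y \<oplus>\<^sub>Y y') = F' y \<oplus>\<^bsub>cind J\<^esub> F' y'"
    by (auto simp: F'_def cind_simps hom_module_simps(3) intro!: restrict_ext) }
  fix l assume "l \<in> carrier L"
  then obtain a n m b where l: "a \<in> carrier A" "n \<in> carrier N" "m \<in> carrier M" "b \<in> carrier B"
   "l = mat a n m b" by (rule matE)
  have lc: "l \<in> carrier L" using l by simp
  have "G (eM m' \<odot>\<^sub>Y (l \<odot>\<^sub>Y y)) = G (eM (m' \<triangleleft>\<^sub>M a) \<odot>\<^sub>Y y) \<oplus>\<^sub>J mn m' n \<odot>\<^sub>J G (eB \<one>\<^sub>B \<odot>\<^sub>Y y)"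
   if m': "m' \<in> carrier M" for m'
  proof -
   have c: "m' \<triangleleft>\<^sub>M a \<in> carrier M" "mn m' n \<in> carrier B" using m' l by simp_all
   have "eM m' \<odot>\<^sub>Y (l \<odot>\<^sub>Y y) = (eM m' \<otimes>\<^sub>L l) \<odot>\<^sub>Y y" using m' y lc by (simp add: Y.smult_assoc1)
   also have "eM m' \<otimes>\<^sub>L l = eM (m' \<triangleleft>\<^sub>M a) \<oplus>\<^sub>L eB (mn m' n)" using m' l by (simp add: mat_mult mat_add)
   also have "\<dots> \<odot>\<^sub>Y y = eM (m' \<triangleleft>\<^sub>M a) \<odot>\<^sub>Y y \<oplus>\<^sub>Y eB (mn m' n) \<odot>\<^sub>Y y"
    using c y by (intro Y.smult_l_distr) simp_all
   finally show ?thesis using Gadd[OF corner_mem(1)[OF lY y c(1)] corner_mem(2)[OF lY y c(2)]] Gsm[OF c(2) y] by simp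
  qed
  moreover have "G (eB \<one>\<^sub>B \<odot>\<^sub>Y (l \<odot>\<^sub>Y y)) = G (eM m \<odot>\<^sub>Y y) \<oplus>\<^sub>J b \<odot>\<^sub>J G (eB \<one>\<^sub>B \<odot>\<^sub>Y y)"
  proof -
   have "eB \<one>\<^sub>B \<odot>\<^sub>Y (l \<odot>\<^sub>Y y) = (eB \<one>\<^sub>B \<otimes>\<^sub>L l) \<odot>\<^sub>Y y" using y lc by (simp add: Y.smult_assoc1)
   also have "\<dots> = eM m \<odot>\<^sub>Y y \<oplus>\<^sub>Y eB b \<odot>\<^sub>Y y"
    unfolding l(5) mat_split(3)[OF l(1-4)] using l y by (intro Y.smult_l_distr) simp_all
   finally show ?thesis using Gadd[OF corner_mem(1)[OF lY y l(3)] corner_mem(2)[OF lY y l(4)]] Gsm[OF l(4) y] by simp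
  qed
  ultimately show "F' (l \<odot>\<^sub>Y y) = l \<odot>\<^bsub>cind J\<^esub> F' y"
   using l(1-4) unfolding F'_def l(5) by (auto simp: cind_smult intro!: restrict_ext)
 qed
qed

lemma cind_injective:
 assumes J: "injective_module B J" shows "injective_module L (cind J)"
proof -
 have lJ: "left_module B J" using J by (simp add: injective_module_def)
 interpret J: left_module B J by fact
 show ?thesis
  unfolding injective_module_def
 proof (intro conjI cind_left_module lJ allI impI; elim conjE)
  fix X Y :: "('l, 'l fg_carrier) module" and g F
  assume a: "left_module L X" "left_module L Y" "g \<in> lmod_hom L X Y" "inj_on g (carrier X)"
   "F \<in> lmod_hom L X (cind J)"
  interpret X: left_module L X by (rule a(1))
  interpret Y: left_module L Y by (rule a(2))
  have eBc: "eB b \<in> carrier L" if "b \<in> carrier B" for b using that by simp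
  have gc: "g \<in> lmod_hom B (corner B eB X) (corner B eB Y)" by (rule corner_hom[OF a(3) eBc ring_B])
  have inj: "inj_on g (carrier (corner B eB X))" using a(4) by (auto simp: inj_on_def)
  have Fs: "(\<lambda>x. snd (F x)) \<in> lmod_hom B (corner B eB X) J"
   by (rule hom_comp[OF corner_hom[OF a(5) eBc ring_B] cind_pair_homs(2)[OF lJ]])
  obtain G where G: "G \<in> lmod_hom B (corner B eB Y) J"
   "\<And>x. x \<in> carrier (corner B eB X) \<Longrightarrow> G (g x) = snd (F x)"
   using baer_extend_inj[OF lJ injective_imp_baer[OF J] corner_B[OF a(1)] corner_B[OF a(2)] gc inj Fs] by blast
  define F' where "F' = (\<lambda>y. (\<lambda>m\<in>carrier M. G (eM m \<odot>\<^sub>Y y), G (eB \<one>\<^sub>B \<odot>\<^sub>Y y)))"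
  have F': "F' \<in> lmod_hom L Y (cind J)" unfolding F'_def by (rule cind_extend[OF a(2) lJ G(1)])
  have "F' (g x) = F x" if x: "x \<in> carrier X" for x
  proof -
   obtain h y where p: "F x = (h, y)" "h \<in> carrier (hom_module B M J)" "y \<in> carrier J"
    using hom_closed[OF a(5) x] by (auto simp: cind_simps)
   have h': "h \<in> lmod_hom B M J" using p by (simp add: hom_module_simps)
   have gx: "g x \<in> carrier Y" using hom_closed[OF a(3) x] .
   have *: "G (l \<odot>\<^sub>Y g x) = snd (l \<odot>\<^bsub>cind J\<^esub> F x)" if "l \<in> carrier L" "l \<odot>\<^sub>X x \<in> carrier (corner B eB X)" for l
    using G(2)[OF that(2)] hom_smult[OF a(3) that(1) x] hom_smult[OF a(5) that(1) x] by simp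
   have "G (eM m \<odot>\<^sub>Y g x) = h m" if m: "m \<in> carrier M" for m
    using *[OF _ corner_mem(1)[OF a(1) x m]] m p hom_closed[OF h' m] by (simp add: cind_smult)
   moreover have "G (eB \<one>\<^sub>B \<odot>\<^sub>Y g x) = y"
    using *[OF _ corner_mem(2)[OF a(1) x B.one_closed]] p hom_zero[OF left_module_M lJ h'] by (simp add: cind_smult)
   moreover have "h \<in> extensional (carrier M)" using p by (simp add: hom_module_simps)
   ultimately show ?thesis unfolding F'_def p(1) by (auto simp: extensional_def restrict_def)
  qed
  then show "\<exists>h\<in>lmod_hom L Y (cind J). \<forall>x\<in>carrier X. h (g x) = F x" using F' by blast
 qed
qed

text \<open>
 For \<open>T = M \<otimes> X\<close> the module \<open>cind T\<close> is also induced: a homomorphism from it into an \<open>L\<close>-module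
 \<open>Z\<close> is determined by, and can be built from, its restriction to \<open>X \<simeq> Hom(M, T)\<close>, an arbitrary
 \<open>A\<close>-homomorphism into \<open>eA 1 Z\<close>. Therefore it inherits projectivity from \<open>X\<close>.
\<close>

lemma cind_projective:
 fixes X :: "('a, 'a fg_carrier) module"
 assumes E: "induces_equivalence A B M" and X: "projective_module A X" "finitely_generated A X"
 shows "projective_module L (cind (tensor_module A M X))"
proof -
 have lX: "left_module A X" using X by (simp add: projective_module_def)
 have "fin_proj_dim A X"
  using X lX projective_pd_lt_1[OF X] by (auto simp: fin_proj_dim_iff fg_module_def)
 note un = equivalence_unit[OF E bimodule_M this]
 interpret t: tensor_pair A B M X by (rule un(1))
 let ?T = "tensor_module A M X"
 let ?H = "hom_module B M ?T"
 note lT = t.T_left_module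
 interpret T: left_module B ?T by (rule lT)
 have lH: "left_module A ?H" by (rule hom_module_left_module[OF bimodule_M lT])
 interpret H: left_module A ?H by (rule lH)
 interpret C: left_module L "cind ?T" by (rule cind_left_module[OF lT])
 define u where "u = adj_unit A M X"
 have u: "u \<in> lmod_iso A X ?H" using un(5) by (simp add: u_def)
 have um: "u p m = t.pt m p" if "m \<in> carrier M" for p m using that by (simp add: u_def adj_unit_def)
 define ui where "ui = inv_into (carrier X) u"
 note ui = iso_inverse[OF u lX, folded ui_def]
 have eAc: "eA a \<in> carrier L" if "a \<in> carrier A" for a using that by simp
 show ?thesis
  unfolding projective_module_def
 proof (intro conjI cind_left_module lT allI impI; elim conjE)
  fix V W :: "('l, 'l fg_carrier) module" and g F
  assume a: "left_module L V" "left_module L W" "g \<in> lmod_hom L V W" "g ` carrier V = carrier W"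
   "F \<in> lmod_hom L (cind ?T) W"
  interpret V: left_module L V by (rule a(1))
  interpret W: left_module L W by (rule a(2))
  have f0: "(\<lambda>p. F (u p, \<zero>\<^sub>?T)) \<in> lmod_hom A X (corner A eA W)"
   by (rule hom_comp[OF hom_comp[OF iso_hom[OF u] cind_pair_homs(1)[OF lT]] corner_hom[OF a(5) eAc ring_A]])
  have gA: "g \<in> lmod_hom A (corner A eA V) (corner A eA W)" by (rule corner_hom[OF a(3) eAc ring_A])
  have gs: "g ` carrier (corner A eA V) = carrier (corner A eA W)"
  proof
   show "g ` carrier (corner A eA V) \<subseteq> carrier (corner A eA W)" using hom_closed[OF gA] by blast
   show "carrier (corner A eA W) \<subseteq> g ` carrier (corner A eA V)"
   proof
    fix w assume w: "w \<in> carrier (corner A eA W)"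
    then have "w \<in> g ` carrier V" using a(4) by simp
    then obtain v where v: "v \<in> carrier V" "w = g v" by blast
    have "eA \<one>\<^sub>A \<odot>\<^sub>V (eA \<one>\<^sub>A \<odot>\<^sub>V v) = eA \<one>\<^sub>A \<odot>\<^sub>V v"
     using v V.smult_assoc1[of "eA \<one>\<^sub>A" "eA \<one>\<^sub>A" v] by (simp add: mat_mult)
    then have "eA \<one>\<^sub>A \<odot>\<^sub>V v \<in> carrier (corner A eA V)" using v by simp
    moreover have "g (eA \<one>\<^sub>A \<odot>\<^sub>V v) = w" using v w hom_smult[OF a(3), of "eA \<one>\<^sub>A" v] by simp
    ultimately show "w \<in> g ` carrier (corner A eA V)" by blast
   qed
  qed
  obtain h0 where h0: "h0 \<in> lmod_hom A X (corner A eA V)"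
   "\<And>p. p \<in> carrier X \<Longrightarrow> g (h0 p) = F (u p, \<zero>\<^sub>?T)"
   using projective_lift[OF X corner_A[OF a(1)] corner_A[OF a(2)] gA gs f0] by metis
  have h0V: "h0 p \<in> carrier V" "eA \<one>\<^sub>A \<odot>\<^sub>V h0 p = h0 p" if "p \<in> carrier X" for p
   using hom_closed[OF h0(1) that] by auto
  have h0s: "h0 (a \<odot>\<^sub>X p) = eA a \<odot>\<^sub>V h0 p" if "a \<in> carrier A" "p \<in> carrier X" for a p
   using hom_smult[OF h0(1) that] by simp
  have h0a: "h0 (p \<oplus>\<^sub>X q) = h0 p \<oplus>\<^sub>V h0 q" if "p \<in> carrier X" "q \<in> carrier X" for p q
   using hom_add[OF h0(1) that] by simp
  obtain \<omega> where \<omega>: "\<omega> \<in> lmod_hom B ?T (corner B eB V)"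
   "\<And>m p. m \<in> carrier M \<Longrightarrow> p \<in> carrier X \<Longrightarrow> \<omega> (t.pt m p) = eM m \<odot>\<^sub>V h0 p"
  proof (rule t.tensor_lift[OF corner_B[OF a(1)], of "\<lambda>m p. eM m \<odot>\<^sub>V h0 p"])
   fix m p assume m: "m \<in> carrier M" "p \<in> carrier X"
   show "eM m \<odot>\<^sub>V h0 p \<in> carrier (corner B eB V)"
    using corner_mem(1)[OF a(1), of "h0 p" m] m h0V by simp
   show "eM (m \<oplus>\<^sub>M m') \<odot>\<^sub>V h0 p = eM m \<odot>\<^sub>V h0 p \<oplus>\<^bsub>corner B eB V\<^esub> eM m' \<odot>\<^sub>V h0 p" if "m' \<in> carrier M" for m'
    using m that h0V V.smult_l_distr[of "eM m" "eM m'" "h0 p"] by (simp add: mat_add)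
   show "eM m \<odot>\<^sub>V h0 (p \<oplus>\<^sub>X p') = eM m \<odot>\<^sub>V h0 p \<oplus>\<^bsub>corner B eB V\<^esub> eM m \<odot>\<^sub>V h0 p'" if "p' \<in> carrier X" for p'
    using m that h0V by (simp add: h0a V.smult_r_distr)
   show "eM (m \<triangleleft>\<^sub>M a) \<odot>\<^sub>V h0 p = eM m \<odot>\<^sub>V h0 (a \<odot>\<^sub>X p)" if "a \<in> carrier A" for a
    using m that h0V V.smult_assoc1[of "eM m" "eA a" "h0 p"] by (simp add: h0s mat_mult)
   show "eM (b \<odot>\<^sub>M m) \<odot>\<^sub>V h0 p = b \<odot>\<^bsub>corner B eB V\<^esub> (eM m \<odot>\<^sub>V h0 p)" if "b \<in> carrier B" for b
    using m that h0V V.smult_assoc1[of "eB b" "eM m" "h0 p"] by (simp add: mat_mult)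
  qed (rule that)
  have \<omega>V: "\<omega> s \<in> carrier V" "eB \<one>\<^sub>B \<odot>\<^sub>V \<omega> s = \<omega> s" if "s \<in> carrier ?T" for s
   using hom_closed[OF \<omega>(1) that] by auto
  have \<omega>a: "\<omega> (s \<oplus>\<^sub>?T s') = \<omega> s \<oplus>\<^sub>V \<omega> s'" if "s \<in> carrier ?T" "s' \<in> carrier ?T" for s s'
   using hom_add[OF \<omega>(1) that] by simp
  have \<omega>s: "\<omega> (b \<odot>\<^sub>?T s) = eB b \<odot>\<^sub>V \<omega> s" if "b \<in> carrier B" "s \<in> carrier ?T" for b s
   using hom_smult[OF \<omega>(1) that] by simp
  have \<omega>0: "\<omega> \<zero>\<^sub>?T = \<zero>\<^sub>V" using hom_zero[OF lT corner_B[OF a(1)] \<omega>(1)] by simp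
  \<comment> \<open>The image of \<open>s\<close> under \<open>n\<close> in the coinduced module, an element of \<open>Hom(M, T)\<close>.\<close>
  define \<kappa> where "\<kappa> n s = (\<lambda>m \<in> carrier M. mn m n \<odot>\<^sub>?T s)" for n s
  have \<kappa>c: "\<kappa> n s \<in> carrier ?H" if "n \<in> carrier N" "s \<in> carrier ?T" for n s
   unfolding \<kappa>_def by (rule hom_restrictI[OF pairing_hom[OF lT that(2,1)] left_module_M])
  \<comment> \<open>The lift on \<open>Hom(M, T)\<close>; on \<open>T\<close> it is \<open>\<omega>\<close>.\<close>
  define P where "P h = h0 (ui h)" for h
  have P: "P \<in> lmod_hom A ?H (corner A eA V)" unfolding P_def by (rule hom_comp[OF iso_hom[OF ui(1)] h0(1)])
  have Pu: "P (u p) = h0 p" if "p \<in> carrier X" for p using ui(2)[OF that] by (simp add: P_def)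
  have PV: "P h \<in> carrier V" "eA \<one>\<^sub>A \<odot>\<^sub>V P h = P h" if "h \<in> carrier ?H" for h
   using hom_closed[OF P that] by auto
  have Pa: "P (h \<oplus>\<^sub>?H k) = P h \<oplus>\<^sub>V P k" if "h \<in> carrier ?H" "k \<in> carrier ?H" for h k
   using hom_add[OF P that] by simp
  have Ps: "P (a \<odot>\<^sub>?H h) = eA a \<odot>\<^sub>V P h" if "a \<in> carrier A" "h \<in> carrier ?H" for a h
   using hom_smult[OF P that] by simp
  have P0: "P \<zero>\<^sub>?H = \<zero>\<^sub>V" using hom_zero[OF lH corner_A[OF a(1)] P] by simp
  have P\<omega>: "eM m \<odot>\<^sub>V P h = \<omega> (h m)" if h: "h \<in> carrier ?H" and m: "m \<in> carrier M" for h m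
  proof -
   have "ui h \<in> carrier X" "u (ui h) = h" using hom_closed[OF iso_hom[OF ui(1)] h] ui(3)[OF h] by auto
   then show ?thesis using \<omega>(2)[OF m, of "ui h"] um[OF m, of "ui h"] by (simp add: P_def)
  qed
  have key: "eN n \<odot>\<^sub>V \<omega> s = P (\<kappa> n s)" if n: "n \<in> carrier N" and s: "s \<in> carrier ?T" for n s
   using s
  proof (induction s rule: t.tensor_induct)
   case (pure m p)
   have "eN n \<odot>\<^sub>V \<omega> (t.pt m p) = eA (nm n m) \<odot>\<^sub>V h0 p"
    using pure n h0V V.smult_assoc1[of "eN n" "eM m" "h0 p"] by (simp add: \<omega>(2) mat_mult)
   moreover have "\<kappa> n (t.pt m p) = u (nm n m \<odot>\<^sub>X p)"
    using pure n by (intro hom_module_ext[OF \<kappa>c hom_closed[OF iso_hom[OF u]]])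
     (simp_all add: \<kappa>_def um t.pt_smult mn_nm t.pt_balanced)
   ultimately show ?case using pure n by (simp add: Pu h0s)
  next
   case (add s s')
   have "\<kappa> n (s \<oplus>\<^sub>?T s') = \<kappa> n s \<oplus>\<^sub>?H \<kappa> n s'"
    using add n by (auto simp: \<kappa>_def hom_module_simps(3) T.smult_r_distr intro!: restrict_ext)
   then show ?case using add n \<omega>V \<kappa>c by (simp add: \<omega>a Pa V.smult_r_distr)
  next
   case zero
   have "\<kappa> n \<zero>\<^sub>?T = \<zero>\<^sub>?H" using n by (auto simp: \<kappa>_def hom_module_simps(2) intro!: restrict_ext)
   then show ?case using n by (simp add: \<omega>0 P0)
  qed
  define F' where "F' p = P (fst p) \<oplus>\<^sub>V \<omega> (snd p)" for p
  have F': "F' \<in> lmod_hom L (cind ?T) V"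
  proof (rule lmod_homI)
   fix p assume "p \<in> carrier (cind ?T)"
   then obtain h s where p: "p = (h, s)" "h \<in> carrier ?H" "s \<in> carrier ?T" by (auto simp: cind_simps)
   show "F' p \<in> carrier V" using p PV \<omega>V by (simp add: F'_def)
   show "F' (p \<oplus>\<^bsub>cind ?T\<^esub> q) = F' p \<oplus>\<^sub>V F' q" if "q \<in> carrier (cind ?T)" for q
    using that p PV \<omega>V by (auto simp: F'_def cind_simps Pa \<omega>a V.M.a_ac)
   fix l assume "l \<in> carrier L"
   then obtain a n m b where l: "a \<in> carrier A" "n \<in> carrier N" "m \<in> carrier M" "b \<in> carrier B"
    "l = mat a n m b" by (rule matE)
   have lc: "l \<in> carrier L" using l by simp
   have hm: "h m \<in> carrier ?T" using p l hom_closed[of h B M ?T m] by (simp add: hom_module_simps)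
   have "l \<odot>\<^bsub>cind ?T\<^esub> p = (a \<odot>\<^sub>?H h \<oplus>\<^sub>?H \<kappa> n s, h m \<oplus>\<^sub>?T b \<odot>\<^sub>?T s)"
    unfolding p(1) l(5) cind_smult[OF l(1-4)]
    by (auto simp: hom_module_simps(3,4) \<kappa>_def intro!: restrict_ext)
   then have 1: "F' (l \<odot>\<^bsub>cind ?T\<^esub> p) = (eA a \<odot>\<^sub>V P h \<oplus>\<^sub>V eN n \<odot>\<^sub>V \<omega> s) \<oplus>\<^sub>V (eM m \<odot>\<^sub>V P h \<oplus>\<^sub>V eB b \<odot>\<^sub>V \<omega> s)"
    using p l hm \<kappa>c by (simp add: F'_def Pa Ps \<omega>a \<omega>s key P\<omega>)
   have "l \<odot>\<^sub>V P h = (l \<otimes>\<^sub>L eA \<one>\<^sub>A) \<odot>\<^sub>V P h" using lc PV[OF p(2)] by (simp add: V.smult_assoc1)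
   also have "\<dots> = eA a \<odot>\<^sub>V P h \<oplus>\<^sub>V eM m \<odot>\<^sub>V P h"
    unfolding l(5) mat_split(1)[OF l(1-4)] using l PV[OF p(2)] by (intro V.smult_l_distr) simp_all
   finally have 2: "l \<odot>\<^sub>V P h = eA a \<odot>\<^sub>V P h \<oplus>\<^sub>V eM m \<odot>\<^sub>V P h" .
   have "l \<odot>\<^sub>V \<omega> s = (l \<otimes>\<^sub>L eB \<one>\<^sub>B) \<odot>\<^sub>V \<omega> s" using lc \<omega>V[OF p(3)] by (simp add: V.smult_assoc1)
   also have "\<dots> = eN n \<odot>\<^sub>V \<omega> s \<oplus>\<^sub>V eB b \<odot>\<^sub>V \<omega> s"
    unfolding l(5) mat_split(2)[OF l(1-4)] using l \<omega>V[OF p(3)] by (intro V.smult_l_distr) simp_all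
   finally have 3: "l \<odot>\<^sub>V \<omega> s = eN n \<odot>\<^sub>V \<omega> s \<oplus>\<^sub>V eB b \<odot>\<^sub>V \<omega> s" .
   have "l \<odot>\<^sub>V F' p = l \<odot>\<^sub>V P h \<oplus>\<^sub>V l \<odot>\<^sub>V \<omega> s"
    using p lc PV \<omega>V by (simp add: F'_def V.smult_r_distr)
   then show "F' (l \<odot>\<^bsub>cind ?T\<^esub> p) = l \<odot>\<^sub>V F' p"
    unfolding 1 2 3 using l PV[OF p(2)] \<omega>V[OF p(3)] by (simp add: V.M.a_ac)
  qed
  have g\<omega>: "g (\<omega> s) = F (\<zero>\<^sub>?H, s)" if "s \<in> carrier ?T" for s
   using that
  proof (induction s rule: t.tensor_induct)
   case (pure m p)
   have up: "u p \<in> carrier ?H" using hom_closed[OF iso_hom[OF u] pure(2)] .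
   then have c: "(u p, \<zero>\<^sub>?T) \<in> carrier (cind ?T)" by (simp add: cind_simps)
   have "g (\<omega> (t.pt m p)) = eM m \<odot>\<^sub>W F (u p, \<zero>\<^sub>?T)"
    using pure h0V[OF pure(2)] hom_smult[OF a(3), of "eM m" "h0 p"] by (simp add: \<omega>(2) h0(2))
   also have "\<dots> = F (\<zero>\<^sub>?H, u p m)"
    using hom_smult[OF a(5) _ c, of "eM m"] pure cind_eM[OF lT up pure(1)] by simp
   finally show ?case using um[OF pure(1)] by simp
  next
   case (add s s')
   have "F (\<zero>\<^sub>?H, s \<oplus>\<^sub>?T s') = F ((\<zero>\<^sub>?H, s) \<oplus>\<^bsub>cind ?T\<^esub> (\<zero>\<^sub>?H, s'))" by (simp add: cind_simps)
   also have "\<dots> = F (\<zero>\<^sub>?H, s) \<oplus>\<^sub>W F (\<zero>\<^sub>?H, s')"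
    using add by (intro hom_add[OF a(5)]) (simp_all add: cind_simps)
   finally show ?case using add \<omega>V by (simp add: \<omega>a hom_add[OF a(3)])
  next
   case zero
   show ?case using \<omega>0 hom_zero[OF a(1,2,3)] hom_zero[OF cind_left_module[OF lT] a(2,5)] by (simp add: cind_simps)
  qed
  have "g (F' p) = F p" if "p \<in> carrier (cind ?T)" for p
  proof -
   obtain h s where p: "p = (h, s)" "h \<in> carrier ?H" "s \<in> carrier ?T" using \<open>p \<in> carrier (cind ?T)\<close> by (auto simp: cind_simps)
   have "F p = F ((h, \<zero>\<^sub>?T) \<oplus>\<^bsub>cind ?T\<^esub> (\<zero>\<^sub>?H, s))" using p by (simp add: cind_simps)
   also have "\<dots> = F (h, \<zero>\<^sub>?T) \<oplus>\<^sub>W F (\<zero>\<^sub>?H, s)"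
    using p by (intro hom_add[OF a(5)]) (simp_all add: cind_simps)
   also have "F (h, \<zero>\<^sub>?T) = g (P h)"
    using h0(2)[OF hom_closed[OF iso_hom[OF ui(1)] p(2)]] ui(3)[OF p(2)] by (simp add: P_def)
   finally show ?thesis using p PV \<omega>V g\<omega>[OF p(3)] by (simp add: F'_def hom_add[OF a(3)])
  qed
  then show "\<exists>h\<in>lmod_hom L (cind ?T) V. \<forall>p\<in>carrier (cind ?T). g (h p) = F p" using F' by blast
 qed
qed

text \<open>
 Coinduction is exact on \<open>(inj B)\<^sup><\<^sup>\<infinity>\<close> and preserves injectives, so it carries an injective resolution of \<open>Y\<close> to one
 of \<open>cind Y\<close>.
\<close>

lemma cind_id:
 fixes Y :: "('b, 'b fg_carrier) module"
 assumes E: "induces_equivalence A B M"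
 shows "fin_inj_dim B Y \<Longrightarrow> id_lt B n Y \<Longrightarrow> id_lt L n (cind Y)"
proof (induction n arbitrary: Y)
 case (0 Y)
 have Y: "left_module B Y" using 0 by (simp add: fin_inj_dim_def fg_module_def)
 have z: "carrier Y = {\<zero>\<^sub>Y}" using 0 id_lt_0[OF Y] by simp
 interpret H: left_module A "hom_module B M Y" by (rule hom_module_left_module[OF bimodule_M Y])
 have "h = \<zero>\<^bsub>hom_module B M Y\<^esub>" if h: "h \<in> carrier (hom_module B M Y)" for h
 proof (rule hom_module_ext[OF h H.M.zero_closed])
  fix m assume m: "m \<in> carrier M"
  have "h \<in> lmod_hom B M Y" using h by (simp add: hom_module_simps)
  then have "h m \<in> carrier Y" using m by (rule hom_closed)
  then show "h m = \<zero>\<^bsub>hom_module B M Y\<^esub> m" using m z by (simp add: hom_module_simps)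
 qed
 then have "carrier (hom_module B M Y) = {\<zero>\<^bsub>hom_module B M Y\<^esub>}" using H.M.zero_closed by blast
 then show ?case using id_lt_0[OF cind_left_module[OF Y]] z by (simp add: cind_simps)
next
 case (Suc n Y)
 have Y: "left_module B Y" using Suc.prems by (simp add: fin_inj_dim_def fg_module_def)
 from Y Suc.prems(2) obtain J C :: "('b, 'b fg_carrier) module" and k p where s: "ses B Y J C k p"
  "finitely_generated B J" "injective_module B J" "id_lt B n C" by (elim id_lt_SucE)
 note s' = sesD[OF s(1)]
 have J: "fin_inj_dim B J"
  using injective_id_lt_1[OF s(3,2)] s'(2) s(2) by (auto simp: fin_inj_dim_iff fg_module_def)
 have C: "fin_inj_dim B C"
  using finitely_generated_image[OF s'(2,3,6,7) s(2)] s'(3) s(4) by (auto simp: fin_inj_dim_iff fg_module_def)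
 have ex: "\<exists>k' \<in> carrier (hom_module B M J). \<forall>m \<in> carrier M. p (k' m) = h m"
  if h: "h \<in> carrier (hom_module B M C)" for h
 proof -
  have "h \<in> lmod_hom B M C" using h by (simp add: hom_module_simps)
  then show ?thesis using equivalence_hom_exact[OF E bimodule_M s(1) Suc.prems(1) J C] by metis
 qed
 have "fg_module A (hom_module B M J)"
  using equivalence_counit(2)[OF E bimodule_M J] by (simp add: fin_proj_dim_def)
 then have fg: "finitely_generated L (cind J)" using s(2) by (intro cind_fg s') (simp add: fg_module_def)
 show ?case
  by (rule id_lt_SucI[OF cind_ses[OF s(1) ex] fg cind_injective[OF s(3)] Suc.IH[OF C s(4)]])
qed

text \<open>
 The projective presentation \<open>P \<rightarrow> Hom(M, Y)\<close> gives by adjunction a surjection \<open>M \<otimes> P \<rightarrow> Y\<close> whose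
 kernel \<open>Z\<close> again has finite injective dimension, and \<open>Hom(M, Z)\<close> is the syzygy of \<open>Hom(M, Y)\<close>.
\<close>

lemma cind_pd:
 fixes Y :: "('b, 'b fg_carrier) module"
 assumes E: "induces_equivalence A B M"
  and noeth: "\<And>(Y :: ('b, 'b fg_carrier) module) U. fg_module B Y \<Longrightarrow> submod B Y U \<Longrightarrow>
   finitely_generated B (sub Y U)"
 shows "fin_inj_dim B Y \<Longrightarrow> pd_lt A n (hom_module B M Y) \<Longrightarrow> pd_lt L n (cind Y)"
proof (induction n arbitrary: Y)
 case (0 Y)
 have Y: "left_module B Y" using 0 by (simp add: fin_inj_dim_def fg_module_def)
 interpret Y: left_module B Y by fact
 have h: "carrier (hom_module B M Y) = {\<zero>\<^bsub>hom_module B M Y\<^esub>}"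
  using 0 pd_lt_0[OF hom_module_left_module[OF bimodule_M Y]] by simp
 have "{\<zero>\<^sub>Y} = carrier Y"
  by (rule equivalence_counit(4)[OF E bimodule_M 0(1) Y.submod_zero]) (simp add: h hom_module_simps(2))
 then show ?case using pd_lt_0[OF cind_left_module[OF Y]] h by (auto simp: cind_simps)
next
 case (Suc n Y)
 have Y: "left_module B Y" using Suc.prems by (simp add: fin_inj_dim_def fg_module_def)
 let ?HY = "hom_module B M Y"
 note lHY = hom_module_left_module[OF bimodule_M Y]
 from lHY Suc.prems(2) obtain K P :: "('a, 'a fg_carrier) module" and k p where s: "ses A K P ?HY k p"
  "finitely_generated A P" "projective_module A P" "pd_lt A n K" by (elim pd_lt_SucE)
 note s' = sesD[OF s(1)]
 have P: "fin_proj_dim A P"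
  using projective_pd_lt_1[OF s(3,2)] s'(2) s(2) by (auto simp: fin_proj_dim_iff fg_module_def)
 note un = equivalence_unit[OF E bimodule_M P]
 interpret t: tensor_pair A B M P by (rule un(1))
 let ?T = "tensor_module A M P"
 note lT = t.T_left_module
 interpret T: left_module B ?T by (rule lT)
 obtain q where q: "q \<in> lmod_hom B ?T Y" "\<And>m x. m \<in> carrier M \<Longrightarrow> x \<in> carrier P \<Longrightarrow> q (t.pt m x) = p x m"
  by (rule tensor_eval[OF un(1) Y s'(6)]) (rule that)
 have sq: "submod B Y (q ` carrier ?T)" by (rule submod_image[OF lT Y q(1) T.submod_carrier])
 have qs: "q ` carrier ?T = carrier Y"
 proof (rule equivalence_counit(4)[OF E bimodule_M Suc.prems(1) sq])
  fix h m assume a: "h \<in> carrier ?HY" "m \<in> carrier M"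
  obtain x where x: "x \<in> carrier P" "p x = h" using s'(11)[OF a(1)] by blast
  have "h m = q (t.pt m x)" using q(2)[OF a(2) x(1)] x by simp
  moreover have "t.pt m x \<in> carrier ?T" using a x by simp
  ultimately show "h m \<in> q ` carrier ?T" by simp
 qed
 obtain W :: "('b, 'b fg_carrier) module" and \<theta> where W: "fg_module B W" "\<theta> \<in> lmod_iso B ?T W"
  using fg_module_copy[of B ?T] un(2) unfolding fin_inj_dim_def by blast
 have lW: "left_module B W" using W by (simp add: fg_module_def)
 define \<theta>' where "\<theta>' = inv_into (carrier ?T) \<theta>"
 note \<theta>' = iso_inverse[OF W(2) lT, folded \<theta>'_def]
 have q': "(\<lambda>w. q (\<theta>' w)) \<in> lmod_hom B W Y" by (rule hom_comp[OF iso_hom[OF \<theta>'(1)] q(1)])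
 have "(\<lambda>w. q (\<theta>' w)) ` carrier W = carrier Y" using iso_surj[OF \<theta>'(1)] qs by (metis image_image)
 note kq = ses_kernel[OF lW Y q' this]
 let ?Z = "sub W (mod_kernel W Y (\<lambda>w. q (\<theta>' w)))"
 have smZ: "submod B W (mod_kernel W Y (\<lambda>w. q (\<theta>' w)))" by (rule submod_kernel[OF lW Y q'])
 have lZ: "left_module B ?Z" by (rule sesD(1)[OF kq])
 obtain i where "id_lt B i ?T" using un(2) by (auto simp: fin_inj_dim_iff)
 then have "id_lt B i W" using id_lt_iso[OF \<theta>'(1)] by blast
 moreover obtain j where "id_lt B j Y" using Suc.prems(1) by (auto simp: fin_inj_dim_iff)
 ultimately have "\<exists>k. id_lt B k ?Z" using id_kernel[OF kq] by blast
 then have Z: "fin_inj_dim B ?Z" using noeth[OF W(1) smZ] lZ by (simp add: fin_inj_dim_iff fg_module_def)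
 have \<theta>'Z: "\<theta>' \<in> lmod_hom B ?Z ?T" by (rule hom_restrict[OF iso_hom[OF \<theta>'(1)] submodD(1)[OF smZ]])
 have \<theta>c: "\<theta> x \<in> carrier W" if "x \<in> carrier ?T" for x using hom_closed[OF iso_hom[OF W(2)] that] .
 have zT: "ses B ?Z ?T Y \<theta>' q"
 proof (rule sesI[OF lZ lT Y \<theta>'Z _ q(1)])
  show "w = \<zero>\<^sub>?Z" if "w \<in> carrier ?Z" "\<theta>' w = \<zero>\<^sub>?T" for w
   using that \<theta>'(3)[of w] hom_zero[OF lT lW iso_hom[OF W(2)]] by (simp add: mod_kernel_def)
  show "\<exists>t\<in>carrier ?T. q t = y" if "y \<in> carrier Y" for y
  proof -
   have "y \<in> q ` carrier ?T" using qs that by simp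
   then show ?thesis by auto
  qed
  show "q (\<theta>' w) = \<zero>\<^sub>Y" if "w \<in> carrier ?Z" for w using that by (simp add: mod_kernel_def)
  show "\<exists>w\<in>carrier ?Z. x = \<theta>' w" if x: "x \<in> carrier ?T" "q x = \<zero>\<^sub>Y" for x
   using \<theta>'(2)[OF x(1)] \<theta>c[OF x(1)] x(2) by (intro bexI[of _ "\<theta> x"]) (simp_all add: mod_kernel_def)
 qed
 define u where "u = adj_unit A M P"
 have u: "u \<in> lmod_iso A P (hom_module B M ?T)" using un(5) by (simp add: u_def)
 have um: "u x m = t.pt m x" if "m \<in> carrier M" for x m using that by (simp add: u_def adj_unit_def)
 have uc: "u x \<in> carrier (hom_module B M ?T)" if "x \<in> carrier P" for x using hom_closed[OF iso_hom[OF u] that] .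
 have ex: "\<exists>k' \<in> carrier (hom_module B M ?T). \<forall>m \<in> carrier M. q (k' m) = h m" if h: "h \<in> carrier ?HY" for h
 proof -
  obtain x where x: "x \<in> carrier P" "p x = h" using s'(11)[OF h] by blast
  have "\<forall>m \<in> carrier M. q (u x m) = h m" using x q(2) um by simp
  then show ?thesis using uc[OF x(1)] by blast
 qed
 have fgHT: "finitely_generated A (hom_module B M ?T)"
  by (rule finitely_generated_image[OF s'(2) hom_module_left_module[OF bimodule_M lT] iso_hom[OF u] iso_surj[OF u] s(2)])
 have fgT: "finitely_generated B ?T" using un(2) by (simp add: fin_inj_dim_def fg_module_def)
 have p0: "hom_map M q (u x) = \<zero>\<^sub>?HY \<longleftrightarrow> p x = \<zero>\<^sub>?HY" if x: "x \<in> carrier P" for x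
 proof -
  have "hom_map M q (u x) = p x"
   by (rule hom_module_ext[OF hom_closed[OF hom_map_hom[OF bimodule_M q(1)] uc[OF x]] hom_closed[OF s'(6) x]])
    (simp add: hom_map_def um q(2)[OF _ x])
  then show ?thesis by simp
 qed
 have "ses A (hom_module B M ?Z) (hom_module B M ?T) ?HY (hom_map M \<theta>') (hom_map M q)"
  by (rule hom_ses[OF bimodule_M zT]) (rule ex)
 from s(1) this u obtain i where "i \<in> lmod_iso A K (hom_module B M ?Z)"
  by (rule ses_kernel_iso) (erule p0, rule that)
 then have "pd_lt A n (hom_module B M ?Z)"
  by (rule pd_lt_iso[OF s'(1) hom_module_left_module[OF bimodule_M lZ] _ s(4)])
 note IH = Suc.IH[OF Z this]
 show ?case
  by (rule pd_lt_SucI[OF cind_ses[OF zT ex] cind_fg[OF lT fgHT fgT] cind_projective[OF E s(3,2)] IH])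
qed

end

section \<open>Algebras over a central subring\<close>

lemma opposite_ring_simps [simp]:
 "carrier (opposite_ring R) = carrier R" "\<zero>\<^bsub>opposite_ring R\<^esub> = \<zero>\<^sub>R" "\<one>\<^bsub>opposite_ring R\<^esub> = \<one>\<^sub>R"
 "x \<oplus>\<^bsub>opposite_ring R\<^esub> y = x \<oplus>\<^sub>R y" "x \<otimes>\<^bsub>opposite_ring R\<^esub> y = y \<otimes>\<^sub>R x"
 "opposite_ring (opposite_ring R) = R"
 by (simp_all add: opposite_ring_def)

lemma opposite_ring_ring: assumes "ring R" shows "ring (opposite_ring R)"
proof -
 interpret R: ring R by fact
 show ?thesis
 proof (rule ringI)
  show "abelian_group (opposite_ring R)"
  proof (rule abelian_groupI)
   show "\<exists>y\<in>carrier (opposite_ring R). y \<oplus>\<^bsub>opposite_ring R\<^esub> x = \<zero>\<^bsub>opposite_ring R\<^esub>"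
    if "x \<in> carrier (opposite_ring R)" for x
    using that R.l_neg by (intro bexI[of _ "\<ominus>\<^sub>R x"]) simp_all
  qed (simp_all add: R.a_ac)
  show "monoid (opposite_ring R)" by (rule monoidI) (simp_all add: R.m_assoc)
 qed (simp_all add: R.l_distr R.r_distr)
qed

definition central_algebra :: "('k, 'p) ring_scheme \<Rightarrow> ('k \<Rightarrow> 'r) \<Rightarrow> 'r ring \<Rightarrow> bool"
 where "central_algebra K \<eta> R \<longleftrightarrow> ring R \<and> \<eta> \<in> ring_hom K R \<and>
  (\<forall>k\<in>carrier K. \<forall>x\<in>carrier R. \<eta> k \<otimes>\<^sub>R x = x \<otimes>\<^sub>R \<eta> k)"

lemma central_algebraD:
 assumes "central_algebra K \<eta> R"
 shows "ring R" "\<And>k. k \<in> carrier K \<Longrightarrow> \<eta> k \<in> carrier R" "\<eta> \<one>\<^sub>K = \<one>\<^sub>R"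
  "\<And>s t. s \<in> carrier K \<Longrightarrow> t \<in> carrier K \<Longrightarrow> \<eta> (s \<oplus>\<^sub>K t) = \<eta> s \<oplus>\<^sub>R \<eta> t"
  "\<And>s t. s \<in> carrier K \<Longrightarrow> t \<in> carrier K \<Longrightarrow> \<eta> (s \<otimes>\<^sub>K t) = \<eta> s \<otimes>\<^sub>R \<eta> t"
  "\<And>k x. k \<in> carrier K \<Longrightarrow> x \<in> carrier R \<Longrightarrow> \<eta> k \<otimes>\<^sub>R x = x \<otimes>\<^sub>R \<eta> k"
 using assms unfolding central_algebra_def ring_hom_def by (blast+)

lemma central_algebra_opposite:
 assumes "central_algebra K \<eta> R" shows "central_algebra K \<eta> (opposite_ring R)"
 unfolding central_algebra_def
proof (intro conjI ballI opposite_ring_ring)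
 note R = central_algebraD[OF assms]
 show "ring R" by (rule R(1))
 show "\<eta> \<in> ring_hom K (opposite_ring R)"
  using R(2-5) R(6)[OF _ R(2)] by (auto simp: ring_hom_def)
 show "\<eta> k \<otimes>\<^bsub>opposite_ring R\<^esub> x = x \<otimes>\<^bsub>opposite_ring R\<^esub> \<eta> k"
  if "k \<in> carrier K" "x \<in> carrier (opposite_ring R)" for k x
  using R(6)[of k x] that by simp
qed

text \<open>
 With a left \<open>R\<close>-module seen as a bimodule over \<open>K\<close> and the opposite of \<open>R\<close>, its dual over \<open>K\<close> becomes a case of
 \<open>hom_module\<close>, which gives it the structure of a left module over the opposite ring.
\<close>

definition op_bimodule :: "('k \<Rightarrow> 'r) \<Rightarrow> ('r, 'x, 'q) module_scheme \<Rightarrow> ('k, 'x, 'r) bimodule"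
 where "op_bimodule \<eta> X = \<lparr>carrier = carrier X, mult = undefined, one = undefined, zero = \<zero>\<^sub>X,
  add = add X, smult = (\<lambda>k x. \<eta> k \<odot>\<^sub>X x), rsmult = (\<lambda>x r. r \<odot>\<^sub>X x)\<rparr>"

lemma op_bimodule_simps [simp]:
 "carrier (op_bimodule \<eta> X) = carrier X" "\<zero>\<^bsub>op_bimodule \<eta> X\<^esub> = \<zero>\<^sub>X"
 "x \<oplus>\<^bsub>op_bimodule \<eta> X\<^esub> y = x \<oplus>\<^sub>X y" "k \<odot>\<^bsub>op_bimodule \<eta> X\<^esub> x = \<eta> k \<odot>\<^sub>X x" "x \<triangleleft>\<^bsub>op_bimodule \<eta> X\<^esub> r = r \<odot>\<^sub>X x"
 by (simp_all add: op_bimodule_def)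

lemma op_bimodule_bimodule:
 assumes K: "ring K" and R: "central_algebra K \<eta> R" and X: "left_module R X"
 shows "bimodule K (opposite_ring R) (op_bimodule \<eta> X)"
proof -
 interpret K: ring K by fact
 interpret X: left_module R X by fact
 note R' = central_algebraD[OF R]
 have 0: "\<eta> \<zero>\<^sub>K = \<zero>\<^sub>R" using R'(4)[of "\<zero>\<^sub>K" "\<zero>\<^sub>K"] R'(2)[of "\<zero>\<^sub>K"] by (simp add: X.R.add.r_cancel_one')
 have l: "left_module K (op_bimodule \<eta> X)"
  by (rule left_moduleI[OF K]) (simp_all add: R'(2-5) 0 X.M.a_ac X.smult_l_distr X.smult_r_distr X.smult_assoc1)
 show ?thesis
 proof (intro bimodule.intro l opposite_ring_ring R'(1) bimodule_axioms.intro)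
  fix k x r assume "k \<in> carrier K" "x \<in> carrier (op_bimodule \<eta> X)" "r \<in> carrier (opposite_ring R)"
  then show "(k \<odot>\<^bsub>op_bimodule \<eta> X\<^esub> x) \<triangleleft>\<^bsub>op_bimodule \<eta> X\<^esub> r = k \<odot>\<^bsub>op_bimodule \<eta> X\<^esub> (x \<triangleleft>\<^bsub>op_bimodule \<eta> X\<^esub> r)"
   using R'(2,6) by (simp add: X.smult_assoc1[symmetric])
 qed (simp_all add: X.smult_l_distr X.smult_r_distr X.smult_assoc1)
qed

lemma op_bimodule_left:
 "ring K \<Longrightarrow> central_algebra K \<eta> R \<Longrightarrow> left_module R X \<Longrightarrow> left_module K (op_bimodule \<eta> X)"
 by (rule bimodule.axioms(1)[OF op_bimodule_bimodule])

lemma op_bimodule_hom: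
 assumes "central_algebra K \<eta> R" "h \<in> lmod_hom R X Y"
 shows "h \<in> lmod_hom K (op_bimodule \<eta> X) (op_bimodule \<eta> Y)"
 using hom_closed[OF assms(2)] hom_add[OF assms(2)] hom_smult[OF assms(2)] central_algebraD(2)[OF assms(1)]
 by (intro lmod_homI) simp_all

lemma submod_op_bimodule:
 "central_algebra K \<eta> R \<Longrightarrow> submod R X U \<Longrightarrow> submod K (op_bimodule \<eta> X) U"
 using central_algebraD(2)[of K \<eta> R] by (auto simp: submod_def)

lemma fg_op_bimodule:
 assumes K: "ring K" and R: "central_algebra K \<eta> R" and X: "left_module R X" and fg: "finitely_generated K (op_bimodule \<eta> X)"
 shows "finitely_generated R X"
proof -
 note l = op_bimodule_left[OF K R X]
 obtain S where S: "finite S" "S \<subseteq> carrier (op_bimodule \<eta> X)"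
  "\<And>U. submod K (op_bimodule \<eta> X) U \<Longrightarrow> S \<subseteq> U \<Longrightarrow> U = carrier (op_bimodule \<eta> X)"
  by (rule finitely_generatedE[OF l fg]) (rule that)
 show ?thesis
  by (rule finitely_generatedI[OF X S(1)]) (use S(2) S(3)[OF submod_op_bimodule[OF R]] in auto)
qed

section \<open>Noetherian modules\<close>

definition noeth :: "('r, 'p) ring_scheme \<Rightarrow> ('r, 'x, 'q) module_scheme \<Rightarrow> bool"
 where "noeth R X \<longleftrightarrow> left_module R X \<and> (\<forall>U. submod R X U \<longrightarrow> finitely_generated R (sub X U))"

lemma noethD: "noeth R X \<Longrightarrow> left_module R X"
 "noeth R X \<Longrightarrow> submod R X U \<Longrightarrow> finitely_generated R (sub X U)"
 by (auto simp: noeth_def)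

lemma noeth_fg: assumes "noeth R X" shows "finitely_generated R X"
proof -
 interpret X: left_module R X using assms by (rule noethD)
 have "finitely_generated R (sub X (carrier X))" by (rule noethD(2)[OF assms X.submod_carrier])
 then show ?thesis by simp
qed

lemma noeth_image:
 assumes X: "noeth R X" and Y: "left_module R Y" and h: "h \<in> lmod_hom R X Y"
  and s: "h ` carrier X = carrier Y"
 shows "noeth R Y"
 unfolding noeth_def
proof (intro conjI Y allI impI)
 fix U assume U: "submod R Y U"
 note lX = noethD(1)[OF X]
 interpret X: left_module R X by fact
 interpret Y: left_module R Y by fact
 let ?V = "{x \<in> carrier X. h x \<in> U}"
 have V: "submod R X ?V" by (rule submod_vimage[OF lX Y h U])
 have hV: "h ` ?V = U" unfolding s[symmetric] using s submodD(1)[OF U] by auto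
 show "finitely_generated R (sub Y U)"
 proof (rule finitely_generated_image[OF X.submod_left_module[OF V] Y.submod_left_module[OF U] _ _ noethD(2)[OF X V]])
  show "h \<in> lmod_hom R (sub X ?V) (sub Y U)"
   using hV by (intro hom_into_sub hom_restrict[OF h] submodD(1)[OF V]) simp
 qed (use hV in simp)
qed

text \<open>
 A finitely generated image together with a finitely generated kernel gives finitely many generators, and
 both conditions are inherited by submodules.
\<close>

lemma noeth_ext:
 assumes X: "left_module R X" and Y: "noeth R Y" and f: "f \<in> lmod_hom R X Y"
  and ker: "noeth R (sub X (mod_kernel X Y f))"
 shows "noeth R X"
 unfolding noeth_def
proof (intro conjI X allI impI)
 fix U assume U: "submod R X U"
 note lY = noethD(1)[OF Y]
 interpret X: left_module R X by fact
 interpret Y: left_module R Y by fact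
 note U' = submodD[OF U]
 have k: "submod R X (mod_kernel X Y f)" by (rule submod_kernel[OF X lY f])
 have fU: "submod R Y (f ` U)" by (rule submod_image[OF X lY f U])
 have kU: "submod R (sub X (mod_kernel X Y f)) (U \<inter> mod_kernel X Y f)"
  using X.submod_Int[OF U k] by (simp add: submod_sub[OF k])
 have lU: "left_module R (sub X U)" by (rule X.submod_left_module[OF U])
 obtain S where S: "finite S" "S \<subseteq> f ` U" "\<And>V. submod R (sub Y (f ` U)) V \<Longrightarrow> S \<subseteq> V \<Longrightarrow> V = f ` U"
  using finitely_generatedE[OF Y.submod_left_module[OF fU] noethD(2)[OF Y fU]] by auto
 obtain T where T: "finite T" "T \<subseteq> U" "S = f ` T" using finite_subset_image[OF S(1,2)] by blast
 have "finitely_generated R (sub X (U \<inter> mod_kernel X Y f))" using noethD(2)[OF ker kU] by simp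
 then obtain T0 where T0: "finite T0" "T0 \<subseteq> U \<inter> mod_kernel X Y f"
  "\<And>V. submod R (sub X (U \<inter> mod_kernel X Y f)) V \<Longrightarrow> T0 \<subseteq> V \<Longrightarrow> V = U \<inter> mod_kernel X Y f"
  using finitely_generatedE[OF X.submod_left_module[OF X.submod_Int[OF U k]]] by auto
 show "finitely_generated R (sub X U)"
 proof (rule finitely_generatedI[OF lU, of "T \<union> T0"])
  fix V assume V: "submod R (sub X U) V" "T \<union> T0 \<subseteq> V"
  have VX: "submod R X V" "V \<subseteq> U" using V by (auto simp: submod_sub[OF U])
  have "submod R (sub Y (f ` U)) (f ` V)"
   using submod_image[OF X lY f VX(1)] VX(2) by (auto simp: submod_sub[OF fU])
  moreover have "S \<subseteq> f ` V" using V(2) T(3) by auto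
  ultimately have 1: "f ` V = f ` U" by (rule S(3))
  have "submod R (sub X (U \<inter> mod_kernel X Y f)) (V \<inter> (U \<inter> mod_kernel X Y f))"
   using X.submod_Int[OF VX(1) X.submod_Int[OF U k]] by (auto simp: submod_sub[OF X.submod_Int[OF U k]])
  then have "V \<inter> (U \<inter> mod_kernel X Y f) = U \<inter> mod_kernel X Y f" using V(2) T0(2) by (intro T0(3)) auto
  then have 2: "U \<inter> mod_kernel X Y f \<subseteq> V" by blast
  show "carrier (sub X U) \<subseteq> V"
  proof
   fix u assume "u \<in> carrier (sub X U)"
   then have u: "u \<in> U" "u \<in> carrier X" using U'(2) by auto
   then have "f u \<in> f ` V" using 1 by blast
   then obtain v where v: "v \<in> V" "f v = f u" by auto
   have vX: "v \<in> carrier X" "v \<in> U" using v VX U'(2) by auto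
   have "u \<oplus>\<^sub>X \<ominus>\<^sub>X v \<in> U" using U'(4)[OF u(1) X.submod_minus[OF U vX(2)]] .
   moreover have "u \<oplus>\<^sub>X \<ominus>\<^sub>X v \<in> mod_kernel X Y f"
    using u vX v hom_closed[OF f] by (simp add: mod_kernel_def hom_add[OF f] hom_minus[OF X lY f] Y.M.r_neg)
   ultimately have "v \<oplus>\<^sub>X (u \<oplus>\<^sub>X \<ominus>\<^sub>X v) \<in> V" using 2 v submodD(4)[OF VX(1)] by blast
   then show "u \<in> V" using X.add_diff_cancel[OF u(2) vX(1)] by simp
  qed
 qed (use T T0 in auto)
qed

lemma noeth_trivial:
 assumes X: "left_module R X" and z: "carrier X = {\<zero>\<^sub>X}" shows "noeth R X"
 unfolding noeth_def
proof (intro conjI X allI impI)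
 fix U assume U: "submod R X U"
 interpret X: left_module R X by fact
 have "U = {\<zero>\<^sub>X}" using submodD(1,3)[OF U] z by auto
 then show "finitely_generated R (sub X U)"
  by (intro trivial_module(1) X.submod_left_module[OF U]) simp
qed

lemma noeth_same_carrier:
 assumes X: "noeth K X" and Y: "left_module K Y" and c: "carrier Y = carrier X"
  and a: "\<And>x y. x \<in> carrier X \<Longrightarrow> y \<in> carrier X \<Longrightarrow> x \<oplus>\<^sub>Y y = x \<oplus>\<^sub>X y"
  and s: "\<And>k x. k \<in> carrier K \<Longrightarrow> x \<in> carrier X \<Longrightarrow> k \<odot>\<^sub>Y x = k \<odot>\<^sub>X x"
 shows "noeth K Y"
proof (rule noeth_image[OF X Y, of "\<lambda>x. x"])
 show "(\<lambda>x. x) \<in> lmod_hom K X Y" by (rule lmod_homI) (simp_all add: a c s)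
qed (simp add: c)

text \<open>
 Induction on the number of generators: adjoining one to a submodule gives an extension of a quotient of \<open>R\<close>.
\<close>

lemma noeth_op_bimodule:
 fixes R :: "'r ring" and X :: "('r, 'x, 'q) module_scheme"
 assumes K: "ring K" and R: "central_algebra K \<eta> R" and n: "noeth K (op_bimodule \<eta> (reg R))"
  and X: "left_module R X" and fg: "finitely_generated R X"
 shows "noeth K (op_bimodule \<eta> X)"
proof -
 interpret X: left_module R X by fact
 have lR: "left_module R (reg R)" by (rule reg_left_module[OF X.R.ring_axioms])
 note cl = op_bimodule_left[OF K R]
 obtain S where S: "finite S" "S \<subseteq> carrier X" "\<And>U. submod R X U \<Longrightarrow> S \<subseteq> U \<Longrightarrow> U = carrier X"
  using finitely_generatedE[OF X fg] by blast
 have "noeth K (op_bimodule \<eta> (sub X (span R X T)))" if "finite T" "T \<subseteq> carrier X" for T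
  using that
 proof (induction T rule: finite_induct)
  case empty
  have "span R X {} = {\<zero>\<^sub>X}"
   using span_least[OF X.submod_zero, of "{}"] submodD(3)[OF X.submod_span[of "{}"]] by auto
  then show ?case using noeth_trivial[OF cl[OF X.submod_left_module[OF X.submod_zero]]] by simp
 next
  case (insert s T)
  let ?N = "span R X T" and ?N' = "span R X (insert s T)"
  have N: "submod R X ?N" and N': "submod R X ?N'" using insert by (auto intro: X.submod_span)
  have NN: "?N \<subseteq> ?N'" using span_superset[of "insert s T" R X] by (intro span_least[OF N']) auto
  have NN': "submod R (sub X ?N') ?N" using N NN by (simp add: submod_sub[OF N'])
  have lN': "left_module R (sub X ?N')" by (rule X.submod_left_module[OF N'])
  obtain Q :: "('r, 'x set) module" and p where Q: "left_module R Q" "p \<in> lmod_hom R (sub X ?N') Q"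
   "p ` carrier (sub X ?N') = carrier Q" "\<And>x. x \<in> carrier (sub X ?N') \<Longrightarrow> p x = \<zero>\<^sub>Q \<longleftrightarrow> x \<in> ?N"
   by (rule quotient_module[OF lN' NN']) (rule that)
  interpret Q: left_module R Q by (rule Q(1))
  have ps: "p s \<in> carrier Q" using hom_closed[OF Q(2)] span_superset[of "insert s T" R X] by auto
  let ?I = "(\<lambda>r. r \<odot>\<^sub>Q p s) ` carrier R"
  have I: "submod R Q ?I"
   using submod_image[OF lR Q(1) hom_from_reg[OF Q(1) ps] left_module.submod_carrier[OF lR]] by simp
  have sm: "submod R X {x \<in> ?N'. p x \<in> ?I}"
   using submod_vimage[OF lN' Q(1,2) I] by (simp add: submod_sub[OF N'])
  have "p s = \<one>\<^sub>R \<odot>\<^sub>Q p s" using ps by simp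
  then have "p s \<in> ?I" using X.R.one_closed by blast
  moreover have "p t \<in> ?I" if "t \<in> T" for t
  proof -
   have "t \<in> ?N" using span_superset[of T R X] that by blast
   then have "p t = \<zero>\<^sub>Q" using Q(4)[of t] NN by auto
   then show ?thesis using submodD(3)[OF I] by simp
  qed
  ultimately have "insert s T \<subseteq> {x \<in> ?N'. p x \<in> ?I}" using span_superset[of "insert s T" R X] by auto
  then have "?N' \<subseteq> {x \<in> ?N'. p x \<in> ?I}" by (rule span_least[OF sm])
  then have "carrier Q \<subseteq> ?I" unfolding Q(3)[symmetric] by auto
  then have s: "(\<lambda>r. r \<odot>\<^sub>Q p s) ` carrier (op_bimodule \<eta> (reg R)) = carrier (op_bimodule \<eta> Q)"
   using submodD(1)[OF I] by auto
  have "noeth K (op_bimodule \<eta> Q)"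
   by (rule noeth_image[OF n cl[OF Q(1)] op_bimodule_hom[OF R hom_from_reg[OF Q(1) ps]] s])
  moreover have "mod_kernel (op_bimodule \<eta> (sub X ?N')) (op_bimodule \<eta> Q) p = ?N"
   using Q(4) NN by (auto simp: mod_kernel_def)
  then have "sub (op_bimodule \<eta> (sub X ?N')) (mod_kernel (op_bimodule \<eta> (sub X ?N')) (op_bimodule \<eta> Q) p) =
   op_bimodule \<eta> (sub X ?N)" by (simp add: op_bimodule_def)
  ultimately show ?case
   using noeth_ext[OF cl[OF lN'] _ op_bimodule_hom[OF R Q(2)]] insert.IH insert.prems by simp
 qed
 from this[OF S(1,2)] S(3)[OF X.submod_span[OF S(2)] span_superset] show ?thesis by simp
qed

text \<open>
 A strictly monotone bounded rank on the submodules bounds the length of chains, so it makes the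
 module noetherian.
\<close>

lemma rank_noeth:
 assumes X: "left_module R X" and b: "\<And>U. \<rho> U \<le> (n :: nat)"
  and m: "\<And>U V. submod R X U \<Longrightarrow> submod R X V \<Longrightarrow> U \<subset> V \<Longrightarrow> \<rho> U < \<rho> V"
 shows "noeth R X"
 unfolding noeth_def
proof (intro conjI X allI impI)
 fix U assume U: "submod R X U"
 interpret X: left_module R X by fact
 have sp: "submod R X (span R X S)" if "S \<subseteq> U" for S using that submodD(1)[OF U] by (intro X.submod_span) blast
 have "finite {} \<and> {} \<subseteq> U" by simp
 moreover have "\<forall>S. finite S \<and> S \<subseteq> U \<longrightarrow> \<rho> (span R X S) < Suc n" using b by (simp add: less_Suc_eq_le)
 ultimately obtain S where S: "finite S \<and> S \<subseteq> U"
  and max: "\<forall>T. finite T \<and> T \<subseteq> U \<longrightarrow> \<rho> (span R X T) \<le> \<rho> (span R X S)"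
  using ex_has_greatest_nat[of "\<lambda>S. finite S \<and> S \<subseteq> U" "{}" "\<lambda>S. \<rho> (span R X S)" "Suc n"] by blast
 have "x \<in> span R X S" if x: "x \<in> U" for x
 proof (rule ccontr)
  assume no: "x \<notin> span R X S"
  have i: "insert x S \<subseteq> U" using x S by simp
  have "S \<subseteq> span R X (insert x S)" "x \<in> span R X (insert x S)" using span_superset[of "insert x S" R X] by auto
  then have "span R X S \<subset> span R X (insert x S)" using span_least[OF sp[OF i]] no by blast
  then have "\<rho> (span R X S) < \<rho> (span R X (insert x S))" using S i by (intro m sp) auto
  then show False using max S i by (meson finite_insert leD)
 qed
 then have "span R X S = U" using span_least[OF U] S by blast
 then show "finitely_generated R (sub X U)" using span_fg[OF X, of S] S submodD(1)[OF U] by auto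
qed

section \<open>Commutative artinian rings\<close>

definition max_ideal :: "('k, 'p) ring_scheme \<Rightarrow> 'k set \<Rightarrow> bool"
 where "max_ideal K m \<longleftrightarrow> submod K (reg K) m \<and> \<one>\<^sub>K \<notin> m \<and>
  (\<forall>r\<in>carrier K. r \<notin> m \<longrightarrow> (\<exists>s\<in>carrier K. \<exists>a\<in>m. \<one>\<^sub>K = s \<otimes>\<^sub>K r \<oplus>\<^sub>K a))"

lemma max_idealD:
 assumes "max_ideal K m"
 shows "submod K (reg K) m" "\<one>\<^sub>K \<notin> m" "\<And>a. a \<in> m \<Longrightarrow> a \<in> carrier K"
  "\<And>r. r \<in> carrier K \<Longrightarrow> r \<notin> m \<Longrightarrow> \<exists>s\<in>carrier K. \<exists>a\<in>m. \<one>\<^sub>K = s \<otimes>\<^sub>K r \<oplus>\<^sub>K a"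
 using assms submodD(2)[of K "reg K" m] by (auto simp: max_ideal_def)

lemma max_ideal_exists:
 assumes K: "ring K" and I: "submod K (reg K) I" "\<one>\<^sub>K \<notin> I"
 obtains m where "max_ideal K m" "I \<subseteq> m"
proof -
 have lK: "left_module K (reg K)" by (rule reg_left_module[OF K])
 interpret KK: left_module K "reg K" by fact
 obtain m where m: "submod K (reg K) m" "I \<subseteq> m" "m \<inter> {\<one>\<^sub>K} = {}"
  "\<And>r. r \<in> carrier (reg K) \<Longrightarrow> r \<notin> m \<Longrightarrow> \<exists>p\<in>m. \<exists>s\<in>carrier K. p \<oplus>\<^bsub>reg K\<^esub> s \<odot>\<^bsub>reg K\<^esub> r \<in> {\<one>\<^sub>K}"
  by (rule maximal_avoiding[OF lK I(1), of "{\<one>\<^sub>K}"]) (use I(2) in simp, rule that)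
 have "\<exists>s\<in>carrier K. \<exists>a\<in>m. \<one>\<^sub>K = s \<otimes>\<^sub>K r \<oplus>\<^sub>K a" if r: "r \<in> carrier K" "r \<notin> m" for r
 proof -
  obtain p s where ps: "p \<in> m" "s \<in> carrier K" "\<one>\<^sub>K = p \<oplus>\<^sub>K s \<otimes>\<^sub>K r" using m(4)[of r] r by auto
  moreover have "p \<in> carrier K" using submodD(2)[OF m(1) ps(1)] by simp
  ultimately have "\<one>\<^sub>K = s \<otimes>\<^sub>K r \<oplus>\<^sub>K p" using r by (simp add: KK.R.a_comm)
  then show ?thesis using ps by blast
 qed
 then have "max_ideal K m" using m(1,3) by (auto simp: max_ideal_def)
 then show ?thesis using that m(2) by blast
qed

lemma artinian_minimal:
 fixes K :: "('k, 'p) ring_scheme"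
 assumes K: "artinian_ring K" and S: "P0 \<in> \<S>" "\<And>P. P \<in> \<S> \<Longrightarrow> submod K (reg K) P"
 obtains P where "P \<in> \<S>" "\<And>Q. Q \<in> \<S> \<Longrightarrow> Q \<subseteq> P \<Longrightarrow> Q = P"
proof -
 interpret K: cring K using K by (simp add: artinian_ring_def)
 have id: "ideal P K" if "P \<in> \<S>" for P
 proof (rule idealI[OF K.ring_axioms])
  note P = submodD[OF S(2)[OF that]]
  show "subgroup P (add_monoid K)"
  proof (rule subgroup.intro)
   fix x assume x: "x \<in> P"
   have xK: "x \<in> carrier K" using P(2)[OF x] by simp
   have "(\<ominus>\<^sub>K \<one>\<^sub>K) \<odot>\<^bsub>reg K\<^esub> x \<in> P" using x by (intro P(5)) simp_all
   then have "\<ominus>\<^sub>K x \<in> P" using xK by (simp add: K.l_minus)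
   then show "inv\<^bsub>add_monoid K\<^esub> x \<in> P" by (simp add: a_inv_def)
  qed (use P in auto)
  show l: "x \<otimes>\<^sub>K a \<in> P" if "a \<in> P" "x \<in> carrier K" for a x using P(5)[OF that(2,1)] by simp
  show "a \<otimes>\<^sub>K x \<in> P" if "a \<in> P" "x \<in> carrier K" for a x
   using l[OF that] that P(2)[OF that(1)] K.m_comm[of a x] by simp
 qed
 have "\<exists>P\<in>\<S>. \<forall>Q\<in>\<S>. Q \<subseteq> P \<longrightarrow> Q = P"
 proof (rule ccontr)
  assume "\<not> ?thesis"
  then have "\<forall>P\<in>\<S>. \<exists>Q\<in>\<S>. Q \<subset> P" by blast
  then obtain f where f: "\<And>P. P \<in> \<S> \<Longrightarrow> f P \<in> \<S> \<and> f P \<subset> P" by metis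
  define I where "I n = (f ^^ n) P0" for n
  have IS: "I n \<in> \<S>" for n by (induction n) (use S(1) f in \<open>auto simp: I_def\<close>)
  have dec: "I (Suc n) \<subset> I n" for n using f[OF IS[of n]] by (simp add: I_def)
  have "\<exists>n. \<forall>m\<ge>n. I m = I n"
   using K IS id dec unfolding artinian_ring_def by (metis psubset_imp_subset)
  then obtain n where "I (Suc n) = I n" by (meson le_SucI order_refl)
  then show False using dec[of n] by simp
 qed
 then show ?thesis using that by blast
qed

text \<open>
 A chain of \<open>n\<close> ideals leads from \<open>K\<close> down to \<open>P\<close>, and the quotient \<open>P / Q\<close> of each step is simple: it is annihilated by
 a maximal ideal, generated by the class of \<open>x\<close>, and \<open>x\<close> is a multiple of every nonzero class.
\<close>

inductive colength :: "('k, 'p) ring_scheme \<Rightarrow> nat \<Rightarrow> 'k set \<Rightarrow> bool" for K where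
 top: "colength K 0 (carrier K)"
| step: "colength K n P \<Longrightarrow> submod K (reg K) Q \<Longrightarrow> Q \<subseteq> P \<Longrightarrow> x \<in> P \<Longrightarrow> max_ideal K m \<Longrightarrow>
  (\<And>a. a \<in> m \<Longrightarrow> a \<otimes>\<^sub>K x \<in> Q) \<Longrightarrow>
  (\<And>p. p \<in> P \<Longrightarrow> \<exists>q\<in>Q. \<exists>r\<in>carrier K. p = q \<oplus>\<^sub>K r \<otimes>\<^sub>K x) \<Longrightarrow>
  (\<And>p. p \<in> P \<Longrightarrow> p \<notin> Q \<Longrightarrow> \<exists>q\<in>Q. \<exists>r\<in>carrier K. x = q \<oplus>\<^sub>K r \<otimes>\<^sub>K p) \<Longrightarrow> colength K (Suc n) Q"

lemma colength_submod: "ring K \<Longrightarrow> colength K n P \<Longrightarrow> submod K (reg K) P"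
 using left_module.submod_carrier[OF reg_left_module] by (auto elim: colength.cases)

text \<open>
 Every nonzero ideal \<open>P\<close> has a simple quotient. Otherwise \<open>m P = P\<close> for all maximal ideals \<open>m\<close>. Let
 \<open>I\<close> be minimal among the ideals with \<open>I P \<noteq> 0\<close>; it is generated by one element \<open>i\<close>, and
 \<open>m I P = I P \<noteq> 0\<close> yields \<open>m i = I\<close>. So no maximal ideal contains the annihilator of \<open>i\<close>.
\<close>

lemma simple_quotient:
 fixes K :: "('k, 'p) ring_scheme"
 assumes K: "artinian_ring K" and P: "submod K (reg K) P" "P \<noteq> {\<zero>\<^sub>K}"
 obtains Q x m where "submod K (reg K) Q" "Q \<subseteq> P" "x \<in> P" "x \<notin> Q" "max_ideal K m"
  "\<And>a. a \<in> m \<Longrightarrow> a \<otimes>\<^sub>K x \<in> Q" "\<And>p. p \<in> P \<Longrightarrow> \<exists>q\<in>Q. \<exists>r\<in>carrier K. p = q \<oplus>\<^sub>K r \<otimes>\<^sub>K x"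
  "\<And>p. p \<in> P \<Longrightarrow> p \<notin> Q \<Longrightarrow> \<exists>q\<in>Q. \<exists>r\<in>carrier K. x = q \<oplus>\<^sub>K r \<otimes>\<^sub>K p"
proof -
 interpret K: cring K using K by (simp add: artinian_ring_def)
 have lK: "left_module K (reg K)" by (rule reg_left_module[OF K.ring_axioms])
 interpret KK: left_module K "reg K" by fact
 have PK: "p \<in> carrier K" if "p \<in> P" for p using submodD(2)[OF P(1) that] by simp
 define mP where "mP m = span K (reg K) {a \<otimes>\<^sub>K p | a p. a \<in> m \<and> p \<in> P}" for m
 have "\<exists>m. max_ideal K m \<and> \<not> P \<subseteq> mP m"
 proof (rule ccontr)
  assume "\<not> ?thesis"
  then have all: "P \<subseteq> mP m" if "max_ideal K m" for m using that by blast
  define \<S> where "\<S> = {I. submod K (reg K) I \<and> (\<exists>i\<in>I. \<exists>p\<in>P. i \<otimes>\<^sub>K p \<noteq> \<zero>\<^sub>K)}"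
  obtain p where p: "p \<in> P" "p \<noteq> \<zero>\<^sub>K" using P submodD(3)[OF P(1)] by auto
  then have "\<one>\<^sub>K \<otimes>\<^sub>K p \<noteq> \<zero>\<^sub>K" using PK by simp
  then have KS: "carrier K \<in> \<S>" unfolding \<S>_def using KK.submod_carrier p(1) K.one_closed by auto
  have SS: "submod K (reg K) I" if "I \<in> \<S>" for I using that by (simp add: \<S>_def)
  obtain I where I: "I \<in> \<S>" "\<And>J. J \<in> \<S> \<Longrightarrow> J \<subseteq> I \<Longrightarrow> J = I"
   by (rule artinian_minimal[OF K KS SS]) (assumption, rule that, assumption, simp)
  from I(1) obtain i q where iq: "i \<in> I" "q \<in> P" "i \<otimes>\<^sub>K q \<noteq> \<zero>\<^sub>K" by (auto simp: \<S>_def)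
  have sI: "submod K (reg K) I" using I by (simp add: \<S>_def)
  have iK: "i \<in> carrier K" using submodD(2)[OF sI iq(1)] by simp
  have hm: "(\<lambda>r. r \<otimes>\<^sub>K i) \<in> lmod_hom K (reg K) (reg K)"
   using hom_from_reg[OF lK, of i] iK by simp
  have rep: "\<exists>a\<in>m. i = a \<otimes>\<^sub>K i" if m: "max_ideal K m" for m
  proof -
   note m' = max_idealD[OF m]
   let ?J = "(\<lambda>r. r \<otimes>\<^sub>K i) ` m"
   have J: "submod K (reg K) ?J" by (rule submod_image[OF lK lK hm m'(1)])
   have "?J \<in> \<S>"
   proof (rule ccontr)
    assume "?J \<notin> \<S>"
    then have z: "a \<otimes>\<^sub>K i \<otimes>\<^sub>K p = \<zero>\<^sub>K" if "a \<in> m" "p \<in> P" for a p using J that by (auto simp: \<S>_def)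
    have "submod K (reg K) {r \<in> carrier (reg K). r \<otimes>\<^sub>K i \<in> {\<zero>\<^bsub>reg K\<^esub>}}"
     by (rule submod_vimage[OF lK lK hm KK.submod_zero])
    moreover have "{a \<otimes>\<^sub>K p | a p. a \<in> m \<and> p \<in> P} \<subseteq> {r \<in> carrier (reg K). r \<otimes>\<^sub>K i \<in> {\<zero>\<^bsub>reg K\<^esub>}}"
    proof safe
     fix a p assume a: "a \<in> m" "p \<in> P"
     then have "a \<otimes>\<^sub>K p \<otimes>\<^sub>K i = a \<otimes>\<^sub>K i \<otimes>\<^sub>K p" using m'(3) PK iK by (simp add: K.m_ac)
     then show "a \<otimes>\<^sub>K p \<otimes>\<^sub>K i = \<zero>\<^bsub>reg K\<^esub>" using z[OF a] by simp
     show "a \<otimes>\<^sub>K p \<in> carrier (reg K)" using a m'(3) PK by simp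
    qed
    ultimately have "mP m \<subseteq> {r \<in> carrier (reg K). r \<otimes>\<^sub>K i \<in> {\<zero>\<^bsub>reg K\<^esub>}}" unfolding mP_def by (rule span_least)
    then have "q \<otimes>\<^sub>K i = \<zero>\<^sub>K" using all[OF m] iq(2) by auto
    then show False using iq PK iK by (simp add: K.m_comm)
   qed
   moreover have "?J \<subseteq> I" using submodD(5)[OF sI _ iq(1)] m'(3) by auto
   ultimately have "?J = I" by (rule I(2))
   then show ?thesis using iq(1) by auto
  qed
  let ?A = "{r \<in> carrier (reg K). r \<otimes>\<^sub>K i \<in> {\<zero>\<^bsub>reg K\<^esub>}}"
  have A: "submod K (reg K) ?A" by (rule submod_vimage[OF lK lK hm KK.submod_zero])
  have "\<one>\<^sub>K \<notin> ?A" using iq iK PK by auto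
  then obtain m where m: "max_ideal K m" "?A \<subseteq> m" using max_ideal_exists[OF K.ring_axioms A] by blast
  note m' = max_idealD[OF m(1)]
  obtain a where a: "a \<in> m" "i = a \<otimes>\<^sub>K i" using rep[OF m(1)] by blast
  have aK: "a \<in> carrier K" using m'(3)[OF a(1)] .
  have "(\<one>\<^sub>K \<oplus>\<^sub>K \<ominus>\<^sub>K a) \<otimes>\<^sub>K i = i \<oplus>\<^sub>K \<ominus>\<^sub>K (a \<otimes>\<^sub>K i)" using aK iK by (simp add: K.l_distr K.l_minus)
  also have "\<dots> = \<zero>\<^sub>K" using a(2) iK by (simp add: K.r_neg)
  finally have "\<one>\<^sub>K \<oplus>\<^sub>K \<ominus>\<^sub>K a \<in> m" using m(2) aK by auto
  then have "a \<oplus>\<^sub>K (\<one>\<^sub>K \<oplus>\<^sub>K \<ominus>\<^sub>K a) \<in> m" using submodD(4)[OF m'(1) a(1)] by simp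
  moreover have "a \<oplus>\<^sub>K (\<one>\<^sub>K \<oplus>\<^sub>K \<ominus>\<^sub>K a) = \<one>\<^sub>K" using aK K.a_lcomm[of a "\<one>\<^sub>K" "\<ominus>\<^sub>K a"] by (simp add: K.r_neg)
  ultimately show False using m'(2) by simp
 qed
 then obtain m x where m: "max_ideal K m" and x: "x \<in> P" "x \<notin> mP m" by blast
 note m' = max_idealD[OF m]
 have gen: "{a \<otimes>\<^sub>K p | a p. a \<in> m \<and> p \<in> P} \<subseteq> P" using submodD(5)[OF P(1)] m'(3) by auto
 have mPs: "submod K (reg K) (mP m)" unfolding mP_def
  using gen submodD(1)[OF P(1)] by (intro KK.submod_span) blast
 have mPP: "mP m \<subseteq> P" unfolding mP_def by (rule span_least[OF P(1) gen])
 have amP: "a \<otimes>\<^sub>K p \<in> mP m" if "a \<in> m" "p \<in> P" for a p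
  using span_superset[of "{a \<otimes>\<^sub>K p | a p. a \<in> m \<and> p \<in> P}" K "reg K"] that unfolding mP_def by blast
 have lP: "left_module K (sub (reg K) P)" by (rule KK.submod_left_module[OF P(1)])
 have "submod K (sub (reg K) P) (mP m)" using mPs mPP by (simp add: submod_sub[OF P(1)])
 moreover have "mP m \<inter> {x} = {}" using x(2) by simp
 ultimately obtain Q where Q: "submod K (sub (reg K) P) Q" "mP m \<subseteq> Q" "Q \<inter> {x} = {}"
  "\<And>p. p \<in> carrier (sub (reg K) P) \<Longrightarrow> p \<notin> Q \<Longrightarrow>
   \<exists>q\<in>Q. \<exists>r\<in>carrier K. q \<oplus>\<^bsub>sub (reg K) P\<^esub> r \<odot>\<^bsub>sub (reg K) P\<^esub> p \<in> {x}"
  by (rule maximal_avoiding[OF lP]) (rule that)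
 have QP: "submod K (reg K) Q" "Q \<subseteq> P" using Q(1) by (auto simp: submod_sub[OF P(1)])
 note Q' = submodD[OF QP(1)]
 have xK: "x \<in> carrier K" using PK x by simp
 have xQ: "\<exists>q\<in>Q. \<exists>r\<in>carrier K. x = q \<oplus>\<^sub>K r \<otimes>\<^sub>K p" if "p \<in> P" "p \<notin> Q" for p
  using Q(4)[of p] that by auto
 show ?thesis
 proof (rule that[OF QP x(1) _ m _ _ xQ])
  show "x \<notin> Q" using Q(3) by simp
  show "a \<otimes>\<^sub>K x \<in> Q" if "a \<in> m" for a using amP[OF that x(1)] Q(2) by blast
  show "\<exists>q\<in>Q. \<exists>r\<in>carrier K. p = q \<oplus>\<^sub>K r \<otimes>\<^sub>K x" if p: "p \<in> P" for p
  proof (cases "p \<in> Q")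
   case True
   then have "p = p \<oplus>\<^sub>K \<zero>\<^sub>K \<otimes>\<^sub>K x" using PK[OF p] xK by simp
   then show ?thesis using True K.zero_closed by blast
  next
   case False
   obtain q r where qr: "q \<in> Q" "r \<in> carrier K" "x = q \<oplus>\<^sub>K r \<otimes>\<^sub>K p" using xQ[OF p False] by blast
   have qK: "q \<in> carrier K" using Q'(2)[OF qr(1)] by simp
   have pK: "p \<in> carrier K" using PK[OF p] .
   have "r \<notin> m"
   proof
    assume "r \<in> m"
    then have "q \<oplus>\<^sub>K r \<otimes>\<^sub>K p \<in> Q" using amP[OF _ p] Q(2) Q'(4)[OF qr(1)] by (simp add: subset_iff)
    then show False using qr(3) Q(3) by simp
   qed
   then obtain s a where sa: "s \<in> carrier K" "a \<in> m" "\<one>\<^sub>K = s \<otimes>\<^sub>K r \<oplus>\<^sub>K a" using m'(4)[OF qr(2)] by blast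
   have aK: "a \<in> carrier K" using m'(3)[OF sa(2)] .
   have sq: "\<ominus>\<^sub>K (s \<otimes>\<^sub>K q) \<in> Q"
    using KK.submod_minus[OF QP(1) Q'(5)[OF sa(1) qr(1)]] KK.minus_as_smult[of "s \<otimes>\<^sub>K q"] sa(1) qK
    by (simp add: K.l_minus)
   have ap: "a \<otimes>\<^sub>K p \<in> Q" using amP[OF sa(2) p] Q(2) by blast
   have "p = (s \<otimes>\<^sub>K r \<oplus>\<^sub>K a) \<otimes>\<^sub>K p" using sa(3) pK by (metis K.l_one)
   also have "\<dots> = s \<otimes>\<^sub>K (r \<otimes>\<^sub>K p) \<oplus>\<^sub>K a \<otimes>\<^sub>K p" using sa(1) aK qr(2) pK by (simp add: K.l_distr K.m_assoc)
   also have "s \<otimes>\<^sub>K (r \<otimes>\<^sub>K p) = \<ominus>\<^sub>K (s \<otimes>\<^sub>K q) \<oplus>\<^sub>K s \<otimes>\<^sub>K x"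
   proof -
    have "s \<otimes>\<^sub>K x = s \<otimes>\<^sub>K q \<oplus>\<^sub>K s \<otimes>\<^sub>K (r \<otimes>\<^sub>K p)" unfolding qr(3) using sa(1) qK qr(2) pK by (simp add: K.r_distr)
    then show ?thesis using sa(1) qK qr(2) pK by (simp add: K.a_assoc[symmetric] K.l_neg)
   qed
   finally have "p = (\<ominus>\<^sub>K (s \<otimes>\<^sub>K q) \<oplus>\<^sub>K a \<otimes>\<^sub>K p) \<oplus>\<^sub>K s \<otimes>\<^sub>K x"
    using sa(1) qK aK pK xK by (simp add: K.a_ac)
   moreover have "\<ominus>\<^sub>K (s \<otimes>\<^sub>K q) \<oplus>\<^sub>K a \<otimes>\<^sub>K p \<in> Q" using Q'(4)[OF sq ap] by simp
   ultimately show ?thesis using sa(1) by blast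
  qed
 qed
qed

lemma colength_zero:
 assumes K: "artinian_ring K" obtains n where "colength K n {\<zero>\<^sub>K}"
proof -
 interpret K: cring K using K by (simp add: artinian_ring_def)
 let ?S = "{P. \<exists>n. colength K n P}"
 obtain P where P: "P \<in> ?S" "\<And>Q. Q \<in> ?S \<Longrightarrow> Q \<subseteq> P \<Longrightarrow> Q = P"
 proof (rule artinian_minimal[OF K, of "carrier K" ?S])
  show "carrier K \<in> ?S" using colength.top[of K] by blast
 qed (use colength_submod[OF K.ring_axioms] that in auto)
 obtain n where n: "colength K n P" using P(1) by blast
 have "P = {\<zero>\<^sub>K}"
 proof (rule ccontr)
  assume "P \<noteq> {\<zero>\<^sub>K}"
  then obtain Q x m where Q: "submod K (reg K) Q" "Q \<subseteq> P" "x \<in> P" "x \<notin> Q" "max_ideal K m"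
   "\<And>a. a \<in> m \<Longrightarrow> a \<otimes>\<^sub>K x \<in> Q" "\<And>p. p \<in> P \<Longrightarrow> \<exists>q\<in>Q. \<exists>r\<in>carrier K. p = q \<oplus>\<^sub>K r \<otimes>\<^sub>K x"
  "\<And>p. p \<in> P \<Longrightarrow> p \<notin> Q \<Longrightarrow> \<exists>q\<in>Q. \<exists>r\<in>carrier K. x = q \<oplus>\<^sub>K r \<otimes>\<^sub>K p"
   using simple_quotient[OF K colength_submod[OF K.ring_axioms n]] by metis
  have "colength K (Suc n) Q" by (rule colength.step[OF n Q(1,2,3,5,6,7,8)])
  then show False using P(2)[of Q] Q(2,3,4) by blast
 qed
 then show ?thesis using that n by blast
qed

text \<open>
 The rank of \<open>U\<close> counts the steps \<open>Q \<subseteq> P\<close> of the chain in which \<open>U \<inter> P\<close> is not contained in \<open>Q\<close>. Such a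
 \<open>U\<close> covers the simple quotient \<open>P / Q\<close>, so for \<open>V\<close> above \<open>U\<close> with \<open>V \<inter> Q = U \<inter> Q\<close> also \<open>V \<inter> P = U \<inter> P\<close>.
\<close>

lemma colength_rank:
 assumes K: "ring K" and c: "colength K n P"
 shows "\<exists>\<rho>. (\<forall>U. \<rho> U \<le> n) \<and> (\<forall>U V. submod K (reg K) U \<longrightarrow> submod K (reg K) V \<longrightarrow> U \<subseteq> V \<longrightarrow>
  \<rho> U \<le> \<rho> V \<and> (U \<inter> P = V \<inter> P \<longrightarrow> U \<noteq> V \<longrightarrow> \<rho> U < (\<rho> V :: nat)))"
 using c
proof (induction rule: colength.induct)
 case top
 have "U = V" if "submod K (reg K) U" "submod K (reg K) V" "U \<inter> carrier K = V \<inter> carrier K" for U V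
  using that submodD(1)[OF that(1)] submodD(1)[OF that(2)] by auto
 then show ?case by (intro exI[of _ "\<lambda>_. 0"]) blast
next
 case (step n P Q x m)
 interpret K: ring K by fact
 interpret KK: left_module K "reg K" by (rule reg_left_module[OF K])
 have P: "submod K (reg K) P" by (rule colength_submod[OF K step.hyps(1)])
 obtain \<rho> :: "_ \<Rightarrow> nat" where \<rho>: "\<And>U. \<rho> U \<le> n"
  "\<And>U V. submod K (reg K) U \<Longrightarrow> submod K (reg K) V \<Longrightarrow> U \<subseteq> V \<Longrightarrow> \<rho> U \<le> \<rho> V"
  "\<And>U V. submod K (reg K) U \<Longrightarrow> submod K (reg K) V \<Longrightarrow> U \<subseteq> V \<Longrightarrow> U \<inter> P = V \<inter> P \<Longrightarrow> U \<noteq> V \<Longrightarrow> \<rho> U < \<rho> V"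
  using step.IH by metis
 define \<sigma> where "\<sigma> U = \<rho> U + (if U \<inter> P \<subseteq> Q then 0 else 1)" for U
 have "\<sigma> U < \<sigma> V" if U: "submod K (reg K) U" and V: "submod K (reg K) V" and UV: "U \<subseteq> V"
  and eq: "U \<inter> Q = V \<inter> Q" "U \<noteq> V" for U V
 proof (cases "U \<inter> P = V \<inter> P")
  case True then show ?thesis using \<rho>(3)[OF U V UV True eq(2)] by (simp add: \<sigma>_def)
 next
  case False
  then obtain v where v: "v \<in> V" "v \<in> P" "v \<notin> U" using UV by blast
  have "u \<in> Q" if u: "u \<in> U" "u \<in> P" for u
  proof (rule ccontr)
   assume no: "u \<notin> Q"
   obtain q r where qr: "q \<in> Q" "r \<in> carrier K" "x = q \<oplus>\<^sub>K r \<otimes>\<^sub>K u" using step.hyps(8)[OF u(2) no] by blast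
   obtain q' r' where qr': "q' \<in> Q" "r' \<in> carrier K" "v = q' \<oplus>\<^sub>K r' \<otimes>\<^sub>K x" using step.hyps(7)[OF v(2)] by blast
   have c: "u \<in> carrier K" "q \<in> carrier K" "q' \<in> carrier K" "v \<in> carrier K"
    using submodD(2)[OF P] u v qr(1) qr'(1) step.hyps(3) by auto
   let ?w = "q' \<oplus>\<^sub>K r' \<otimes>\<^sub>K q" and ?t = "(r' \<otimes>\<^sub>K r) \<otimes>\<^sub>K u"
   have w: "?w \<in> Q" using submodD(4)[OF step.hyps(2) qr'(1) submodD(5)[OF step.hyps(2) qr'(2) qr(1)]] by simp
   have t: "?t \<in> U" using submodD(5)[OF U _ u(1), of "r' \<otimes>\<^sub>K r"] qr(2) qr'(2) by simp
   have tc: "?w \<in> carrier (reg K)" "?t \<in> carrier (reg K)" using c qr(2) qr'(2) by simp_all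
   have e: "v = ?w \<oplus>\<^sub>K ?t" using c qr qr' by (simp add: K.r_distr K.m_assoc K.a_assoc)
   have "\<ominus>\<^bsub>reg K\<^esub> ?t \<in> V" using KK.submod_minus[OF V] t UV by blast
   then have "v \<oplus>\<^sub>K \<ominus>\<^bsub>reg K\<^esub> ?t \<in> V" using submodD(4)[OF V v(1)] by simp
   moreover have "v \<oplus>\<^sub>K \<ominus>\<^bsub>reg K\<^esub> ?t = ?w" using e tc KK.M.a_assoc[OF tc KK.M.a_inv_closed[OF tc(2)]]
     KK.M.r_neg[OF tc(2)] KK.M.r_zero[OF tc(1)] by simp
   ultimately have "?w \<in> U" using w eq(1) by auto
   then have "?w \<oplus>\<^sub>K ?t \<in> U" using submodD(4)[OF U _ t] by simp
   then show False using v(3) e by simp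
  qed
  moreover have "\<not> V \<inter> P \<subseteq> Q" using v eq(1) by blast
  ultimately show ?thesis using \<rho>(2)[OF U V UV] by (auto simp: \<sigma>_def)
 qed
 moreover have "\<sigma> U \<le> \<sigma> V" if "submod K (reg K) U" "submod K (reg K) V" "U \<subseteq> V" for U V
  using \<rho>(2)[OF that] that(3) by (auto simp: \<sigma>_def)
 moreover have "\<sigma> U \<le> Suc n" for U using \<rho>(1)[of U] by (simp add: \<sigma>_def)
 ultimately show ?case by (intro exI[of _ \<sigma>]) blast
qed

lemma artinian_noeth:
 assumes K: "artinian_ring K" shows "noeth K (reg K)"
proof -
 interpret K: cring K using K by (simp add: artinian_ring_def)
 have lK: "left_module K (reg K)" by (rule reg_left_module[OF K.ring_axioms])
 obtain n where n: "colength K n {\<zero>\<^sub>K}" by (rule colength_zero[OF K])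
 obtain \<rho> where \<rho>: "\<And>U. \<rho> U \<le> n" "\<And>U V. submod K (reg K) U \<Longrightarrow> submod K (reg K) V \<Longrightarrow> U \<subseteq> V \<Longrightarrow>
   U \<inter> {\<zero>\<^sub>K} = V \<inter> {\<zero>\<^sub>K} \<Longrightarrow> U \<noteq> V \<Longrightarrow> \<rho> U < (\<rho> V :: nat)"
  using colength_rank[OF K.ring_axioms n] by metis
 show ?thesis
 proof (rule rank_noeth[OF lK \<rho>(1)])
  fix U V assume "submod K (reg K) U" "submod K (reg K) V" "U \<subset> V"
  then show "\<rho> U < \<rho> V" using submodD(3)[of K "reg K"] by (intro \<rho>(2)) auto
 qed
qed

section \<open>The minimal injective cogenerator of a commutative artinian ring\<close>

definition ann :: "('k, 'e, 'q) module_scheme \<Rightarrow> 'k set \<Rightarrow> 'e set"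
 where "ann E P = {e \<in> carrier E. \<forall>p\<in>P. p \<odot>\<^sub>E e = \<zero>\<^sub>E}"

lemma annI: "e \<in> carrier E \<Longrightarrow> (\<And>p. p \<in> P \<Longrightarrow> p \<odot>\<^sub>E e = \<zero>\<^sub>E) \<Longrightarrow> e \<in> ann E P"
 and annD: "e \<in> ann E P \<Longrightarrow> e \<in> carrier E" "e \<in> ann E P \<Longrightarrow> p \<in> P \<Longrightarrow> p \<odot>\<^sub>E e = \<zero>\<^sub>E"
 by (auto simp: ann_def)

text \<open>
 Elements outside \<open>m\<close> are units modulo \<open>m\<close>.
\<close>

lemma max_ideal_invert:
 assumes E: "left_module K E" and m: "max_ideal K m" and u: "u \<in> ann E m" and k: "k \<in> carrier K" "k \<notin> m"
 obtains s where "s \<in> carrier K" "u = s \<odot>\<^sub>E (k \<odot>\<^sub>E u)"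
proof -
 interpret E: left_module K E by fact
 obtain s a where sa: "s \<in> carrier K" "a \<in> m" "\<one>\<^sub>K = s \<otimes>\<^sub>K k \<oplus>\<^sub>K a"
  using max_idealD(4)[OF m k] by blast
 have "u = (s \<otimes>\<^sub>K k \<oplus>\<^sub>K a) \<odot>\<^sub>E u" using sa(3) annD(1)[OF u] by (metis E.smult_one)
 also have "\<dots> = s \<odot>\<^sub>E (k \<odot>\<^sub>E u)"
  using sa max_idealD(3)[OF m sa(2)] k(1) annD(1)[OF u] annD(2)[OF u sa(2)]
  by (simp add: E.smult_l_distr E.smult_assoc1)
 finally show thesis by (rule that[OF sa(1)])
qed

text \<open>
 Each simple module occurs at most once in the socle. This is what distinguishes the minimal injective
 cogenerator, and it bounds the length of \<open>E\<close> by that of \<open>K\<close>.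
\<close>

definition one_dim :: "('k, 'p) ring_scheme \<Rightarrow> ('k, 'e, 'q) module_scheme \<Rightarrow> bool"
 where "one_dim K E \<longleftrightarrow> (\<forall>m u v. max_ideal K m \<and> u \<in> ann E m \<and> v \<in> ann E m \<and> u \<noteq> \<zero>\<^sub>E \<longrightarrow>
  (\<exists>k\<in>carrier K. v = k \<odot>\<^sub>E u))"

lemma one_dimD:
 "one_dim K E \<Longrightarrow> max_ideal K m \<Longrightarrow> u \<in> ann E m \<Longrightarrow> v \<in> ann E m \<Longrightarrow> u \<noteq> \<zero>\<^sub>E \<Longrightarrow>
  \<exists>k\<in>carrier K. v = k \<odot>\<^sub>E u"
 unfolding one_dim_def by metis

lemma smult_commute:
 assumes "cring K" "left_module K E" "a \<in> carrier K" "b \<in> carrier K" "e \<in> carrier E"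
 shows "a \<odot>\<^sub>E (b \<odot>\<^sub>E e) = b \<odot>\<^sub>E (a \<odot>\<^sub>E e)"
proof -
 interpret K: cring K by fact
 interpret E: left_module K E by fact
 show ?thesis using assms K.m_comm[of a b] by (simp add: E.smult_assoc1[symmetric])
qed

lemma smult_hom:
 assumes "cring K" "left_module K E" "x \<in> carrier K"
 shows "(\<lambda>e. x \<odot>\<^sub>E e) \<in> lmod_hom K E E"
proof -
 interpret E: left_module K E by fact
 show ?thesis using assms(3) smult_commute[OF assms(1,2)]
  by (intro lmod_homI) (auto simp: E.smult_r_distr)
qed

lemma ann_submod:
 assumes K: "cring K" and E: "left_module K E" and P: "P \<subseteq> carrier K"
 shows "submod K E (ann E P)"
proof -
 interpret E: left_module K E by fact
 show ?thesis
  using P smult_commute[OF K E]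
  by (auto simp: submod_def ann_def E.smult_r_distr subset_iff)
qed

text \<open>
 If \<open>P = Q + K x\<close> is a simple step of the chain of ideals, then multiplication by \<open>x\<close> maps \<open>ann E Q\<close>
 into \<open>ann E m\<close> with kernel \<open>ann E P\<close>.
\<close>

lemma ann_step:
 assumes K: "cring K" and E: "left_module K E"
  and P: "submod K (reg K) P" and Q: "Q \<subseteq> P" and x: "x \<in> P"
  and m: "max_ideal K m" and mx: "\<And>a. a \<in> m \<Longrightarrow> a \<otimes>\<^sub>K x \<in> Q"
  and gen: "\<And>p. p \<in> P \<Longrightarrow> \<exists>q\<in>Q. \<exists>r\<in>carrier K. p = q \<oplus>\<^sub>K r \<otimes>\<^sub>K x"
  and e: "e \<in> ann E Q"
 shows "x \<odot>\<^sub>E e \<in> ann E m" "x \<odot>\<^sub>E e = \<zero>\<^sub>E \<Longrightarrow> e \<in> ann E P"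
proof -
 interpret E: left_module K E by fact
 have PK: "p \<in> carrier K" if "p \<in> P" for p using submodD(2)[OF P that] by simp
 have eE: "e \<in> carrier E" using annD(1)[OF e] .
 show "x \<odot>\<^sub>E e \<in> ann E m"
 proof (rule annI)
  fix a assume a: "a \<in> m"
  have "a \<odot>\<^sub>E (x \<odot>\<^sub>E e) = (a \<otimes>\<^sub>K x) \<odot>\<^sub>E e"
   using max_idealD(3)[OF m a] PK[OF x] eE by (simp add: E.smult_assoc1)
  then show "a \<odot>\<^sub>E (x \<odot>\<^sub>E e) = \<zero>\<^sub>E" using annD(2)[OF e mx[OF a]] by simp
 qed (use PK[OF x] eE in simp)
 show "e \<in> ann E P" if z: "x \<odot>\<^sub>E e = \<zero>\<^sub>E"
 proof (rule annI[OF eE])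
  fix p assume "p \<in> P"
  then obtain q r where qr: "q \<in> Q" "r \<in> carrier K" "p = q \<oplus>\<^sub>K r \<otimes>\<^sub>K x" using gen by blast
  have "q \<in> carrier K" using PK Q qr(1) by blast
  then show "p \<odot>\<^sub>E e = \<zero>\<^sub>E"
   using qr eE PK[OF x] annD(2)[OF e qr(1)] z by (simp add: E.smult_l_distr E.smult_assoc1)
 qed
qed

lemma ann_top:
 assumes "left_module K E" shows "ann E (carrier K) = {\<zero>\<^sub>E}"
proof -
 interpret E: left_module K E by fact
 have "e = \<zero>\<^sub>E" if "e \<in> ann E (carrier K)" for e
  using annD(2)[OF that E.R.one_closed] annD(1)[OF that] by simp
 then show ?thesis by (auto simp: ann_def)
qed

lemma ann_zero:
 assumes "left_module K E" shows "ann E {\<zero>\<^sub>K} = carrier E"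
proof -
 interpret E: left_module K E by fact
 show ?thesis by (auto simp: ann_def)
qed

text \<open>
 By \<open>ann_step\<close>, each step of a chain of ideals of \<open>K\<close> enlarges the annihilator in \<open>E\<close> by at most one simple module.
 So a strictly monotone rank on the submodules of \<open>E\<close> is bounded by the length of \<open>K\<close>.
\<close>

lemma one_dim_rank:
 assumes K: "cring K" and E: "left_module K E" and one: "one_dim K E" and c: "colength K r P"
 shows "\<exists>\<rho>. (\<forall>U. \<rho> U \<le> r) \<and>
  (\<forall>U V. submod K E U \<longrightarrow> submod K E V \<longrightarrow> U \<subset> V \<longrightarrow> V \<subseteq> ann E P \<longrightarrow> \<rho> U < (\<rho> V :: nat))"
 using c
proof (induction rule: colength.induct)
 case top
 interpret E: left_module K E by fact
 have "U = {\<zero>\<^sub>E}" if "submod K E U" "U \<subseteq> ann E (carrier K)" for U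
  using submodD(3)[OF that(1)] that(2) unfolding ann_top[OF E] by auto
 then have "\<not> U \<subset> V" if "submod K E U" "submod K E V" "V \<subseteq> ann E (carrier K)" for U V
  using that by (metis psubset_imp_subset psubset_eq subset_trans)
 then show ?case by (intro exI[of _ "\<lambda>_. 0"]) auto
next
 case (step n P Q x m)
 interpret K: cring K by fact
 interpret E: left_module K E by fact
 have P: "submod K (reg K) P" by (rule colength_submod[OF K.ring_axioms step.hyps(1)])
 have xK: "x \<in> carrier K" using submodD(2)[OF P step.hyps(4)] by simp
 have PK: "P \<subseteq> carrier K" using submodD(1)[OF P] by simp
 have st: "\<And>e. e \<in> ann E Q \<Longrightarrow> x \<odot>\<^sub>E e \<in> ann E m"
  "\<And>e. e \<in> ann E Q \<Longrightarrow> x \<odot>\<^sub>E e = \<zero>\<^sub>E \<Longrightarrow> e \<in> ann E P"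
  by (rule ann_step[OF K E P step.hyps(3,4,5)], (rule step.hyps(6,7), assumption | assumption)+)+
 obtain \<rho> :: "_ \<Rightarrow> nat" where \<rho>: "\<And>U. \<rho> U \<le> n"
  "\<And>U V. submod K E U \<Longrightarrow> submod K E V \<Longrightarrow> U \<subset> V \<Longrightarrow> V \<subseteq> ann E P \<Longrightarrow> \<rho> U < \<rho> V"
  using step.IH by metis
 have A: "submod K E (ann E P)" by (rule ann_submod[OF K E PK])
 define \<sigma> where "\<sigma> U = \<rho> (U \<inter> ann E P) + (if \<exists>u\<in>U. x \<odot>\<^sub>E u \<noteq> \<zero>\<^sub>E then 1 else 0)" for U
 have "\<sigma> U < \<sigma> V" if U: "submod K E U" and V: "submod K E V" and UV: "U \<subset> V" and VA: "V \<subseteq> ann E Q" for U V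
 proof -
  note U' = submodD[OF U] and V' = submodD[OF V]
  have UA: "submod K E (U \<inter> ann E P)" and VA': "submod K E (V \<inter> ann E P)"
   using E.submod_Int[OF U A] E.submod_Int[OF V A] by auto
  have le: "\<rho> (U \<inter> ann E P) \<le> \<rho> (V \<inter> ann E P)"
   using \<rho>(2)[OF UA VA'] UV by (cases "U \<inter> ann E P = V \<inter> ann E P") (auto intro: less_imp_le)
  show ?thesis
  proof (cases "U \<inter> ann E P = V \<inter> ann E P")
   case False
   then have "\<rho> (U \<inter> ann E P) < \<rho> (V \<inter> ann E P)" using UV by (intro \<rho>(2)[OF UA VA']) auto
   then show ?thesis unfolding \<sigma>_def using UV by auto
  next
   case True
   obtain v where v: "v \<in> V" "v \<notin> U" using UV by blast
   have "x \<odot>\<^sub>E v \<noteq> \<zero>\<^sub>E" using st(2)[of v] v VA True by blast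
   moreover have "x \<odot>\<^sub>E u = \<zero>\<^sub>E" if u: "u \<in> U" for u
   proof (rule ccontr)
    assume nz: "x \<odot>\<^sub>E u \<noteq> \<zero>\<^sub>E"
    have "u \<in> ann E Q" "v \<in> ann E Q" using u v UV VA by auto
    then obtain k where k: "k \<in> carrier K" "x \<odot>\<^sub>E v = k \<odot>\<^sub>E (x \<odot>\<^sub>E u)"
     using one_dimD[OF one step.hyps(5) st(1) st(1) nz] by blast
    have uE: "u \<in> carrier E" "v \<in> carrier E" using U'(2)[OF u] V'(2)[OF v(1)] by auto
    have ku: "k \<odot>\<^sub>E u \<in> U" using U'(5)[OF k(1) u] .
    let ?w = "v \<oplus>\<^sub>E \<ominus>\<^sub>E (k \<odot>\<^sub>E u)"
    have w: "?w \<in> V" using V'(4)[OF v(1)] E.submod_minus[OF V] ku UV by blast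
    have "x \<odot>\<^sub>E ?w = \<zero>\<^sub>E"
     using k uE xK smult_commute[OF K E k(1) xK uE(1)] by (simp add: E.smult_r_distr E.smult_r_minus E.M.r_neg)
    then have "?w \<in> ann E P" using st(2) w VA by blast
    then have "?w \<in> U" using w True by blast
    then have "k \<odot>\<^sub>E u \<oplus>\<^sub>E ?w \<in> U" using U'(4)[OF ku] by blast
    then show False using v(2) E.add_diff_cancel[of v "k \<odot>\<^sub>E u"] uE k(1) by simp
   qed
   ultimately show ?thesis unfolding \<sigma>_def using True v by auto
  qed
 qed
 moreover have "\<sigma> U \<le> Suc n" for U using \<rho>(1)[of "U \<inter> ann E P"] by (simp add: \<sigma>_def)
 ultimately show ?case by (intro exI[of _ \<sigma>]) blast
qed

text \<open>
 An endomorphism of \<open>ann E Q\<close> which vanishes on \<open>ann E P\<close> factors through multiplication by \<open>x\<close>, whose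
 image is at most one-dimensional; so it is multiplication by a multiple of \<open>x\<close>.
\<close>

lemma one_dim_endo:
 assumes K: "cring K" and E: "left_module K E" and one: "one_dim K E" and c: "colength K r P"
 shows "h \<in> lmod_hom K E E \<Longrightarrow> \<exists>k\<in>carrier K. \<forall>e\<in>ann E P. h e = k \<odot>\<^sub>E e"
 using c
proof (induction rule: colength.induct)
 case top
 interpret E: left_module K E by fact
 show ?case unfolding ann_top[OF E] using hom_zero[OF E E top]
  by (intro bexI[of _ "\<zero>\<^sub>K"]) simp_all
next
 case (step n P Q x m)
 interpret K: cring K by fact
 interpret E: left_module K E by fact
 have P: "submod K (reg K) P" by (rule colength_submod[OF K.ring_axioms step.hyps(1)])
 have xK: "x \<in> carrier K" using submodD(2)[OF P step.hyps(4)] by simp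
 have st: "\<And>e. e \<in> ann E Q \<Longrightarrow> x \<odot>\<^sub>E e \<in> ann E m"
  "\<And>e. e \<in> ann E Q \<Longrightarrow> x \<odot>\<^sub>E e = \<zero>\<^sub>E \<Longrightarrow> e \<in> ann E P"
  by (rule ann_step[OF K E P step.hyps(3,4,5)], (rule step.hyps(6,7), assumption | assumption)+)+
 note h = step.prems
 obtain k where k: "k \<in> carrier K" "\<forall>e\<in>ann E P. h e = k \<odot>\<^sub>E e" using step.IH[OF h] by blast
 define g where "g e = h e \<oplus>\<^sub>E \<ominus>\<^sub>E (k \<odot>\<^sub>E e)" for e
 have g: "g \<in> lmod_hom K E E" unfolding g_def
  by (rule hom_sum[OF E h hom_neg[OF E smult_hom[OF K E k(1)]]])
 have hg: "h e = k \<odot>\<^sub>E e \<oplus>\<^sub>E g e" if "e \<in> carrier E" for e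
  using that k(1) hom_closed[OF h that] E.add_diff_cancel by (simp add: g_def)
 have gP: "g e = \<zero>\<^sub>E" if "e \<in> ann E P" for e
  using k that annD(1)[OF that] by (simp add: g_def E.M.r_neg)
 have "\<exists>c\<in>carrier K. \<forall>e\<in>ann E Q. g e = c \<odot>\<^sub>E (x \<odot>\<^sub>E e)"
 proof (cases "\<forall>e\<in>ann E Q. x \<odot>\<^sub>E e = \<zero>\<^sub>E")
  case True
  then have "\<forall>e\<in>ann E Q. g e = \<zero>\<^sub>K \<odot>\<^sub>E (x \<odot>\<^sub>E e)" using gP st(2) by simp
  then show ?thesis by blast
 next
  case False
  then obtain e0 where e0: "e0 \<in> ann E Q" "x \<odot>\<^sub>E e0 \<noteq> \<zero>\<^sub>E" by blast
  have e0E: "e0 \<in> carrier E" using annD(1)[OF e0(1)] .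
  have "g e0 \<in> ann E m"
  proof (rule annI[OF hom_closed[OF g e0E]])
   fix a assume a: "a \<in> m"
   have aK: "a \<in> carrier K" using max_idealD(3)[OF step.hyps(5) a] .
   have "a \<odot>\<^sub>E e0 \<in> ann E Q" using submodD(5)[OF ann_submod[OF K E] aK e0(1)] submodD(1)[OF step.hyps(2)] by simp
   moreover have "x \<odot>\<^sub>E (a \<odot>\<^sub>E e0) = \<zero>\<^sub>E"
    using annD(2)[OF st(1)[OF e0(1)] a] smult_commute[OF K E aK xK e0E] by simp
   ultimately have "g (a \<odot>\<^sub>E e0) = \<zero>\<^sub>E" by (intro gP st(2))
   then show "a \<odot>\<^sub>E g e0 = \<zero>\<^sub>E" using hom_smult[OF g aK e0E] by simp
  qed
  then obtain c where c: "c \<in> carrier K" "g e0 = c \<odot>\<^sub>E (x \<odot>\<^sub>E e0)"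
   using one_dimD[OF one step.hyps(5) st(1)[OF e0(1)] _ e0(2)] by blast
  have "g e = c \<odot>\<^sub>E (x \<odot>\<^sub>E e)" if e: "e \<in> ann E Q" for e
  proof -
   have eE: "e \<in> carrier E" using annD(1)[OF e] .
   obtain d where d: "d \<in> carrier K" "x \<odot>\<^sub>E e = d \<odot>\<^sub>E (x \<odot>\<^sub>E e0)"
    using one_dimD[OF one step.hyps(5) st(1)[OF e0(1)] st(1)[OF e] e0(2)] by blast
   let ?w = "e \<oplus>\<^sub>E \<ominus>\<^sub>E (d \<odot>\<^sub>E e0)"
   have AQ: "submod K E (ann E Q)" using submodD(1)[OF step.hyps(2)] by (intro ann_submod[OF K E]) simp
   have w: "?w \<in> ann E Q"
    using submodD(4)[OF AQ e E.submod_minus[OF AQ submodD(5)[OF AQ d(1) e0(1)]]] .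
   have "x \<odot>\<^sub>E ?w = \<zero>\<^sub>E"
    using d eE e0E xK smult_commute[OF K E d(1) xK e0E] by (simp add: E.smult_r_distr E.smult_r_minus E.M.r_neg)
   then have "g ?w = \<zero>\<^sub>E" using w by (intro gP st(2))
   moreover have "g e = g (d \<odot>\<^sub>E e0) \<oplus>\<^sub>E g ?w"
    using hom_add[OF g, of "d \<odot>\<^sub>E e0" ?w] E.add_diff_cancel[of e "d \<odot>\<^sub>E e0"] d(1) eE e0E by simp
   ultimately have "g e = d \<odot>\<^sub>E g e0"
    using hom_smult[OF g d(1) e0E] hom_closed[OF g e0E] d(1) by simp
   then show ?thesis using c d xK e0E smult_commute[OF K E d(1) c(1), of "x \<odot>\<^sub>E e0"] by simp
  qed
  then show ?thesis using c(1) by blast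
 qed
 then obtain c where c: "c \<in> carrier K" "\<forall>e\<in>ann E Q. g e = c \<odot>\<^sub>E (x \<odot>\<^sub>E e)" by blast
 have "h e = (k \<oplus>\<^sub>K c \<otimes>\<^sub>K x) \<odot>\<^sub>E e" if "e \<in> ann E Q" for e
  using hg[OF annD(1)[OF that]] c annD(1)[OF that] that k(1) xK
  by (simp add: E.smult_l_distr E.smult_assoc1)
 then show ?case using k(1) c(1) xK by (intro bexI[of _ "k \<oplus>\<^sub>K c \<otimes>\<^sub>K x"]) auto
qed

definition chain_of :: "('k, 'p) ring_scheme \<Rightarrow> ('k, 'e, 'q) module_scheme \<Rightarrow> nat \<Rightarrow> bool"
 where "chain_of K E n \<longleftrightarrow> (\<exists>U. (\<forall>i\<le>n. submod K E (U i)) \<and> (\<forall>i<n. U i \<subset> U (Suc i)))"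

text \<open>
 The bound makes a module of maximal length exist among those in \<open>one_dim\<close>.
\<close>

lemma chain_bound:
 assumes K: "cring K" and E: "left_module K E" and one: "one_dim K E" and c: "colength K r {\<zero>\<^sub>K}"
  and ch: "chain_of K E n"
 shows "n \<le> r"
proof -
 obtain \<rho> where \<rho>: "\<And>U. \<rho> U \<le> r"
  "\<And>U V. submod K E U \<Longrightarrow> submod K E V \<Longrightarrow> U \<subset> V \<Longrightarrow> V \<subseteq> ann E {\<zero>\<^sub>K} \<Longrightarrow> \<rho> U < (\<rho> V :: nat)"
  using one_dim_rank[OF K E one c] by metis
 obtain U where U: "\<And>i. i \<le> n \<Longrightarrow> submod K E (U i)" "\<And>i. i < n \<Longrightarrow> U i \<subset> U (Suc i)"
  using ch by (auto simp: chain_of_def)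
 have "i \<le> \<rho> (U i)" if "i \<le> n" for i
  using that
 proof (induction i)
  case (Suc i)
  have "\<rho> (U i) < \<rho> (U (Suc i))"
   using Suc.prems U submodD(1)[OF U(1)[OF Suc.prems]] by (intro \<rho>(2)) (auto simp: ann_zero[OF E])
  then show ?case using Suc by simp
 qed simp
 from this[of n] \<rho>(1)[of "U n"] show ?thesis by simp
qed

lemma chain_grow:
 assumes E: "left_module K E" and F: "left_module K F" and i: "i \<in> lmod_hom K E F"
  and inj: "inj_on i (carrier E)" and ns: "i ` carrier E \<noteq> carrier F" and ch: "chain_of K E n"
 shows "chain_of K F (Suc n)"
proof -
 interpret F: left_module K F by fact
 obtain U where U: "\<And>i. i \<le> n \<Longrightarrow> submod K E (U i)" "\<And>i. i < n \<Longrightarrow> U i \<subset> U (Suc i)"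
  using ch by (auto simp: chain_of_def)
 define V where "V j = (if j \<le> n then i ` U j else carrier F)" for j
 have "submod K F (V j)" for j
  using submod_image[OF E F i U(1)] F.submod_carrier by (simp add: V_def)
 moreover have "V j \<subset> V (Suc j)" if "j < Suc n" for j
 proof (cases "j < n")
  case True
  have "U (Suc j) \<subseteq> carrier E" "U j \<subset> U (Suc j)" using submodD(1)[OF U(1)[of "Suc j"]] U(2) True by auto
  then have "i ` U j \<subset> i ` U (Suc j)" using inj by (meson image_strict_mono inj_on_subset)
  then show ?thesis using True by (simp add: V_def)
 next
  case False
  then have "j = n" using that by simp
  moreover have "i ` U n \<subseteq> i ` carrier E" using submodD(1)[OF U(1)[of n]] by auto
  moreover have "i ` carrier E \<subset> carrier F" using ns hom_closed[OF i] by auto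
  ultimately show ?thesis by (auto simp: V_def)
 qed
 ultimately show ?thesis unfolding chain_of_def by blast
qed

lemma one_dim_iso:
 assumes K: "ring K" and E: "left_module K E" "left_module K F" and i: "i \<in> lmod_iso K E F" and one: "one_dim K E"
 shows "one_dim K F"
 unfolding one_dim_def
proof (intro allI impI, elim conjE)
 fix m u v assume m: "max_ideal K m" and u: "u \<in> ann F m" and v: "v \<in> ann F m" and nz: "u \<noteq> \<zero>\<^sub>F"
 define j where "j = inv_into (carrier E) i"
 note j = iso_inverse[OF i E(1), folded j_def]
 note jh = iso_hom[OF j(1)]
 have *: "j w \<in> ann E m" if "w \<in> ann F m" for w
 proof (rule annI[OF hom_closed[OF jh annD(1)[OF that]]])
  fix a assume "a \<in> m"
  then show "a \<odot>\<^sub>E j w = \<zero>\<^sub>E"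
   using hom_smult[OF jh max_idealD(3)[OF m] annD(1)[OF that], of a] annD(2)[OF that] hom_zero[OF E(2,1) jh] by simp
 qed
 have "j u \<noteq> \<zero>\<^sub>E" using nz j(3)[OF annD(1)[OF u]] hom_zero[OF E iso_hom[OF i]] by auto
 then obtain k where k: "k \<in> carrier K" "j v = k \<odot>\<^sub>E j u" using one_dimD[OF one m *[OF u] *[OF v]] by blast
 then have "v = k \<odot>\<^sub>F u"
  using j(3)[OF annD(1)[OF v]] j(3)[OF annD(1)[OF u]]
   hom_smult[OF iso_hom[OF i] k(1) hom_closed[OF jh annD(1)[OF u]]] by simp
 then show "\<exists>k\<in>carrier K. v = k \<odot>\<^sub>F u" using k(1) by blast
qed

text \<open>
 \<open>E\<close> is chosen of maximal length among the finitely generated modules in \<open>one_dim\<close>. If a homomorphism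
 \<open>f\<close> from an ideal into \<open>E\<close> were not given by an element, then amalgamating \<open>E\<close> with \<open>K\<close> along \<open>f\<close>,
 and dividing by a submodule maximal with respect to meeting \<open>E\<close> trivially, would lead to a
 longer module in \<open>one_dim\<close>. If a maximal ideal \<open>m\<close> annihilated no element of \<open>E\<close>, then
 \<open>E \<oplus> K / m\<close> would be longer.
\<close>

lemma injective_cogenerator_exists:
 fixes K :: "('k, 'p) ring_scheme"
 assumes K: "artinian_ring K"
 obtains E :: "('k, 'k fg_carrier) module" where "left_module K E" "one_dim K E" "baer K E"
  "\<And>m. max_ideal K m \<Longrightarrow> \<exists>e\<in>ann E m. e \<noteq> \<zero>\<^sub>E"
proof -
 have cK: "cring K" using K by (simp add: artinian_ring_def)
 interpret K: cring K by (rule cK)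
 have lK: "left_module K (reg K)" by (rule reg_left_module[OF K.ring_axioms])
 interpret KK: left_module K "reg K" by fact
 obtain r where r: "colength K r {\<zero>\<^sub>K}" by (rule colength_zero[OF K])
 define good :: "('k, 'k fg_carrier) module \<Rightarrow> bool"
  where "good E \<longleftrightarrow> fg_module K E \<and> one_dim K E" for E
 have z: "left_module K zero_module" by (rule zero_module_left_module[OF K.ring_axioms])
 have "good zero_module" using z trivial_module(1)[OF z carrier_zero_module]
  by (auto simp: good_def fg_module_def one_dim_def ann_def zero_module_def)
 moreover have "chain_of K zero_module 0"
  using left_module.submod_carrier[OF z] by (auto simp: chain_of_def)
 ultimately have ex: "\<exists>n E. good E \<and> chain_of K E n" by blast
 have bound: "\<forall>n. (\<exists>E. good E \<and> chain_of K E n) \<longrightarrow> n \<le> r"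
  using chain_bound[OF cK _ _ r] by (auto simp: good_def fg_module_def)
 define \<C> where "\<C> n \<longleftrightarrow> (\<exists>E. good E \<and> chain_of K E n)" for n
 define n where "n = Greatest \<C>"
 have bd: "n' \<le> r" if "\<C> n'" for n' using bound that unfolding \<C>_def by simp
 have "\<exists>n. \<C> n" using ex unfolding \<C>_def .
 then have "\<C> n" unfolding n_def using GreatestI_ex_nat[of \<C> r] bd by simp
 then have n: "\<exists>E. good E \<and> chain_of K E n" "\<And>n'. \<C> n' \<Longrightarrow> n' \<le> n"
  using Greatest_le_nat[of \<C> _ r] bd unfolding n_def \<C>_def[of "Greatest \<C>"] by simp_all
 obtain E where E: "good E" "chain_of K E n" using n(1) by blast
 have lE: "left_module K E" and fgE: "finitely_generated K E" and one: "one_dim K E"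
  using E(1) by (auto simp: good_def fg_module_def)
 interpret E: left_module K E by fact
 \<comment> \<open>By the choice of \<open>E\<close>, it has no proper embedding into a module of the same kind.\<close>
 have grow: "i ` carrier E = carrier F"
  if g: "left_module K F" "finitely_generated K F" "one_dim K F" "i \<in> lmod_hom K E F" "inj_on i (carrier E)"
  for F :: "('k, 'f) module" and i
 proof (rule ccontr)
  assume ns: "i ` carrier E \<noteq> carrier F"
  obtain F' :: "('k, 'k fg_carrier) module" and t where t: "fg_module K F'" "t \<in> lmod_iso K F F'"
   using fg_module_copy[of K F] g(1,2) unfolding fg_module_def by blast
  have lF': "left_module K F'" using t by (simp add: fg_module_def)
  have "good F'" using t one_dim_iso[OF K.ring_axioms g(1) lF' t(2) g(3)] by (simp add: good_def)
  moreover have "chain_of K F' (Suc n)"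
  proof (rule chain_grow[OF lE lF' hom_comp[OF g(4) iso_hom[OF t(2)]] _ _ E(2)])
   show "inj_on (\<lambda>x. t (i x)) (carrier E)"
    using g(5) iso_inj[OF t(2)] hom_closed[OF g(4)] by (simp add: inj_on_def)
   have "(\<lambda>x. t (i x)) ` carrier E = t ` (i ` carrier E)" by auto
   moreover have "t ` (i ` carrier E) \<noteq> t ` carrier F"
   proof
    assume "t ` (i ` carrier E) = t ` carrier F"
    then have "i ` carrier E = carrier F"
     using inj_on_image_eq_iff[OF iso_inj[OF t(2)], of "i ` carrier E" "carrier F"] hom_closed[OF g(4)] by blast
    then show False using ns by simp
   qed
   ultimately show "(\<lambda>x. t (i x)) ` carrier E \<noteq> carrier F'" using iso_surj[OF t(2)] by simp
  qed
  ultimately have "\<C> (Suc n)" unfolding \<C>_def by blast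
  then have "Suc n \<le> n" by (rule n(2))
  then show False by simp
 qed
 have "baer K E"
  unfolding baer_def
 proof (intro allI impI, elim conjE)
  fix U f assume U: "submod K (reg K) U" and f: "f \<in> lmod_hom K (sub (reg K) U) E"
  let ?D = "dsum E (reg K)"
  have lD: "left_module K ?D" by (rule dsum_left_module[OF lE lK])
  interpret D: left_module K ?D by fact
  note DH = dsum_homs[OF lE lK]
  have lU: "left_module K (sub (reg K) U)" by (rule KK.submod_left_module[OF U])
  \<comment> \<open>Dividing by the graph of \<open>- f\<close> identifies \<open>f u\<close> in \<open>E\<close> with \<open>u\<close> in \<open>K\<close>.\<close>
  define G where "G = (\<lambda>u. (f u, \<ominus>\<^bsub>reg K\<^esub> u)) ` U"
  have Gh: "(\<lambda>u. (f u, \<ominus>\<^bsub>reg K\<^esub> u)) \<in> lmod_hom K (sub (reg K) U) ?D"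
   by (rule hom_pair[OF f hom_neg[OF lK sub_hom[OF submodD(1)[OF U]]]])
  have G: "submod K ?D G"
   using submod_image[OF lU lD Gh left_module.submod_carrier[OF lU]] by (simp add: G_def)
  let ?S = "{(e, \<zero>\<^bsub>reg K\<^esub>) | e. e \<in> carrier E \<and> e \<noteq> \<zero>\<^sub>E}"
  have "G \<inter> ?S = {}"
  proof -
   have "f u = \<zero>\<^sub>E" if u: "u \<in> U" "\<ominus>\<^bsub>reg K\<^esub> u = \<zero>\<^bsub>reg K\<^esub>" for u
   proof -
    have "u \<in> carrier (reg K)" using submodD(2)[OF U u(1)] .
    then have "u = \<zero>\<^bsub>reg K\<^esub>" using u(2) KK.M.minus_minus[of u] KK.a_minus_zero by simp
    then show ?thesis using hom_zero[OF lU lE f] by simp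
   qed
   then show ?thesis unfolding G_def by auto
  qed
  then obtain C where C: "submod K ?D C" "G \<subseteq> C" "C \<inter> ?S = {}"
   "\<And>w. w \<in> carrier ?D \<Longrightarrow> w \<notin> C \<Longrightarrow> \<exists>c\<in>C. \<exists>k\<in>carrier K. c \<oplus>\<^sub>?D k \<odot>\<^sub>?D w \<in> ?S"
   by (rule maximal_avoiding[OF lD G]) (rule that)
  obtain Q :: "('k, ('k fg_carrier \<times> 'k) set) module" and p where Q: "left_module K Q" "p \<in> lmod_hom K ?D Q"
   "p ` carrier ?D = carrier Q" "\<And>x. x \<in> carrier ?D \<Longrightarrow> p x = \<zero>\<^sub>Q \<longleftrightarrow> x \<in> C"
   by (rule quotient_module[OF lD C(1)]) (rule that)
  interpret Q: left_module K Q by (rule Q(1))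
  define i where "i e = p (e, \<zero>\<^bsub>reg K\<^esub>)" for e
  have i: "i \<in> lmod_hom K E Q" unfolding i_def by (rule hom_comp[OF DH(3) Q(2)])
  have i0: "e = \<zero>\<^sub>E" if "e \<in> carrier E" "i e = \<zero>\<^sub>Q" for e
  proof (rule ccontr)
   assume "e \<noteq> \<zero>\<^sub>E"
   then have "(e, \<zero>\<^bsub>reg K\<^esub>) \<in> C \<inter> ?S" using that Q(4)[of "(e, \<zero>\<^bsub>reg K\<^esub>)"] by (auto simp: i_def)
   then show False using C(3) by blast
  qed
  have inj: "inj_on i (carrier E)" using hom_inj_iff[OF lE Q(1) i] i0 by blast
  have fgQ: "finitely_generated K Q"
   by (rule finitely_generated_image[OF lD Q(1,2,3) dsum_fg[OF lE lK fgE reg_fg[OF K.ring_axioms]]])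
  \<comment> \<open>A multiple of \<open>q\<close> lies in \<open>i E\<close> by the maximality of \<open>C\<close>; being outside \<open>m\<close>, the factor can be inverted on \<open>q\<close>.\<close>
  have ess: "\<exists>e\<in>ann E m. q = i e" if m: "max_ideal K m" and q: "q \<in> ann Q m" for m q
  proof (cases "q = \<zero>\<^sub>Q")
   case True
   then show ?thesis using hom_zero[OF lE Q(1) i] max_idealD(3)[OF m] by (intro bexI[of _ "\<zero>\<^sub>E"]) (auto simp: ann_def)
  next
   case False
   have "q \<in> p ` carrier ?D" using annD(1)[OF q] Q(3) by simp
   then obtain w where w: "w \<in> carrier ?D" "q = p w" by blast
   have wC: "w \<notin> C" using False w Q(4) by simp
   obtain c k e where ck: "c \<in> C" "k \<in> carrier K" "(e, \<zero>\<^bsub>reg K\<^esub>) = c \<oplus>\<^sub>?D k \<odot>\<^sub>?D w"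
    "e \<in> carrier E" "e \<noteq> \<zero>\<^sub>E"
    using C(4)[OF w(1) wC] unfolding mem_Collect_eq by metis
   have cD: "c \<in> carrier ?D" using submodD(2)[OF C(1) ck(1)] .
   have "i e = p c \<oplus>\<^sub>Q k \<odot>\<^sub>Q q"
    unfolding i_def ck(3) w(2) using hom_add[OF Q(2) cD, of "k \<odot>\<^sub>?D w"] hom_smult[OF Q(2) ck(2) w(1)]
     D.smult_closed[OF ck(2) w(1)] by (simp del: dsum_simps)
   also have "p c = \<zero>\<^sub>Q" using Q(4)[OF cD] ck(1) by simp
   finally have ie: "i e = k \<odot>\<^sub>Q q" using ck(2) annD(1)[OF q] by simp
   have "k \<notin> m" using annD(2)[OF q, of k] ie i0[OF ck(4)] ck(5) by auto
   obtain s where s: "s \<in> carrier K" "q = s \<odot>\<^sub>Q (k \<odot>\<^sub>Q q)"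
    by (rule max_ideal_invert[OF Q(1) m q ck(2) \<open>k \<notin> m\<close>])
   have qi: "q = i (s \<odot>\<^sub>E e)" using hom_smult[OF i s(1) ck(4)] ie s(2) by simp
   have "s \<odot>\<^sub>E e \<in> ann E m"
   proof (rule annI)
    show se: "s \<odot>\<^sub>E e \<in> carrier E" using s(1) ck(4) by simp
    fix b assume b: "b \<in> m"
    have bK: "b \<in> carrier K" using max_idealD(3)[OF m b] .
    have "i (b \<odot>\<^sub>E (s \<odot>\<^sub>E e)) = \<zero>\<^sub>Q" using hom_smult[OF i bK se] qi annD(2)[OF q b] by simp
    then show "b \<odot>\<^sub>E (s \<odot>\<^sub>E e) = \<zero>\<^sub>E" using bK se by (intro i0) simp_all
   qed
   then show ?thesis using qi by blast
  qed
  have oneQ: "one_dim K Q"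
   unfolding one_dim_def
  proof (intro allI impI, elim conjE)
   fix m u v assume m: "max_ideal K m" and u: "u \<in> ann Q m" and v: "v \<in> ann Q m" and nz: "u \<noteq> \<zero>\<^sub>Q"
   obtain e where e: "e \<in> ann E m" "u = i e" using ess[OF m u] by blast
   obtain e' where e': "e' \<in> ann E m" "v = i e'" using ess[OF m v] by blast
   have "e \<noteq> \<zero>\<^sub>E" using nz e(2) hom_zero[OF lE Q(1) i] by auto
   then obtain k where "k \<in> carrier K" "e' = k \<odot>\<^sub>E e" using one_dimD[OF one m e(1) e'(1)] by blast
   then show "\<exists>k\<in>carrier K. v = k \<odot>\<^sub>Q u" using hom_smult[OF i _ annD(1)[OF e(1)]] e e' by blast
  qed
  \<comment> \<open>So a preimage in \<open>E\<close> of the class of \<open>1 \<in> K\<close> represents \<open>f\<close>.\<close>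
  have iE: "i ` carrier E = carrier Q" by (rule grow[OF Q(1) fgQ oneQ i inj])
  have o: "(\<zero>\<^sub>E, \<one>\<^sub>K) \<in> carrier ?D" by simp
  then have "p (\<zero>\<^sub>E, \<one>\<^sub>K) \<in> i ` carrier E" using iE hom_closed[OF Q(2) o] by simp
  then obtain i0' where i0': "i0' \<in> carrier E" "p (\<zero>\<^sub>E, \<one>\<^sub>K) = i i0'" by blast
  have "f u = u \<odot>\<^sub>E i0'" if u: "u \<in> U" for u
  proof -
   have uK: "u \<in> carrier K" using submodD(2)[OF U u] by simp
   have uR: "u \<in> carrier (reg K)" using uK by simp
   have fu: "f u \<in> carrier E" using hom_closed[OF f] u by simp
   have nu: "\<ominus>\<^bsub>reg K\<^esub> u \<in> carrier (reg K)" by (rule KK.M.a_inv_closed[OF uR])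
   have GC: "(f u, \<ominus>\<^bsub>reg K\<^esub> u) \<in> C" using C(2) u by (auto simp: G_def)
   have GD: "(f u, \<ominus>\<^bsub>reg K\<^esub> u) \<in> carrier ?D" using fu nu by simp
   have o': "(\<zero>\<^sub>E, u) \<in> carrier ?D" using uK by simp
   have "u \<odot>\<^sub>?D (\<zero>\<^sub>E, \<one>\<^sub>K) = (\<zero>\<^sub>E, u)" using uK by simp
   then have pu: "p (\<zero>\<^sub>E, u) = i (u \<odot>\<^sub>E i0')"
    using hom_smult[OF Q(2) uK o] i0' hom_smult[OF i uK i0'(1)] by simp
   have "(f u, \<ominus>\<^bsub>reg K\<^esub> u) \<oplus>\<^sub>?D (\<zero>\<^sub>E, u) = (f u, \<zero>\<^bsub>reg K\<^esub>)"
    using fu KK.M.l_neg[OF uR] by simp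
   then have "i (f u) = p (f u, \<ominus>\<^bsub>reg K\<^esub> u) \<oplus>\<^sub>Q p (\<zero>\<^sub>E, u)"
    unfolding i_def using hom_add[OF Q(2) GD o'] by simp
   also have "p (f u, \<ominus>\<^bsub>reg K\<^esub> u) = \<zero>\<^sub>Q" using Q(4)[OF GD] GC by simp
   finally have "i (f u) = i (u \<odot>\<^sub>E i0')" using pu hom_closed[OF Q(2) o'] by simp
   then show ?thesis using inj fu i0'(1) uK by (simp add: inj_on_eq_iff)
  qed
  then show "\<exists>i\<in>carrier E. \<forall>u\<in>U. f u = u \<odot>\<^sub>E i" using i0'(1) by blast
 qed
 moreover have "\<exists>e\<in>ann E m. e \<noteq> \<zero>\<^sub>E" if m: "max_ideal K m" for m
 proof (rule ccontr)
  assume "\<not> (\<exists>e\<in>ann E m. e \<noteq> \<zero>\<^sub>E)"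
  then have no: "e = \<zero>\<^sub>E" if "e \<in> ann E m" for e using that by blast
  note m' = max_idealD[OF m]
  obtain Q :: "('k, 'k set) module" and p where Q: "left_module K Q" "p \<in> lmod_hom K (reg K) Q"
   "p ` carrier (reg K) = carrier Q" "\<And>x. x \<in> carrier (reg K) \<Longrightarrow> p x = \<zero>\<^sub>Q \<longleftrightarrow> x \<in> m"
   by (rule quotient_module[OF lK m'(1)]) (rule that)
  interpret Q: left_module K Q by (rule Q(1))
  have lD: "left_module K (dsum E Q)" by (rule dsum_left_module[OF lE Q(1)])
  have fgD: "finitely_generated K (dsum E Q)"
   by (rule dsum_fg[OF lE Q(1) fgE finitely_generated_image[OF lK Q(1,2,3) reg_fg[OF K.ring_axioms]]])
  have o: "\<one>\<^sub>K \<in> carrier (reg K)" by simp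
  have pa: "p a = a \<odot>\<^sub>Q p \<one>\<^sub>K" if "a \<in> carrier K" for a
   using hom_smult[OF Q(2) that o] that by simp
  have cyc: "\<exists>a\<in>carrier K. q = a \<odot>\<^sub>Q p \<one>\<^sub>K" if q: "q \<in> carrier Q" for q
  proof -
   obtain a where a: "a \<in> carrier K" "q = p a" using q unfolding Q(3)[symmetric] by auto
   show ?thesis by (rule bexI[OF _ a(1)]) (rule a(2)[unfolded pa[OF a(1)]])
  qed
  have p1: "p \<one>\<^sub>K \<in> carrier Q" by (rule hom_closed[OF Q(2) o])
  have mQ: "a \<odot>\<^sub>Q q = \<zero>\<^sub>Q" if a: "a \<in> m" and q: "q \<in> carrier Q" for a q
  proof -
   have aK: "a \<in> carrier K" using m'(3)[OF a] .
   have "a \<odot>\<^sub>Q p \<one>\<^sub>K = \<zero>\<^sub>Q" using pa[OF aK, symmetric] Q(4)[of a] a aK by simp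
   then show ?thesis using cyc[OF q] smult_commute[OF cK Q(1) aK _ p1] by auto
  qed
  have gen: "\<exists>k\<in>carrier K. v = k \<odot>\<^sub>Q u" if u: "u \<in> carrier Q" "u \<noteq> \<zero>\<^sub>Q" and v: "v \<in> carrier Q" for u v
  proof -
   obtain a b where ab: "a \<in> carrier K" "u = a \<odot>\<^sub>Q p \<one>\<^sub>K" "b \<in> carrier K" "v = b \<odot>\<^sub>Q p \<one>\<^sub>K"
    using cyc[OF u(1)] cyc[OF v] by blast
   have am: "a \<notin> m" using u(2) ab mQ[OF _ p1] by auto
   have "p \<one>\<^sub>K \<in> ann Q m" using p1 mQ by (intro annI)
   from max_ideal_invert[OF Q(1) m this ab(1) am] obtain s
    where s: "s \<in> carrier K" "p \<one>\<^sub>K = s \<odot>\<^sub>Q (a \<odot>\<^sub>Q p \<one>\<^sub>K)" .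
   then have "v = (b \<otimes>\<^sub>K s) \<odot>\<^sub>Q u" using ab u(1) by (simp add: Q.smult_assoc1)
   then show ?thesis using ab(3) s(1) by blast
  qed
  have oneD: "one_dim K (dsum E Q)"
   unfolding one_dim_def
  proof (intro allI impI, elim conjE)
   fix m1 u v assume m1: "max_ideal K m1" and u: "u \<in> ann (dsum E Q) m1" and v: "v \<in> ann (dsum E Q) m1"
    and nz: "u \<noteq> \<zero>\<^bsub>dsum E Q\<^esub>"
   obtain u1 u2 v1 v2 where uv: "u = (u1, u2)" "v = (v1, v2)" by (metis surj_pair)
   have uc: "u1 \<in> carrier E" "u2 \<in> carrier Q" "v1 \<in> carrier E" "v2 \<in> carrier Q"
    using annD(1)[OF u] annD(1)[OF v] uv by auto
   have u1: "u1 \<in> ann E m1" "v1 \<in> ann E m1" "u2 \<in> ann Q m1" "v2 \<in> ann Q m1"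
    using annD(2)[OF u] annD(2)[OF v] uv uc by (auto intro!: annI)
   show "\<exists>k\<in>carrier K. v = k \<odot>\<^bsub>dsum E Q\<^esub> u"
   proof (cases "m \<subseteq> m1")
    case True
    have "u1 \<in> ann E m" "v1 \<in> ann E m" using u1 True by (auto simp: ann_def)
    then have e0: "u1 = \<zero>\<^sub>E" "v1 = \<zero>\<^sub>E" using no by auto
    then have "u2 \<noteq> \<zero>\<^sub>Q" using nz uv by auto
    then obtain k where "k \<in> carrier K" "v2 = k \<odot>\<^sub>Q u2" using gen[OF uc(2) _ uc(4)] by blast
    then show ?thesis using uv e0 by (intro bexI[of _ k]) auto
   next
    case False
    then obtain a where a: "a \<in> m" "a \<notin> m1" by blast
    have z: "q = \<zero>\<^sub>Q" if q: "q \<in> ann Q m1" for q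
     by (rule max_ideal_invert[OF Q(1) m1 q m'(3)[OF a(1)] a(2)]) (simp add: mQ[OF a(1) annD(1)[OF q]])
    then have q0: "u2 = \<zero>\<^sub>Q" "v2 = \<zero>\<^sub>Q" using u1 by auto
    then have "u1 \<noteq> \<zero>\<^sub>E" using nz uv by auto
    then obtain k where "k \<in> carrier K" "v1 = k \<odot>\<^sub>E u1" using one_dimD[OF one m1 u1(1,2)] by blast
    then show ?thesis using uv q0 by (intro bexI[of _ k]) auto
   qed
  qed
  have "(\<lambda>e. (e, \<zero>\<^sub>Q)) ` carrier E = carrier (dsum E Q)"
   by (rule grow[OF lD fgD oneD dsum_homs(3)[OF lE Q(1)]]) (auto simp: inj_on_def)
  moreover note p1
  moreover have "p \<one>\<^sub>K \<noteq> \<zero>\<^sub>Q" using Q(4)[of "\<one>\<^sub>K"] m'(2) by simp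
  moreover have "(\<zero>\<^sub>E, p \<one>\<^sub>K) \<in> carrier (dsum E Q)" using calculation(2) by simp
  ultimately show False by auto
 qed
 ultimately show ?thesis using that lE one by blast
qed

section \<open>The columns of the Morita ring\<close>

text \<open>
 Applied to the projective module \<open>A\<close>, the equivalence says that \<open>M \<otimes>\<^sub>A A = M\<close> has finite
 injective dimension over \<open>B\<close> and that \<open>A\<close> is the endomorphism ring of \<open>M\<close>.
\<close>

lemma equivalence_bimodule:
 fixes A :: "('a, 'p) ring_scheme" and B :: "('b, 'q) ring_scheme" and M :: "('b, 'm, 'a, 't) bimodule_scheme"
 assumes E: "induces_equivalence A B M" and M: "bimodule B A M"
 obtains Y :: "('b, 'b fg_carrier) module" and \<theta> where "fin_inj_dim B Y" "\<theta> \<in> lmod_iso B M Y"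
  "\<And>h. h \<in> lmod_hom B M Y \<Longrightarrow> \<exists>a\<in>carrier A. \<forall>m\<in>carrier M. h m = \<theta> (m \<triangleleft>\<^sub>M a)"
  "\<And>a. a \<in> carrier A \<Longrightarrow> \<forall>m\<in>carrier M. m \<triangleleft>\<^sub>M a = \<zero>\<^sub>M \<Longrightarrow> a = \<zero>\<^sub>A"
proof -
 interpret M: bimodule B A M by fact
 have lA: "left_module A (reg A)" by (rule reg_left_module[OF M.S.ring_axioms])
 have fgA: "finitely_generated A (reg A)" by (rule reg_fg[OF M.S.ring_axioms])
 obtain X :: "('a, 'a fg_carrier) module" and j where X: "fg_module A X" "j \<in> lmod_iso A (reg A) X"
  using fg_module_copy[of A "reg A"] lA fgA unfolding fg_module_def by blast
 have lX: "left_module A X" using X by (simp add: fg_module_def)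
 have "pd_lt A (Suc 0) X"
  by (rule pd_lt_iso[OF lA lX X(2) projective_pd_lt_1[OF reg_projective[OF M.S.ring_axioms] fgA]])
 then have "fin_proj_dim A X" using X(1) by (auto simp: fin_proj_dim_iff)
 note un = equivalence_unit[OF E M this]
 interpret t: tensor_pair A B M X by (rule un(1))
 let ?T = "tensor_module A M X" and ?u = "j \<one>\<^sub>A"
 define k where "k = inv_into (carrier (reg A)) j"
 note k = iso_inverse[OF X(2) lA, folded k_def] and jh = iso_hom[OF X(2)]
 note kh = iso_hom[OF k(1)]
 have kc: "k x \<in> carrier A" if "x \<in> carrier X" for x using hom_closed[OF kh that] by simp
 have u: "?u \<in> carrier X" using hom_closed[OF jh, of "\<one>\<^sub>A"] by simp
 have ju: "j a = a \<odot>\<^sub>X ?u" if "a \<in> carrier A" for a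
  using hom_smult[OF jh that, of "\<one>\<^sub>A"] that by simp
 define \<Theta> where "\<Theta> m = pure_tensor A M X m ?u" for m
 have pj: "pure_tensor A M X m (j a) = \<Theta> (m \<triangleleft>\<^sub>M a)" if "m \<in> carrier M" "a \<in> carrier A" for m a
  using that u by (simp add: \<Theta>_def ju[OF that(2)] t.pt_balanced)
 have Th: "\<Theta> \<in> lmod_hom B M ?T"
  unfolding \<Theta>_def using u by (intro lmod_homI) (simp_all add: t.pt_add_l t.pt_smult)
 have "\<Theta> \<in> lmod_iso B M ?T"
 proof (rule isoI[OF Th])
  obtain h where h: "h \<in> lmod_hom B ?T M"
   "\<And>m x. m \<in> carrier M \<Longrightarrow> x \<in> carrier X \<Longrightarrow> h (pure_tensor A M X m x) = m \<triangleleft>\<^sub>M k x"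
  proof (rule t.tensor_lift[OF M.L.left_module_axioms, of "\<lambda>m x. m \<triangleleft>\<^sub>M k x"])
   show "m \<triangleleft>\<^sub>M k (x \<oplus>\<^sub>X x') = m \<triangleleft>\<^sub>M k x \<oplus>\<^sub>M m \<triangleleft>\<^sub>M k x'"
    if "m \<in> carrier M" "x \<in> carrier X" "x' \<in> carrier X" for m x x'
    using that kc hom_add[OF kh that(2,3)] by (simp add: M.rsmult_r_distr)
   show "m \<triangleleft>\<^sub>M a \<triangleleft>\<^sub>M k x = m \<triangleleft>\<^sub>M k (a \<odot>\<^sub>X x)"
    if "m \<in> carrier M" "a \<in> carrier A" "x \<in> carrier X" for m a x
    using that kc hom_smult[OF kh that(2,3)] by (simp add: M.rsmult_assoc)
  qed (use kc that in \<open>simp_all add: M.rsmult_l_distr M.smult_rsmult_assoc\<close>)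
  have "h (\<Theta> m) = m" if "m \<in> carrier M" for m
   using h(2)[OF that u] k(2)[of "\<one>\<^sub>A"] that by (simp add: \<Theta>_def)
  then show "inj_on \<Theta> (carrier M)" by (rule inj_on_inverseI)
  show "\<Theta> ` carrier M = carrier ?T"
  proof (rule t.submod_T_total)
   show "submod B ?T (\<Theta> ` carrier M)"
    by (rule submod_image[OF M.L.left_module_axioms t.T_left_module Th M.L.submod_carrier])
   show "pure_tensor A M X m x \<in> \<Theta> ` carrier M" if "m \<in> carrier M" "x \<in> carrier X" for m x
    using pj[OF that(1) kc[OF that(2)]] k(3)[OF that(2)] that(1) kc[OF that(2)] by auto
  qed
 qed
 note Ti = this
 obtain Y :: "('b, 'b fg_carrier) module" and \<kappa> where Y: "fg_module B Y" "\<kappa> \<in> lmod_iso B ?T Y"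
  using fg_module_copy[of B ?T] un(2) by (auto simp: fin_inj_dim_iff)
 define \<kappa>' where "\<kappa>' = inv_into (carrier ?T) \<kappa>"
 note \<kappa>' = iso_inverse[OF Y(2) t.T_left_module, folded \<kappa>'_def]
 show thesis
 proof (rule that[of Y "\<lambda>m. \<kappa> (\<Theta> m)"])
  show "fin_inj_dim B Y" using un(2) Y(1) id_lt_iso[OF \<kappa>'(1)] by (auto simp: fin_inj_dim_iff)
  show "(\<lambda>m. \<kappa> (\<Theta> m)) \<in> lmod_iso B M Y" by (rule iso_comp[OF Ti Y(2)])
  fix h assume h: "h \<in> lmod_hom B M Y"
  obtain x where x: "x \<in> carrier X" "\<forall>m\<in>carrier M. \<kappa>' (h m) = pure_tensor A M X m x"
   using un(3)[OF hom_comp[OF h iso_hom[OF \<kappa>'(1)]]] by blast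
  have "h m = \<kappa> (\<Theta> (m \<triangleleft>\<^sub>M k x))" if m: "m \<in> carrier M" for m
   using \<kappa>'(3)[OF hom_closed[OF h m]] x(2) m pj[OF m kc[OF x(1)]] k(3)[OF x(1)] by simp
  then show "\<exists>a\<in>carrier A. \<forall>m\<in>carrier M. h m = \<kappa> (\<Theta> (m \<triangleleft>\<^sub>M a))" using kc[OF x(1)] by blast
 next
  fix a assume a: "a \<in> carrier A" "\<forall>m\<in>carrier M. m \<triangleleft>\<^sub>M a = \<zero>\<^sub>M"
  have "j a = \<zero>\<^sub>X"
  proof (rule un(4))
   show "j a \<in> carrier X" using hom_closed[OF jh, of a] a(1) by simp
   show "pure_tensor A M X m (j a) = \<zero>\<^sub>?T" if "m \<in> carrier M" for m
    using pj[OF that a(1)] a(2) that hom_zero[OF M.L.left_module_axioms t.T_left_module Th] by simp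
  qed
  then show "a = \<zero>\<^sub>A" using k(2)[of a] k(2)[of "\<zero>\<^sub>A"] hom_zero[OF lA lX jh] a(1) by simp
 qed
qed

context morita_matrix begin

text \<open>
 The first column of \<open>L\<close> is a copy of the module coinduced from \<open>M\<close>. It enters through the
 element \<open>g\<close> corresponding to the identity of \<open>M\<close>, so that the isomorphism is \<open>l \<mapsto> l g\<close>.
\<close>

lemma column_generator:
 assumes E: "induces_equivalence A B M"
 obtains Y :: "('b, 'b fg_carrier) module" and g r where "left_module B Y" "id_lt L r (cind Y)" "g \<in> carrier (cind Y)"
  "\<And>a n m b. a \<in> carrier A \<Longrightarrow> n \<in> carrier N \<Longrightarrow> m \<in> carrier M \<Longrightarrow> b \<in> carrier B \<Longrightarrow>
   mat a n m b \<odot>\<^bsub>cind Y\<^esub> g = \<zero>\<^bsub>cind Y\<^esub> \<longleftrightarrow> a = \<zero>\<^sub>A \<and> m = \<zero>\<^sub>M"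
  "\<And>p. p \<in> carrier (cind Y) \<Longrightarrow> \<exists>a\<in>carrier A. \<exists>m\<in>carrier M. p = mat a \<zero>\<^sub>N m \<zero>\<^sub>B \<odot>\<^bsub>cind Y\<^esub> g"
proof -
 obtain Y :: "('b, 'b fg_carrier) module" and \<theta> where Y: "fin_inj_dim B Y" "\<theta> \<in> lmod_iso B M Y"
  "\<And>h. h \<in> lmod_hom B M Y \<Longrightarrow> \<exists>a\<in>carrier A. \<forall>m\<in>carrier M. h m = \<theta> (m \<triangleleft>\<^sub>M a)"
  "\<And>a. a \<in> carrier A \<Longrightarrow> \<forall>m\<in>carrier M. m \<triangleleft>\<^sub>M a = \<zero>\<^sub>M \<Longrightarrow> a = \<zero>\<^sub>A"
  by (rule equivalence_bimodule[OF E bimodule_M]) (rule that)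
 have lY: "left_module B Y" using Y(1) by (simp add: fin_inj_dim_def fg_module_def)
 interpret Y: left_module B Y by fact
 obtain r where r: "id_lt B r Y" using Y(1) by (auto simp: fin_inj_dim_iff)
 note \<theta> = iso_hom[OF Y(2)]
 have \<theta>0: "\<theta> \<zero>\<^sub>M = \<zero>\<^sub>Y" by (rule hom_zero[OF left_module_M lY \<theta>])
 have \<theta>i: "m = \<zero>\<^sub>M" if "m \<in> carrier M" "\<theta> m = \<zero>\<^sub>Y" for m
  using that hom_inj_iff[OF left_module_M lY \<theta>] iso_inj[OF Y(2)] by blast
 define g where "g = (restrict \<theta> (carrier M), \<zero>\<^sub>Y)"
 have act: "mat a n m b \<odot>\<^bsub>cind Y\<^esub> g = (\<lambda>m'\<in>carrier M. \<theta> (m' \<triangleleft>\<^sub>M a), \<theta> m)"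
  if "a \<in> carrier A" "n \<in> carrier N" "m \<in> carrier M" "b \<in> carrier B" for a n m b
  using that hom_closed[OF \<theta>] by (auto simp: g_def cind_smult intro!: restrict_ext)
 show thesis
 proof (rule that[OF lY cind_id[OF E Y(1) r]])
  show "g \<in> carrier (cind Y)" using hom_restrictI[OF \<theta> left_module_M] by (simp add: g_def cind_simps)
  fix a n m b assume c: "a \<in> carrier A" "n \<in> carrier N" "m \<in> carrier M" "b \<in> carrier B"
  show "mat a n m b \<odot>\<^bsub>cind Y\<^esub> g = \<zero>\<^bsub>cind Y\<^esub> \<longleftrightarrow> a = \<zero>\<^sub>A \<and> m = \<zero>\<^sub>M"
  proof
   assume z: "mat a n m b \<odot>\<^bsub>cind Y\<^esub> g = \<zero>\<^bsub>cind Y\<^esub>"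
   have z': "(\<lambda>m'\<in>carrier M. \<theta> (m' \<triangleleft>\<^sub>M a)) = (\<lambda>m'\<in>carrier M. \<zero>\<^sub>Y)" "\<theta> m = \<zero>\<^sub>Y"
    using z unfolding act[OF c] by (simp_all add: cind_simps hom_module_simps(2))
   have "m' \<triangleleft>\<^sub>M a = \<zero>\<^sub>M" if "m' \<in> carrier M" for m'
    using fun_cong[OF z'(1), of m'] that \<theta>i c(1) by simp
   then show "a = \<zero>\<^sub>A \<and> m = \<zero>\<^sub>M" using Y(4)[OF c(1)] \<theta>i[OF c(3) z'(2)] by blast
  next
   assume "a = \<zero>\<^sub>A \<and> m = \<zero>\<^sub>M"
   then show "mat a n m b \<odot>\<^bsub>cind Y\<^esub> g = \<zero>\<^bsub>cind Y\<^esub>"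
    unfolding act[OF c] by (auto simp: cind_simps hom_module_simps(2) \<theta>0 intro!: restrict_ext)
  qed
 next
  fix p assume "p \<in> carrier (cind Y)"
  then obtain h y where p: "p = (h, y)" "h \<in> carrier (hom_module B M Y)" "y \<in> carrier Y" by (auto simp: cind_simps)
  have h: "h \<in> lmod_hom B M Y" "h \<in> extensional (carrier M)" using p(2) by (simp_all add: hom_module_simps)
  obtain a where a: "a \<in> carrier A" "\<forall>m\<in>carrier M. h m = \<theta> (m \<triangleleft>\<^sub>M a)" using Y(3)[OF h(1)] by blast
  have "y \<in> \<theta> ` carrier M" using p(3) iso_surj[OF Y(2)] by simp
  then obtain m where m: "m \<in> carrier M" "y = \<theta> m" by auto
  have "h = (\<lambda>m'\<in>carrier M. \<theta> (m' \<triangleleft>\<^sub>M a))"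
   using h(2) a(2) by (intro extensionalityI[of _ "carrier M"]) auto
  then have "p = mat a \<zero>\<^sub>N m \<zero>\<^sub>B \<odot>\<^bsub>cind Y\<^esub> g" using act a(1) m p(1) by simp
  then show "\<exists>a\<in>carrier A. \<exists>m\<in>carrier M. p = mat a \<zero>\<^sub>N m \<zero>\<^sub>B \<odot>\<^bsub>cind Y\<^esub> g" using a(1) m(1) by blast
 qed
qed

end

section \<open>Duality over a central commutative artinian ring\<close>

text \<open>
 The properties of the minimal injective cogenerator \<open>E\<close> from which the duality \<open>Hom\<^sub>K(-, E)\<close> is derived: \<open>E\<close> is
 injective of finite length, its endomorphisms are scalars, and every simple \<open>K\<close>-module embeds into it.
\<close>

locale dualizing_module = E: left_module K E
 for K :: "('k, 'p) ring_scheme" and E :: "('k, 'e) module" +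
 assumes comm: "cring K" and baer: "baer K E"
  and noeth_E: "noeth K E"
  and endo: "h \<in> lmod_hom K E E \<Longrightarrow> \<exists>k\<in>carrier K. \<forall>e\<in>carrier E. h e = k \<odot>\<^sub>E e"
  and cogenerator: "submod K (reg K) I \<Longrightarrow> \<one>\<^sub>K \<notin> I \<Longrightarrow> \<exists>e\<in>carrier E. e \<noteq> \<zero>\<^sub>E \<and> (\<forall>k\<in>I. k \<odot>\<^sub>E e = \<zero>\<^sub>E)"
begin

lemma ring_K: "ring K" and module_E: "left_module K E"
 by (rule E.R.ring_axioms E.left_module_axioms)+

definition dual :: "('k \<Rightarrow> 'r) \<Rightarrow> ('r, 'x, 'q) module_scheme \<Rightarrow> ('r, 'x \<Rightarrow> 'e) module"
 where "dual \<eta> X = hom_module K (op_bimodule \<eta> X) E"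

lemma dual_simps:
 "f \<in> carrier (dual \<eta> X) \<longleftrightarrow> f \<in> lmod_hom K (op_bimodule \<eta> X) E \<and> f \<in> extensional (carrier X)"
 "\<zero>\<^bsub>dual \<eta> X\<^esub> = (\<lambda>x\<in>carrier X. \<zero>\<^sub>E)" "f \<oplus>\<^bsub>dual \<eta> X\<^esub> g = (\<lambda>x\<in>carrier X. f x \<oplus>\<^sub>E g x)"
 "r \<odot>\<^bsub>dual \<eta> X\<^esub> f = (\<lambda>x\<in>carrier X. f (r \<odot>\<^sub>X x))"
 by (simp_all add: dual_def hom_module_simps)

lemma dual_hom: "f \<in> carrier (dual \<eta> X) \<Longrightarrow> f \<in> lmod_hom K (op_bimodule \<eta> X) E"
 by (simp add: dual_simps)

lemma dual_closed: "f \<in> carrier (dual \<eta> X) \<Longrightarrow> x \<in> carrier X \<Longrightarrow> f x \<in> carrier E"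
 using hom_closed[OF dual_hom, of f \<eta> X x] by simp

lemma dual_add: "f \<in> carrier (dual \<eta> X) \<Longrightarrow> x \<in> carrier X \<Longrightarrow> y \<in> carrier X \<Longrightarrow> f (x \<oplus>\<^sub>X y) = f x \<oplus>\<^sub>E f y"
 using hom_add[OF dual_hom, of f \<eta> X x y] by simp

lemma dual_smult: "f \<in> carrier (dual \<eta> X) \<Longrightarrow> k \<in> carrier K \<Longrightarrow> x \<in> carrier X \<Longrightarrow> f (\<eta> k \<odot>\<^sub>X x) = k \<odot>\<^sub>E f x"
 using hom_smult[OF dual_hom, of f \<eta> X k x] by simp

lemma dual_ext:
 assumes "f \<in> carrier (dual \<eta> X)" "g \<in> carrier (dual \<eta> X)" "\<And>x. x \<in> carrier X \<Longrightarrow> f x = g x" shows "f = g"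
 using assms by (intro hom_module_ext[of f K "op_bimodule \<eta> X" E g]) (simp_all add: dual_def)

lemma dual_left_module:
 "central_algebra K \<eta> R \<Longrightarrow> left_module R X \<Longrightarrow> left_module (opposite_ring R) (dual \<eta> X)"
 unfolding dual_def by (rule hom_module_left_module[OF op_bimodule_bimodule[OF ring_K] module_E])

lemma dual_zero:
 assumes "central_algebra K \<eta> R" "left_module R X" "f \<in> carrier (dual \<eta> X)" shows "f \<zero>\<^sub>X = \<zero>\<^sub>E"
 using hom_zero[OF op_bimodule_left[OF ring_K assms(1,2)] module_E dual_hom[OF assms(3)]] by simp

lemma dualI:
 assumes "central_algebra K \<eta> R" "left_module R X" "h \<in> lmod_hom K (op_bimodule \<eta> X) E"
 shows "restrict h (carrier X) \<in> carrier (dual \<eta> X)"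
 using hom_restrictI[OF assms(3) op_bimodule_left[OF ring_K assms(1,2)]] by (simp add: dual_def)

text \<open>\<open>Hom(X, DP) = Hom(P, DX)\<close>, both being the bilinear maps from \<open>X \<times> P\<close> to \<open>E\<close> balanced over \<open>R\<close>.\<close>

lemma dual_flip:
 assumes R: "central_algebra K \<eta> R" and P: "left_module R P" and X: "left_module (opposite_ring R) X"
  and F: "F \<in> lmod_hom (opposite_ring R) X (dual \<eta> P)"
 shows "(\<lambda>p. \<lambda>x\<in>carrier X. F x p) \<in> lmod_hom R P (dual \<eta> X)"
proof -
 interpret P: left_module R P by fact
 interpret X: left_module "opposite_ring R" X by fact
 note R' = central_algebraD[OF R]
 note Fc = hom_closed[OF F]
 have Fa: "F (x \<oplus>\<^sub>X y) p = F x p \<oplus>\<^sub>E F y p" if "x \<in> carrier X" "y \<in> carrier X" "p \<in> carrier P" for x y p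
  using hom_add[OF F that(1,2)] that(3) by (simp add: dual_simps)
 have Fs: "F (r \<odot>\<^sub>X x) p = F x (r \<odot>\<^sub>P p)" if "r \<in> carrier R" "x \<in> carrier X" "p \<in> carrier P" for r x p
  using hom_smult[OF F, of r x] that by (simp add: dual_simps)
 have c: "(\<lambda>x\<in>carrier X. F x p) \<in> carrier (dual \<eta> X)" if p: "p \<in> carrier P" for p
 proof (rule dualI[OF central_algebra_opposite[OF R] X lmod_homI])
  show "F (k \<odot>\<^bsub>op_bimodule \<eta> X\<^esub> x) p = k \<odot>\<^sub>E F x p" if "k \<in> carrier K" "x \<in> carrier (op_bimodule \<eta> X)" for k x
   using that p Fs[OF R'(2)[OF that(1)]] dual_smult[OF Fc[of x]] by simp
 qed (use p Fa dual_closed[OF Fc] in simp_all)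
 show ?thesis
 proof (rule lmod_homI[OF c])
  show "(\<lambda>x\<in>carrier X. F x (p \<oplus>\<^sub>P q)) = (\<lambda>x\<in>carrier X. F x p) \<oplus>\<^bsub>dual \<eta> X\<^esub> (\<lambda>x\<in>carrier X. F x q)"
   if "p \<in> carrier P" "q \<in> carrier P" for p q
   using that by (auto simp: dual_simps(3) dual_add[OF Fc] intro!: restrict_ext)
  show "(\<lambda>x\<in>carrier X. F x (r \<odot>\<^sub>P p)) = r \<odot>\<^bsub>dual \<eta> X\<^esub> (\<lambda>x\<in>carrier X. F x p)"
   if "r \<in> carrier R" "p \<in> carrier P" for r p
   using that Fs by (auto simp: dual_simps(4) intro!: restrict_ext)
 qed
qed

lemma dual_map_hom:
 assumes R: "central_algebra K \<eta> R" and U: "left_module R U" and g: "g \<in> lmod_hom R U X"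
 shows "(\<lambda>f. \<lambda>u\<in>carrier U. f (g u)) \<in> lmod_hom (opposite_ring R) (dual \<eta> X) (dual \<eta> U)"
proof (rule lmod_homI)
 note gc = hom_closed[OF g]
 show "(\<lambda>u\<in>carrier U. f (g u)) \<in> carrier (dual \<eta> U)" if "f \<in> carrier (dual \<eta> X)" for f
  by (rule dualI[OF R U hom_comp[OF op_bimodule_hom[OF R g] dual_hom[OF that]]])
 show "(\<lambda>u\<in>carrier U. (f \<oplus>\<^bsub>dual \<eta> X\<^esub> f') (g u)) = (\<lambda>u\<in>carrier U. f (g u)) \<oplus>\<^bsub>dual \<eta> U\<^esub> (\<lambda>u\<in>carrier U. f' (g u))" for f f'
  using gc by (auto simp: dual_simps(3) intro!: restrict_ext)
 interpret U: left_module R U by fact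
 show "(\<lambda>u\<in>carrier U. (r \<odot>\<^bsub>dual \<eta> X\<^esub> f) (g u)) = r \<odot>\<^bsub>dual \<eta> U\<^esub> (\<lambda>u\<in>carrier U. f (g u))"
  if "r \<in> carrier (opposite_ring R)" for r f
  using that gc hom_smult[OF g] by (auto simp: dual_simps(4) intro!: restrict_ext)
qed

lemma dual_ses:
 assumes R: "central_algebra K \<eta> R" and s: "ses R X Y Z f g"
 shows "ses (opposite_ring R) (dual \<eta> Z) (dual \<eta> Y) (dual \<eta> X)
  (\<lambda>\<phi>. \<lambda>y\<in>carrier Y. \<phi> (g y)) (\<lambda>\<phi>. \<lambda>x\<in>carrier X. \<phi> (f x))"
proof -
 note s' = sesD[OF s]
 note l = op_bimodule_left[OF ring_K R s'(1)] op_bimodule_left[OF ring_K R s'(2)] op_bimodule_left[OF ring_K R s'(3)]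
 note fK = op_bimodule_hom[OF R s'(4)] and gK = op_bimodule_hom[OF R s'(6)]
 show ?thesis
 proof (rule sesI[OF dual_left_module[OF R s'(3)] dual_left_module[OF R s'(2)] dual_left_module[OF R s'(1)]
    dual_map_hom[OF R s'(2,6)] _ dual_map_hom[OF R s'(1,4)]])
  fix \<phi> assume \<phi>: "\<phi> \<in> carrier (dual \<eta> Z)"
  show "\<phi> = \<zero>\<^bsub>dual \<eta> Z\<^esub>" if z: "(\<lambda>y\<in>carrier Y. \<phi> (g y)) = \<zero>\<^bsub>dual \<eta> Y\<^esub>"
  proof (rule dual_ext[OF \<phi> abelian_groupE(2)[OF left_module.axioms(2)[OF dual_left_module[OF R s'(3)]]]])
   fix x assume x: "x \<in> carrier Z"
   obtain y where "y \<in> carrier Y" "g y = x" using s'(11)[OF x] by blast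
   then show "\<phi> x = \<zero>\<^bsub>dual \<eta> Z\<^esub> x" using fun_cong[OF z, of y] x by (simp add: dual_simps)
  qed
  show "(\<lambda>x\<in>carrier X. (\<lambda>y\<in>carrier Y. \<phi> (g y)) (f x)) = \<zero>\<^bsub>dual \<eta> X\<^esub>"
   using s'(9) hom_closed[OF s'(4)] dual_zero[OF R s'(3) \<phi>] by (auto simp: dual_simps intro!: restrict_ext)
 next
  fix \<phi> assume \<phi>: "\<phi> \<in> carrier (dual \<eta> X)"
  have inj: "inj_on f (carrier (op_bimodule \<eta> X))" using s'(5) by simp
  obtain h where h: "h \<in> lmod_hom K (op_bimodule \<eta> Y) E" "\<And>x. x \<in> carrier (op_bimodule \<eta> X) \<Longrightarrow> h (f x) = \<phi> x"
   by (rule baer_extend_inj[OF module_E baer l(1,2) fK inj dual_hom[OF \<phi>]]) (rule that)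
  show "\<exists>\<psi>\<in>carrier (dual \<eta> Y). (\<lambda>x\<in>carrier X. \<psi> (f x)) = \<phi>"
  proof (rule bexI[OF _ dualI[OF R s'(2) h(1)]])
   show "(\<lambda>x\<in>carrier X. restrict h (carrier Y) (f x)) = \<phi>"
    using h(2) hom_closed[OF s'(4)] \<phi> by (intro extensionalityI[of _ "carrier X"]) (auto simp: dual_simps)
  qed
 next
  fix \<phi> assume \<phi>: "\<phi> \<in> carrier (dual \<eta> Y)" and z: "(\<lambda>x\<in>carrier X. \<phi> (f x)) = \<zero>\<^bsub>dual \<eta> X\<^esub>"
  have gs: "g ` carrier (op_bimodule \<eta> Y) = carrier (op_bimodule \<eta> Z)" using s'(7) by simp
  obtain k where k: "k \<in> lmod_hom K (op_bimodule \<eta> Z) E" "\<And>y. y \<in> carrier (op_bimodule \<eta> Y) \<Longrightarrow> k (g y) = \<phi> y"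
  proof (rule hom_factor[OF l(2,3) module_E gK gs dual_hom[OF \<phi>]])
   fix y assume y: "y \<in> carrier (op_bimodule \<eta> Y)" "g y = \<zero>\<^bsub>op_bimodule \<eta> Z\<^esub>"
   then obtain x where "x \<in> carrier X" "y = f x" using s'(10)[of y] by auto
   then show "\<phi> y = \<zero>\<^sub>E" using fun_cong[OF z, of x] by (simp add: dual_simps)
  qed (rule that)
  show "\<exists>\<psi>\<in>carrier (dual \<eta> Z). \<phi> = (\<lambda>y\<in>carrier Y. \<psi> (g y))"
  proof (rule bexI[OF _ dualI[OF R s'(3) k(1)]])
   show "\<phi> = (\<lambda>y\<in>carrier Y. restrict k (carrier Z) (g y))"
    using k(2) hom_closed[OF s'(6)] \<phi> by (intro extensionalityI[of _ "carrier Y"]) (auto simp: dual_simps)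
  qed
 qed
qed

text \<open>
 By \<open>dual_flip\<close>, a homomorphism from \<open>X\<close> into \<open>DP\<close> is one from \<open>P\<close> into \<open>DX\<close>. An embedding \<open>X \<rightarrow> Y\<close> dualizes
 to a surjection \<open>DY \<rightarrow> DX\<close>, along which it can be lifted.
\<close>

lemma dual_injective:
 fixes R :: "'r ring"
 assumes R: "central_algebra K \<eta> R" and P: "projective_module R P" "finitely_generated R P"
 shows "injective_module (opposite_ring R) (dual \<eta> P)"
 unfolding injective_module_def
proof (intro conjI allI impI; (elim conjE)?)
 have lP: "left_module R P" using P by (simp add: projective_module_def)
 note R' = central_algebra_opposite[OF R]
 show "left_module (opposite_ring R) (dual \<eta> P)" by (rule dual_left_module[OF R lP])
 fix X Y :: "('r, 'r fg_carrier) module" and g F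
 assume a: "left_module (opposite_ring R) X" "left_module (opposite_ring R) Y"
  "g \<in> lmod_hom (opposite_ring R) X Y" "inj_on g (carrier X)" "F \<in> lmod_hom (opposite_ring R) X (dual \<eta> P)"
 let ?p = "\<lambda>f. \<lambda>x\<in>carrier X. f (g x)"
 have p: "?p \<in> lmod_hom R (dual \<eta> Y) (dual \<eta> X)" using dual_map_hom[OF R' a(1,3)] by simp
 have lXY: "left_module R (dual \<eta> X)" "left_module R (dual \<eta> Y)"
  using dual_left_module[OF R' a(1)] dual_left_module[OF R' a(2)] by simp_all
 have "\<phi> \<in> ?p ` carrier (dual \<eta> Y)" if \<phi>: "\<phi> \<in> carrier (dual \<eta> X)" for \<phi>
 proof -
  have inj: "inj_on g (carrier (op_bimodule \<eta> X))" using a(4) by simp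
  obtain h where h: "h \<in> lmod_hom K (op_bimodule \<eta> Y) E" "\<And>x. x \<in> carrier (op_bimodule \<eta> X) \<Longrightarrow> h (g x) = \<phi> x"
   by (rule baer_extend_inj[OF module_E baer op_bimodule_left[OF ring_K R' a(1)] op_bimodule_left[OF ring_K R' a(2)]
      op_bimodule_hom[OF R' a(3)] inj dual_hom[OF \<phi>]]) (rule that)
  have "?p (restrict h (carrier Y)) = \<phi>"
   using h(2) hom_closed[OF a(3)] \<phi> by (intro extensionalityI[of _ "carrier X"]) (auto simp: dual_simps)
  then show ?thesis using imageI[OF dualI[OF R' a(2) h(1)], of ?p] by simp
 qed
 then have ps: "?p ` carrier (dual \<eta> Y) = carrier (dual \<eta> X)" using hom_closed[OF p] by blast
 obtain H where H: "H \<in> lmod_hom R P (dual \<eta> Y)" "\<And>p. p \<in> carrier P \<Longrightarrow> ?p (H p) = (\<lambda>x\<in>carrier X. F x p)"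
  by (rule projective_lift[OF P lXY(2,1) p ps dual_flip[OF R lP a(1,5)]]) (rule that)
 have G: "(\<lambda>y. \<lambda>p\<in>carrier P. H p y) \<in> lmod_hom (opposite_ring R) Y (dual \<eta> P)"
  using dual_flip[OF R' a(2), of P H] lP H(1) by simp
 moreover have "(\<lambda>p\<in>carrier P. H p (g x)) = F x" if x: "x \<in> carrier X" for x
 proof (rule extensionalityI[of _ "carrier P"])
  show "F x \<in> extensional (carrier P)" using hom_closed[OF a(5) x] by (simp add: dual_simps)
  show "(\<lambda>p\<in>carrier P. H p (g x)) p = F x p" if "p \<in> carrier P" for p
   using fun_cong[OF H(2)[OF that], of x] x that by simp
 qed simp
 ultimately show "\<exists>h\<in>lmod_hom (opposite_ring R) Y (dual \<eta> P). \<forall>x\<in>carrier X. h (g x) = F x"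
  by (intro bexI[OF _ G]) simp
qed

end

context dualizing_module begin

text \<open>
 Evaluation at the elements of a finite generating set embeds \<open>D X\<close> into a finite power of \<open>E\<close>.
\<close>

lemma dual_noeth:
 fixes R :: "'r ring"
 assumes R: "central_algebra K \<eta> R" and X: "left_module R X" and fg: "finitely_generated K (op_bimodule \<eta> X)"
 shows "noeth K (op_bimodule \<eta> (dual \<eta> X))"
proof -
 note R' = central_algebra_opposite[OF R]
 have lX: "left_module K (op_bimodule \<eta> X)" by (rule op_bimodule_left[OF ring_K R X])
 let ?D = "op_bimodule \<eta> (dual \<eta> X)"
 have lD: "left_module K ?D" by (rule op_bimodule_left[OF ring_K R' dual_left_module[OF R X]])
 interpret D: left_module K ?D by (rule lD)
 define V where "V S = {f \<in> carrier (dual \<eta> X). \<forall>s\<in>S. f s = \<zero>\<^sub>E}" for S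
 have ev: "(\<lambda>f. f s) \<in> lmod_hom K ?D E" if s: "s \<in> carrier X" for s
  using s dual_closed dual_smult
  by (intro lmod_homI) (simp_all add: dual_simps(3,4))
 have V: "submod K ?D (V S)" if S: "S \<subseteq> carrier X" for S
  unfolding submod_def
 proof (intro conjI ballI)
  show "\<zero>\<^sub>?D \<in> V S" using D.M.zero_closed S by (auto simp: V_def dual_simps(2))
  fix f assume f: "f \<in> V S"
  show "f \<oplus>\<^sub>?D f' \<in> V S" if "f' \<in> V S" for f'
   using f that D.M.a_closed[of f f'] S by (auto simp: V_def dual_simps(3))
  show "k \<odot>\<^sub>?D f \<in> V S" if "k \<in> carrier K" for k
   using f that D.smult_closed[of k f] S by (auto simp: V_def dual_simps(4) dual_smult)
 qed (auto simp: V_def)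
 have lV: "left_module K (sub ?D (V S))" if "S \<subseteq> carrier X" for S
  by (rule D.submod_left_module[OF V[OF that]])
 have step: "noeth K (sub ?D (V S)) \<Longrightarrow> noeth K ?D" if "finite S" "S \<subseteq> carrier X" for S
  using that
 proof (induction S rule: finite_induct)
  case empty
  then show ?case by (simp add: V_def op_bimodule_def)
 next
  case (insert s S)
  have S: "s \<in> carrier X" "S \<subseteq> carrier X" using insert.prems by auto
  have "mod_kernel (sub ?D (V S)) E (\<lambda>f. f s) = V (insert s S)"
   by (auto simp: mod_kernel_def V_def)
  then have "noeth K (sub (sub ?D (V S)) (mod_kernel (sub ?D (V S)) E (\<lambda>f. f s)))"
   using insert.prems(1) by simp
  from noeth_ext[OF lV[OF S(2)] noeth_E hom_restrict[OF ev[OF S(1)] submodD(1)[OF V[OF S(2)]]] this]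
  show ?case by (rule insert.IH[OF _ S(2)])
 qed
 obtain S where S: "finite S" "S \<subseteq> carrier (op_bimodule \<eta> X)"
  "\<And>U. submod K (op_bimodule \<eta> X) U \<Longrightarrow> S \<subseteq> U \<Longrightarrow> U = carrier (op_bimodule \<eta> X)"
  by (rule finitely_generatedE[OF lX fg]) (rule that)
 have SX: "S \<subseteq> carrier X" using S(2) by simp
 have "f = \<zero>\<^sub>?D" if f: "f \<in> V S" for f
 proof -
  have fD: "f \<in> carrier (dual \<eta> X)" using f by (simp add: V_def)
  have "mod_kernel (op_bimodule \<eta> X) E f = carrier (op_bimodule \<eta> X)"
   by (rule S(3)[OF submod_kernel[OF lX module_E dual_hom[OF fD]]])
    (use f SX in \<open>auto simp: V_def mod_kernel_def\<close>)
  then have z: "f x = \<zero>\<^sub>E" if "x \<in> carrier X" for x using that by (auto simp: mod_kernel_def)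
  show ?thesis
   by (rule dual_ext[OF fD]) (use D.M.zero_closed z in \<open>simp_all add: dual_simps(2)\<close>)
 qed
 then have "V S \<subseteq> {\<zero>\<^sub>?D}" by blast
 then have "V S = {\<zero>\<^sub>?D}" using submodD(3)[OF V[OF SX]] by blast
 then have "noeth K (sub ?D (V S))" by (intro noeth_trivial[OF lV[OF SX]]) simp
 then show ?thesis by (rule step[OF S(1) SX])
qed

text \<open>
 A functional on \<open>D X\<close> that vanishes on the functionals vanishing on finitely many elements \<open>s\<close> of \<open>X\<close>
 is the evaluation at a linear combination of the \<open>s\<close>, since the endomorphisms of \<open>E\<close> are scalars.
\<close>

lemma evaluation_surj:
 fixes R :: "'r ring"
 assumes R: "central_algebra K \<eta> R" and X: "left_module R X" and S: "finite S" "S \<subseteq> carrier X"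
  and F: "F \<in> lmod_hom K (op_bimodule \<eta> (dual \<eta> X)) E"
  and van: "\<And>f. f \<in> carrier (dual \<eta> X) \<Longrightarrow> \<forall>s\<in>S. f s = \<zero>\<^sub>E \<Longrightarrow> F f = \<zero>\<^sub>E"
 shows "\<exists>x\<in>carrier X. \<forall>f\<in>carrier (dual \<eta> X). F f = f x"
 using S F van
proof (induction S arbitrary: F rule: finite_induct)
 interpret X: left_module R X by fact
 {
  case empty
  show ?case using empty(3) dual_zero[OF R X] by (intro bexI[of _ "\<zero>\<^sub>X"]) simp_all
 next
  case (insert s S)
  note F = insert.prems(2)
  note R' = central_algebra_opposite[OF R]
  let ?D = "op_bimodule \<eta> (dual \<eta> X)"
  have lD: "left_module K ?D" by (rule op_bimodule_left[OF ring_K R' dual_left_module[OF R X]])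
  interpret D: left_module K ?D by (rule lD)
  have s: "s \<in> carrier X" "S \<subseteq> carrier X" using insert.prems by auto
  have ev: "(\<lambda>f. f x) \<in> lmod_hom K ?D E" if "x \<in> carrier X" for x
   using that dual_closed dual_smult by (intro lmod_homI) (simp_all add: dual_simps(3,4))
  let ?V = "{f \<in> carrier (dual \<eta> X). \<forall>s\<in>S. f s = \<zero>\<^sub>E}"
  have V: "submod K ?D ?V"
   unfolding submod_def
  proof (intro conjI ballI)
   show "\<zero>\<^sub>?D \<in> ?V" using D.M.zero_closed s by (auto simp: dual_simps(2))
   fix f assume f: "f \<in> ?V"
   show "f \<oplus>\<^sub>?D f' \<in> ?V" if "f' \<in> ?V" for f'
    using f that D.M.a_closed[of f f'] s by (auto simp: dual_simps(3))
   show "k \<odot>\<^sub>?D f \<in> ?V" if "k \<in> carrier K" for k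
    using f that D.smult_closed[of k f] s by (auto simp: dual_simps(4) dual_smult)
  qed auto
  have lV: "left_module K (sub ?D ?V)" by (rule D.submod_left_module[OF V])
  have evV: "(\<lambda>f. f s) \<in> lmod_hom K (sub ?D ?V) E" by (rule hom_restrict[OF ev[OF s(1)] submodD(1)[OF V]])
  let ?I = "(\<lambda>f. f s) ` ?V"
  have I: "submod K E ?I" by (rule submod_image[OF lD module_E ev[OF s(1)] V])
  have sI: "(\<lambda>f. f s) ` carrier (sub ?D ?V) = carrier (sub E ?I)" by simp
  have eI: "(\<lambda>f. f s) \<in> lmod_hom K (sub ?D ?V) (sub E ?I)" by (rule hom_into_sub[OF evV]) simp
  obtain \<phi> where \<phi>: "\<phi> \<in> lmod_hom K (sub E ?I) E" "\<And>f. f \<in> carrier (sub ?D ?V) \<Longrightarrow> \<phi> (f s) = F f"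
   by (rule hom_factor[OF lV E.submod_left_module[OF I] module_E eI sI hom_restrict[OF F submodD(1)[OF V]]])
    (use insert.prems(3) that in auto)
  obtain h where h: "h \<in> lmod_hom K E E" "\<And>u. u \<in> ?I \<Longrightarrow> h u = \<phi> u"
   by (rule baer_extend[OF module_E baer module_E I \<phi>(1)]) (rule that)
  obtain k where k: "k \<in> carrier K" "\<forall>e\<in>carrier E. h e = k \<odot>\<^sub>E e" using endo[OF h(1)] by blast
  let ?x = "\<eta> k \<odot>\<^sub>X s"
  have x: "?x \<in> carrier X" using s central_algebraD(2)[OF R k(1)] by simp
  have G: "(\<lambda>f. F f \<oplus>\<^sub>E \<ominus>\<^sub>E f ?x) \<in> lmod_hom K ?D E"
   by (rule hom_sum[OF module_E F hom_neg[OF module_E ev[OF x]]])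
  have "\<exists>y\<in>carrier X. \<forall>f\<in>carrier (dual \<eta> X). F f \<oplus>\<^sub>E \<ominus>\<^sub>E f ?x = f y"
  proof (rule insert.IH[OF s(2) G])
   fix f assume f: "f \<in> carrier (dual \<eta> X)" "\<forall>s\<in>S. f s = \<zero>\<^sub>E"
   then have fV: "f \<in> carrier (sub ?D ?V)" by simp
   have "F f = h (f s)" using \<phi>(2)[OF fV] h(2)[of "f s"] f by auto
   then show "F f \<oplus>\<^sub>E \<ominus>\<^sub>E f ?x = \<zero>\<^sub>E"
    using k dual_closed[OF f(1) s(1)] dual_smult[OF f(1) k(1) s(1)] by (simp add: E.M.r_neg)
  qed
  then obtain y where y: "y \<in> carrier X" "\<forall>f\<in>carrier (dual \<eta> X). F f \<oplus>\<^sub>E \<ominus>\<^sub>E f ?x = f y" by blast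
  have "F f = f (?x \<oplus>\<^sub>X y)" if f: "f \<in> carrier (dual \<eta> X)" for f
   using y f x dual_add[OF f x y(1)] E.add_diff_cancel[of "F f" "f ?x"] dual_closed[OF f x]
    hom_closed[OF F, of f] by simp
  then show ?case using x y(1) by (intro bexI[of _ "?x \<oplus>\<^sub>X y"]) auto
 }
qed

text \<open>
 A nonzero \<open>x\<close> is detected by a functional: the annihilator of \<open>x\<close> is a proper ideal, so some nonzero
 element of \<open>E\<close> is annihilated by it, and injectivity extends the resulting functional on \<open>K x\<close>.
\<close>

lemma functional_exists:
 fixes R :: "'r ring"
 assumes R: "central_algebra K \<eta> R" and X: "left_module R X" and x: "x \<in> carrier X" "x \<noteq> \<zero>\<^sub>X"
 obtains f where "f \<in> carrier (dual \<eta> X)" "f x \<noteq> \<zero>\<^sub>E"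
proof -
 interpret X: left_module R X by fact
 interpret K: ring K by (rule ring_K)
 note lX = op_bimodule_left[OF ring_K R X] and lK = reg_left_module[OF ring_K]
 let ?X = "op_bimodule \<eta> X" and ?q = "\<lambda>k. \<eta> k \<odot>\<^sub>X x"
 interpret KX: left_module K ?X by (rule lX)
 have q: "?q \<in> lmod_hom K (reg K) ?X" using hom_from_reg[OF lX, of x] x(1) by simp
 let ?I = "mod_kernel (reg K) ?X ?q" and ?U = "?q ` carrier (reg K)"
 have "\<one>\<^sub>K \<notin> ?I" using x central_algebraD(3)[OF R] by (simp add: mod_kernel_def)
 then obtain e where e: "e \<in> carrier E" "e \<noteq> \<zero>\<^sub>E" "\<forall>k\<in>?I. k \<odot>\<^sub>E e = \<zero>\<^sub>E"
  using cogenerator[OF submod_kernel[OF lK lX q]] by blast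
 have U: "submod K ?X ?U"
  by (rule submod_image[OF lK lX q left_module.submod_carrier[OF lK]])
 have sU: "?q ` carrier (reg K) = carrier (sub ?X ?U)" by simp
 have qU: "?q \<in> lmod_hom K (reg K) (sub ?X ?U)" by (rule hom_into_sub[OF q]) simp
 obtain h where h: "h \<in> lmod_hom K (sub ?X ?U) E" "\<And>k. k \<in> carrier (reg K) \<Longrightarrow> h (?q k) = k \<odot>\<^sub>E e"
  by (rule hom_factor[OF lK KX.submod_left_module[OF U] module_E qU sU hom_from_reg[OF module_E e(1)]])
   (use e(3) that in \<open>auto simp: mod_kernel_def\<close>)
 obtain f where f: "f \<in> lmod_hom K ?X E" "\<And>u. u \<in> ?U \<Longrightarrow> f u = h u"
  by (rule baer_extend[OF module_E baer lX U h(1)]) (rule that)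
 have xq: "?q \<one>\<^sub>K = x" using x central_algebraD(3)[OF R] by simp
 have "f (?q \<one>\<^sub>K) = h (?q \<one>\<^sub>K)" by (rule f(2)) simp
 then have "f x = e" using h(2)[of "\<one>\<^sub>K"] e(1) unfolding xq by simp
 then show thesis using that[OF dualI[OF R X f(1)]] x(1) e(2) by simp
qed

lemma evaluation_iso:
 fixes R :: "'r ring"
 assumes R: "central_algebra K \<eta> R" and X: "left_module R X" and fg: "finitely_generated K (op_bimodule \<eta> X)"
 shows "(\<lambda>x. \<lambda>f\<in>carrier (dual \<eta> X). f x) \<in> lmod_iso R X (dual \<eta> (dual \<eta> X))"
proof (rule isoI)
 note R' = central_algebra_opposite[OF R]
 note lX = op_bimodule_left[OF ring_K R X] and lD = dual_left_module[OF R X]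
 have lDD: "left_module R (dual \<eta> (dual \<eta> X))" using dual_left_module[OF R' lD] by simp
 let ?ev = "\<lambda>x. \<lambda>f\<in>carrier (dual \<eta> X). f x"
 show ev: "?ev \<in> lmod_hom R X (dual \<eta> (dual \<eta> X))"
  by (rule dual_flip[OF R X lD hom_id])
 have "x = \<zero>\<^sub>X" if x: "x \<in> carrier X" "?ev x = \<zero>\<^bsub>dual \<eta> (dual \<eta> X)\<^esub>" for x
 proof (rule ccontr)
  assume "x \<noteq> \<zero>\<^sub>X"
  then obtain f where "f \<in> carrier (dual \<eta> X)" "f x \<noteq> \<zero>\<^sub>E" by (rule functional_exists[OF R X x(1)]) (rule that)
  then show False using fun_cong[OF x(2), of f] by (simp add: dual_simps(2))
 qed
 then show "inj_on ?ev (carrier X)" using hom_inj_iff[OF X lDD ev] by blast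
 obtain S where S: "finite S" "S \<subseteq> carrier (op_bimodule \<eta> X)"
  "\<And>U. submod K (op_bimodule \<eta> X) U \<Longrightarrow> S \<subseteq> U \<Longrightarrow> U = carrier (op_bimodule \<eta> X)"
  by (rule finitely_generatedE[OF lX fg]) (rule that)
 have "F \<in> ?ev ` carrier X" if F: "F \<in> carrier (dual \<eta> (dual \<eta> X))" for F
 proof -
  have "F f = \<zero>\<^sub>E" if f: "f \<in> carrier (dual \<eta> X)" "\<forall>s\<in>S. f s = \<zero>\<^sub>E" for f
  proof -
   have "mod_kernel (op_bimodule \<eta> X) E f = carrier (op_bimodule \<eta> X)"
    by (rule S(3)[OF submod_kernel[OF lX module_E dual_hom[OF f(1)]]])
     (use f S(2) in \<open>auto simp: mod_kernel_def\<close>)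
   then have "f x = \<zero>\<^sub>E" if "x \<in> carrier X" for x using that by (auto simp: mod_kernel_def)
   then have "f = \<zero>\<^bsub>dual \<eta> X\<^esub>"
    using f(1) by (intro extensionalityI[of _ "carrier X"]) (auto simp: dual_simps)
   then show ?thesis using dual_zero[OF R' lD F] by simp
  qed
  then obtain x where x: "x \<in> carrier X" "\<forall>f\<in>carrier (dual \<eta> X). F f = f x"
   using evaluation_surj[OF R X S(1) _ dual_hom[OF F]] S(2) by auto
  have "F = ?ev x"
   using x F by (intro extensionalityI[of _ "carrier (dual \<eta> X)"]) (auto simp: dual_simps(1))
  then show ?thesis using x(1) by simp
 qed
 then show "?ev ` carrier X = carrier (dual \<eta> (dual \<eta> X))" using hom_closed[OF ev] by blast
qed

lemma dual_fg:
 fixes R :: "'r ring"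
 assumes R: "central_algebra K \<eta> R" and n: "noeth K (op_bimodule \<eta> (reg R))"
  and X: "left_module R X" "finitely_generated R X"
 shows "finitely_generated (opposite_ring R) (dual \<eta> X)"
proof (rule fg_op_bimodule[OF ring_K central_algebra_opposite[OF R] dual_left_module[OF R X(1)]])
 show "finitely_generated K (op_bimodule \<eta> (dual \<eta> X))"
  by (rule noeth_fg[OF dual_noeth[OF R X(1) noeth_fg[OF noeth_op_bimodule[OF ring_K R n X]]]])
qed

text \<open>
 A projective presentation of \<open>X\<close> dualizes to an embedding of \<open>DX\<close> into an injective module.
\<close>

lemma id_lt_dual_step:
 fixes R :: "'r ring"
 assumes R: "central_algebra K \<eta> R" and n: "noeth K (op_bimodule \<eta> (reg R))"
  and step: "\<And>Z :: ('r, 'r fg_carrier) module. left_module R Z \<Longrightarrow> pd_lt R n Z \<Longrightarrow> id_lt (opposite_ring R) n (dual \<eta> Z)"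
  and X: "left_module R X" "pd_lt R (Suc n) X"
 shows "id_lt (opposite_ring R) (Suc n) (dual \<eta> X)"
proof -
 obtain Z P :: "('r, 'r fg_carrier) module" and k p where s: "ses R Z P X k p" "finitely_generated R P"
  "projective_module R P" "pd_lt R n Z"
  by (rule pd_lt_SucE[OF X]) (rule that)
 show ?thesis
  by (rule id_lt_SucI[OF dual_ses[OF R s(1)] dual_fg[OF R n sesD(2)[OF s(1)] s(2)]
     dual_injective[OF R s(3,2)] step[OF sesD(1)[OF s(1)] s(4)]])
qed

lemma id_lt_dual_0:
 fixes R :: "'r ring"
 assumes R: "central_algebra K \<eta> R" and X: "left_module R X" "pd_lt R 0 X"
 shows "id_lt (opposite_ring R) 0 (dual \<eta> X)"
proof -
 have lD: "left_module (opposite_ring R) (dual \<eta> X)" by (rule dual_left_module[OF R X(1)])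
 interpret D: left_module "opposite_ring R" "dual \<eta> X" by fact
 have z: "carrier X = {\<zero>\<^sub>X}" using X pd_lt_0 by blast
 have "f = \<zero>\<^bsub>dual \<eta> X\<^esub>" if f: "f \<in> carrier (dual \<eta> X)" for f
  by (rule dual_ext[OF f D.M.zero_closed]) (use z dual_zero[OF R X(1) f] in \<open>simp add: dual_simps(2)\<close>)
 then have "carrier (dual \<eta> X) = {\<zero>\<^bsub>dual \<eta> X\<^esub>}" using D.M.zero_closed by blast
 then show ?thesis using id_lt_0[OF lD] by simp
qed

lemma id_lt_dual:
 fixes R :: "'r ring"
 assumes R: "central_algebra K \<eta> R" and n: "noeth K (op_bimodule \<eta> (reg R))"
  and X: "left_module R X" "pd_lt R n X"
 shows "id_lt (opposite_ring R) n (dual \<eta> X)"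
proof -
 have *: "left_module R Z \<Longrightarrow> pd_lt R n Z \<Longrightarrow> id_lt (opposite_ring R) n (dual \<eta> Z)"
  for Z :: "('r, 'r fg_carrier) module" and n
 proof (induction n arbitrary: Z)
  case 0 then show ?case by (rule id_lt_dual_0[OF R])
 next
  case (Suc n) then show ?case by (intro id_lt_dual_step[OF R n])
 qed
 show ?thesis
 proof (cases n)
  case 0 then show ?thesis using id_lt_dual_0[OF R] X by simp
 next
  case (Suc n') then show ?thesis using id_lt_dual_step[OF R n * X(1)] X(2) by simp
 qed
qed

end

section \<open>The Gorenstein property of Morita rings\<close>

lemma dualizing_module_exists:
 fixes K :: "('k, 'p) ring_scheme"
 assumes K: "artinian_ring K"
 obtains E :: "('k, 'k fg_carrier) module" where "dualizing_module K E"
proof -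
 have cK: "cring K" using K by (simp add: artinian_ring_def)
 interpret K: cring K by (rule cK)
 obtain E :: "('k, 'k fg_carrier) module" where E: "left_module K E" "one_dim K E" "baer K E"
  "\<And>m. max_ideal K m \<Longrightarrow> \<exists>e\<in>ann E m. e \<noteq> \<zero>\<^sub>E"
  by (rule injective_cogenerator_exists[OF K]) (rule that)
 obtain r where r: "colength K r {\<zero>\<^sub>K}" by (rule colength_zero[OF K])
 show thesis
 proof (rule that[of E], intro dualizing_module.intro dualizing_module_axioms.intro cK E(1,3))
  obtain \<rho> where \<rho>: "\<And>U. \<rho> U \<le> r"
   "\<And>U V. submod K E U \<Longrightarrow> submod K E V \<Longrightarrow> U \<subset> V \<Longrightarrow> V \<subseteq> ann E {\<zero>\<^sub>K} \<Longrightarrow> \<rho> U < (\<rho> V :: nat)"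
   using one_dim_rank[OF cK E(1,2) r] by metis
  show "noeth K E"
   using submodD(1) by (intro rank_noeth[OF E(1) \<rho>(1)] \<rho>(2)) (auto simp: ann_zero[OF E(1)])
  show "\<exists>k\<in>carrier K. \<forall>e\<in>carrier E. h e = k \<odot>\<^sub>E e" if "h \<in> lmod_hom K E E" for h
   using one_dim_endo[OF cK E(1,2) r that] by (simp add: ann_zero[OF E(1)])
  fix I assume I: "submod K (reg K) I" "\<one>\<^sub>K \<notin> I"
  obtain m where m: "max_ideal K m" "I \<subseteq> m" by (rule max_ideal_exists[OF K.ring_axioms I])
  obtain e where e: "e \<in> ann E m" "e \<noteq> \<zero>\<^sub>E" using E(4)[OF m(1)] by blast
  show "\<exists>e\<in>carrier E. e \<noteq> \<zero>\<^sub>E \<and> (\<forall>k\<in>I. k \<odot>\<^sub>E e = \<zero>\<^sub>E)" using m(2) annD(1,2)[OF e(1)] e(2) by (intro bexI[of _ e]) auto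
 qed
qed

lemma noeth_opposite:
 assumes K: "ring K" and R: "central_algebra K \<eta> R" and n: "noeth K (op_bimodule \<eta> (reg R))"
 shows "noeth K (op_bimodule \<eta> (reg (opposite_ring R)))"
proof (rule noeth_same_carrier[OF n])
 note R' = central_algebra_opposite[OF R]
 show "left_module K (op_bimodule \<eta> (reg (opposite_ring R)))"
  by (rule bimodule.axioms(1)[OF op_bimodule_bimodule[OF K R' reg_left_module[OF central_algebraD(1)[OF R']]]])
qed (simp_all add: central_algebraD(6)[OF R])

text \<open>
 The second condition says that the kernel of \<open>f'\<close> already maps onto \<open>C\<close>, and symmetrically.
\<close>

lemma dsum_iso:
 assumes X: "left_module R X" and C: "left_module R C" "left_module R C'"
  and f: "f \<in> lmod_hom R X C" "f' \<in> lmod_hom R X C'"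
  and inj: "\<And>x. x \<in> carrier X \<Longrightarrow> f x = \<zero>\<^sub>C \<Longrightarrow> f' x = \<zero>\<^bsub>C'\<^esub> \<Longrightarrow> x = \<zero>\<^sub>X"
  and s: "\<And>p. p \<in> carrier C \<Longrightarrow> \<exists>x\<in>carrier X. f x = p \<and> f' x = \<zero>\<^bsub>C'\<^esub>"
   "\<And>p. p \<in> carrier C' \<Longrightarrow> \<exists>x\<in>carrier X. f' x = p \<and> f x = \<zero>\<^sub>C"
 shows "(\<lambda>x. (f x, f' x)) \<in> lmod_iso R X (dsum C C')"
proof (rule isoI)
 interpret X: left_module R X by fact
 interpret C: left_module R C by fact
 interpret C': left_module R C' by fact
 show F: "(\<lambda>x. (f x, f' x)) \<in> lmod_hom R X (dsum C C')" by (rule hom_pair[OF f])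
 show "inj_on (\<lambda>x. (f x, f' x)) (carrier X)"
  unfolding hom_inj_iff[OF X dsum_left_module[OF C] F] using inj by simp
 have "p \<in> (\<lambda>x. (f x, f' x)) ` carrier X" if p: "p \<in> carrier (dsum C C')" for p
 proof -
  obtain q q' where q: "p = (q, q')" "q \<in> carrier C" "q' \<in> carrier C'" using p by auto
  obtain x where x: "x \<in> carrier X" "f x = q" "f' x = \<zero>\<^bsub>C'\<^esub>" using s(1)[OF q(2)] by blast
  obtain y where y: "y \<in> carrier X" "f' y = q'" "f y = \<zero>\<^sub>C" using s(2)[OF q(3)] by blast
  have "p = (f (x \<oplus>\<^sub>X y), f' (x \<oplus>\<^sub>X y))"
   using x y q by (simp add: hom_add[OF f(1)] hom_add[OF f(2)])
  then show ?thesis using x(1) y(1) by (intro image_eqI[of _ _ "x \<oplus>\<^sub>X y"]) simp_all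
 qed
 then show "(\<lambda>x. (f x, f' x)) ` carrier X = carrier (dsum C C')" using hom_closed[OF F] by blast
qed

context morita_matrix begin

lemma cind_map_inverse:
 assumes Y: "left_module B Y" and i: "\<And>y. y \<in> carrier Y \<Longrightarrow> k (g y) = y" and p: "p \<in> carrier (cind Y)"
 shows "cind_map k (cind_map g p) = p"
proof -
 obtain h y where p: "p = (h, y)" "h \<in> carrier (hom_module B M Y)" "y \<in> carrier Y" using p by (auto simp: cind_simps)
 have h: "h \<in> lmod_hom B M Y" "h \<in> extensional (carrier M)" using p by (simp_all add: hom_module_simps)
 have "hom_map M k (hom_map M g h) = h"
  using h(2) i hom_closed[OF h(1)] by (intro extensionalityI[of _ "carrier M"]) (auto simp: hom_map_def)
 then show ?thesis using i p by (simp add: cind_map_def)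
qed

lemma cind_map_iso:
 assumes Y: "left_module B Y" "left_module B Z" and g: "g \<in> lmod_iso B Y Z"
 shows "cind_map g \<in> lmod_iso L (cind Y) (cind Z)"
proof (rule isoI)
 let ?k = "inv_into (carrier Y) g"
 note k = iso_inverse[OF g Y(1)]
 show c: "cind_map g \<in> lmod_hom L (cind Y) (cind Z)" by (rule cind_map_hom[OF iso_hom[OF g] Y(1)])
 show "inj_on (cind_map g) (carrier (cind Y))"
  by (rule inj_on_inverseI[of _ "cind_map ?k"]) (rule cind_map_inverse[where k = ?k and g = g, OF Y(1) k(2)])
 have "p \<in> cind_map g ` carrier (cind Y)" if p: "p \<in> carrier (cind Z)" for p
 proof (rule image_eqI)
  show "p = cind_map g (cind_map ?k p)" using cind_map_inverse[where k = g and g = ?k, OF Y(2) k(3) p] by simp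
  show "cind_map ?k p \<in> carrier (cind Y)" by (rule hom_closed[OF cind_map_hom[OF iso_hom[OF k(1)] Y(2)] p])
 qed
 then show "cind_map g ` carrier (cind Y) = carrier (cind Z)" using hom_closed[OF c] by blast
qed

text \<open>
 A central element commutes with the two diagonal idempotents, which makes it diagonal.
\<close>

lemma central_diagonal:
 assumes \<eta>: "central_algebra K \<eta> L" and k: "k \<in> carrier K"
 shows "\<eta> k = mat (\<alpha> (\<eta> k)) \<zero>\<^sub>N \<zero>\<^sub>M (\<beta> (\<eta> k))" "\<alpha> (\<eta> k) \<in> carrier A" "\<beta> (\<eta> k) \<in> carrier B"
proof -
 obtain a n m b where c: "a \<in> carrier A" "n \<in> carrier N" "m \<in> carrier M" "b \<in> carrier B" "\<eta> k = mat a n m b"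
  using matE[OF central_algebraD(2)[OF \<eta> k]] .
 have e: "mat a \<zero>\<^sub>N m \<zero>\<^sub>B = mat a n \<zero>\<^sub>M \<zero>\<^sub>B"
  using central_algebraD(6)[OF \<eta> k, of "eA \<one>\<^sub>A"] c by (simp add: mat_mult)
 have "m = \<zero>\<^sub>M" using arg_cong[OF e, of \<mu>] c by simp
 moreover have "n = \<zero>\<^sub>N" using arg_cong[OF e, of \<nu>] c by simp
 ultimately show "\<eta> k = mat (\<alpha> (\<eta> k)) \<zero>\<^sub>N \<zero>\<^sub>M (\<beta> (\<eta> k))" "\<alpha> (\<eta> k) \<in> carrier A" "\<beta> (\<eta> k) \<in> carrier B"
  using c by simp_all
qed

text \<open>
 Through its central diagonal entries, \<open>K\<close> also acts on the corner \<open>B\<close>.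
\<close>

lemma central_algebra_B:
 assumes \<eta>: "central_algebra K \<eta> L" shows "central_algebra K (\<lambda>k. \<beta> (\<eta> k)) B"
proof -
 note d = central_diagonal[OF \<eta>] and c = central_algebraD[OF \<eta>]
 have \<beta>: "\<beta> (x \<oplus>\<^sub>L y) = \<beta> x \<oplus>\<^sub>B \<beta> y" "\<beta> (\<eta> k \<otimes>\<^sub>L x) = \<beta> (\<eta> k) \<otimes>\<^sub>B \<beta> x" "\<beta> (x \<otimes>\<^sub>L \<eta> k) = \<beta> x \<otimes>\<^sub>B \<beta> (\<eta> k)"
  if t: "x \<in> carrier L" "y \<in> carrier L" "k \<in> carrier K" for x y k
 proof -
  obtain a n m b where x: "a \<in> carrier A" "n \<in> carrier N" "m \<in> carrier M" "b \<in> carrier B" "x = mat a n m b"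
   by (rule matE[OF t(1)])
  obtain a' n' m' b' where y: "a' \<in> carrier A" "n' \<in> carrier N" "m' \<in> carrier M" "b' \<in> carrier B" "y = mat a' n' m' b'"
   by (rule matE[OF t(2)])
  show "\<beta> (x \<oplus>\<^sub>L y) = \<beta> x \<oplus>\<^sub>B \<beta> y" using x y by (simp add: mat_add)
  obtain a0 b0 where k: "a0 \<in> carrier A" "b0 \<in> carrier B" "\<eta> k = mat a0 \<zero>\<^sub>N \<zero>\<^sub>M b0" using d[OF t(3)] by blast
  show "\<beta> (\<eta> k \<otimes>\<^sub>L x) = \<beta> (\<eta> k) \<otimes>\<^sub>B \<beta> x" "\<beta> (x \<otimes>\<^sub>L \<eta> k) = \<beta> x \<otimes>\<^sub>B \<beta> (\<eta> k)"
   using x k by (simp_all add: mat_mult)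
 qed
 have "\<beta> (\<eta> k) \<otimes>\<^sub>B b = b \<otimes>\<^sub>B \<beta> (\<eta> k)" if "k \<in> carrier K" "b \<in> carrier B" for k b
  using c(6)[OF that(1), of "eB b"] \<beta>(2,3)[of "eB b" "eB b" k] that by simp
 moreover have "(\<lambda>k. \<beta> (\<eta> k)) \<in> ring_hom K B"
  using d(3) c(2-5) \<beta>(1) \<beta>(2)[OF c(2) c(2)] by (auto simp: ring_hom_def mat_one)
 ultimately show ?thesis by (simp add: central_algebra_def ring_B)
qed

lemma noeth_B:
 assumes \<eta>: "central_algebra K \<eta> L" and K: "ring K" and n: "noeth K (op_bimodule \<eta> (reg L))"
 shows "noeth K (op_bimodule (\<lambda>k. \<beta> (\<eta> k)) (reg B))"
proof (rule noeth_image[OF n])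
 note B' = central_algebra_B[OF \<eta>]
 show "left_module K (op_bimodule (\<lambda>k. \<beta> (\<eta> k)) (reg B))"
  by (rule bimodule.axioms(1)[OF op_bimodule_bimodule[OF K B' reg_left_module[OF ring_B]]])
 show "\<beta> \<in> lmod_hom K (op_bimodule \<eta> (reg L)) (op_bimodule (\<lambda>k. \<beta> (\<eta> k)) (reg B))"
 proof (rule lmod_homI)
  fix x assume "x \<in> carrier (op_bimodule \<eta> (reg L))"
  then have xL: "x \<in> carrier L" by simp
  obtain a n m b where x: "a \<in> carrier A" "n \<in> carrier N" "m \<in> carrier M" "b \<in> carrier B" "x = mat a n m b"
   by (rule matE[OF xL])
  show "\<beta> x \<in> carrier (op_bimodule (\<lambda>k. \<beta> (\<eta> k)) (reg B))" using x by simp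
  show "\<beta> (k \<odot>\<^bsub>op_bimodule \<eta> (reg L)\<^esub> x) = k \<odot>\<^bsub>op_bimodule (\<lambda>k. \<beta> (\<eta> k)) (reg B)\<^esub> \<beta> x" if k: "k \<in> carrier K" for k
  proof -
   obtain a0 b0 where k: "a0 \<in> carrier A" "b0 \<in> carrier B" "\<eta> k = mat a0 \<zero>\<^sub>N \<zero>\<^sub>M b0"
    using central_diagonal[OF \<eta> k] by blast
   then show ?thesis using x by (simp add: mat_mult)
  qed
  show "\<beta> (x \<oplus>\<^bsub>op_bimodule \<eta> (reg L)\<^esub> y) = \<beta> x \<oplus>\<^bsub>op_bimodule (\<lambda>k. \<beta> (\<eta> k)) (reg B)\<^esub> \<beta> y"
   if y: "y \<in> carrier (op_bimodule \<eta> (reg L))" for y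
  proof -
   have yL: "y \<in> carrier L" using y by simp
   obtain a' n' m' b' where "a' \<in> carrier A" "n' \<in> carrier N" "m' \<in> carrier M" "b' \<in> carrier B" "y = mat a' n' m' b'"
    by (rule matE[OF yL])
   then show ?thesis using x by (simp add: mat_add)
  qed
 qed
 have "b \<in> \<beta> ` carrier L" if "b \<in> carrier B" for b
  by (rule image_eqI[of _ _ "eB b"]) (use that in simp_all)
 moreover have "\<beta> l \<in> carrier B" if "l \<in> carrier L" for l
  using matE[OF that] by (metis proj_mat)
 ultimately show "\<beta> ` carrier (op_bimodule \<eta> (reg L)) = carrier (op_bimodule (\<lambda>k. \<beta> (\<eta> k)) (reg B))" by auto
qed

lemma morita_matrix_swap: "morita_matrix B A M N L nm mn (\<lambda>b m n a. mat a n m b) \<beta> \<mu> \<nu> \<alpha>"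
proof (intro morita_matrix.intro ring_A ring_B ring_L bimodule_M bimodule_N morita_matrix_axioms.intro)
 show "\<exists>b\<in>carrier B. \<exists>m\<in>carrier M. \<exists>n\<in>carrier N. \<exists>a\<in>carrier A. l = mat a n m b" if l: "l \<in> carrier L" for l
  using mat_exists[OF l] by blast
qed (simp_all add: mn_add_l mn_add_r nm_add_l nm_add_r mn_smult nm_smult mn_rsmult nm_rsmult mn_balanced
  nm_balanced mn_nm nm_mn mat_add mat_mult mat_one mat_zero A.a_comm N.L.M.a_comm M.L.M.a_comm)

end

lemma noeth_submod_fg:
 fixes R :: "'r ring" and Y :: "('r, 'y) module"
 assumes K: "ring K" and R: "central_algebra K \<eta> R" and n: "noeth K (op_bimodule \<eta> (reg R))"
  and Y: "fg_module R Y" and U: "submod R Y U"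
 shows "finitely_generated R (sub Y U)"
proof -
 have lY: "left_module R Y" "finitely_generated R Y" using Y by (simp_all add: fg_module_def)
 interpret Y: left_module R Y by (rule lY(1))
 have "finitely_generated K (sub (op_bimodule \<eta> Y) U)"
  by (rule noethD(2)[OF noeth_op_bimodule[OF K R n lY] submod_op_bimodule[OF R U]])
 then have "finitely_generated K (op_bimodule \<eta> (sub Y U))" by (simp add: op_bimodule_def)
 then show ?thesis by (rule fg_op_bimodule[OF K R Y.submod_left_module[OF U]])
qed

context morita_matrix begin

text \<open>
 The part of the dual of \<open>L\<close> that lives on the second row is coinduced from the dual of \<open>B\<close>:
 a functional on the row is determined by its values on \<open>b m\<close> and \<open>b\<close>, for \<open>m\<close> in \<open>M\<close> and \<open>b\<close> in \<open>B\<close>.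
\<close>

lemma dual_row:
 fixes K :: "('k, 'p) ring_scheme" and E :: "('k, 'k fg_carrier) module" and \<eta> :: "'k \<Rightarrow> 'l"
 assumes EQ: "induces_equivalence A B M" and D: "dualizing_module K E"
  and \<eta>: "central_algebra K \<eta> L" and n: "noeth K (op_bimodule \<eta> (reg L))"
 defines "DL \<equiv> dualizing_module.dual K E \<eta> (reg (opposite_ring L))"
 obtains W :: "('l, ('m \<Rightarrow> 'b \<Rightarrow> 'k fg_carrier) \<times> ('b \<Rightarrow> 'k fg_carrier)) module" and f r
 where "left_module L W" "pd_lt L r W" "f \<in> lmod_hom L DL W"
  "\<And>\<theta>. \<theta> \<in> carrier DL \<Longrightarrow> f \<theta> = \<zero>\<^sub>W \<longleftrightarrow> (\<forall>m\<in>carrier M. \<forall>b\<in>carrier B. \<theta> (mat \<zero>\<^sub>A \<zero>\<^sub>N m b) = \<zero>\<^sub>E)"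
  "\<And>p. p \<in> carrier W \<Longrightarrow> \<exists>\<theta>\<in>carrier DL. f \<theta> = p \<and> (\<forall>a\<in>carrier A. \<forall>n\<in>carrier N. \<theta> (mat a n \<zero>\<^sub>M \<zero>\<^sub>B) = \<zero>\<^sub>E)"
proof -
 interpret D: dualizing_module K E by (rule D)
 note K = D.ring_K
 let ?\<epsilon> = "\<lambda>k. \<beta> (\<eta> k)" and ?L' = "opposite_ring L" and ?B' = "opposite_ring B"
 note B = central_algebra_B[OF \<eta>] and \<eta>' = central_algebra_opposite[OF \<eta>]
 note B' = central_algebra_opposite[OF B] and nB = noeth_B[OF \<eta> K n]
 note nB' = noeth_opposite[OF K B nB]
 have rB': "ring ?B'" and rL': "ring ?L'" using opposite_ring_ring ring_B ring_L by auto
 note lB' = reg_left_module[OF rB'] and lL' = reg_left_module[OF rL']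
 define DB where "DB = D.dual ?\<epsilon> (reg ?B')"
 have lDB: "left_module B DB" using D.dual_left_module[OF B' lB'] by (simp add: DB_def)
 have lDL: "left_module L DL" using D.dual_left_module[OF \<eta>' lL'] by (simp add: DL_def)
 interpret DB: left_module B DB by (rule lDB)
 interpret DL: left_module L DL by (rule lDL)
 have "injective_module B DB"
  using D.dual_injective[OF B' reg_projective[OF rB'] reg_fg[OF rB']] by (simp add: DB_def)
 moreover have fgDB: "finitely_generated B DB"
  using D.dual_fg[OF B' nB' lB' reg_fg[OF rB']] by (simp add: DB_def)
 moreover obtain Y :: "('b, 'b fg_carrier) module" and \<kappa> where Y: "fg_module B Y" "\<kappa> \<in> lmod_iso B DB Y"
  using fg_module_copy[of B DB] lDB fgDB unfolding fg_module_def by blast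
 have lY: "left_module B Y" using Y(1) by (simp add: fg_module_def)
 ultimately have fid: "fin_inj_dim B Y"
  using Y injective_id_lt_1[OF injective_iso[OF _ Y(2) lY]] by (auto simp: fin_inj_dim_iff fg_module_def)
 obtain r where r: "pd_lt A r (hom_module B M Y)"
  using equivalence_counit(2)[OF EQ bimodule_M fid] by (auto simp: fin_proj_dim_iff)
 have pdY: "pd_lt L r (cind Y)"
  by (rule cind_pd[OF EQ noeth_submod_fg[OF K B nB] fid r])
 note \<kappa>' = iso_inverse(1)[OF Y(2) lDB]
 have pdW: "pd_lt L r (cind DB)"
  by (rule pd_lt_iso[OF cind_left_module[OF lY] cind_left_module[OF lDB] cind_map_iso[OF lY lDB \<kappa>'] pdY])

 have DB_iff: "f \<in> carrier DB \<longleftrightarrow> f \<in> lmod_hom K (op_bimodule ?\<epsilon> (reg ?B')) E \<and> f \<in> extensional (carrier B)" for f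
  by (simp add: DB_def D.dual_simps)
 have DBop: "f \<oplus>\<^bsub>DB\<^esub> g = (\<lambda>x\<in>carrier B. f x \<oplus>\<^sub>E g x)" "b \<odot>\<^bsub>DB\<^esub> f = (\<lambda>x\<in>carrier B. f (x \<otimes>\<^sub>B b))"
  "\<zero>\<^bsub>DB\<^esub> = (\<lambda>x\<in>carrier B. \<zero>\<^sub>E)" for f g b by (simp_all add: DB_def D.dual_simps)
 have DLop: "f \<oplus>\<^bsub>DL\<^esub> g = (\<lambda>x\<in>carrier L. f x \<oplus>\<^sub>E g x)" "l \<odot>\<^bsub>DL\<^esub> f = (\<lambda>x\<in>carrier L. f (x \<otimes>\<^sub>L l))" for f g l
  by (simp_all add: DL_def D.dual_simps)
 have DBc: "f x \<in> carrier E" if "f \<in> carrier DB" "x \<in> carrier B" for f x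
  using D.dual_closed[of f ?\<epsilon> "reg ?B'" x] that by (simp add: DB_def)
 have DBa: "f (x \<oplus>\<^sub>B y) = f x \<oplus>\<^sub>E f y" if "f \<in> carrier DB" "x \<in> carrier B" "y \<in> carrier B" for f x y
  using D.dual_add[of f ?\<epsilon> "reg ?B'" x y] that by (simp add: DB_def)
 have DBk: "f (x \<otimes>\<^sub>B ?\<epsilon> k) = k \<odot>\<^sub>E f x" if "f \<in> carrier DB" "x \<in> carrier B" "k \<in> carrier K" for f x k
  using D.dual_smult[of f ?\<epsilon> "reg ?B'" k x] that by (simp add: DB_def)
 have DB0: "f \<zero>\<^sub>B = \<zero>\<^sub>E" if "f \<in> carrier DB" for f
  using D.dual_zero[OF B' lB', of f] that by (simp add: DB_def)
 have DLa: "f (x \<oplus>\<^sub>L y) = f x \<oplus>\<^sub>E f y" if "f \<in> carrier DL" "x \<in> carrier L" "y \<in> carrier L" for f x y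
  using D.dual_add[of f \<eta> "reg ?L'" x y] that by (simp add: DL_def)
 have DL0: "f \<zero>\<^sub>L = \<zero>\<^sub>E" if "f \<in> carrier DL" for f
  using D.dual_zero[OF \<eta>' lL', of f] that by (simp add: DL_def)

 \<comment> \<open>The restriction of a functional to the corner \<open>B\<close> gives the homomorphism into the coinduced module.\<close>
 define \<rho> where "\<rho> \<theta> = (\<lambda>b\<in>carrier B. \<theta> (eB b))" for \<theta> :: "'l \<Rightarrow> 'k fg_carrier"
 have eB_hom: "eB \<in> lmod_hom K (op_bimodule ?\<epsilon> (reg ?B')) (op_bimodule \<eta> (reg ?L'))"
 proof (rule lmod_homI)
  fix k b assume k: "k \<in> carrier K" and b: "b \<in> carrier (op_bimodule ?\<epsilon> (reg ?B'))"
  obtain a0 b0 where "a0 \<in> carrier A" "b0 \<in> carrier B" "\<eta> k = mat a0 \<zero>\<^sub>N \<zero>\<^sub>M b0"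
   using central_diagonal[OF \<eta> k] by blast
  then show "eB (k \<odot>\<^bsub>op_bimodule ?\<epsilon> (reg ?B')\<^esub> b) = k \<odot>\<^bsub>op_bimodule \<eta> (reg ?L')\<^esub> eB b"
   using b by (simp add: mat_mult)
 qed (simp_all add: mat_add)
 have \<rho>DB: "\<rho> \<theta> \<in> carrier DB" if "\<theta> \<in> carrier DL" for \<theta>
  using D.dualI[OF B' lB' hom_comp[OF eB_hom D.dual_hom[of \<theta> \<eta> "reg ?L'"]]] that
  by (simp add: \<rho>_def DB_def DL_def)
 have \<rho>: "\<rho> \<in> lmod_hom B (corner B eB DL) DB"
 proof (rule lmod_homI)
  show "\<rho> (b \<odot>\<^bsub>corner B eB DL\<^esub> \<theta>) = b \<odot>\<^bsub>DB\<^esub> \<rho> \<theta>" if "b \<in> carrier B" for b \<theta>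
   using that by (auto simp: \<rho>_def DLop DBop mat_mult intro!: restrict_ext)
 qed (auto simp: \<rho>DB[unfolded \<rho>_def] \<rho>_def DLop DBop intro!: restrict_ext)
 define f where "f \<theta> = (\<lambda>m\<in>carrier M. \<rho> (eM m \<odot>\<^bsub>DL\<^esub> \<theta>), \<rho> (eB \<one>\<^sub>B \<odot>\<^bsub>DL\<^esub> \<theta>))" for \<theta>
 have f: "f \<in> lmod_hom L DL (cind DB)" unfolding f_def by (rule cind_extend[OF lDL lDB \<rho>])
 have f_eq: "f \<theta> = (\<lambda>m\<in>carrier M. \<lambda>b\<in>carrier B. \<theta> (eM (b \<odot>\<^sub>M m)), \<lambda>b\<in>carrier B. \<theta> (eB b))" for \<theta>
  unfolding f_def \<rho>_def DLop by (auto simp: mat_mult intro!: restrict_ext)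
 show thesis
 proof (rule that[OF cind_left_module[OF lDB] pdW f])
  fix \<theta> assume \<theta>: "\<theta> \<in> carrier DL"
  have split: "\<theta> (mat \<zero>\<^sub>A \<zero>\<^sub>N m b) = \<theta> (eM m) \<oplus>\<^sub>E \<theta> (eB b)" if "m \<in> carrier M" "b \<in> carrier B" for m b
   using DLa[OF \<theta>, of "eM m" "eB b"] that by (simp add: mat_add)
  show "f \<theta> = \<zero>\<^bsub>cind DB\<^esub> \<longleftrightarrow> (\<forall>m\<in>carrier M. \<forall>b\<in>carrier B. \<theta> (mat \<zero>\<^sub>A \<zero>\<^sub>N m b) = \<zero>\<^sub>E)"
  proof
   assume "f \<theta> = \<zero>\<^bsub>cind DB\<^esub>"
   then have z: "(\<lambda>m\<in>carrier M. \<lambda>b\<in>carrier B. \<theta> (eM (b \<odot>\<^sub>M m))) = (\<lambda>m\<in>carrier M. \<lambda>b\<in>carrier B. \<zero>\<^sub>E)"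
    "(\<lambda>b\<in>carrier B. \<theta> (eB b)) = (\<lambda>b\<in>carrier B. \<zero>\<^sub>E)"
    unfolding f_eq by (simp_all add: cind_simps hom_module_simps(2) DBop)
   have "\<theta> (eM m) = \<zero>\<^sub>E" if "m \<in> carrier M" for m
    using fun_cong[OF fun_cong[OF z(1)], of m "\<one>\<^sub>B"] that by simp
   moreover have "\<theta> (eB b) = \<zero>\<^sub>E" if "b \<in> carrier B" for b
    using fun_cong[OF z(2), of b] that by simp
   ultimately show "\<forall>m\<in>carrier M. \<forall>b\<in>carrier B. \<theta> (mat \<zero>\<^sub>A \<zero>\<^sub>N m b) = \<zero>\<^sub>E" by (intro ballI, subst split) simp_all
  next
   assume "\<forall>m\<in>carrier M. \<forall>b\<in>carrier B. \<theta> (mat \<zero>\<^sub>A \<zero>\<^sub>N m b) = \<zero>\<^sub>E"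
   then have z: "\<And>m. m \<in> carrier M \<Longrightarrow> \<theta> (eM m) = \<zero>\<^sub>E" "\<And>b. b \<in> carrier B \<Longrightarrow> \<theta> (eB b) = \<zero>\<^sub>E"
    by simp_all
   then have "(\<lambda>m\<in>carrier M. \<lambda>b\<in>carrier B. \<theta> (eM (b \<odot>\<^sub>M m))) = (\<lambda>m\<in>carrier M. \<lambda>b\<in>carrier B. \<zero>\<^sub>E)"
    "(\<lambda>b\<in>carrier B. \<theta> (eB b)) = (\<lambda>b\<in>carrier B. \<zero>\<^sub>E)"
    by (intro restrict_ext z; simp)+
   then show "f \<theta> = \<zero>\<^bsub>cind DB\<^esub>" unfolding f_eq by (simp del: restrict_apply add: cind_simps hom_module_simps(2) DBop)
  qed
 next
  fix p assume "p \<in> carrier (cind DB)"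
  then obtain h d where p: "p = (h, d)" "h \<in> carrier (hom_module B M DB)" "d \<in> carrier DB" by (auto simp: cind_simps)
  have h: "h \<in> lmod_hom B M DB" "h \<in> extensional (carrier M)" using p(2) by (simp_all add: hom_module_simps)
  have hm: "h m \<in> carrier DB" if "m \<in> carrier M" for m using hom_closed[OF h(1) that] .
  have hs: "h (b \<odot>\<^sub>M m) \<one>\<^sub>B = h m b" if "m \<in> carrier M" "b \<in> carrier B" for m b
   using hom_smult[OF h(1) that(2,1)] that(2) by (simp add: DBop)
  have h0: "h \<zero>\<^sub>M = \<zero>\<^bsub>DB\<^esub>" by (rule hom_zero[OF left_module_M lDB h(1)])
  \<comment> \<open>Since \<open>h (b m) 1 = h m b\<close>, the functional is recovered from the values of \<open>h\<close> at \<open>1\<close>.\<close>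
  define t where "t l = h (\<mu> l) \<one>\<^sub>B \<oplus>\<^sub>E d (\<beta> l)" for l
  have tm: "t (mat a n m b) = h m \<one>\<^sub>B \<oplus>\<^sub>E d b"
   if "a \<in> carrier A" "n \<in> carrier N" "m \<in> carrier M" "b \<in> carrier B" for a n m b
   using that by (simp add: t_def)
  have th: "t \<in> lmod_hom K (op_bimodule \<eta> (reg ?L')) E"
  proof (rule lmod_homI)
   fix x assume "x \<in> carrier (op_bimodule \<eta> (reg ?L'))"
   then have xL: "x \<in> carrier L" by simp
   obtain a n m b where x: "a \<in> carrier A" "n \<in> carrier N" "m \<in> carrier M" "b \<in> carrier B" "x = mat a n m b"
    by (rule matE[OF xL])
   have cl: "h m \<one>\<^sub>B \<in> carrier E" "d b \<in> carrier E" using DBc hm p(3) x by auto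
   show "t x \<in> carrier E" using cl tm x by simp
   show "t (x \<oplus>\<^bsub>op_bimodule \<eta> (reg ?L')\<^esub> y) = t x \<oplus>\<^sub>E t y" if y: "y \<in> carrier (op_bimodule \<eta> (reg ?L'))" for y
   proof -
    have yL: "y \<in> carrier L" using y by simp
    obtain a' n' m' b' where y: "a' \<in> carrier A" "n' \<in> carrier N" "m' \<in> carrier M" "b' \<in> carrier B" "y = mat a' n' m' b'"
     by (rule matE[OF yL])
    have "h m' \<one>\<^sub>B \<in> carrier E" "d b' \<in> carrier E" using DBc hm p(3) y by auto
    then show ?thesis using x y cl hom_add[OF h(1) x(3) y(3)] DBa[OF p(3) x(4) y(4)]
     by (simp add: mat_add tm DBop D.E.M.a_ac)
   qed
   show "t (k \<odot>\<^bsub>op_bimodule \<eta> (reg ?L')\<^esub> x) = k \<odot>\<^sub>E t x" if k: "k \<in> carrier K" for k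
   proof -
    obtain a0 b0 where e: "a0 \<in> carrier A" "b0 \<in> carrier B" "\<eta> k = mat a0 \<zero>\<^sub>N \<zero>\<^sub>M b0"
     using central_diagonal[OF \<eta> k] by blast
    have eB: "?\<epsilon> k = b0" using e by simp
    have "x \<otimes>\<^sub>L \<eta> k = \<eta> k \<otimes>\<^sub>L x" using central_algebraD(6)[OF \<eta> k xL] by simp
    also have "\<dots> = mat (a0 \<otimes>\<^sub>A a) (a0 \<odot>\<^sub>N n) (b0 \<odot>\<^sub>M m) (b0 \<otimes>\<^sub>B b)" using e x by (simp add: mat_mult)
    finally have "t (x \<otimes>\<^sub>L \<eta> k) = h m b0 \<oplus>\<^sub>E d (b0 \<otimes>\<^sub>B b)" using e x tm hs by simp
    also have "h m b0 = k \<odot>\<^sub>E h m \<one>\<^sub>B" using DBk[OF hm[OF x(3)] B.one_closed k] e(2) unfolding eB by simp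
    also have "b0 \<otimes>\<^sub>B b = b \<otimes>\<^sub>B ?\<epsilon> k" using central_algebraD(6)[OF B k x(4)] unfolding eB .
    also have "d (b \<otimes>\<^sub>B ?\<epsilon> k) = k \<odot>\<^sub>E d b" by (rule DBk[OF p(3) x(4) k])
    finally show ?thesis using x tm cl k by (simp add: D.E.smult_r_distr)
   qed
  qed
  let ?t = "restrict t (carrier L)"
  have tL: "?t \<in> carrier DL" using D.dualI[OF \<eta>' lL' th] by (simp add: DL_def)
  have "f ?t = p"
  proof -
   have "(\<lambda>m\<in>carrier M. \<lambda>b\<in>carrier B. ?t (eM (b \<odot>\<^sub>M m))) = h"
   proof (rule extensionalityI[of _ "carrier M"])
    fix m assume m: "m \<in> carrier M"
    have "(\<lambda>b\<in>carrier B. ?t (eM (b \<odot>\<^sub>M m))) = h m"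
     using hm[OF m] m DB0[OF p(3)] DBc[OF hm[OF m]]
     by (intro extensionalityI[of _ "carrier B"]) (simp_all add: tm hs DB_iff)
    then show "(\<lambda>m\<in>carrier M. \<lambda>b\<in>carrier B. ?t (eM (b \<odot>\<^sub>M m))) m = h m" using m by simp
   qed (simp_all add: h(2))
   moreover have "(\<lambda>b\<in>carrier B. ?t (eB b)) = d"
    using p(3) DBc[OF p(3)]
    by (intro extensionalityI[of _ "carrier B"]) (simp_all add: tm h0 DBop DB_iff)
   ultimately show ?thesis unfolding f_eq p(1) by simp
  qed
  moreover have "?t (mat a n \<zero>\<^sub>M \<zero>\<^sub>B) = \<zero>\<^sub>E" if "a \<in> carrier A" "n \<in> carrier N" for a n
   using that DB0[OF p(3)] by (simp add: tm h0 DBop)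
  ultimately show "\<exists>\<theta>\<in>carrier DL. f \<theta> = p \<and> (\<forall>a\<in>carrier A. \<forall>n\<in>carrier N. \<theta> (mat a n \<zero>\<^sub>M \<zero>\<^sub>B) = \<zero>\<^sub>E)"
   using tL by blast
 qed
qed

text \<open>
 The regular left module is the sum of the two columns. The dual of the regular right module is the sum of
 the duals of the two rows, and duality turns its projective resolutions into injective ones.
\<close>

lemma gorenstein_matrix_ring:
 fixes K :: "'k ring" and \<eta> :: "'k \<Rightarrow> 'l"
 assumes EM: "induces_equivalence A B M" and EN: "induces_equivalence B A N" and K: "artinian_ring K"
  and \<eta>: "central_algebra K \<eta> L" and n: "noeth K (op_bimodule \<eta> (reg L))"
 shows "gorenstein L"
proof -
 interpret S: morita_matrix B A M N L nm mn "\<lambda>b m n a. mat a n m b" \<beta> \<mu> \<nu> \<alpha> by (rule morita_matrix_swap)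
 let ?L' = "opposite_ring L"
 have lL: "left_module L (reg L)" by (rule reg_left_module[OF ring_L])
 have rL': "ring ?L'" by (rule opposite_ring_ring[OF ring_L])
 have lL': "left_module ?L' (reg ?L')" by (rule reg_left_module[OF rL'])
 have "\<exists>r. id_lt L r (reg L)"
 proof -
  obtain Y :: "('b, 'b fg_carrier) module" and g r where Y: "left_module B Y" "id_lt L r (cind Y)" "g \<in> carrier (cind Y)"
   "\<And>a n m b. a \<in> carrier A \<Longrightarrow> n \<in> carrier N \<Longrightarrow> m \<in> carrier M \<Longrightarrow> b \<in> carrier B \<Longrightarrow>
    mat a n m b \<odot>\<^bsub>cind Y\<^esub> g = \<zero>\<^bsub>cind Y\<^esub> \<longleftrightarrow> a = \<zero>\<^sub>A \<and> m = \<zero>\<^sub>M"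
   "\<And>p. p \<in> carrier (cind Y) \<Longrightarrow> \<exists>a\<in>carrier A. \<exists>m\<in>carrier M. p = mat a \<zero>\<^sub>N m \<zero>\<^sub>B \<odot>\<^bsub>cind Y\<^esub> g"
   by (rule column_generator[OF EM]) (rule that)
  obtain Z :: "('a, 'a fg_carrier) module" and h s where Z: "left_module A Z" "id_lt L s (S.cind Z)" "h \<in> carrier (S.cind Z)"
   "\<And>b m n a. b \<in> carrier B \<Longrightarrow> m \<in> carrier M \<Longrightarrow> n \<in> carrier N \<Longrightarrow> a \<in> carrier A \<Longrightarrow>
    mat a n m b \<odot>\<^bsub>S.cind Z\<^esub> h = \<zero>\<^bsub>S.cind Z\<^esub> \<longleftrightarrow> b = \<zero>\<^sub>B \<and> n = \<zero>\<^sub>N"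
   "\<And>p. p \<in> carrier (S.cind Z) \<Longrightarrow> \<exists>b\<in>carrier B. \<exists>n\<in>carrier N. p = mat \<zero>\<^sub>A n \<zero>\<^sub>M b \<odot>\<^bsub>S.cind Z\<^esub> h"
   by (rule S.column_generator[OF EN]) (rule that)
  note lY = cind_left_module[OF Y(1)] and lZ = S.cind_left_module[OF Z(1)]
  have "(\<lambda>l. (l \<odot>\<^bsub>cind Y\<^esub> g, l \<odot>\<^bsub>S.cind Z\<^esub> h)) \<in> lmod_iso L (reg L) (dsum (cind Y) (S.cind Z))"
  proof (rule dsum_iso[OF lL lY lZ hom_from_reg[OF lY Y(3)] hom_from_reg[OF lZ Z(3)]])
   fix l assume l: "l \<in> carrier (reg L)" "l \<odot>\<^bsub>cind Y\<^esub> g = \<zero>\<^bsub>cind Y\<^esub>" "l \<odot>\<^bsub>S.cind Z\<^esub> h = \<zero>\<^bsub>S.cind Z\<^esub>"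
   have lL: "l \<in> carrier L" using l(1) by simp
   obtain a n m b where x: "a \<in> carrier A" "n \<in> carrier N" "m \<in> carrier M" "b \<in> carrier B" "l = mat a n m b"
    by (rule matE[OF lL])
   then show "l = \<zero>\<^bsub>reg L\<^esub>" using l(2,3) Y(4)[OF x(1-4)] Z(4)[OF x(4,3,2,1)] by (simp add: mat_zero)
  next
   fix p assume "p \<in> carrier (cind Y)"
   then obtain a m where x: "a \<in> carrier A" "m \<in> carrier M" "p = mat a \<zero>\<^sub>N m \<zero>\<^sub>B \<odot>\<^bsub>cind Y\<^esub> g" using Y(5) by blast
   then show "\<exists>l\<in>carrier (reg L). l \<odot>\<^bsub>cind Y\<^esub> g = p \<and> l \<odot>\<^bsub>S.cind Z\<^esub> h = \<zero>\<^bsub>S.cind Z\<^esub>"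
    using Z(4)[of "\<zero>\<^sub>B" m "\<zero>\<^sub>N" a] by (intro bexI[of _ "mat a \<zero>\<^sub>N m \<zero>\<^sub>B"]) simp_all
  next
   fix p assume "p \<in> carrier (S.cind Z)"
   then obtain b n where x: "b \<in> carrier B" "n \<in> carrier N" "p = mat \<zero>\<^sub>A n \<zero>\<^sub>M b \<odot>\<^bsub>S.cind Z\<^esub> h" using Z(5) by blast
   then show "\<exists>l\<in>carrier (reg L). l \<odot>\<^bsub>S.cind Z\<^esub> h = p \<and> l \<odot>\<^bsub>cind Y\<^esub> g = \<zero>\<^bsub>cind Y\<^esub>"
    using Y(4)[of "\<zero>\<^sub>A" n "\<zero>\<^sub>M" b] by (intro bexI[of _ "mat \<zero>\<^sub>A n \<zero>\<^sub>M b"]) simp_all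
  qed
  moreover have "id_lt L (max r s) (dsum (cind Y) (S.cind Z))"
   by (rule id_lt_dsum[OF lY lZ id_lt_mono[OF Y(2)] id_lt_mono[OF Z(2)]]) simp_all
  ultimately show ?thesis using id_lt_iso by blast
 qed
 moreover have "\<exists>r. id_lt ?L' r (reg ?L')"
 proof -
  note \<eta>' = central_algebra_opposite[OF \<eta>]
  obtain E :: "('k, 'k fg_carrier) module" where DE: "dualizing_module K E"
   by (rule dualizing_module_exists[OF K]) (rule that)
  interpret D: dualizing_module K E by (rule DE)
  define DL where "DL = D.dual \<eta> (reg ?L')"
  have lDL: "left_module L DL" using D.dual_left_module[OF \<eta>' lL'] by (simp add: DL_def)
  obtain W :: "('l, ('m \<Rightarrow> 'b \<Rightarrow> 'k fg_carrier) \<times> ('b \<Rightarrow> 'k fg_carrier)) module" and f r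
   where W: "left_module L W" "pd_lt L r W" "f \<in> lmod_hom L DL W"
   "\<And>\<theta>. \<theta> \<in> carrier DL \<Longrightarrow> f \<theta> = \<zero>\<^sub>W \<longleftrightarrow> (\<forall>m\<in>carrier M. \<forall>b\<in>carrier B. \<theta> (mat \<zero>\<^sub>A \<zero>\<^sub>N m b) = \<zero>\<^sub>E)"
   "\<And>p. p \<in> carrier W \<Longrightarrow> \<exists>\<theta>\<in>carrier DL. f \<theta> = p \<and> (\<forall>a\<in>carrier A. \<forall>n\<in>carrier N. \<theta> (mat a n \<zero>\<^sub>M \<zero>\<^sub>B) = \<zero>\<^sub>E)"
   by (rule dual_row[OF EM DE \<eta> n, folded DL_def]) (rule that)
  obtain V :: "('l, ('n \<Rightarrow> 'a \<Rightarrow> 'k fg_carrier) \<times> ('a \<Rightarrow> 'k fg_carrier)) module" and g s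
   where V: "left_module L V" "pd_lt L s V" "g \<in> lmod_hom L DL V"
   "\<And>\<theta>. \<theta> \<in> carrier DL \<Longrightarrow> g \<theta> = \<zero>\<^sub>V \<longleftrightarrow> (\<forall>n\<in>carrier N. \<forall>a\<in>carrier A. \<theta> (mat a n \<zero>\<^sub>M \<zero>\<^sub>B) = \<zero>\<^sub>E)"
   "\<And>p. p \<in> carrier V \<Longrightarrow> \<exists>\<theta>\<in>carrier DL. g \<theta> = p \<and> (\<forall>b\<in>carrier B. \<forall>m\<in>carrier M. \<theta> (mat \<zero>\<^sub>A \<zero>\<^sub>N m b) = \<zero>\<^sub>E)"
   by (rule S.dual_row[OF EN DE \<eta> n, folded DL_def]) (rule that)
  have iso: "(\<lambda>\<theta>. (f \<theta>, g \<theta>)) \<in> lmod_iso L DL (dsum W V)"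
  proof (rule dsum_iso[OF lDL W(1) V(1) W(3) V(3)])
   fix \<theta> assume \<theta>: "\<theta> \<in> carrier DL" "f \<theta> = \<zero>\<^sub>W" "g \<theta> = \<zero>\<^sub>V"
   show "\<theta> = \<zero>\<^bsub>DL\<^esub>"
   proof (rule extensionalityI[of _ "carrier L"])
    fix l assume l: "l \<in> carrier L"
    obtain a n m b where x: "a \<in> carrier A" "n \<in> carrier N" "m \<in> carrier M" "b \<in> carrier B" "l = mat a n m b"
     by (rule matE[OF l])
    have "\<theta> (mat a n \<zero>\<^sub>M \<zero>\<^sub>B \<oplus>\<^sub>L mat \<zero>\<^sub>A \<zero>\<^sub>N m b) = \<theta> (mat a n \<zero>\<^sub>M \<zero>\<^sub>B) \<oplus>\<^sub>E \<theta> (mat \<zero>\<^sub>A \<zero>\<^sub>N m b)"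
     using D.dual_add[of \<theta> \<eta> "reg ?L'"] \<theta>(1) x by (simp add: DL_def)
    moreover have "\<theta> (mat a n \<zero>\<^sub>M \<zero>\<^sub>B) = \<zero>\<^sub>E" "\<theta> (mat \<zero>\<^sub>A \<zero>\<^sub>N m b) = \<zero>\<^sub>E"
     using W(4)[OF \<theta>(1)] V(4)[OF \<theta>(1)] \<theta>(2,3) x by auto
    ultimately show "\<theta> l = \<zero>\<^bsub>DL\<^esub> l" using x l by (simp add: mat_add DL_def D.dual_simps)
   qed (use \<theta>(1) in \<open>simp_all add: DL_def D.dual_simps\<close>)
  next
   fix p assume "p \<in> carrier W"
   then obtain \<theta> where "\<theta> \<in> carrier DL" "f \<theta> = p" "\<forall>a\<in>carrier A. \<forall>n\<in>carrier N. \<theta> (mat a n \<zero>\<^sub>M \<zero>\<^sub>B) = \<zero>\<^sub>E"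
    using W(5) by blast
   then show "\<exists>\<theta>\<in>carrier DL. f \<theta> = p \<and> g \<theta> = \<zero>\<^sub>V" using V(4)[of \<theta>] by blast
  next
   fix p assume "p \<in> carrier V"
   then obtain \<theta> where "\<theta> \<in> carrier DL" "g \<theta> = p" "\<forall>b\<in>carrier B. \<forall>m\<in>carrier M. \<theta> (mat \<zero>\<^sub>A \<zero>\<^sub>N m b) = \<zero>\<^sub>E"
    using V(5) by blast
   then show "\<exists>\<theta>\<in>carrier DL. g \<theta> = p \<and> f \<theta> = \<zero>\<^sub>W" using W(4)[of \<theta>] by blast
  qed
  have pd: "pd_lt L (max r s) (dsum W V)"
   by (rule pd_lt_dsum[OF W(1) V(1) pd_lt_mono[OF W(2)] pd_lt_mono[OF V(2)]]) simp_all
  have "pd_lt L (max r s) DL"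
   by (rule pd_lt_iso[OF dsum_left_module[OF W(1) V(1)] lDL iso_inverse(1)[OF iso lDL] pd])
  then have "id_lt ?L' (max r s) (D.dual \<eta> DL)" by (rule D.id_lt_dual[OF \<eta> n lDL])
  moreover have "finitely_generated K (op_bimodule \<eta> (reg ?L'))"
   by (rule noeth_fg[OF noeth_opposite[OF D.ring_K \<eta> n]])
  ultimately show ?thesis
   using id_lt_iso[OF D.evaluation_iso[OF \<eta>' lL']] unfolding DL_def by blast
 qed
 ultimately show ?thesis
  using lL lL' reg_fg[OF ring_L] reg_fg[OF rL']
  by (auto simp: gorenstein_def fin_inj_dim_iff fg_module_def)
qed

end

lemma artinian_fg_noeth:
 fixes K :: "'k ring"
 assumes K: "artinian_ring K" and X: "left_module K X" and fg: "finitely_generated K X"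
 shows "noeth K X"
proof -
 have cK: "cring K" using K by (simp add: artinian_ring_def)
 interpret K: cring K by (rule cK)
 have c: "central_algebra K (\<lambda>k. k) K"
  using K.m_comm by (simp add: central_algebra_def K.ring_axioms ring_hom_def)
 note l = bimodule.axioms(1)[OF op_bimodule_bimodule[OF K.ring_axioms c]]
 have "noeth K (op_bimodule (\<lambda>k. k) (reg K))"
  by (rule noeth_same_carrier[OF artinian_noeth[OF K] l[OF reg_left_module[OF K.ring_axioms]]]) simp_all
 from noeth_op_bimodule[OF K.ring_axioms c this X fg] show ?thesis
  by (rule noeth_same_carrier[OF _ X]) simp_all
qed

lemma artin_algebra_noeth:
 fixes K :: "'k ring" and R :: "'r ring"
 assumes a: "artin_algebra K \<eta> R"
 shows "central_algebra K \<eta> R" "noeth K (op_bimodule \<eta> (reg R))"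
proof -
 show c: "central_algebra K \<eta> R" using a by (auto simp: artin_algebra_def central_algebra_def)
 have K: "artinian_ring K" and fg: "finitely_generated K (restrict_scalars \<eta> R)"
  using a by (simp_all add: artin_algebra_def)
 interpret K: cring K using K by (simp add: artinian_ring_def)
 interpret R: left_module K "op_bimodule \<eta> (reg R)"
  by (rule bimodule.axioms(1)[OF op_bimodule_bimodule[OF K.ring_axioms c reg_left_module[OF central_algebraD(1)[OF c]]]])
 have s: "carrier (restrict_scalars \<eta> R) = carrier R" "\<zero>\<^bsub>restrict_scalars \<eta> R\<^esub> = \<zero>\<^sub>R"
  "x \<oplus>\<^bsub>restrict_scalars \<eta> R\<^esub> y = x \<oplus>\<^sub>R y" "k \<odot>\<^bsub>restrict_scalars \<eta> R\<^esub> x = \<eta> k \<otimes>\<^sub>R x" for x y k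
  by (simp_all add: restrict_scalars_def)
 have l: "left_module K (restrict_scalars \<eta> R)"
  by (rule left_moduleI[OF K.ring_axioms], unfold s)
   (use R.M.a_closed R.M.zero_closed R.M.a_assoc R.M.a_comm R.M.l_zero R.smult_closed R.smult_l_null
    R.smult_l_distr R.smult_r_distr R.smult_assoc1 R.smult_one in simp_all)
 show "noeth K (op_bimodule \<eta> (reg R))"
  by (rule noeth_same_carrier[OF artinian_fg_noeth[OF K l fg] R.left_module_axioms]) (simp_all add: s)
qed

text \<open>The pairing \<open>M \<times> N \<rightarrow> B\<close> behind a bimodule homomorphism \<open>M \<otimes>\<^sub>A N \<rightarrow> B\<close>.\<close>

lemma tensor_bimodule_pairing:
 assumes M: "bimodule B A M" and N: "bimodule A B N"
  and \<phi>: "\<phi> \<in> bimod_hom B B (tensor_bimodule A M N) (regular_bimodule B)"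
 defines "p \<equiv> \<lambda>m n. \<phi> (pure_tensor A M N m n)"
 shows "\<And>m n. m \<in> carrier M \<Longrightarrow> n \<in> carrier N \<Longrightarrow> p m n \<in> carrier B"
  "\<And>m m' n. m \<in> carrier M \<Longrightarrow> m' \<in> carrier M \<Longrightarrow> n \<in> carrier N \<Longrightarrow> p (m \<oplus>\<^sub>M m') n = p m n \<oplus>\<^sub>B p m' n"
  "\<And>m n n'. m \<in> carrier M \<Longrightarrow> n \<in> carrier N \<Longrightarrow> n' \<in> carrier N \<Longrightarrow> p m (n \<oplus>\<^sub>N n') = p m n \<oplus>\<^sub>B p m n'"
  "\<And>b m n. b \<in> carrier B \<Longrightarrow> m \<in> carrier M \<Longrightarrow> n \<in> carrier N \<Longrightarrow> p (b \<odot>\<^sub>M m) n = b \<otimes>\<^sub>B p m n"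
  "\<And>b m n. b \<in> carrier B \<Longrightarrow> m \<in> carrier M \<Longrightarrow> n \<in> carrier N \<Longrightarrow> p m (n \<triangleleft>\<^sub>N b) = p m n \<otimes>\<^sub>B b"
  "\<And>a m n. a \<in> carrier A \<Longrightarrow> m \<in> carrier M \<Longrightarrow> n \<in> carrier N \<Longrightarrow> p (m \<triangleleft>\<^sub>M a) n = p m (a \<odot>\<^sub>N n)"
proof -
 interpret N: bimodule A B N by (rule N)
 interpret t: tensor_pair A B M N by (intro tensor_pair.intro M N.L.left_module_axioms)
 let ?T = "tensor_bimodule A M N"
 have T: "carrier ?T = carrier t.T" "x \<oplus>\<^sub>?T y = x \<oplus>\<^bsub>t.T\<^esub> y" "b \<odot>\<^sub>?T x = b \<odot>\<^bsub>t.T\<^esub> x"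
  "x \<triangleleft>\<^sub>?T b = tensor_induced A M N (\<lambda>(m, n). (m, n \<triangleleft>\<^sub>N b)) x" for x y b
  by (simp_all add: tensor_bimodule_def module.defs bimodule.defs)
 have \<phi>h: "\<phi> \<in> lmod_hom B ?T (reg B)" and \<phi>r: "\<And>x b. x \<in> carrier ?T \<Longrightarrow> b \<in> carrier B \<Longrightarrow> \<phi> (x \<triangleleft>\<^sub>?T b) = \<phi> x \<otimes>\<^sub>B b"
  using \<phi> by (auto simp: bimod_hom_def regular_bimodule_def)
 have cl: "t.pt m n \<in> carrier ?T" if "m \<in> carrier M" "n \<in> carrier N" for m n using that by (simp add: T)
 have r: "t.pt m n \<triangleleft>\<^sub>?T b = t.pt m (n \<triangleleft>\<^sub>N b)" if b: "b \<in> carrier B" for b m n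
 proof -
  have "frag_extend (\<lambda>q. frag_of ((\<lambda>(m, n). (m, n \<triangleleft>\<^sub>N b)) q)) x \<in> t.N" if "x \<in> tensor_relations A M N" for x
   using that
   by (rule t.relationE)
    (use b t.relationI in \<open>simp_all add: frag_extend_diff N.rsmult_l_distr N.smult_rsmult_assoc\<close>)
  from t.induced_cls[OF this, of "frag_of (m, n)"] show ?thesis
   by (simp add: T t.pt_cls)
 qed
 show "p m n \<in> carrier B" if "m \<in> carrier M" "n \<in> carrier N" for m n
  using hom_closed[OF \<phi>h cl[OF that]] by (simp add: p_def)
 show "p (m \<oplus>\<^sub>M m') n = p m n \<oplus>\<^sub>B p m' n" if "m \<in> carrier M" "m' \<in> carrier M" "n \<in> carrier N" for m m' n
  using hom_add[OF \<phi>h cl[OF that(1,3)] cl[OF that(2,3)]] that by (simp add: p_def T t.pt_add_l)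
 show "p m (n \<oplus>\<^sub>N n') = p m n \<oplus>\<^sub>B p m n'" if "m \<in> carrier M" "n \<in> carrier N" "n' \<in> carrier N" for m n n'
  using hom_add[OF \<phi>h cl[OF that(1,2)] cl[OF that(1,3)]] that by (simp add: p_def T t.pt_add_r)
 show "p (b \<odot>\<^sub>M m) n = b \<otimes>\<^sub>B p m n" if "b \<in> carrier B" "m \<in> carrier M" "n \<in> carrier N" for b m n
  using hom_smult[OF \<phi>h that(1) cl[OF that(2,3)]] that by (simp add: p_def T t.pt_smult)
 show "p m (n \<triangleleft>\<^sub>N b) = p m n \<otimes>\<^sub>B b" if "b \<in> carrier B" "m \<in> carrier M" "n \<in> carrier N" for b m n
  using \<phi>r[OF cl[OF that(2,3)] that(1)] by (simp add: p_def r[OF that(1)])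
 show "p (m \<triangleleft>\<^sub>M a) n = p m (a \<odot>\<^sub>N n)" if "a \<in> carrier A" "m \<in> carrier M" "n \<in> carrier N" for a m n
  using that by (simp add: p_def t.pt_balanced)
qed

lemma morita_context_matrix:
 fixes A :: "'a ring" and B :: "'b ring" and N :: "('a, 'n, 'b) bimodule" and M :: "('b, 'm, 'a) bimodule"
 assumes mc: "morita_context A B N M \<phi> \<psi>" and L: "ring (morita_ring A B N M \<phi> \<psi>)"
 shows "morita_matrix A B N M (morita_ring A B N M \<phi> \<psi>)
  (\<lambda>m n. \<phi> (pure_tensor A M N m n)) (\<lambda>n m. \<psi> (pure_tensor B N M n m)) (\<lambda>a n m b. (a, n, m, b))
  fst (\<lambda>l. fst (snd l)) (\<lambda>l. fst (snd (snd l))) (\<lambda>l. snd (snd (snd l)))"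
proof -
 interpret morita_context A B N M \<phi> \<psi> by (rule mc)
 note P = tensor_bimodule_pairing[OF M.bimodule_axioms N.bimodule_axioms phi_hom]
 note Q = tensor_bimodule_pairing[OF N.bimodule_axioms M.bimodule_axioms psi_hom]
 show ?thesis
  by (intro morita_matrix.intro morita_matrix_axioms.intro L A.ring_axioms B.ring_axioms
    M.bimodule_axioms N.bimodule_axioms)
   (auto simp: P(1-5) Q(1-5) P(6) Q(6) phi_psi psi_phi[symmetric] morita_ring_def)
qed

theorem theorem6p2:
  fixes A :: "'a ring" and B :: "'b ring"
    and N :: "('a, 'n, 'b) bimodule" and M :: "('b, 'm, 'a) bimodule"
    and \<phi> :: "(('m \<times> 'n) \<Rightarrow>\<^sub>0 int) set \<Rightarrow> 'b"
    and \<psi> :: "(('n \<times> 'm) \<Rightarrow>\<^sub>0 int) set \<Rightarrow> 'a"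
    and K :: "'k ring" and \<eta> :: "'k \<Rightarrow> 'a \<times> 'n \<times> 'm \<times> 'b"
  assumes "morita_context A B N M \<phi> \<psi>"
    and "artin_algebra K \<eta> (morita_ring A B N M \<phi> \<psi>)"
    and "induces_equivalence A B M"
    and "induces_equivalence B A N"
  shows "gorenstein (morita_ring A B N M \<phi> \<psi>)"
proof -
 have "ring (morita_ring A B N M \<phi> \<psi>)" and K: "artinian_ring K"
  using assms(2) by (simp_all add: artin_algebra_def)
 from morita_context_matrix[OF assms(1) this(1)] show ?thesis
  by (rule morita_matrix.gorenstein_matrix_ring[OF _ assms(3,4) K artin_algebra_noeth[OF assms(2)]])
qed

end
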